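(* Let $c>0$ and let $\lambda_1,\lambda_2$ be real numbers in the unstable regime. Then $E$ has a mountain pass geometry on $S(c)$: there exists $k>0$ such that, setting $A_k=\{u\in S(c): \|\nabla u\|_2^2\le k\}$, $$\Gamma(c)=\{g\in C([0,1],S(c)) : g(0)\in A_k,\ E(g(1))<0\},\qquad \gamma(c)=\inf_{g\in\Gamma(c)}\max_{t\in[0,1]}E(g(t)),$$ the set $\Gamma(c)$ is non-empty and $$\gamma(c)>\max\Big\{\sup_{g\in\Gamma(c)}E(g(0)),\ \sup_{g\in\Gamma(c)}E(g(1))\Big\}.$$ Moreover there exists a couple $(u_c,\mu_c)\in H\times(0,\infty)$ solving $$-\tfrac12\Delta u_c+\lambda_1|u_c|^2u_c+\lambda_2(K\star|u_c|^2)u_c+\mu_c u_c=0$$ with $\|u_c\|_2^2=c$ and $E(u_c)=\gamma(c)$. In addition $u_c$ is a ground state, i.e. $$E(u_c)=\inf\{E(u): u\in S(c),\ E'|_{S(c)}(u)=0\}.$$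
   Context: $H=H^1(\mathbb{R}^3,\mathbb{C})$ (regarded as a real Hilbert space) with its usual norm. $K(x)=\frac{1-3\cos^2\theta}{|x|^3}$ is the dipolar kernel, $\theta$ being the angle between $x$ and $(0,0,1)$; $f\mapsto K\star f$ is the corresponding operator, i.e. the Fourier multiplier with symbol $\hat K(\xi)=\frac43\pi\,\frac{2\xi_3^2-\xi_1^2-\xi_2^2}{|\xi|^2}$ (with $\mathcal F(u)(\xi)=\int u(x)e^{-ix\cdot\xi}dx$), bounded on $L^p(\mathbb{R}^3)$ for $1<p<\infty$. The pair $(\lambda_1,\lambda_2)\in\mathbb{R}^2$ with $\lambda_2\ne0$ is in the unstable regime if $\lambda_1-\frac43\pi\lambda_2<0$ when $\lambda_2>0$, and $\lambda_1+\frac83\pi\lambda_2<0$ when $\lambda_2<0$. The energy is $E(u)=\frac12\|\nabla u\|_2^2+\frac{\lambda_1}{2}\|u\|_4^4+\frac{\lambda_2}{2}\int_{\mathbb{R}^3}(K\star|u|^2)|u|^2dx$ for $u\in H$, and $S(c)=\{u\in H:\|u\|_2^2=c\}$. $E'|_{S(c)}(u)=0$ means that $u$ is a critical point of $E$ restricted to $S(c)$. *)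

theory Defs
  imports "HOL-Analysis.Analysis"
begin

section \<open>The Sobolev space \<open>H\<^sup>1(\<real>\<^sup>3, \<complex>)\<close> as a real inner product space\<close>

subsection \<open>Square integrable functions\<close>

definition square_integrable :: "(real^3 \<Rightarrow> 'b::euclidean_space) \<Rightarrow> bool" where
  "square_integrable f \<longleftrightarrow>
     f \<in> borel_measurable lborel \<and> integrable lborel (\<lambda>x. (norm (f x))\<^sup>2)"

lemma square_integrable_measurable:
  "square_integrable f \<Longrightarrow> f \<in> borel_measurable borel"
  by (simp add: square_integrable_def)

lemma square_integrable_bilinear:
  fixes f :: "real^3 \<Rightarrow> 'b::euclidean_space" and g :: "real^3 \<Rightarrow> 'c::euclidean_space"
    and h :: "real^3 \<Rightarrow> 'd::{banach, second_countable_topology}"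
  assumes "square_integrable f" "square_integrable g" and m: "h \<in> borel_measurable lborel"
    and b: "\<And>x. norm (h x) \<le> norm (f x) * norm (g x)"
  shows "integrable lborel h"
proof (rule Bochner_Integration.integrable_bound)
  show "integrable lborel (\<lambda>x. (norm (f x))\<^sup>2 + (norm (g x))\<^sup>2)"
    using assms(1,2) unfolding square_integrable_def by simp
  have "norm (h x) \<le> (norm (f x))\<^sup>2 + (norm (g x))\<^sup>2" for x
  proof -
    have "2 * (norm (f x) * norm (g x)) \<le> (norm (f x))\<^sup>2 + (norm (g x))\<^sup>2"
      using sum_squares_bound[of "norm (f x)" "norm (g x)"] by (simp add: mult.assoc)
    moreover have "0 \<le> norm (f x) * norm (g x)" by simp
    ultimately show ?thesis using b[of x] by linarith
  qed
  then show "AE x in lborel. norm (h x) \<le> norm ((norm (f x))\<^sup>2 + (norm (g x))\<^sup>2)"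
    by auto
qed (fact m)

lemma square_integrable_inner:
  fixes f g :: "real^3 \<Rightarrow> 'b::euclidean_space"
  assumes "square_integrable f" "square_integrable g"
  shows "integrable lborel (\<lambda>x. f x \<bullet> g x)"
proof -
  note [measurable] = assms[THEN square_integrable_measurable]
  show ?thesis
    by (rule square_integrable_bilinear[OF assms]) (simp_all add: Cauchy_Schwarz_ineq2)
qed

lemma square_integrable_add:
  assumes f: "square_integrable f" and g: "square_integrable g"
  shows "square_integrable (\<lambda>x. f x + g x)"
proof -
  note [measurable] = f[THEN square_integrable_measurable] g[THEN square_integrable_measurable]
  have "integrable lborel (\<lambda>x. f x \<bullet> f x + 2 * (f x \<bullet> g x) + g x \<bullet> g x)"
    using square_integrable_inner[OF f f] square_integrable_inner[OF f g]
      square_integrable_inner[OF g g] by simp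
  moreover have "(\<lambda>x. f x \<bullet> f x + 2 * (f x \<bullet> g x) + g x \<bullet> g x) = (\<lambda>x. (norm (f x + g x))\<^sup>2)"
    by (auto simp: fun_eq_iff power2_norm_eq_inner inner_add_left inner_add_right inner_commute)
  ultimately show ?thesis
    unfolding square_integrable_def
    by simp
qed

lemma square_integrable_scaleR:
  assumes "square_integrable f"
  shows "square_integrable (\<lambda>x. c *\<^sub>R f x)"
  using assms unfolding square_integrable_def by (auto simp: power_mult_distrib)

lemma square_integrable_0: "square_integrable (\<lambda>x. 0)"
  by (simp add: square_integrable_def)

lemma borel_measurable_vec_nth':
  fixes G :: "real^3 \<Rightarrow> complex^3"
  assumes [measurable]: "G \<in> borel_measurable M"
  shows "(\<lambda>x. G x $ i) \<in> borel_measurable M"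
proof -
  have "(\<lambda>y::complex^3. y $ i) \<in> borel_measurable borel"
    by (intro borel_measurable_continuous_onI continuous_intros)
  then show ?thesis using assms by measurable
qed

lemma square_integrable_nth:
  fixes G :: "real^3 \<Rightarrow> complex^3"
  assumes "square_integrable G"
  shows "square_integrable (\<lambda>x. G x $ i)"
proof -
  have m: "(\<lambda>x. G x $ i) \<in> borel_measurable borel"
    using square_integrable_measurable[OF assms] by (rule borel_measurable_vec_nth')
  note [measurable] = m
  have "integrable lborel (\<lambda>x. (norm (G x $ i))\<^sup>2)"
    by (rule square_integrable_bilinear[OF assms assms])
       (simp_all add: power2_eq_square mult_mono Finite_Cartesian_Product.norm_nth_le)
  with m show ?thesis by (simp add: square_integrable_def)
qed

subsection \<open>Test functions\<close>

definition partial_deriv :: "3 \<Rightarrow> (real^3 \<Rightarrow> real) \<Rightarrow> real^3 \<Rightarrow> real" where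
  "partial_deriv i f x = frechet_derivative f (at x) (axis i 1)"

primrec C_k :: "nat \<Rightarrow> (real^3 \<Rightarrow> real) \<Rightarrow> bool" where
  "C_k 0 f \<longleftrightarrow> continuous_on UNIV f"
| "C_k (Suc n) f \<longleftrightarrow> (\<forall>x. f differentiable at x) \<and> (\<forall>i. C_k n (partial_deriv i f))"

definition test_function :: "(real^3 \<Rightarrow> real) \<Rightarrow> bool" where
  "test_function \<phi> \<longleftrightarrow> (\<forall>n. C_k n \<phi>) \<and> compact (closure {x. \<phi> x \<noteq> 0})"

lemma square_integrable_continuous_compact:
  fixes \<phi> :: "real^3 \<Rightarrow> real"
  assumes c: "continuous_on UNIV \<phi>" and k: "compact K" and z: "\<And>x. x \<notin> K \<Longrightarrow> \<phi> x = 0"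
  shows "square_integrable \<phi>"
proof -
  have m[measurable]: "\<phi> \<in> borel_measurable lborel"
    using borel_measurable_continuous_onI[OF c] by simp
  have "integrable lborel (\<lambda>x. indicator K x *\<^sub>R (\<phi> x)\<^sup>2)"
    by (intro borel_integrable_compact k continuous_intros continuous_on_subset[OF c]) auto
  also have "(\<lambda>x. indicator K x *\<^sub>R (\<phi> x)\<^sup>2) = (\<lambda>x. (norm (\<phi> x))\<^sup>2)"
    using z by (auto simp: indicator_def fun_eq_iff)
  finally show ?thesis using m by (simp add: square_integrable_def)
qed

lemma test_function_square_integrable:
  assumes "test_function \<phi>" shows "square_integrable \<phi>"
proof (rule square_integrable_continuous_compact)
  have "C_k 0 \<phi>" using assms unfolding test_function_def by blast
  then show "continuous_on UNIV \<phi>" by simp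
  show "compact (closure {x. \<phi> x \<noteq> 0})" using assms by (simp add: test_function_def)
  show "\<phi> x = 0" if "x \<notin> closure {x. \<phi> x \<noteq> 0}" for x
    using that closure_subset[of "{x. \<phi> x \<noteq> 0}"] by auto
qed

lemma test_function_partial_square_integrable:
  assumes "test_function \<phi>" shows "square_integrable (partial_deriv i \<phi>)"
proof (rule square_integrable_continuous_compact)
  have "C_k 1 \<phi>" using assms unfolding test_function_def by blast
  then show "continuous_on UNIV (partial_deriv i \<phi>)" by simp
  let ?K = "closure {x. \<phi> x \<noteq> 0}"
  show "compact ?K" using assms by (simp add: test_function_def)
  show "partial_deriv i \<phi> x = 0" if x: "x \<notin> ?K" for x
  proof -
    have "(\<phi> has_derivative (\<lambda>h. 0)) (at x)"
    proof (rule has_derivative_transform_within_open[of "\<lambda>x. 0"])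
      show "open (- ?K)" "x \<in> - ?K" using x by auto
      show "0 = \<phi> y" if "y \<in> - ?K" for y
        using that closure_subset[of "{x. \<phi> x \<noteq> 0}"] by auto
    qed auto
    then have "frechet_derivative \<phi> (at x) = (\<lambda>h. 0)"
      by (metis frechet_derivative_at)
    then show ?thesis by (simp add: partial_deriv_def)
  qed
qed

subsection \<open>The fundamental lemma of the calculus of variations\<close>

definition flat_exp :: "real \<Rightarrow> nat \<Rightarrow> real \<Rightarrow> real" where
  "flat_exp s k t = (if t > 0 then exp (- s / t) / t ^ k else 0)"

lemma flat_exp_tendsto_0:
  fixes s :: real
  assumes s: "s > 0"
  shows "((\<lambda>t. exp (- s / t) / t ^ k) \<longlongrightarrow> 0) (at_right 0)"
proof -
  have "((\<lambda>y::real. (y ^ k / exp y)) \<longlongrightarrow> 0) at_top"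
    by (rule tendsto_power_div_exp_0)
  moreover have "filterlim (\<lambda>t. s * inverse t) at_top (at_right 0)"
    using tendsto_const s filterlim_inverse_at_top_right
    by (rule filterlim_tendsto_pos_mult_at_top)
  ultimately have "((\<lambda>t. (s * inverse t) ^ k / exp (s * inverse t)) \<longlongrightarrow> 0) (at_right 0)"
    by (rule filterlim_compose)
  then have "((\<lambda>t. (1 / s ^ k) * ((s * inverse t) ^ k / exp (s * inverse t))) \<longlongrightarrow> 0) (at_right 0)"
    by (rule tendsto_mult_right_zero)
  moreover have "(\<lambda>t. (1 / s ^ k) * ((s * inverse t) ^ k / exp (s * inverse t)))
      = (\<lambda>t. exp (- s / t) / t ^ k)"
    using s by (simp add: fun_eq_iff divide_inverse power_mult_distrib exp_minus power_inverse)
  ultimately show ?thesis by simp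
qed

lemma inverse_power_deriv:
  "t \<noteq> 0 \<Longrightarrow>
    ((\<lambda>t::real. inverse t ^ k) has_real_derivative - real k * inverse t ^ Suc k) (at t)"
proof (induction k)
  case (Suc k)
  have "((\<lambda>t. inverse t) has_real_derivative - (inverse t ^ Suc (Suc 0))) (at t)"
    using DERIV_inverse[OF Suc.prems] by simp
  from DERIV_mult[OF this Suc.IH[OF Suc.prems]] show ?case
    by (simp add: algebra_simps)
qed simp

lemma flat_exp_deriv:
  assumes s: "s > 0"
  shows "(flat_exp s k has_real_derivative
     (- real k * flat_exp s (Suc k) t + s * flat_exp s (Suc (Suc k)) t)) (at t)"
proof -
  consider "t < 0" | "t = 0" | "t > 0" by linarith
  then show ?thesis
  proof cases
    case 1
    have "(flat_exp s k has_real_derivative 0) (at t)"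
      by (rule has_field_derivative_transform_within_open[of "\<lambda>t. 0" 0 t "{..<0}"])
         (use 1 in \<open>auto simp: flat_exp_def\<close>)
    with 1 show ?thesis by (simp add: flat_exp_def)
  next
    case 3
    have "((\<lambda>t. exp (- s / t)) has_real_derivative exp (- s / t) * (s * inverse t ^ 2)) (at t)"
      using 3 by (auto intro!: derivative_eq_intros simp: power2_eq_square divide_inverse)
    from DERIV_mult[OF this inverse_power_deriv[of t k]] 3
    have "((\<lambda>t. exp (- s / t) * inverse t ^ k) has_real_derivative
        (exp (- s / t) * (s * inverse t ^ 2)) * inverse t ^ k
        + (- real k * inverse t ^ Suc k) * exp (- s / t)) (at t)"
      by simp
    moreover have "(exp (- s / t) * (s * inverse t ^ 2)) * inverse t ^ k
        + (- real k * inverse t ^ Suc k) * exp (- s / t)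
        = - real k * flat_exp s (Suc k) t + s * flat_exp s (Suc (Suc k)) t"
      using 3 by (simp add: flat_exp_def power2_eq_square divide_inverse power_inverse algebra_simps)
    moreover have "(\<lambda>t. exp (- s / t) * inverse t ^ k) = (\<lambda>t. exp (- s / t) / t ^ k)"
      by (simp add: divide_inverse power_inverse)
    ultimately have "((\<lambda>t. exp (- s / t) / t ^ k) has_real_derivative
       (- real k * flat_exp s (Suc k) t + s * flat_exp s (Suc (Suc k)) t)) (at t)"
      by simp
    then show ?thesis
      by (rule has_field_derivative_transform_within_open[of _ _ t "{0<..}"])
         (use 3 in \<open>auto simp: flat_exp_def\<close>)
  next
    case 2
    have r: "((\<lambda>y. (flat_exp s k y - flat_exp s k 0) / (y - 0)) \<longlongrightarrow> 0) (at_right 0)"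
      by (rule Lim_transform_eventually[OF flat_exp_tendsto_0[OF s, of "Suc k"]])
         (auto simp: flat_exp_def mult.commute intro!: eventually_at_rightI[of 0 1])
    have l: "((\<lambda>y. (flat_exp s k y - flat_exp s k 0) / (y - 0)) \<longlongrightarrow> 0) (at_left 0)"
      by (rule Lim_transform_eventually[OF tendsto_const])
         (auto simp: flat_exp_def intro!: eventually_at_leftI[of "-1"])
    have "((\<lambda>y. (flat_exp s k y - flat_exp s k 0) / (y - 0)) \<longlongrightarrow> 0) (at 0)"
      using r l by (simp add: filterlim_split_at)
    then have "(flat_exp s k has_real_derivative 0) (at 0)"
      by (simp add: has_field_derivative_iff)
    with 2 show ?thesis by (simp add: flat_exp_def)
  qed
qed


lemma flat_exp_Suc: "flat_exp s k t = t * flat_exp s (Suc k) t"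
  by (simp add: flat_exp_def)

definition poly_bump :: "real \<Rightarrow> real \<Rightarrow> real \<Rightarrow> real poly \<Rightarrow> nat \<Rightarrow> real \<Rightarrow> real" where
  "poly_bump s a b P k t = poly P t * flat_exp s k ((t - a) * (b - t))"

lemma poly_bump_deriv:
  assumes s: "s > 0"
  shows "\<exists>P' k'. \<forall>t. (poly_bump s a b P k has_real_derivative poly_bump s a b P' k' t) (at t)"
proof -
  define q where "q = [:- a, 1:] * [:b, -1:]"
  have q: "poly q t = (t - a) * (b - t)" for t
    by (simp add: q_def algebra_simps)
  define P' where "P' = pderiv P * q\<^sup>2 - smult (real k) (P * pderiv q * q) + smult s (P * pderiv q)"
  have "(poly_bump s a b P k has_real_derivative poly_bump s a b P' (Suc (Suc k)) t) (at t)" for t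
  proof -
    let ?F = "flat_exp s (Suc (Suc k)) (poly q t)"
    have "((\<lambda>t. flat_exp s k (poly q t)) has_real_derivative
        (- real k * flat_exp s (Suc k) (poly q t) + s * ?F) * poly (pderiv q) t) (at t)"
      by (rule DERIV_chain2[OF flat_exp_deriv[OF s] poly_DERIV])
    from DERIV_mult[OF poly_DERIV this]
    have D: "((\<lambda>t. poly P t * flat_exp s k (poly q t)) has_real_derivative
        poly (pderiv P) t * flat_exp s k (poly q t)
        + ((- real k * flat_exp s (Suc k) (poly q t) + s * ?F) * poly (pderiv q) t) * poly P t) (at t)" .
    have e1: "flat_exp s (Suc k) (poly q t) = poly q t * ?F"
      by (rule flat_exp_Suc)
    have e0: "flat_exp s k (poly q t) = poly q t * (poly q t * ?F)"
      using e1 flat_exp_Suc[of s k] by simp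
    have "poly (pderiv P) t * flat_exp s k (poly q t)
        + ((- real k * flat_exp s (Suc k) (poly q t) + s * ?F) * poly (pderiv q) t) * poly P t
        = poly P' t * ?F"
      unfolding e1 e0 by (simp add: P'_def power2_eq_square algebra_simps)
    with D show ?thesis by (simp add: poly_bump_def[abs_def] q)
  qed
  then show ?thesis by blast
qed

lemma C_k_prod_bump:
  assumes s: "s > 0" and g: "\<forall>i. \<exists>P k. g i = poly_bump s (a $ i) (b $ i) P k"
  shows "C_k n (\<lambda>x. \<Prod>i\<in>UNIV. g i (x $ i))"
  using g
proof (induction n arbitrary: g)
  have ex: "\<exists>g'. (\<forall>i. \<exists>P k. g' i = poly_bump s (a $ i) (b $ i) P k)
      \<and> (\<forall>i t. (g i has_real_derivative g' i t) (at t))"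
    if gs: "\<forall>i. \<exists>P k. g i = poly_bump s (a $ i) (b $ i) P k" for g
  proof -
    have "\<exists>h. (\<exists>P k. h = poly_bump s (a $ i) (b $ i) P k)
        \<and> (\<forall>t. (g i has_real_derivative h t) (at t))" for i
    proof -
      obtain P k where gi: "g i = poly_bump s (a $ i) (b $ i) P k" using gs by blast
      obtain P' k' where "\<forall>t. (poly_bump s (a $ i) (b $ i) P k has_real_derivative
          poly_bump s (a $ i) (b $ i) P' k' t) (at t)"
        using poly_bump_deriv[OF s] by blast
      then show ?thesis unfolding gi by blast
    qed
    then have "\<forall>i. \<exists>h. (\<exists>P k. h = poly_bump s (a $ i) (b $ i) P k)
        \<and> (\<forall>t. (g i has_real_derivative h t) (at t))" by blast
    from choice[OF this] show ?thesis by blast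
  qed
  have D: "((\<lambda>x. \<Prod>i\<in>UNIV. g i (x $ i)) has_derivative
      (\<lambda>y. \<Sum>i\<in>UNIV. (g' i (x $ i) * (y $ i)) * (\<Prod>j\<in>UNIV - {i}. g j (x $ j)))) (at x)"
    if g': "\<forall>i t. (g i has_real_derivative g' i t) (at t)" for g g' and x :: "real^3"
  proof (rule has_derivative_prod)
    fix i
    have "((\<lambda>x. x $ i) has_derivative (\<lambda>y. y $ i)) (at x)"
      by (rule bounded_linear_imp_has_derivative[OF bounded_linear_vec_nth])
    moreover have "(g i has_derivative (\<lambda>y. g' i (x $ i) * y)) (at (x $ i))"
      using g' by (simp add: has_field_derivative_def)
    ultimately show "((\<lambda>x. g i (x $ i)) has_derivative (\<lambda>y. g' i (x $ i) * y $ i)) (at x)"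
      by (rule has_derivative_compose)
  qed
  {
    case 0
    then obtain g' where "\<forall>i t. (g i has_real_derivative g' i t) (at t)" using ex by blast
    from D[OF this] have "isCont (\<lambda>x. \<Prod>i\<in>UNIV. g i (x $ i)) x" for x
      by (rule has_derivative_continuous)
    then show ?case by (simp add: continuous_at_imp_continuous_on)
  next
    case (Suc n)
    then obtain g' where g': "\<forall>i. \<exists>P k. g' i = poly_bump s (a $ i) (b $ i) P k"
      "\<forall>i t. (g i has_real_derivative g' i t) (at t)" using ex by blast
    note D = D[OF g'(2)]
    have "partial_deriv i (\<lambda>x. \<Prod>i\<in>UNIV. g i (x $ i))
        = (\<lambda>x. \<Prod>j\<in>UNIV. (g(i := g' i)) j (x $ j))" for i
    proof
      fix x :: "real^3"
      have "partial_deriv i (\<lambda>x. \<Prod>i\<in>UNIV. g i (x $ i)) x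
          = (\<Sum>l\<in>UNIV. (g' l (x $ l) * (axis i 1 $ l)) * (\<Prod>j\<in>UNIV - {l}. g j (x $ j)))"
        unfolding partial_deriv_def by (subst frechet_derivative_at[OF D, symmetric]) simp
      also have "\<dots> = (\<Sum>l\<in>UNIV. if l = i then g' i (x $ i) * (\<Prod>j\<in>UNIV - {i}. g j (x $ j)) else 0)"
        by (rule sum.cong) (auto simp: axis_def)
      also have "\<dots> = g' i (x $ i) * (\<Prod>j\<in>UNIV - {i}. g j (x $ j))"
        by simp
      also have "\<dots> = (\<Prod>j\<in>UNIV. (g(i := g' i)) j (x $ j))"
        by (subst prod.remove[of _ i]) auto
      finally show "partial_deriv i (\<lambda>x. \<Prod>i\<in>UNIV. g i (x $ i)) x
        = (\<Prod>j\<in>UNIV. (g(i := g' i)) j (x $ j))" .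
    qed
    moreover have "C_k n (\<lambda>x. \<Prod>j\<in>UNIV. (g(i := g' i)) j (x $ j))" for i
      by (rule Suc.IH) (use Suc.prems g'(1) in auto)
    moreover have "(\<lambda>x. \<Prod>i\<in>UNIV. g i (x $ i)) differentiable at x" for x
      using D unfolding differentiable_def by blast
    ultimately show ?case by simp
  }
qed

definition box_bump :: "real \<Rightarrow> real^3 \<Rightarrow> real^3 \<Rightarrow> real^3 \<Rightarrow> real" where
  "box_bump s a b x = (\<Prod>i\<in>UNIV. flat_exp s 0 ((x $ i - a $ i) * (b $ i - x $ i)))"

lemma box_bump_inside:
  "x \<in> box a b \<Longrightarrow> box_bump s a b x
    = (\<Prod>i\<in>UNIV. exp (- s / ((x $ i - a $ i) * (b $ i - x $ i))))"
  unfolding box_bump_def by (rule prod.cong) (auto simp: flat_exp_def mem_box_cart)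

lemma box_bump_outside:
  assumes ab: "\<And>i. a $ i < b $ i" and x: "x \<notin> box a b"
  shows "box_bump s a b x = 0"
proof -
  obtain i where "\<not> (a $ i < x $ i \<and> x $ i < b $ i)"
    using x by (auto simp: mem_box_cart)
  with ab[of i] have "(x $ i - a $ i) * (b $ i - x $ i) \<le> 0"
    by (auto simp: mult_le_0_iff not_less)
  then have "flat_exp s 0 ((x $ i - a $ i) * (b $ i - x $ i)) = 0"
    by (simp add: flat_exp_def)
  then show ?thesis unfolding box_bump_def by (auto intro!: prod_zero)
qed

lemma test_function_box_bump:
  assumes ab: "\<And>i. a $ i < b $ i" and s: "s > 0"
  shows "test_function (box_bump s a b)"
  unfolding test_function_def
proof (intro conjI allI)
  have e: "box_bump s a b = (\<lambda>x. \<Prod>i\<in>UNIV. (\<lambda>i. poly_bump s (a $ i) (b $ i) 1 0) i (x $ i))"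
    by (simp add: box_bump_def[abs_def] poly_bump_def)
  show "C_k n (box_bump s a b)" for n
    unfolding e by (rule C_k_prod_bump[OF s]) blast
  have "{x. box_bump s a b x \<noteq> 0} \<subseteq> cbox a b"
    using box_bump_outside[OF ab] box_subset_cbox by blast
  then have "closure {x. box_bump s a b x \<noteq> 0} \<subseteq> cbox a b"
    by (rule closure_minimal) (rule closed_cbox)
  then show "compact (closure {x. box_bump s a b x \<noteq> 0})"
    by (meson bounded_cbox bounded_subset closed_closure compact_eq_bounded_closed)
qed

lemma box_bump_bounds: "s > 0 \<Longrightarrow> 0 \<le> box_bump s a b x \<and> box_bump s a b x \<le> 1"
  unfolding box_bump_def
  by (intro conjI prod_nonneg prod_le_1) (auto simp: flat_exp_def)

lemma box_bump_tendsto: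
  assumes ab: "\<And>i. a $ i < b $ i"
  shows "(\<lambda>n. box_bump (1 / Suc n) a b x) \<longlonglongrightarrow> indicator (box a b) x"
proof (cases "x \<in> box a b")
  case True
  have "(\<lambda>n. \<Prod>i\<in>UNIV. exp (- (1 / real (Suc n)) / ((x $ i - a $ i) * (b $ i - x $ i))))
      \<longlonglongrightarrow> (\<Prod>i\<in>(UNIV :: 3 set). exp (- 0 / ((x $ i - a $ i) * (b $ i - x $ i))))"
    using True
    by (intro tendsto_intros LIMSEQ_Suc[OF lim_1_over_n])
       (metis diff_gt_0_iff_gt less_irrefl mem_box_cart(1) mult_pos_pos)
  with True show ?thesis by (simp add: box_bump_inside)
qed (simp add: box_bump_outside[OF ab])

lemma fundamental_lemma_boxes:
  fixes f :: "real^3 \<Rightarrow> real"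
  assumes f: "square_integrable f"
    and z: "\<And>\<phi>. test_function \<phi> \<Longrightarrow> (LINT x|lborel. f x * \<phi> x) = 0"
  shows "(LINT x|lborel. indicator (box a b) x * f x) = 0"
proof (cases "\<forall>i. a $ i < b $ i")
  case True
  then have ab: "\<And>i. a $ i < b $ i" by blast
  note [measurable] = f[THEN square_integrable_measurable]
  let ?s = "\<lambda>n x. box_bump (1 / Suc n) a b x * f x"
  have t: "test_function (box_bump (1 / Suc n) a b)" for n
    by (rule test_function_box_bump[OF ab]) simp
  have [measurable]: "box_bump (1 / Suc n) a b \<in> borel_measurable borel" for n
    using square_integrable_measurable[OF test_function_square_integrable[OF t]] .
  then have [measurable]: "box_bump (1 / (1 + real n)) a b \<in> borel_measurable borel" for n
    by simp
  have i: "square_integrable (indicator (cbox a b) :: real^3 \<Rightarrow> real)"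
    by (auto simp: square_integrable_def power2_eq_square indicator_inter_arith[symmetric]
        intro!: integrable_real_indicator emeasure_lborel_cbox_finite)
  have "(\<lambda>n. LINT x|lborel. ?s n x) \<longlonglongrightarrow> (LINT x|lborel. indicator (box a b) x * f x)"
  proof (rule integral_dominated_convergence[where w = "\<lambda>x. \<bar>indicator (cbox a b) x * f x\<bar>"])
    show "integrable lborel (\<lambda>x. \<bar>indicator (cbox a b) x * f x\<bar>)"
      by (rule square_integrable_bilinear[OF i f]) (auto simp: abs_mult)
    show "AE x in lborel. (\<lambda>n. ?s n x) \<longlonglongrightarrow> indicator (box a b) x * f x"
      by (intro AE_I2 tendsto_mult tendsto_const box_bump_tendsto[OF ab])
    show "AE x in lborel. norm (?s n x) \<le> \<bar>indicator (cbox a b) x * f x\<bar>" for n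
    proof (intro AE_I2)
      fix x
      have "\<bar>box_bump (1 / Suc n) a b x\<bar> \<le> indicator (cbox a b) x"
        using box_bump_bounds[of "1 / Suc n" a b x] box_bump_outside[OF ab, of x "1 / Suc n"]
          box_subset_cbox[of a b] by (cases "x \<in> box a b") (auto simp: indicator_def)
      then show "norm (?s n x) \<le> \<bar>indicator (cbox a b) x * f x\<bar>"
        by (simp add: abs_mult mult_right_mono)
    qed
  qed auto
  moreover have "(LINT x|lborel. ?s n x) = 0" for n
    using z[OF t[of n]] by (simp add: mult.commute)
  ultimately show ?thesis by (simp add: LIMSEQ_const_iff)
next
  case False
  then obtain i where i: "\<not> a $ i < b $ i" by blast
  have "x \<notin> box a b" for x
  proof
    assume "x \<in> box a b"
    then have "a $ i < x $ i" "x $ i < b $ i" by (simp_all add: mem_box_cart)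
    with i show False by linarith
  qed
  then have "box a b = {}" by blast
  then show ?thesis by simp
qed

lemma fundamental_lemma:
  fixes f :: "real^3 \<Rightarrow> real"
  assumes f: "square_integrable f"
    and z: "\<And>\<phi>. test_function \<phi> \<Longrightarrow> (LINT x|lborel. f x * \<phi> x) = 0"
  shows "AE x in lborel. f x = 0"
proof -
  note [measurable] = f[THEN square_integrable_measurable]
  let ?Q = "\<lambda>n::nat. box (- (real n *\<^sub>R One)) (real n *\<^sub>R One) :: (real^3) set"
  have "AE x in lborel. indicator (?Q n) x * f x = 0" for n
  proof -
    let ?g = "\<lambda>x. indicator (?Q n) x * f x"
    have "square_integrable (indicator (?Q n) :: real^3 \<Rightarrow> real)"
      by (auto simp: square_integrable_def power2_eq_square indicator_inter_arith[symmetric]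
          emeasure_lborel_box_finite)
    then have g: "integrable lborel ?g"
      by (rule square_integrable_bilinear[OF _ f]) (auto simp: abs_mult)
    have si: "set_integrable lborel A ?g" if "A \<in> sets borel" for A
      unfolding set_integrable_def using g that by (intro integrable_mult_indicator) auto
    let ?E = "range (\<lambda>(a, b). box a b :: (real^3) set)"
    have E: "sets borel = sigma_sets UNIV ?E"
      by (simp add: borel_eq_box)
    have "(LINT x:A|lborel. ?g x) = 0" if "A \<in> sets borel" for A
    proof -
      have "Int_stable ?E" by (auto simp: Int_stable_def box_Int_box)
      moreover have "?E \<subseteq> Pow UNIV" by simp
      moreover have "A \<in> sigma_sets UNIV ?E" using that E by simp
      ultimately show ?thesis
      proof (induction rule: sigma_sets_induct_disjoint)
        case (basic A)
        then obtain a b where A: "A = box a b" by auto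
        obtain c d where cd: "box a b \<inter> ?Q n = box c d" using box_Int_box by blast
        have "(LINT x:A|lborel. ?g x) = (LINT x|lborel. indicator (box c d) x * f x)"
          unfolding set_lebesgue_integral_def A cd[symmetric]
          by (rule Bochner_Integration.integral_cong) (auto simp: indicator_def)
        then show ?case using fundamental_lemma_boxes[OF f z] by simp
      next
        case empty
        show ?case by (simp add: set_lebesgue_integral_def)
      next
        case (compl A)
        then have A: "A \<in> sets borel" using E by simp
        have "(LINT x:UNIV|lborel. ?g x) = (LINT x:A|lborel. ?g x) + (LINT x:UNIV - A|lborel. ?g x)"
          using set_integral_Un[of A "UNIV - A" lborel ?g] si A by auto
        moreover have "(LINT x:UNIV|lborel. ?g x) = 0"
          using fundamental_lemma_boxes[OF f z] by (simp add: set_lebesgue_integral_def)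
        ultimately show ?case using compl by simp
      next
        case (union A)
        then have A: "A i \<in> sets borel" for i using E by auto
        have "(LINT x:(\<Union>i. A i)|lborel. ?g x) = (\<Sum>i. (LINT x:(A i)|lborel. ?g x))"
          by (rule lebesgue_integral_countable_add)
             (use A union in \<open>auto simp: disjoint_family_on_def intro!: si\<close>)
        with union show ?case by simp
      qed
    qed
    then show ?thesis
      by (intro density_unique_real[OF g, of "\<lambda>x. 0"]) (auto simp: set_lebesgue_integral_def)
  qed
  then have "AE x in lborel. \<forall>n. indicator (?Q n) x * f x = 0"
    by (subst AE_all_countable) blast
  then show ?thesis
  proof eventually_elim
    case (elim x)
    obtain n where "x \<in> ?Q n" using UN_box_eq_UNIV by blast
    with elim[rule_format, of n] show ?case by simp
  qed
qed

subsection \<open>Weak gradients\<close>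

definition weak_gradient_of :: "(real^3 \<Rightarrow> complex) \<Rightarrow> (real^3 \<Rightarrow> complex^3) \<Rightarrow> bool" where
  "weak_gradient_of u G \<longleftrightarrow> (\<forall>\<phi> i. test_function \<phi> \<longrightarrow>
     (LINT x|lborel. u x * of_real (partial_deriv i \<phi> x))
       = - (LINT x|lborel. G x $ i * of_real (\<phi> x)))"

definition H1 :: "(real^3 \<Rightarrow> complex) \<Rightarrow> bool" where
  "H1 u \<longleftrightarrow> square_integrable u \<and> (\<exists>G. square_integrable G \<and> weak_gradient_of u G)"

definition weak_gradient :: "(real^3 \<Rightarrow> complex) \<Rightarrow> real^3 \<Rightarrow> complex^3" where
  "weak_gradient u = (SOME G. square_integrable G \<and> weak_gradient_of u G)"

lemma H1_square_integrable: "H1 u \<Longrightarrow> square_integrable u"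
  by (simp add: H1_def)

lemma weak_gradient:
  assumes "H1 u"
  shows "square_integrable (weak_gradient u)" "weak_gradient_of u (weak_gradient u)"
  using someI_ex[of "\<lambda>G. square_integrable G \<and> weak_gradient_of u G"] assms
  unfolding H1_def weak_gradient_def by blast+

lemma square_integrable_of_real:
  "square_integrable (\<phi> :: real^3 \<Rightarrow> real) \<Longrightarrow> square_integrable (\<lambda>x. complex_of_real (\<phi> x))"
  by (auto simp: square_integrable_def)

lemma square_integrable_mult:
  fixes f g :: "real^3 \<Rightarrow> complex"
  assumes "square_integrable f" "square_integrable g"
  shows "integrable lborel (\<lambda>x. f x * g x)"
proof -
  note [measurable] = assms[THEN square_integrable_measurable]
  show ?thesis
    by (rule square_integrable_bilinear[OF assms]) (simp_all add: norm_mult)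
qed

lemma test_function_mult_integrable:
  assumes "square_integrable f" "test_function \<phi>"
  shows "integrable lborel (\<lambda>x. f x * complex_of_real (\<phi> x))"
    "integrable lborel (\<lambda>x. f x * complex_of_real (partial_deriv i \<phi> x))"
  using assms square_integrable_mult square_integrable_of_real test_function_square_integrable
    test_function_partial_square_integrable by blast+

lemma fundamental_lemma_complex:
  fixes f :: "real^3 \<Rightarrow> complex"
  assumes f: "square_integrable f"
    and z: "\<And>\<phi>. test_function \<phi> \<Longrightarrow> (LINT x|lborel. f x * of_real (\<phi> x)) = 0"
  shows "AE x in lborel. f x = 0"
proof -
  note m[measurable] = f[THEN square_integrable_measurable]
  have r: "square_integrable (\<lambda>x. Re (f x))"
    unfolding square_integrable_def
  proof
    have "norm ((norm (Re (f x)))\<^sup>2) \<le> norm (f x) * norm (f x)" for x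
      using mult_mono[OF abs_Re_le_cmod abs_Re_le_cmod, of "f x" "f x"]
      by (simp add: power2_eq_square)
    then show "integrable lborel (\<lambda>x. (norm (Re (f x)))\<^sup>2)"
      by (intro square_integrable_bilinear[OF f f]) simp_all
  qed simp
  have i: "square_integrable (\<lambda>x. Im (f x))"
    unfolding square_integrable_def
  proof
    have "norm ((norm (Im (f x)))\<^sup>2) \<le> norm (f x) * norm (f x)" for x
      using mult_mono[OF abs_Im_le_cmod abs_Im_le_cmod, of "f x" "f x"]
      by (simp add: power2_eq_square)
    then show "integrable lborel (\<lambda>x. (norm (Im (f x)))\<^sup>2)"
      by (intro square_integrable_bilinear[OF f f]) simp_all
  qed simp
  have "AE x in lborel. Re (f x) = 0"
  proof (rule fundamental_lemma[OF r])
    fix \<phi> assume t: "test_function \<phi>"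
    show "(LINT x|lborel. Re (f x) * \<phi> x) = 0"
      using integral_Re[OF test_function_mult_integrable(1)[OF f t]] z[OF t] by simp
  qed
  moreover have "AE x in lborel. Im (f x) = 0"
  proof (rule fundamental_lemma[OF i])
    fix \<phi> assume t: "test_function \<phi>"
    show "(LINT x|lborel. Im (f x) * \<phi> x) = 0"
      using integral_Im[OF test_function_mult_integrable(1)[OF f t]] z[OF t] by simp
  qed
  ultimately show ?thesis by eventually_elim (simp add: complex_eq_iff)
qed

lemma square_integrable_diff:
  "square_integrable f \<Longrightarrow> square_integrable g \<Longrightarrow> square_integrable (\<lambda>x. f x - g x)"
  using square_integrable_add[of f "\<lambda>x. (-1) *\<^sub>R g x"] square_integrable_scaleR[of g "-1"] by simp

lemma weak_gradient_unique:
  assumes G: "square_integrable G" "weak_gradient_of u G"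
    and G': "square_integrable G'" "weak_gradient_of v G'" and uv: "AE x in lborel. u x = v x"
    and u: "square_integrable u" "square_integrable v"
  shows "AE x in lborel. G x = G' x"
proof -
  have "AE x in lborel. G x $ i - G' x $ i = 0" for i
  proof (rule fundamental_lemma_complex)
    have si: "square_integrable (\<lambda>x. G x $ i)" "square_integrable (\<lambda>x. G' x $ i)"
      using G G' by (auto intro: square_integrable_nth)
    then show "square_integrable (\<lambda>x. G x $ i - G' x $ i)"
      by (rule square_integrable_diff)
    fix \<phi> assume t: "test_function \<phi>"
    note [measurable] = u[THEN square_integrable_measurable]
      square_integrable_measurable[OF test_function_partial_square_integrable[OF t]]
    have "(LINT x|lborel. u x * of_real (partial_deriv i \<phi> x))
        = (LINT x|lborel. v x * of_real (partial_deriv i \<phi> x))"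
      by (rule integral_cong_AE) (use uv in auto)
    moreover have
      "(LINT x|lborel. u x * of_real (partial_deriv i \<phi> x)) = - (LINT x|lborel. G x $ i * of_real (\<phi> x))"
      "(LINT x|lborel. v x * of_real (partial_deriv i \<phi> x)) = - (LINT x|lborel. G' x $ i * of_real (\<phi> x))"
      using G(2) G'(2) t unfolding weak_gradient_of_def by blast+
    ultimately have "(LINT x|lborel. G x $ i * of_real (\<phi> x))
        = (LINT x|lborel. G' x $ i * of_real (\<phi> x))"
      by simp
    then show "(LINT x|lborel. (G x $ i - G' x $ i) * of_real (\<phi> x)) = 0"
      using test_function_mult_integrable(1)[OF si(1) t] test_function_mult_integrable(1)[OF si(2) t]
      by (simp add: left_diff_distrib)
  qed
  then have "AE x in lborel. \<forall>i\<in>UNIV. G x $ i - G' x $ i = 0"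
    by (intro AE_finite_allI) auto
  then show ?thesis by eventually_elim (simp add: vec_eq_iff)
qed

lemma weak_gradient_of_add:
  assumes "square_integrable u" "square_integrable v" "square_integrable G" "square_integrable G'"
    "weak_gradient_of u G" "weak_gradient_of v G'"
  shows "weak_gradient_of (\<lambda>x. u x + v x) (\<lambda>x. G x + G' x)"
  unfolding weak_gradient_of_def
proof (intro allI impI)
  fix \<phi> i assume t: "test_function \<phi>"
  show "(LINT x|lborel. (u x + v x) * complex_of_real (partial_deriv i \<phi> x))
      = - (LINT x|lborel. (G x + G' x) $ i * complex_of_real (\<phi> x))"
    using assms(5,6) t
      test_function_mult_integrable(2)[OF assms(1) t, of i]
      test_function_mult_integrable(2)[OF assms(2) t, of i]
      test_function_mult_integrable(1)[OF square_integrable_nth[OF assms(3)] t, of i]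
      test_function_mult_integrable(1)[OF square_integrable_nth[OF assms(4)] t, of i]
    by (simp add: distrib_right weak_gradient_of_def)
qed

lemma weak_gradient_of_scaleR:
  assumes "weak_gradient_of u G"
  shows "weak_gradient_of (\<lambda>x. c *\<^sub>R u x) (\<lambda>x. c *\<^sub>R G x)"
  using assms by (simp add: weak_gradient_of_def)

lemma weak_gradient_of_0: "weak_gradient_of (\<lambda>x. 0) (\<lambda>x. 0)"
  by (simp add: weak_gradient_of_def)

lemma H1_0: "H1 (\<lambda>x. 0)"
  unfolding H1_def
  by (intro conjI exI[of _ "\<lambda>x. 0"] square_integrable_0 weak_gradient_of_0)

lemma H1_add: "H1 u \<Longrightarrow> H1 v \<Longrightarrow> H1 (\<lambda>x. u x + v x)"
  unfolding H1_def[of "\<lambda>x. u x + v x"]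
  by (intro conjI exI[of _ "\<lambda>x. weak_gradient u x + weak_gradient v x"]
      square_integrable_add weak_gradient_of_add weak_gradient H1_square_integrable)

lemma H1_scaleR: "H1 u \<Longrightarrow> H1 (\<lambda>x. c *\<^sub>R u x)"
  unfolding H1_def[of "\<lambda>x. c *\<^sub>R u x"]
  by (intro conjI exI[of _ "\<lambda>x. c *\<^sub>R weak_gradient u x"]
      square_integrable_scaleR weak_gradient_of_scaleR weak_gradient H1_square_integrable)

lemma H1_uminus: "H1 u \<Longrightarrow> H1 (\<lambda>x. - u x)"
  using H1_scaleR[of u "-1"] by simp

lemma H1_diff: "H1 u \<Longrightarrow> H1 v \<Longrightarrow> H1 (\<lambda>x. u x - v x)"
  using H1_add[of u "\<lambda>x. - v x"] H1_uminus[of v] by simp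

subsection \<open>The inner product space\<close>

definition H1_eq :: "(real^3 \<Rightarrow> complex) \<Rightarrow> (real^3 \<Rightarrow> complex) \<Rightarrow> bool" where
  "H1_eq u v \<longleftrightarrow> H1 u \<and> H1 v \<and> (AE x in lborel. u x = v x)"

lemma part_equivp_H1_eq: "part_equivp H1_eq"
proof (rule part_equivpI)
  show "\<exists>u. H1_eq u u" unfolding H1_eq_def using H1_0 by auto
  show "symp H1_eq" unfolding H1_eq_def by (auto intro!: sympI)
  show "transp H1_eq" unfolding H1_eq_def by (rule transpI) auto
qed

quotient_type h1 = "real^3 \<Rightarrow> complex" / partial: H1_eq
  morphisms fun_of h1_of
  by (rule part_equivp_H1_eq)

text \<open>\<^term>\<open>fun_of u\<close> is an arbitrary representative of the class \<open>u\<close>.\<close>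

definition grad :: "h1 \<Rightarrow> real^3 \<Rightarrow> complex^3" where
  "grad u = weak_gradient (fun_of u)"

instantiation h1 :: real_inner
begin

lift_definition zero_h1 :: h1 is "\<lambda>x. 0"
  by (simp add: H1_eq_def H1_0)

lift_definition plus_h1 :: "h1 \<Rightarrow> h1 \<Rightarrow> h1" is "\<lambda>u v x. u x + v x"
  unfolding H1_eq_def by (auto intro: H1_add elim: eventually_elim2)

lift_definition uminus_h1 :: "h1 \<Rightarrow> h1" is "\<lambda>u x. - u x"
  unfolding H1_eq_def by (auto intro: H1_uminus)

lift_definition minus_h1 :: "h1 \<Rightarrow> h1 \<Rightarrow> h1" is "\<lambda>u v x. u x - v x"
  unfolding H1_eq_def by (auto intro: H1_diff elim: eventually_elim2)

lift_definition scaleR_h1 :: "real \<Rightarrow> h1 \<Rightarrow> h1" is "\<lambda>c u x. c *\<^sub>R u x"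
  unfolding H1_eq_def by (auto intro: H1_scaleR)

definition inner_h1 :: "h1 \<Rightarrow> h1 \<Rightarrow> real" where
  "inner_h1 u v = (LINT x|lborel. fun_of u x \<bullet> fun_of v x) + (LINT x|lborel. grad u x \<bullet> grad v x)"

definition norm_h1 :: "h1 \<Rightarrow> real" where
  "norm_h1 u = sqrt (inner u u)"

definition sgn_h1 :: "h1 \<Rightarrow> h1" where
  "sgn_h1 u = inverse (norm u) *\<^sub>R u"

definition dist_h1 :: "h1 \<Rightarrow> h1 \<Rightarrow> real" where
  "dist_h1 u v = norm (u - v)"

definition uniformity_h1 :: "(h1 \<times> h1) filter" where
  "uniformity_h1 = (INF e\<in>{0<..}. principal {(x, y). dist x y < e})"

definition open_h1 :: "h1 set \<Rightarrow> bool" where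
  "open_h1 U \<longleftrightarrow> (\<forall>x\<in>U. \<forall>\<^sub>F (x', y) in uniformity. x' = x \<longrightarrow> y \<in> U)"

lemma fun_of_H1: "H1 (fun_of u)"
  using Quotient3_rep_reflp[OF Quotient3_h1, of u] by (simp add: H1_eq_def)

lemma fun_of_h1_of: "H1 f \<Longrightarrow> AE x in lborel. fun_of (h1_of f) x = f x"
  using Quotient3_rep_abs[OF Quotient3_h1, of f] by (simp add: H1_eq_def)

lemma h1_eqI: "(AE x in lborel. fun_of u x = fun_of v x) \<Longrightarrow> u = v"
  using Quotient3_rel_rep[OF Quotient3_h1, of u v] fun_of_H1 by (simp add: H1_eq_def)

lemma plus_h1_eq: "u + v = h1_of (\<lambda>x. fun_of u x + fun_of v x)"
  by (simp add: plus_h1_def)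

lemma scaleR_h1_eq: "c *\<^sub>R u = h1_of (\<lambda>x. c *\<^sub>R fun_of u x)"
  by (simp add: scaleR_h1_def)

lemma fun_of_plus: "AE x in lborel. fun_of (u + v) x = fun_of u x + fun_of v x"
  unfolding plus_h1_eq by (intro fun_of_h1_of H1_add fun_of_H1)

lemma fun_of_scaleR: "AE x in lborel. fun_of (c *\<^sub>R u) x = c *\<^sub>R fun_of u x"
  unfolding scaleR_h1_eq by (intro fun_of_h1_of H1_scaleR fun_of_H1)

lemma fun_of_zero: "AE x in lborel. fun_of 0 x = 0"
  unfolding zero_h1_def by (intro fun_of_h1_of H1_0)

lemma fun_of_square_integrable: "square_integrable (fun_of u)"
  by (rule H1_square_integrable[OF fun_of_H1])

lemma grad_square_integrable: "square_integrable (grad u)"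
  unfolding grad_def by (rule weak_gradient(1)[OF fun_of_H1])

lemma grad_weak_gradient: "weak_gradient_of (fun_of u) (grad u)"
  unfolding grad_def by (rule weak_gradient(2)[OF fun_of_H1])

lemma grad_eqI:
  assumes "square_integrable G" "weak_gradient_of v G" "square_integrable v"
    "AE x in lborel. fun_of u x = v x"
  shows "AE x in lborel. grad u x = G x"
  by (rule weak_gradient_unique[OF grad_square_integrable grad_weak_gradient assms(1,2,4)
        fun_of_square_integrable assms(3)])

lemma grad_plus: "AE x in lborel. grad (u + v) x = grad u x + grad v x"
  by (rule grad_eqI[OF _ _ _ fun_of_plus])
     (intro square_integrable_add weak_gradient_of_add grad_square_integrable
        grad_weak_gradient fun_of_square_integrable)+

lemma grad_scaleR: "AE x in lborel. grad (c *\<^sub>R u) x = c *\<^sub>R grad u x"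
  by (rule grad_eqI[OF _ _ _ fun_of_scaleR])
     (intro square_integrable_scaleR weak_gradient_of_scaleR grad_square_integrable
        grad_weak_gradient fun_of_square_integrable)+

lemma grad_zero: "AE x in lborel. grad 0 x = 0"
  by (rule grad_eqI[OF _ _ _ fun_of_zero])
     (intro square_integrable_0 weak_gradient_of_0)+

lemmas h1_measurable [measurable] =
  square_integrable_measurable[OF fun_of_square_integrable]
  square_integrable_measurable[OF grad_square_integrable]

instance
proof
  fix u v w :: h1 and a b :: real
  show "u + v + w = u + (v + w)" "u + v = v + u" "0 + u = u" "- u + u = 0" "u - v = u + - v"
    "a *\<^sub>R (u + v) = a *\<^sub>R u + a *\<^sub>R v" "(a + b) *\<^sub>R u = a *\<^sub>R u + b *\<^sub>R u"
    "a *\<^sub>R b *\<^sub>R u = (a * b) *\<^sub>R u" "1 *\<^sub>R u = u"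
    by (transfer; auto simp: H1_eq_def algebra_simps intro: H1_0 H1_add H1_diff H1_uminus H1_scaleR)+
  show "dist u v = norm (u - v)" by (rule dist_h1_def)
  show "sgn u = inverse (norm u) *\<^sub>R u" by (rule sgn_h1_def)
  show "uniformity = (INF e\<in>{0<..}. principal {(x, y :: h1). dist x y < e})"
    by (rule uniformity_h1_def)
  show "open U \<longleftrightarrow> (\<forall>x\<in>U. \<forall>\<^sub>F (x', y) in uniformity. x' = x \<longrightarrow> y \<in> U)" for U :: "h1 set"
    by (rule open_h1_def)
  show "norm u = sqrt (u \<bullet> u)" by (rule norm_h1_def)
  show "u \<bullet> v = v \<bullet> u" by (simp add: inner_h1_def inner_commute)
  note si = square_integrable_inner[OF fun_of_square_integrable fun_of_square_integrable]
    square_integrable_inner[OF grad_square_integrable grad_square_integrable]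
  show "(u + v) \<bullet> w = u \<bullet> w + v \<bullet> w"
  proof -
    have "(LINT x|lborel. fun_of (u + v) x \<bullet> fun_of w x)
        = (LINT x|lborel. fun_of u x \<bullet> fun_of w x + fun_of v x \<bullet> fun_of w x)"
      by (rule integral_cong_AE)
         (simp_all, use fun_of_plus[of u v] in \<open>eventually_elim, simp add: inner_add_left\<close>)
    moreover have "(LINT x|lborel. grad (u + v) x \<bullet> grad w x)
        = (LINT x|lborel. grad u x \<bullet> grad w x + grad v x \<bullet> grad w x)"
      by (rule integral_cong_AE)
         (simp_all, use grad_plus[of u v] in \<open>eventually_elim, simp add: inner_add_left\<close>)
    ultimately show ?thesis by (simp add: inner_h1_def si)
  qed
  show "(a *\<^sub>R u) \<bullet> v = a * (u \<bullet> v)"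
  proof -
    have "(LINT x|lborel. fun_of (a *\<^sub>R u) x \<bullet> fun_of v x)
        = (LINT x|lborel. a * (fun_of u x \<bullet> fun_of v x))"
      by (rule integral_cong_AE) (simp_all, use fun_of_scaleR[of a u] in \<open>eventually_elim, simp\<close>)
    moreover have "(LINT x|lborel. grad (a *\<^sub>R u) x \<bullet> grad v x)
        = (LINT x|lborel. a * (grad u x \<bullet> grad v x))"
      by (rule integral_cong_AE) (simp_all, use grad_scaleR[of a u] in \<open>eventually_elim, simp\<close>)
    ultimately show ?thesis by (simp add: inner_h1_def distrib_left)
  qed
  have nn: "0 \<le> (LINT x|lborel. fun_of u x \<bullet> fun_of u x)" "0 \<le> (LINT x|lborel. grad u x \<bullet> grad u x)"
    by (auto intro: integral_nonneg_AE)
  then show "0 \<le> u \<bullet> u" by (simp add: inner_h1_def)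
  show "u \<bullet> u = 0 \<longleftrightarrow> u = 0"
  proof
    assume "u \<bullet> u = 0"
    then have "(LINT x|lborel. fun_of u x \<bullet> fun_of u x) = 0"
      using nn unfolding inner_h1_def by linarith
    then have "AE x in lborel. fun_of u x \<bullet> fun_of u x = 0"
      by (subst (asm) integral_nonneg_eq_0_iff_AE) (auto intro: si)
    with fun_of_zero have "AE x in lborel. fun_of u x = fun_of 0 x"
      by eventually_elim simp
    then show "u = 0" by (rule h1_eqI)
  next
    assume u: "u = 0"
    have "(LINT x|lborel. fun_of 0 x \<bullet> fun_of 0 x) = (LINT x|(lborel :: (real^3) measure). 0 :: real)"
      by (rule integral_cong_AE) (simp_all, use fun_of_zero in \<open>eventually_elim, simp\<close>)
    moreover have "(LINT x|lborel. grad 0 x \<bullet> grad 0 x) = (LINT x|(lborel :: (real^3) measure). 0 :: real)"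
      by (rule integral_cong_AE) (simp_all, use grad_zero in \<open>eventually_elim, simp\<close>)
    ultimately show "u \<bullet> u = 0" by (simp add: inner_h1_def u)
  qed
qed

end

section \<open>The dipolar interaction\<close>

text \<open>Fourier transform normalised as \<open>\<integral> f(x) e\<^sup>-\<^sup>i\<^sup>x\<^sup>\<cdot>\<^sup>\<xi> dx\<close>.\<close>

definition fourier :: "(real^3 \<Rightarrow> complex) \<Rightarrow> real^3 \<Rightarrow> complex" where
  "fourier f \<xi> = (LINT x|lborel. f x * cis (- (x \<bullet> \<xi>)))"

text \<open>The transform of a general square integrable function, determined up to null sets
  (Plancherel), is the mean-square limit of the transforms of its truncations to balls, which
  are integrable.\<close>

definition L2_fourier :: "(real^3 \<Rightarrow> complex) \<Rightarrow> (real^3 \<Rightarrow> complex) \<Rightarrow> bool" where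
  "L2_fourier f F \<longleftrightarrow> square_integrable f \<and> square_integrable F \<and>
     ((\<lambda>R. \<integral>\<^sup>+\<xi>. ennreal ((cmod (fourier (\<lambda>x. indicator (ball 0 R) x * f x) \<xi> - F \<xi>))\<^sup>2) \<partial>lborel)
       \<longlongrightarrow> 0) at_top"

definition fourier_multiplier ::
  "(real^3 \<Rightarrow> real) \<Rightarrow> (real^3 \<Rightarrow> complex) \<Rightarrow> (real^3 \<Rightarrow> complex) \<Rightarrow> bool" where
  "fourier_multiplier m f g \<longleftrightarrow> (\<exists>F. L2_fourier f F \<and> L2_fourier g (\<lambda>\<xi>. of_real (m \<xi>) * F \<xi>))"

text \<open>Fourier transform of the kernel \<open>K(x) = (1 - 3 cos\<^sup>2 \<theta>) / \<bar>x\<bar>\<^sup>3\<close>, where \<open>\<theta>\<close> is the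
  angle between \<open>x\<close> and \<open>(0, 0, 1)\<close>.\<close>

definition dipolar_symbol :: "real^3 \<Rightarrow> real" where
  "dipolar_symbol \<xi> =
     4 / 3 * pi * ((2 * (\<xi> $ 3)\<^sup>2 - (\<xi> $ 1)\<^sup>2 - (\<xi> $ 2)\<^sup>2) / (norm \<xi>)\<^sup>2)"

text \<open>\<open>K \<star> f\<close> for real square integrable \<open>f\<close>. The result is real since the symbol is real and
  even, and it is determined up to null sets.\<close>

definition dipolar_conv :: "(real^3 \<Rightarrow> real) \<Rightarrow> real^3 \<Rightarrow> real" where
  "dipolar_conv f = (SOME g :: real^3 \<Rightarrow> real.
     fourier_multiplier dipolar_symbol (\<lambda>x. of_real (f x)) (\<lambda>x. of_real (g x)))"

definition unstable_regime :: "real \<Rightarrow> real \<Rightarrow> bool" where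
  "unstable_regime l\<^sub>1 l\<^sub>2 \<longleftrightarrow> l\<^sub>2 \<noteq> 0 \<and>
     (l\<^sub>2 > 0 \<longrightarrow> l\<^sub>1 - 4 / 3 * pi * l\<^sub>2 < 0) \<and>
     (l\<^sub>2 < 0 \<longrightarrow> l\<^sub>1 + 8 / 3 * pi * l\<^sub>2 < 0)"

section \<open>The constrained variational problem\<close>

definition abs_sq :: "h1 \<Rightarrow> real^3 \<Rightarrow> real" where
  "abs_sq u x = (cmod (fun_of u x))\<^sup>2"

definition l2_inner :: "h1 \<Rightarrow> h1 \<Rightarrow> real" where
  "l2_inner u v = (LINT x|lborel. fun_of u x \<bullet> fun_of v x)"

definition mass :: "h1 \<Rightarrow> real" where
  "mass u = (LINT x|lborel. abs_sq u x)"

definition kinetic :: "h1 \<Rightarrow> real" where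
  "kinetic u = (LINT x|lborel. (norm (grad u x))\<^sup>2)"

definition energy :: "real \<Rightarrow> real \<Rightarrow> h1 \<Rightarrow> real" where
  "energy l\<^sub>1 l\<^sub>2 u = 1 / 2 * kinetic u
     + l\<^sub>1 / 2 * (LINT x|lborel. (cmod (fun_of u x)) ^ 4)
     + l\<^sub>2 / 2 * (LINT x|lborel. dipolar_conv (abs_sq u) x * abs_sq u x)"

definition sphere_S :: "real \<Rightarrow> h1 set" where
  "sphere_S c = {u. mass u = c}"

definition A_set :: "real \<Rightarrow> real \<Rightarrow> h1 set" where
  "A_set c k = {u \<in> sphere_S c. kinetic u \<le> k}"

definition mp_paths :: "real \<Rightarrow> real \<Rightarrow> real \<Rightarrow> real \<Rightarrow> (real \<Rightarrow> h1) set" where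
  "mp_paths l\<^sub>1 l\<^sub>2 c k = {g. path g \<and> path_image g \<subseteq> sphere_S c \<and>
     pathstart g \<in> A_set c k \<and> energy l\<^sub>1 l\<^sub>2 (pathfinish g) < 0}"

text \<open>Infima and suprema are taken in the extended reals, where they always exist; the inner
  supremum is a maximum because the energy is continuous and \<open>[0, 1]\<close> is compact.\<close>

definition mp_level :: "real \<Rightarrow> real \<Rightarrow> real \<Rightarrow> real \<Rightarrow> ereal" where
  "mp_level l\<^sub>1 l\<^sub>2 c k =
     (INF g\<in>mp_paths l\<^sub>1 l\<^sub>2 c k. SUP t\<in>{0..1}. ereal (energy l\<^sub>1 l\<^sub>2 (g t)))"

text \<open>The tangent space of \<^term>\<open>sphere_S c\<close> at \<open>u\<close> consists of all \<open>v\<close> with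
  \<^prop>\<open>l2_inner u v = 0\<close>, and the derivative of the restricted energy is the restriction of
  the Frechet derivative on \<open>H\<^sup>1\<close> to it.\<close>

definition critical_on_sphere :: "real \<Rightarrow> real \<Rightarrow> real \<Rightarrow> h1 \<Rightarrow> bool" where
  "critical_on_sphere l\<^sub>1 l\<^sub>2 c u \<longleftrightarrow> u \<in> sphere_S c \<and>
     (\<exists>D. (energy l\<^sub>1 l\<^sub>2 has_derivative D) (at u) \<and> (\<forall>v. l2_inner u v = 0 \<longrightarrow> D v = 0))"

text \<open>Weak solutions of
  \<open>- 1/2 \<Delta>u + l\<^sub>1 \<bar>u\<bar>\<^sup>2 u + l\<^sub>2 (K \<star> \<bar>u\<bar>\<^sup>2) u + \<mu> u = 0\<close>, i.e. equality in the dual of \<open>H\<^sup>1\<close>.\<close>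

definition solves_stationary :: "real \<Rightarrow> real \<Rightarrow> real \<Rightarrow> h1 \<Rightarrow> bool" where
  "solves_stationary l\<^sub>1 l\<^sub>2 \<mu> u \<longleftrightarrow> (\<forall>v.
     1 / 2 * (LINT x|lborel. (\<Sum>i\<in>UNIV. grad u x $ i * cnj (grad v x $ i)))
     + of_real l\<^sub>1 * (LINT x|lborel. of_real (abs_sq u x) * fun_of u x * cnj (fun_of v x))
     + of_real l\<^sub>2 * (LINT x|lborel. of_real (dipolar_conv (abs_sq u) x) * fun_of u x * cnj (fun_of v x))
     + of_real \<mu> * (LINT x|lborel. fun_of u x * cnj (fun_of v x)) = 0)"

end

theory Submission
  imports Defs "HOL-Probability.Probability" "HOL-Library.Diagonal_Subsequence"
begin

text \<open>Everything takes place on the Fourier side. Writing \<open>A\<close> for the kinetic energy, \<open>M\<close> for the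
  mass and \<open>B\<close> for the quartic part of the energy, so that \<open>E = (A + B) / 2\<close>, the Gagliardo--Nirenberg
  quotient \<open>- B / (A sqrt (A M))\<close> attains a positive maximum \<open>J\<close>: in the unstable regime an anisotropic
  dilation makes \<open>B\<close> negative, the total mass cannot vanish after translations, and a Brezis--Lieb
  splitting excludes dichotomy by the homogeneity of the quotient. Rescaled to mass \<open>c\<close> and
  \<open>B = - 2/3 A\<close>, the maximizer is a critical point of energy \<open>A / 6 = 2 / (27 J\<^sup>2 c)\<close>.

  Any critical point satisfies the Pohozaev identity \<open>A + 3/2 B = 0\<close>. It is obtained by bootstrapping
  the equation to \<open>H\<^sup>2\<close> and testing it with the variation along the vector field \<open>sin (\<eta> \<bullet> x) \<eta>\<close>, which
  on the Fourier side consists of shifts by \<open>\<plusminus> \<eta>\<close>, so that the limit \<open>\<eta> \<longlongrightarrow> 0\<close> needs no decay in \<open>x\<close>.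
  By the maximality of \<open>J\<close>, a point of mass \<open>c\<close> with \<open>A + 3/2 B = 0\<close> has energy at least \<open>2 / (27 J\<^sup>2 c)\<close>.
  Every admissible path passes through such a point, since \<open>A + 3/2 B\<close> is positive for small \<open>A\<close> and
  negative where \<open>E < 0\<close>, and the dilations of the maximizer form an optimal path.\<close>

section \<open>Hilbert spaces\<close>

text \<open>On the transform side all estimates are L^2 estimates: the dipolar operator is
  multiplication by a bounded symbol, and an L^4 norm is the L^2 norm of a product, whose transform
  is a correlation. The weights 1 / (wt^2 wt^2) of two H^1 factors carry 4 powers of decay, while
  integrability in dimension 3 takes more than 3. The estimates are built on the exponent 7/2 in
  between (\<open>decay\<close>). Its integrability gives the product estimate and the
  Hilbert--Schmidt kernels, the spare 1/2 gives smallness at high frequencies, and each pass through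
  the equation gains 2 - 7/4 = 1/4 derivative. The obstacle is that the kernel has no sign and the
  form is negative only for suitably shaped functions, so compactness has to be won modulo
  translations. The constants come from the curve of mass-preserving dilations: with x = 1/t the
  energy is A x^2 / 2 + B x^3 / 2, which is stationary at x = 1 exactly if A + 3/2 B = 0 and then
  has the value A / 6. Combined with equality -B = J A sqrt (A c) this forces J sqrt (A c) = 2/3,
  that is A = 4 / (9 J^2 c).\<close>

lemma orthogonal_projection_exists:
  fixes S :: "'a::{real_inner, complete_space} set"
  assumes S: "subspace S" "closed S"
  obtains p where "p \<in> S" "\<And>s. s \<in> S \<Longrightarrow> (x - p) \<bullet> s = 0"
proof -
  define d where "d = Inf ((\<lambda>s. (norm (x - s))\<^sup>2) ` S)"
  have S0: "0 \<in> S" using S(1) by (rule subspace_0)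
  have bdd: "bdd_below ((\<lambda>s. (norm (x - s))\<^sup>2) ` S)" by (auto intro!: bdd_belowI[of _ 0])
  have dle: "d \<le> (norm (x - s))\<^sup>2" if "s \<in> S" for s
    unfolding d_def using that bdd by (auto intro: cInf_lower)
  have "\<exists>s\<in>S. (norm (x - s))\<^sup>2 < d + 1 / Suc n" for n
  proof -
    have "\<exists>y\<in>(\<lambda>s. (norm (x - s))\<^sup>2) ` S. y < d + 1 / Suc n"
      using S0 bdd unfolding d_def by (subst cInf_less_iff[symmetric]) auto
    then show ?thesis by auto
  qed
  then obtain s where s: "\<And>n. s n \<in> S" "\<And>n. (norm (x - s n))\<^sup>2 < d + 1 / Suc n" by metis
  \<comment> \<open>Parallelogram identity: the midpoint of two near-minimizers lies in
    \<open>S\<close>, so its squared distance to \<open>x\<close> is at least \<open>d\<close>,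
    which leaves little room between the two.\<close>
  have par: "(norm (s m - s n))\<^sup>2 \<le> 2 * (1 / Suc m + 1 / Suc n)" for m n
  proof -
    have mid: "(1/2) *\<^sub>R (s m + s n) \<in> S"
      using S(1) s by (intro subspace_mul subspace_add)
    have "(norm (s m - s n))\<^sup>2
      = 2 * (norm (x - s m))\<^sup>2 + 2 * (norm (x - s n))\<^sup>2 - 4 * (norm (x - (1/2) *\<^sub>R (s m + s n)))\<^sup>2"
      unfolding power2_norm_eq_inner
      by (simp add: inner_diff_left inner_diff_right inner_add_left inner_add_right inner_commute
          field_simps)
    then show ?thesis using dle[OF mid] s(2)[of m] s(2)[of n]
      unfolding distrib_left by linarith
  qed
  have "Cauchy s"
  proof (rule metric_CauchyI)
    fix e :: real assume e: "e > 0"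
    then have e2: "e\<^sup>2 / 4 > 0" by simp
    then obtain N where N: "1 / real (Suc N) < e\<^sup>2 / 4"
      using nat_approx_posE by blast
    show "\<exists>M. \<forall>m\<ge>M. \<forall>n\<ge>M. dist (s m) (s n) < e"
    proof (intro exI allI impI)
      fix m n assume "N \<le> m" "N \<le> n"
      then have "1 / real (Suc m) \<le> 1 / real (Suc N)" "1 / real (Suc n) \<le> 1 / real (Suc N)"
        by (auto intro!: divide_left_mono)
      then have "(norm (s m - s n))\<^sup>2 < e\<^sup>2" using par[of m n] N unfolding distrib_left by linarith
      then show "dist (s m) (s n) < e"
        using e unfolding dist_norm by (meson power_less_imp_less_base less_imp_le)
    qed
  qed
  then obtain p where p: "s \<longlonglongrightarrow> p" using Cauchy_convergent_iff convergent_def by blast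
  have pS: "p \<in> S" using closed_sequentially[OF S(2)] s(1) p by blast
  have pd: "(norm (x - p))\<^sup>2 \<le> d"
  proof (rule LIMSEQ_le)
    show "(\<lambda>n. (norm (x - s n))\<^sup>2) \<longlonglongrightarrow> (norm (x - p))\<^sup>2" by (intro tendsto_intros p)
    show "(\<lambda>n. d + 1 / Suc n) \<longlonglongrightarrow> d"
      using tendsto_add[OF tendsto_const[of d] LIMSEQ_Suc[OF lim_1_over_n]] by simp
    show "\<exists>N. \<forall>n\<ge>N. (norm (x - s n))\<^sup>2 \<le> d + 1 / Suc n" using s(2) less_imp_le by blast
  qed
  have "(x - p) \<bullet> t = 0" if t: "t \<in> S" for t
  proof (rule ccontr)
    assume n: "(x - p) \<bullet> t \<noteq> 0"
    then have tt: "t \<bullet> t > 0" by auto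
    \<comment> \<open>This multiple of \<open>t\<close> minimises the quadratic in \<open>r\<close>
      below; a nonzero inner product would push the squared distance below its infimum
      \<open>d\<close>.\<close>
    define r where "r = ((x - p) \<bullet> t) / (t \<bullet> t)"
    have pr: "p + r *\<^sub>R t \<in> S" using S(1) pS t by (intro subspace_mul subspace_add)
    have "(norm (x - p))\<^sup>2 \<le> (norm (x - (p + r *\<^sub>R t)))\<^sup>2" by (rule order_trans[OF pd dle[OF pr]])
    also have "\<dots> = (norm ((x - p) - r *\<^sub>R t))\<^sup>2" by (simp add: algebra_simps)
    also have "\<dots> = (norm (x - p))\<^sup>2 - 2 * r * ((x - p) \<bullet> t) + r * r * (t \<bullet> t)"
      unfolding power2_norm_eq_inner
      by (simp add: inner_diff_left inner_diff_right inner_commute algebra_simps)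
    also have "\<dots> = (norm (x - p))\<^sup>2 - ((x - p) \<bullet> t)\<^sup>2 / (t \<bullet> t)"
      using tt by (simp add: r_def field_simps power2_eq_square)
    finally have "((x - p) \<bullet> t)\<^sup>2 / (t \<bullet> t) \<le> 0" by simp
    then show False using n tt by (simp add: divide_le_0_iff)
  qed
  with pS show ?thesis by (rule that)
qed

text \<open>The projection error is orthogonal to \<open>S\<close>, hence zero. This is the density
  criterion used later: applied to the set of vectors for which some limit or identity holds, it
  reduces a claim about the whole space to a total family.\<close>

lemma closed_subspace_UNIV:
  fixes S :: "'a::{real_inner, complete_space} set"
  assumes "subspace S" "closed S" and z: "\<And>x. (\<And>s. s \<in> S \<Longrightarrow> x \<bullet> s = 0) \<Longrightarrow> x = 0"
  shows "x \<in> S"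
proof -
  obtain p where p: "p \<in> S" "\<And>s. s \<in> S \<Longrightarrow> (x - p) \<bullet> s = 0"
    using orthogonal_projection_exists[OF assms(1,2)] by blast
  then have "x - p = 0" using z by blast
  with p show ?thesis by simp
qed

lemma riesz_representation:
  fixes f :: "'a::{real_inner, complete_space} \<Rightarrow> real"
  assumes f: "bounded_linear f"
  shows "\<exists>l. \<forall>x. f x = x \<bullet> l"
proof (cases "\<forall>x. f x = 0")
  case True
  then show ?thesis by (intro exI[of _ 0]) simp
next
  case False
  then obtain x where x: "f x \<noteq> 0" by blast
  interpret f: bounded_linear f by (rule f)
  let ?K = "{x. f x = 0}"
  have "subspace ?K" by (simp add: subspace_def f.zero f.add f.scale)
  moreover have "closed ?K"
    by (intro closed_Collect_eq continuous_on_const f.continuous_on continuous_on_id)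
  ultimately obtain p where p: "f p = 0" "\<And>s. f s = 0 \<Longrightarrow> (x - p) \<bullet> s = 0"
    by (rule orthogonal_projection_exists[of ?K x]) auto
  \<comment> \<open>\<open>e\<close> is orthogonal to the kernel, so the representing vector is
    sought among its multiples; the scalar is fixed by evaluating at \<open>e\<close>
    itself.\<close>
  define e where "e = x - p"
  have fe: "f e = f x" using p by (simp add: e_def f.diff)
  then have ee: "e \<bullet> e > 0" using x f.zero by auto
  have "f y = y \<bullet> ((f e / (e \<bullet> e)) *\<^sub>R e)" for y
  proof -
    have "f (y - (f y / f e) *\<^sub>R e) = 0" using fe x by (simp add: f.diff f.scale)
    then have "e \<bullet> (y - (f y / f e) *\<^sub>R e) = 0" using p(2) by (simp add: e_def)
    then have "e \<bullet> y = (f y / f e) * (e \<bullet> e)" by (simp add: inner_diff_right)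
    then show ?thesis using ee fe x by (simp add: inner_commute)
  qed
  then show ?thesis by blast
qed

text \<open>The diagonal argument is run against the sequence itself: along \<open>r\<close> all
  inner products with the \<open>u m\<close> converge. The set \<open>S\<close> of vectors with
  convergent inner products is a closed subspace containing every \<open>u m\<close>. A vector
  orthogonal to all \<open>u m\<close> has constant zero products, hence lies in \<open>S\<close> as
  well, so \<open>S\<close> is everything. Riesz represents the limit functional.\<close>

lemma bounded_weak_subsequence:
  fixes u :: "nat \<Rightarrow> 'a::{real_inner, complete_space}"
  assumes b: "\<And>n. norm (u n) \<le> B"
  obtains r l where "strict_mono (r :: nat \<Rightarrow> nat)" "\<And>x. (\<lambda>n. u (r n) \<bullet> x) \<longlonglongrightarrow> l \<bullet> x"
proof -
  have ib: "\<bar>u n \<bullet> x\<bar> \<le> B * norm x" for n x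
    using Cauchy_Schwarz_ineq2[of "u n" x] b[of n] by (meson mult_right_mono norm_ge_zero order_trans)
  have B0: "0 \<le> B" using b[of 0] norm_ge_zero order_trans by blast
  interpret subseqs "\<lambda>m s. convergent (\<lambda>n. u (s n) \<bullet> u m)"
  proof
    fix m and s :: "nat \<Rightarrow> nat" assume "strict_mono s"
    have "bounded (range (\<lambda>n. u (s n) \<bullet> u m))"
      using ib by (auto simp: bounded_iff)
    then obtain l r where "strict_mono r" "((\<lambda>n. u (s n) \<bullet> u m) \<circ> r) \<longlonglongrightarrow> l"
      using bounded_imp_convergent_subsequence by blast
    then show "\<exists>r. strict_mono r \<and> convergent (\<lambda>n. u ((s \<circ> r) n) \<bullet> u m)"
      by (auto simp: convergent_def o_def)
  qed
  define r where "r = diagseq"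
  have r: "strict_mono r" unfolding r_def by (rule subseq_diagseq)
  have c0: "convergent (\<lambda>n. u (r n) \<bullet> u m)" for m
  proof -
    have "convergent (\<lambda>n. u ((diagseq \<circ> ((+) (Suc m))) n) \<bullet> u m)"
    proof (rule diagseq_holds)
      fix r s :: "nat \<Rightarrow> nat" and n assume "strict_mono r" "convergent (\<lambda>k. u (s k) \<bullet> u n)"
      then show "convergent (\<lambda>k. u ((s \<circ> r) k) \<bullet> u n)"
        using convergent_subseq_convergent[of "\<lambda>k. u (s k) \<bullet> u n" r] by (simp add: o_def)
    qed
    then have "convergent (\<lambda>n. (\<lambda>k. u (r k) \<bullet> u m) (n + Suc m))"
      by (simp add: r_def o_def add.commute)
    then show ?thesis using convergent_ignore_initial_segment[of "\<lambda>k. u (r k) \<bullet> u m"] by blast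
  qed
  define S where "S = {x. convergent (\<lambda>n. u (r n) \<bullet> x)}"
  have S1: "subspace S"
    unfolding S_def subspace_def
    by (auto simp: inner_add_right convergent_const intro!: convergent_add convergent_mult)
  have S2: "closed S"
  proof (rule closed_sequential_limits[THEN iffD2], intro allI impI, elim conjE)
    fix x l assume x: "\<forall>n. x n \<in> S" "x \<longlonglongrightarrow> l"
    have "Cauchy (\<lambda>n. u (r n) \<bullet> l)"
    proof (rule metric_CauchyI)
      fix e :: real assume e: "e > 0"
      obtain k where k: "norm (x k - l) < e / (3 * (B + 1))"
        using x(2)[unfolded LIMSEQ_iff, rule_format, of "e / (3 * (B + 1))"] e B0 by auto
      have "B * norm (x k - l) \<le> (B + 1) * norm (x k - l)" by (simp add: mult_right_mono)
      also have "\<dots> < e / 3" using k B0 by (simp add: field_simps)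
      finally have d: "\<bar>u n \<bullet> (x k - l)\<bar> < e / 3" for n using ib[of n "x k - l"] by linarith
      have "Cauchy (\<lambda>n. u (r n) \<bullet> x k)" using x(1) S_def convergent_Cauchy by auto
      then obtain N where N: "\<And>m n. m \<ge> N \<Longrightarrow> n \<ge> N \<Longrightarrow> \<bar>u (r m) \<bullet> x k - u (r n) \<bullet> x k\<bar> < e / 3"
        using e unfolding Cauchy_def dist_real_def by (metis divide_pos_pos zero_less_numeral)
      show "\<exists>M. \<forall>m\<ge>M. \<forall>n\<ge>M. dist (u (r m) \<bullet> l) (u (r n) \<bullet> l) < e"
      proof (intro exI allI impI)
        fix m n assume "N \<le> m" "N \<le> n"
        with N[of m n] d[of "r m"] d[of "r n"] show "dist (u (r m) \<bullet> l) (u (r n) \<bullet> l) < e"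
          unfolding dist_real_def inner_diff_right by linarith
      qed
    qed
    then show "l \<in> S" by (simp add: S_def Cauchy_convergent_iff)
  qed
  have all: "x \<in> S" for x
  proof (rule closed_subspace_UNIV[OF S1 S2])
    fix x assume "\<And>s. s \<in> S \<Longrightarrow> x \<bullet> s = 0"
    moreover have "u n \<in> S" for n using c0 by (simp add: S_def)
    ultimately have "x \<bullet> u n = 0" for n by blast
    then have "u n \<bullet> x = 0" for n by (metis inner_commute)
    then have "x \<in> S" by (simp add: S_def convergent_const)
    with \<open>\<And>s. s \<in> S \<Longrightarrow> x \<bullet> s = 0\<close> have "x \<bullet> x = 0" by blast
    then show "x = 0" by simp
  qed
  define f where "f x = lim (\<lambda>n. u (r n) \<bullet> x)" for x
  have f: "(\<lambda>n. u (r n) \<bullet> x) \<longlonglongrightarrow> f x" for x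
    using all[of x] by (simp add: S_def f_def convergent_LIMSEQ_iff)
  have "bounded_linear f"
  proof (rule bounded_linear_intro[where K = B])
    show "f (x + y) = f x + f y" for x y
      using LIMSEQ_unique[OF f[of "x + y"]] tendsto_add[OF f f] by (simp add: inner_add_right)
    show "f (t *\<^sub>R x) = t *\<^sub>R f x" for t x
      using LIMSEQ_unique[OF f[of "t *\<^sub>R x"]] tendsto_mult[OF tendsto_const f] by simp
    show "norm (f x) \<le> norm x * B" for x
      by (rule tendsto_upperbound[OF tendsto_norm[OF f]])
         (use ib in \<open>auto simp: mult.commute\<close>)
  qed
  then obtain l where "\<forall>x. f x = x \<bullet> l" using riesz_representation by blast
  then have "(\<lambda>n. u (r n) \<bullet> x) \<longlonglongrightarrow> l \<bullet> x" for x using f[of x] by (simp add: inner_commute)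
  with r show ?thesis by (rule that)
qed

section \<open>The space of square integrable functions\<close>

definition l2_eq :: "(real^3 \<Rightarrow> complex) \<Rightarrow> (real^3 \<Rightarrow> complex) \<Rightarrow> bool" where
  "l2_eq f g \<longleftrightarrow> square_integrable f \<and> square_integrable g \<and> (AE x in lborel. f x = g x)"

lemma part_equivp_l2_eq: "part_equivp l2_eq"
proof (rule part_equivpI)
  show "\<exists>f. l2_eq f f" unfolding l2_eq_def using square_integrable_0 by auto
  show "symp l2_eq" unfolding l2_eq_def by (auto intro!: sympI)
  show "transp l2_eq" unfolding l2_eq_def by (rule transpI) auto
qed

\<comment> \<open>Functions that agree almost everywhere are identified because
  \<open>real_inner\<close> demands that only the zero vector has norm zero; the pattern is that of
  \<open>h1\<close>.\<close>
quotient_type l2 = "real^3 \<Rightarrow> complex" / partial: l2_eq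
  morphisms l2_fun l2_of
  by (rule part_equivp_l2_eq)

lemma square_integrable_uminus: "square_integrable f \<Longrightarrow> square_integrable (\<lambda>x. - f x)"
  using square_integrable_scaleR[of f "-1"] by simp

instantiation l2 :: real_inner
begin

lift_definition zero_l2 :: l2 is "\<lambda>x. 0"
  by (simp add: l2_eq_def square_integrable_0)

lift_definition plus_l2 :: "l2 \<Rightarrow> l2 \<Rightarrow> l2" is "\<lambda>u v x. u x + v x"
  unfolding l2_eq_def by (auto intro: square_integrable_add elim: eventually_elim2)

lift_definition uminus_l2 :: "l2 \<Rightarrow> l2" is "\<lambda>u x. - u x"
  unfolding l2_eq_def by (auto intro: square_integrable_uminus)

lift_definition minus_l2 :: "l2 \<Rightarrow> l2 \<Rightarrow> l2" is "\<lambda>u v x. u x - v x"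
  unfolding l2_eq_def by (auto intro: square_integrable_diff elim: eventually_elim2)

lift_definition scaleR_l2 :: "real \<Rightarrow> l2 \<Rightarrow> l2" is "\<lambda>c u x. c *\<^sub>R u x"
  unfolding l2_eq_def by (auto intro: square_integrable_scaleR)

definition inner_l2 :: "l2 \<Rightarrow> l2 \<Rightarrow> real" where
  "inner_l2 u v = (LINT x|lborel. l2_fun u x \<bullet> l2_fun v x)"

definition norm_l2 :: "l2 \<Rightarrow> real" where
  "norm_l2 u = sqrt (inner u u)"

definition sgn_l2 :: "l2 \<Rightarrow> l2" where
  "sgn_l2 u = inverse (norm u) *\<^sub>R u"

definition dist_l2 :: "l2 \<Rightarrow> l2 \<Rightarrow> real" where
  "dist_l2 u v = norm (u - v)"

definition uniformity_l2 :: "(l2 \<times> l2) filter" where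
  "uniformity_l2 = (INF e\<in>{0<..}. principal {(x, y). dist x y < e})"

definition open_l2 :: "l2 set \<Rightarrow> bool" where
  "open_l2 U \<longleftrightarrow> (\<forall>x\<in>U. \<forall>\<^sub>F (x', y) in uniformity. x' = x \<longrightarrow> y \<in> U)"

lemma l2_fun_square_integrable: "square_integrable (l2_fun u)"
  using Quotient3_rep_reflp[OF Quotient3_l2, of u] by (simp add: l2_eq_def)

lemma l2_fun_l2_of: "square_integrable f \<Longrightarrow> AE x in lborel. l2_fun (l2_of f) x = f x"
  using Quotient3_rep_abs[OF Quotient3_l2, of f] by (simp add: l2_eq_def)

lemma l2_eqI: "(AE x in lborel. l2_fun u x = l2_fun v x) \<Longrightarrow> u = v"
  using Quotient3_rel_rep[OF Quotient3_l2, of u v] l2_fun_square_integrable by (simp add: l2_eq_def)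

lemma l2_fun_plus: "AE x in lborel. l2_fun (u + v) x = l2_fun u x + l2_fun v x"
  unfolding plus_l2_def using l2_fun_l2_of[OF square_integrable_add[OF l2_fun_square_integrable[of u] l2_fun_square_integrable[of v]]]
  by simp

lemma l2_fun_minus: "AE x in lborel. l2_fun (u - v) x = l2_fun u x - l2_fun v x"
  unfolding minus_l2_def using l2_fun_l2_of[OF square_integrable_diff[OF l2_fun_square_integrable[of u] l2_fun_square_integrable[of v]]]
  by simp

lemma l2_fun_scaleR: "AE x in lborel. l2_fun (c *\<^sub>R u) x = c *\<^sub>R l2_fun u x"
  unfolding scaleR_l2_def using l2_fun_l2_of[OF square_integrable_scaleR[OF l2_fun_square_integrable[of u]]]
  by simp

lemma l2_fun_zero: "AE x in lborel. l2_fun 0 x = 0"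
  unfolding zero_l2_def by (intro l2_fun_l2_of square_integrable_0)

lemma l2_fun_measurable [measurable]: "l2_fun u \<in> borel_measurable borel"
  by (rule square_integrable_measurable[OF l2_fun_square_integrable])

instance
proof
  fix u v w :: l2 and a b :: real
  show "u + v + w = u + (v + w)" "u + v = v + u" "0 + u = u" "- u + u = 0" "u - v = u + - v"
    "a *\<^sub>R (u + v) = a *\<^sub>R u + a *\<^sub>R v" "(a + b) *\<^sub>R u = a *\<^sub>R u + b *\<^sub>R u"
    "a *\<^sub>R b *\<^sub>R u = (a * b) *\<^sub>R u" "1 *\<^sub>R u = u"
    by (transfer; auto simp: l2_eq_def algebra_simps intro: square_integrable_0 square_integrable_add
        square_integrable_diff square_integrable_uminus square_integrable_scaleR)+
  show "dist u v = norm (u - v)" by (rule dist_l2_def)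
  show "sgn u = inverse (norm u) *\<^sub>R u" by (rule sgn_l2_def)
  show "uniformity = (INF e\<in>{0<..}. principal {(x, y :: l2). dist x y < e})"
    by (rule uniformity_l2_def)
  show "open U \<longleftrightarrow> (\<forall>x\<in>U. \<forall>\<^sub>F (x', y) in uniformity. x' = x \<longrightarrow> y \<in> U)" for U :: "l2 set"
    by (rule open_l2_def)
  show "norm u = sqrt (u \<bullet> u)" by (rule norm_l2_def)
  show "u \<bullet> v = v \<bullet> u" by (simp add: inner_l2_def inner_commute)
  note si = square_integrable_inner[OF l2_fun_square_integrable l2_fun_square_integrable]
  show "(u + v) \<bullet> w = u \<bullet> w + v \<bullet> w"
  proof -
    have "(LINT x|lborel. l2_fun (u + v) x \<bullet> l2_fun w x)
        = (LINT x|lborel. l2_fun u x \<bullet> l2_fun w x + l2_fun v x \<bullet> l2_fun w x)"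
      by (rule integral_cong_AE)
         (simp_all, use l2_fun_plus[of u v] in \<open>eventually_elim, simp add: inner_add_left\<close>)
    then show ?thesis by (simp add: inner_l2_def si)
  qed
  show "(a *\<^sub>R u) \<bullet> v = a * (u \<bullet> v)"
  proof -
    have "(LINT x|lborel. l2_fun (a *\<^sub>R u) x \<bullet> l2_fun v x)
        = (LINT x|lborel. a * (l2_fun u x \<bullet> l2_fun v x))"
      by (rule integral_cong_AE) (simp_all, use l2_fun_scaleR[of a u] in \<open>eventually_elim, simp\<close>)
    then show ?thesis by (simp add: inner_l2_def)
  qed
  show "0 \<le> u \<bullet> u" by (auto simp: inner_l2_def intro: integral_nonneg_AE)
  show "u \<bullet> u = 0 \<longleftrightarrow> u = 0"
  proof
    assume "u \<bullet> u = 0"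
    then have "AE x in lborel. l2_fun u x \<bullet> l2_fun u x = 0"
      unfolding inner_l2_def by (subst (asm) integral_nonneg_eq_0_iff_AE) (auto intro: si)
    with l2_fun_zero have "AE x in lborel. l2_fun u x = l2_fun 0 x"
      by eventually_elim simp
    then show "u = 0" by (rule l2_eqI)
  next
    assume u: "u = 0"
    have "(LINT x|lborel. l2_fun 0 x \<bullet> l2_fun 0 x) = (LINT x|(lborel :: (real^3) measure). 0 :: real)"
      by (rule integral_cong_AE) (simp_all, use l2_fun_zero in \<open>eventually_elim, simp\<close>)
    then show "u \<bullet> u = 0" by (simp add: inner_l2_def u)
  qed
qed

end

section \<open>Passing between functions and their classes\<close>

lemma l2_of_l2_fun [simp]: "l2_of (l2_fun u) = u"
  by (rule l2_eqI) (rule l2_fun_l2_of[OF l2_fun_square_integrable])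

lemma l2_of_cong:
  assumes "square_integrable f" "square_integrable g" "AE x in lborel. f x = g x"
  shows "l2_of f = l2_of g"
  by (rule l2_eqI) (use l2_fun_l2_of[OF assms(1)] l2_fun_l2_of[OF assms(2)] assms(3) in eventually_elim, simp)

lemma l2_of_eq_iff:
  assumes "square_integrable f" "square_integrable g"
  shows "l2_of f = l2_of g \<longleftrightarrow> (AE x in lborel. f x = g x)"
proof
  assume "l2_of f = l2_of g"
  with l2_fun_l2_of[OF assms(1)] l2_fun_l2_of[OF assms(2)] show "AE x in lborel. f x = g x"
    by (auto elim: eventually_elim2)
qed (rule l2_of_cong[OF assms])

lemma l2_of_add:
  assumes "square_integrable f" "square_integrable g"
  shows "l2_of (\<lambda>x. f x + g x) = l2_of f + l2_of g"
  by (rule l2_eqI)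
     (use l2_fun_l2_of[OF square_integrable_add[OF assms]] l2_fun_l2_of[OF assms(1)] l2_fun_l2_of[OF assms(2)]
        l2_fun_plus[of "l2_of f" "l2_of g"] in eventually_elim, simp)

lemma l2_of_diff:
  assumes "square_integrable f" "square_integrable g"
  shows "l2_of (\<lambda>x. f x - g x) = l2_of f - l2_of g"
  by (rule l2_eqI)
     (use l2_fun_l2_of[OF square_integrable_diff[OF assms]] l2_fun_l2_of[OF assms(1)] l2_fun_l2_of[OF assms(2)]
        l2_fun_minus[of "l2_of f" "l2_of g"] in eventually_elim, simp)

lemma l2_of_scaleR:
  assumes "square_integrable f"
  shows "l2_of (\<lambda>x. c *\<^sub>R f x) = c *\<^sub>R l2_of f"
  by (rule l2_eqI)
     (use l2_fun_l2_of[OF square_integrable_scaleR[OF assms]] l2_fun_l2_of[OF assms(1)]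
        l2_fun_scaleR[of c "l2_of f"] in eventually_elim, simp)

lemma inner_l2_of:
  assumes "square_integrable f" "square_integrable g"
  shows "l2_of f \<bullet> l2_of g = (LINT x|lborel. f x \<bullet> g x)"
proof -
  note [measurable] = assms[THEN square_integrable_measurable]
  show ?thesis unfolding inner_l2_def
    by (rule integral_cong_AE)
       (simp_all, use l2_fun_l2_of[OF assms(1)] l2_fun_l2_of[OF assms(2)] in eventually_elim, simp)
qed

lemma norm_l2_of:
  assumes "square_integrable f"
  shows "(norm (l2_of f))\<^sup>2 = (LINT x|lborel. (cmod (f x))\<^sup>2)"
  by (simp add: power2_norm_eq_inner inner_l2_of assms flip: dot_square_norm)

lemma norm_l2_fun: "(norm u)\<^sup>2 = (LINT x|lborel. (cmod (l2_fun u x))\<^sup>2)"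
  using norm_l2_of[OF l2_fun_square_integrable[of u]] by simp

lemma square_integrable_nn:
  fixes f :: "real^3 \<Rightarrow> 'b::euclidean_space"
  shows "square_integrable f \<longleftrightarrow> f \<in> borel_measurable borel \<and> (\<integral>\<^sup>+x. ennreal ((norm (f x))\<^sup>2) \<partial>lborel) < \<infinity>"
  unfolding square_integrable_def by (auto simp: integrable_iff_bounded)

lemma nn_norm_l2_of:
  assumes "square_integrable f"
  shows "(\<integral>\<^sup>+x. ennreal ((cmod (f x))\<^sup>2) \<partial>lborel) = ennreal ((norm (l2_of f))\<^sup>2)"
  unfolding norm_l2_of[OF assms]
  by (rule nn_integral_eq_integral) (use assms in \<open>auto simp: square_integrable_def\<close>)

lemma square_integrable_bound:
  fixes f :: "real^3 \<Rightarrow> 'b::euclidean_space" and g :: "real^3 \<Rightarrow> 'c::euclidean_space"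
  assumes g: "square_integrable g" and [measurable]: "f \<in> borel_measurable borel"
    and b: "AE x in lborel. norm (f x) \<le> C * norm (g x)"
  shows "square_integrable f"
  unfolding square_integrable_def
proof
  have "integrable lborel (\<lambda>x. C\<^sup>2 * (norm (g x))\<^sup>2)"
    using g by (simp add: square_integrable_def)
  then show "integrable lborel (\<lambda>x. (norm (f x))\<^sup>2)"
  proof (rule Bochner_Integration.integrable_bound)
    show "AE x in lborel. norm ((norm (f x))\<^sup>2) \<le> norm (C\<^sup>2 * (norm (g x))\<^sup>2)"
      using b by eventually_elim (simp add: power_mult_distrib[symmetric] power_mono)
  qed simp
qed simp

lemma borel_measurable_cnj [measurable (raw)]:
  assumes [measurable]: "f \<in> borel_measurable M"
  shows "(\<lambda>x. cnj (f x)) \<in> borel_measurable M"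
proof -
  have "cnj \<in> borel_measurable borel" by (intro borel_measurable_continuous_onI continuous_intros)
  then show ?thesis by measurable
qed

lemma square_integrable_cnj: "square_integrable f \<Longrightarrow> square_integrable (\<lambda>x. cnj (f x))"
  by (rule square_integrable_bound[where g = f and C = 1]) (auto dest: square_integrable_measurable)

lemma square_integrable_cmult:
  assumes f: "square_integrable f" and [measurable]: "m \<in> borel_measurable borel" and "\<And>x. cmod (m x) \<le> C"
  shows "square_integrable (\<lambda>x. m x * f x)"
proof -
  note [measurable] = square_integrable_measurable[OF f]
  show ?thesis
    by (rule square_integrable_bound[OF f, where C = C])
       (use assms(3) in \<open>auto simp: norm_mult intro!: mult_right_mono\<close>)
qed

lemma l2_tendsto_iff:
  assumes "\<And>n. square_integrable (f n)" "square_integrable g"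
  shows "((\<lambda>n. l2_of (f n)) \<longlongrightarrow> l2_of g) F \<longleftrightarrow> ((\<lambda>n. (LINT x|lborel. (cmod (f n x - g x))\<^sup>2)) \<longlongrightarrow> 0) F"
proof -
  have e: "(norm (l2_of (f n) - l2_of g))\<^sup>2 = (LINT x|lborel. (cmod (f n x - g x))\<^sup>2)" for n
    using norm_l2_of[OF square_integrable_diff[OF assms(1)[of n] assms(2)]] l2_of_diff[OF assms(1)[of n] assms(2)]
    by simp
  have "((\<lambda>n. l2_of (f n)) \<longlongrightarrow> l2_of g) F \<longleftrightarrow> ((\<lambda>n. norm (l2_of (f n) - l2_of g)) \<longlongrightarrow> 0) F"
    by (simp add: LIM_zero_iff tendsto_norm_zero_iff)
  also have "\<dots> \<longleftrightarrow> ((\<lambda>n. (norm (l2_of (f n) - l2_of g))\<^sup>2) \<longlongrightarrow> 0) F"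
  proof
    assume "((\<lambda>n. norm (l2_of (f n) - l2_of g)) \<longlongrightarrow> 0) F"
    from tendsto_power[OF this, of 2] show "((\<lambda>n. (norm (l2_of (f n) - l2_of g))\<^sup>2) \<longlongrightarrow> 0) F" by simp
  next
    assume "((\<lambda>n. (norm (l2_of (f n) - l2_of g))\<^sup>2) \<longlongrightarrow> 0) F"
    from tendsto_real_sqrt[OF this] show "((\<lambda>n. norm (l2_of (f n) - l2_of g)) \<longlongrightarrow> 0) F" by simp
  qed
  finally show ?thesis by (simp add: e)
qed

lemma l2_dominated_convergence:
  fixes w :: "real^3 \<Rightarrow> real"
  assumes f: "\<And>n. square_integrable (f n)" and g: "square_integrable g" and w: "square_integrable w"
    and b: "\<And>n. AE x in lborel. cmod (f n x) \<le> w x" and l: "AE x in lborel. (\<lambda>n. f n x) \<longlonglongrightarrow> g x"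
  shows "(\<lambda>n. l2_of (f n)) \<longlonglongrightarrow> l2_of g"
proof -
  note [measurable] = f[THEN square_integrable_measurable] g[THEN square_integrable_measurable]
  have "(\<lambda>n. (LINT x|lborel. (cmod (f n x - g x))\<^sup>2)) \<longlonglongrightarrow> (LINT x|(lborel :: (real^3) measure). 0 :: real)"
  proof (rule integral_dominated_convergence[where w = "\<lambda>x. 4 * (norm (w x))\<^sup>2"])
    show "integrable lborel (\<lambda>x. 4 * (norm (w x))\<^sup>2)" using w by (simp add: square_integrable_def)
    show "AE x in lborel. (\<lambda>n. (cmod (f n x - g x))\<^sup>2) \<longlonglongrightarrow> 0"
      using l
    proof eventually_elim
      case (elim x)
      have "(\<lambda>n. (cmod (f n x - g x))\<^sup>2) \<longlonglongrightarrow> (cmod (g x - g x))\<^sup>2" by (intro tendsto_intros elim)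
      then show ?case by simp
    qed
    have "AE x in lborel. \<forall>n. cmod (f n x) \<le> w x" using b by (simp add: AE_all_countable)
    with l have g': "AE x in lborel. cmod (g x) \<le> w x"
    proof eventually_elim
      case (elim x)
      then show ?case by (intro tendsto_upperbound[OF tendsto_norm[OF elim(1)]]) auto
    qed
    show "AE x in lborel. norm ((cmod (f n x - g x))\<^sup>2) \<le> 4 * (norm (w x))\<^sup>2" for n
      using g' b[of n]
    proof eventually_elim
      case (elim x)
      then have "cmod (f n x - g x) \<le> 2 * norm (w x)"
        using norm_triangle_ineq4[of "f n x" "g x"] by simp
      from power_mono[OF this norm_ge_zero, of 2] show ?case by (simp add: power_mult_distrib)
    qed
  qed auto
  then show ?thesis by (simp add: l2_tendsto_iff[OF f g])
qed

lemma l2_tendsto_AE_subseq: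
  assumes f: "\<And>n. square_integrable (f n)" and g: "square_integrable g"
    and l: "(\<lambda>n. l2_of (f n)) \<longlonglongrightarrow> l2_of g"
  obtains r where "strict_mono (r :: nat \<Rightarrow> nat)" "AE x in lborel. (\<lambda>n. f (r n) x) \<longlonglongrightarrow> g x"
proof -
  note [measurable] = f[THEN square_integrable_measurable] g[THEN square_integrable_measurable]
  have "(\<lambda>n. (LINT x|lborel. norm ((cmod (f n x - g x))\<^sup>2))) \<longlonglongrightarrow> 0"
    using l by (simp add: l2_tendsto_iff[OF f g])
  moreover have "integrable lborel (\<lambda>x. (cmod (f n x - g x))\<^sup>2)" for n
    using square_integrable_diff[OF f g] by (simp add: square_integrable_def)
  ultimately obtain r where r: "strict_mono r" "AE x in lborel. (\<lambda>n. (cmod (f (r n) x - g x))\<^sup>2) \<longlonglongrightarrow> 0"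
    using tendsto_L1_AE_subseq[of lborel "\<lambda>n x. (cmod (f n x - g x))\<^sup>2"] by blast
  from r(2) have "AE x in lborel. (\<lambda>n. f (r n) x) \<longlonglongrightarrow> g x"
  proof eventually_elim
    case (elim x)
    from tendsto_real_sqrt[OF elim] have "(\<lambda>n. norm (f (r n) x - g x)) \<longlonglongrightarrow> 0" by simp
    then show ?case by (simp add: LIM_zero_iff tendsto_norm_zero_iff)
  qed
  with r(1) show ?thesis by (rule that)
qed

text \<open>Riesz--Fischer: a fast subsequence converges almost everywhere, and Fatou's lemma turns
  the pointwise limit into a limit in norm.\<close>

instance l2 :: complete_space
proof
  fix X :: "nat \<Rightarrow> l2" assume X: "Cauchy X"
  have "\<exists>N. \<forall>m\<ge>N. \<forall>n\<ge>N. norm (X m - X n) < (1/2)^k" for k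
    using metric_CauchyD[OF X, of "(1/2)^k"] by (auto simp: dist_norm)
  then obtain N where N: "\<And>k m n. m \<ge> N k \<Longrightarrow> n \<ge> N k \<Longrightarrow> norm (X m - X n) < (1/2)^k" by metis
  \<comment> \<open>Partial sums dominate every earlier \<open>N i\<close>, so both
    \<open>r k\<close> and \<open>r (Suc k)\<close> are late enough for the bound (1/2)^k.\<close>
  define r where "r k = (\<Sum>i\<le>k. N i)" for k
  have rN: "r k \<ge> N k" "r (Suc k) \<ge> N k" for k
    by (auto simp: r_def sum.atMost_Suc intro!: member_le_sum[of k "{..k}" N, simplified] trans_le_add1)
  define f where "f k = l2_fun (X (r k))" for k
  have fs: "square_integrable (f k)" for k unfolding f_def by (rule l2_fun_square_integrable)
  note [measurable] = fs[THEN square_integrable_measurable]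
  have d: "(\<integral>\<^sup>+x. ennreal ((cmod (f (Suc k) x - f k x))\<^sup>2) \<partial>lborel) \<le> ennreal ((1/4)^k)" for k
  proof -
    have "(\<integral>\<^sup>+x. ennreal ((cmod (f (Suc k) x - f k x))\<^sup>2) \<partial>lborel) = ennreal ((norm (X (r (Suc k)) - X (r k)))\<^sup>2)"
      using nn_norm_l2_of[OF square_integrable_diff[OF fs[of "Suc k"] fs[of k]]] l2_of_diff[OF fs[of "Suc k"] fs[of k]]
      by (simp add: f_def)
    also have "\<dots> \<le> ennreal (((1/2)^k)\<^sup>2)"
      using N[OF rN(2) rN(1), of k] by (intro ennreal_leI power_mono) auto
    finally show ?thesis by (simp add: power2_eq_square power_mult_distrib[symmetric])
  qed
  \<comment> \<open>Half of the available decay (1/4)^k is spent on the weight 2^k. Finiteness of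
    the weighted sum at \<open>x\<close> then bounds the k-th increment there by a multiple of sqrt
    (1/2)^k, so the increments are summable.\<close>
  have "(\<integral>\<^sup>+x. (\<Sum>k. ennreal (2^k * (cmod (f (Suc k) x - f k x))\<^sup>2)) \<partial>lborel)
     = (\<Sum>k. \<integral>\<^sup>+x. ennreal (2^k * (cmod (f (Suc k) x - f k x))\<^sup>2) \<partial>lborel)"
    by (rule nn_integral_suminf) simp
  also have "\<dots> \<le> (\<Sum>k. ennreal ((1/2)^k))"
  proof (intro suminf_le summableI)
    fix k
    have "(\<integral>\<^sup>+x. ennreal (2^k * (cmod (f (Suc k) x - f k x))\<^sup>2) \<partial>lborel)
      = ennreal (2^k) * (\<integral>\<^sup>+x. ennreal ((cmod (f (Suc k) x - f k x))\<^sup>2) \<partial>lborel)"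
      by (simp add: ennreal_mult nn_integral_cmult)
    also have "\<dots> \<le> ennreal (2^k) * ennreal ((1/4)^k)" by (intro mult_left_mono d) simp
    also have "\<dots> = ennreal ((1/2)^k)" by (simp add: ennreal_mult[symmetric] power_mult_distrib[symmetric])
    finally show "(\<integral>\<^sup>+x. ennreal (2^k * (cmod (f (Suc k) x - f k x))\<^sup>2) \<partial>lborel) \<le> ennreal ((1/2)^k)" .
  qed
  also have "\<dots> < \<infinity>" by (subst suminf_ennreal_eq[OF _ geometric_sums]) auto
  finally have "AE x in lborel. (\<Sum>k. ennreal (2^k * (cmod (f (Suc k) x - f k x))\<^sup>2)) \<noteq> \<infinity>"
    by (intro nn_integral_noteq_infinite) auto
  then have conv: "AE x in lborel. convergent (\<lambda>k. f k x)"
  proof eventually_elim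
    case (elim x)
    then have s: "summable (\<lambda>k. 2^k * (cmod (f (Suc k) x - f k x))\<^sup>2)"
      by (intro summable_suminf_not_top) auto
    then obtain B where B: "\<And>k. 2^k * (cmod (f (Suc k) x - f k x))\<^sup>2 \<le> B"
      using summable_imp_Bseq[OF s] unfolding Bseq_def by (force simp: abs_le_iff)
    have b: "cmod (f (Suc k) x - f k x) \<le> sqrt B * sqrt (1/2)^k" for k
    proof -
      have "(cmod (f (Suc k) x - f k x))\<^sup>2 \<le> B * (1/2)^k" using B[of k] by (simp add: field_simps power_divide)
      then have "sqrt ((cmod (f (Suc k) x - f k x))\<^sup>2) \<le> sqrt (B * (1/2)^k)" by (rule real_sqrt_le_mono)
      then show ?thesis by (simp add: real_sqrt_mult real_sqrt_power)
    qed
    have "summable (\<lambda>k. f (Suc k) x - f k x)"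
    proof (rule summable_comparison_test')
      show "summable (\<lambda>k. sqrt B * sqrt (1/2)^k)" by (intro summable_mult summable_geometric) (simp add: real_sqrt_divide)
      show "norm (f (Suc k) x - f k x) \<le> sqrt B * sqrt (1/2)^k" if "k \<ge> 0" for k by (rule b)
    qed
    then have "(\<lambda>n. (\<Sum>k<n. f (Suc k) x - f k x)) \<longlonglongrightarrow> (\<Sum>k. f (Suc k) x - f k x)" by (rule summable_LIMSEQ)
    then have "(\<lambda>n. f n x - f 0 x + f 0 x) \<longlonglongrightarrow> (\<Sum>k. f (Suc k) x - f k x) + f 0 x"
      by (intro tendsto_add tendsto_const) (simp add: sum_lessThan_telescope[of "\<lambda>k. f k x"])
    then show ?case by (auto simp: convergent_def)
  qed
  define g where "g x = lim (\<lambda>k. f k x)" for x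
  have [measurable]: "g \<in> borel_measurable borel" unfolding g_def by measurable
  from conv have lim: "AE x in lborel. (\<lambda>k. f k x) \<longlonglongrightarrow> g x"
    by eventually_elim (simp add: g_def convergent_LIMSEQ_iff)
  \<comment> \<open>Fatou's lemma along the subsequence. The estimate yields both the square
    integrability of \<open>g\<close> and the convergence of the full sequence.\<close>
  have G: "(\<integral>\<^sup>+x. ennreal ((cmod (g x - l2_fun (X n) x))\<^sup>2) \<partial>lborel) \<le> ennreal (((1/2)^k)\<^sup>2)" if n: "n \<ge> N k" for n k
  proof -
    have "(\<integral>\<^sup>+x. ennreal ((cmod (g x - l2_fun (X n) x))\<^sup>2) \<partial>lborel)
      = (\<integral>\<^sup>+x. liminf (\<lambda>j. ennreal ((cmod (f j x - l2_fun (X n) x))\<^sup>2)) \<partial>lborel)"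
    proof (rule nn_integral_cong_AE)
      show "AE x in lborel. ennreal ((cmod (g x - l2_fun (X n) x))\<^sup>2) = liminf (\<lambda>j. ennreal ((cmod (f j x - l2_fun (X n) x))\<^sup>2))"
        using lim
      proof eventually_elim
        case (elim x)
        have "(\<lambda>j. ennreal ((cmod (f j x - l2_fun (X n) x))\<^sup>2)) \<longlonglongrightarrow> ennreal ((cmod (g x - l2_fun (X n) x))\<^sup>2)"
          by (intro tendsto_intros elim)
        then show ?case by (intro lim_imp_Liminf[symmetric]) simp_all
      qed
    qed
    also have "\<dots> \<le> liminf (\<lambda>j. \<integral>\<^sup>+x. ennreal ((cmod (f j x - l2_fun (X n) x))\<^sup>2) \<partial>lborel)"
      by (rule nn_integral_liminf) simp
    also have "\<dots> \<le> ennreal (((1/2)^k)\<^sup>2)"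
    proof (rule Liminf_le)
      show "\<forall>\<^sub>F j in sequentially. (\<integral>\<^sup>+x. ennreal ((cmod (f j x - l2_fun (X n) x))\<^sup>2) \<partial>lborel) \<le> ennreal (((1/2)^k)\<^sup>2)"
      proof (rule eventually_sequentiallyI[of k])
        fix j assume "k \<le> j"
        then have "N k \<le> r j" unfolding r_def by (intro member_le_sum) auto
        then have nb: "norm (X (r j) - X n) < (1/2)^k" using N n by blast
        have "(\<integral>\<^sup>+x. ennreal ((cmod (f j x - l2_fun (X n) x))\<^sup>2) \<partial>lborel) = ennreal ((norm (X (r j) - X n))\<^sup>2)"
          using nn_norm_l2_of[OF square_integrable_diff[OF fs[of j] l2_fun_square_integrable[of "X n"]]]
            l2_of_diff[OF fs[of j] l2_fun_square_integrable[of "X n"]]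
          by (simp add: f_def)
        also have "\<dots> \<le> ennreal (((1/2)^k)\<^sup>2)" using nb by (intro ennreal_leI power_mono) auto
        finally show "(\<integral>\<^sup>+x. ennreal ((cmod (f j x - l2_fun (X n) x))\<^sup>2) \<partial>lborel) \<le> ennreal (((1/2)^k)\<^sup>2)" .
      qed
    qed simp
    finally show ?thesis .
  qed
  have gd: "square_integrable (\<lambda>x. g x - l2_fun (X n) x)" if "n \<ge> N k" for n k
    unfolding square_integrable_nn using G[OF that] by (auto simp: less_top[symmetric] top_unique)
  have gs: "square_integrable g"
    using square_integrable_add[OF gd[OF order_refl[of "N 0"]] l2_fun_square_integrable[of "X (N 0)"]] by simp
  have "X \<longlonglongrightarrow> l2_of g"
  proof (rule LIMSEQ_I)
    fix e :: real assume "e > 0"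
    then obtain k where k: "(1/2)^k < e" using real_arch_pow_inv[of e "1/2"] by auto
    have "norm (X n - l2_of g) < e" if n: "n \<ge> N k" for n
    proof -
      have "ennreal ((norm (l2_of g - X n))\<^sup>2) \<le> ennreal (((1/2)^k)\<^sup>2)"
        using G[OF n] nn_norm_l2_of[OF gd[OF n]] l2_of_diff[OF gs l2_fun_square_integrable[of "X n"]] by simp
      then have "(norm (l2_of g - X n))\<^sup>2 \<le> ((1/2)^k)\<^sup>2" by simp
      then have "norm (l2_of g - X n) \<le> (1/2)^k" by (rule power2_le_imp_le) simp
      then show ?thesis using k by (simp add: norm_minus_commute)
    qed
    then show "\<exists>no. \<forall>n\<ge>no. norm (X n - l2_of g) < e" by blast
  qed
  then show "convergent X" by (auto simp: convergent_def)
qed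

section \<open>Complex pairings and density of test functions\<close>

lemma Re_integral_mult_cnj:
  assumes "square_integrable f" "square_integrable g"
  shows "Re (LINT x|lborel. f x * cnj (g x)) = l2_of f \<bullet> l2_of g"
  unfolding inner_l2_of[OF assms]
  using integral_Re[OF square_integrable_mult[OF assms(1) square_integrable_cnj[OF assms(2)]]]
  by (simp add: inner_complex_def)

lemma Im_integral_mult_cnj:
  assumes "square_integrable f" "square_integrable g"
  shows "Im (LINT x|lborel. f x * cnj (g x)) = l2_of f \<bullet> l2_of (\<lambda>x. \<i> * g x)"
proof -
  have "square_integrable (\<lambda>x. \<i> * g x)"
    using assms(2) by (rule square_integrable_cmult) auto
  then show ?thesis unfolding inner_l2_of[OF assms(1) \<open>square_integrable (\<lambda>x. \<i> * g x)\<close>]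
    using integral_Im[OF square_integrable_mult[OF assms(1) square_integrable_cnj[OF assms(2)]]]
    by (simp add: inner_complex_def algebra_simps)
qed

lemma square_integrable_i: "square_integrable f \<Longrightarrow> square_integrable (\<lambda>x. \<i> * f x)"
  by (rule square_integrable_cmult) auto

text \<open>\<open>l2\<close> is a real space and test functions are real valued, so their multiples
  by \<open>\<i>\<close> must be included: orthogonality to both kinds annihilates the real and the
  imaginary part of every complex pairing, and the fundamental lemma applies.\<close>

lemma l2_dense:
  assumes "subspace S" "closed S"
    and "\<And>\<phi>. test_function \<phi> \<Longrightarrow> l2_of (\<lambda>x. of_real (\<phi> x)) \<in> S"
    and "\<And>\<phi>. test_function \<phi> \<Longrightarrow> l2_of (\<lambda>x. \<i> * of_real (\<phi> x)) \<in> S"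
  shows "u \<in> S"
proof (rule closed_subspace_UNIV[OF assms(1,2)])
  fix x assume x: "\<And>s. s \<in> S \<Longrightarrow> x \<bullet> s = 0"
  have "AE t in lborel. l2_fun x t = 0"
  proof (rule fundamental_lemma_complex[OF l2_fun_square_integrable])
    fix \<phi> :: "real^3 \<Rightarrow> real" assume t: "test_function \<phi>"
    have s: "square_integrable (\<lambda>x. complex_of_real (\<phi> x))"
      using square_integrable_of_real[OF test_function_square_integrable[OF t]] .
    show "(LINT t|lborel. l2_fun x t * complex_of_real (\<phi> t)) = 0"
      using Re_integral_mult_cnj[OF l2_fun_square_integrable[of x] s] x[OF assms(3)[OF t]]
        Im_integral_mult_cnj[OF l2_fun_square_integrable[of x] s] x[OF assms(4)[OF t]]
      by (simp add: complex_eq_iff)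
  qed
  with l2_fun_zero show "x = 0" by (intro l2_eqI) (auto elim: eventually_elim2)
qed

text \<open>A common bound on the operator norms makes the set of convergence closed under limits (a
  three-epsilon argument), so strong convergence can be checked on a dense family.\<close>

lemma closed_convergence_set:
  fixes T :: "nat \<Rightarrow> 'a::real_normed_vector \<Rightarrow> 'b::real_normed_vector"
  assumes T: "\<And>n. linear (T n)" "linear U"
    and b: "\<And>n u. norm (T n u) \<le> K * norm u" "\<And>u. norm (U u) \<le> K * norm u"
  shows "subspace {u. (\<lambda>n. T n u) \<longlonglongrightarrow> U u}" "closed {u. (\<lambda>n. T n u) \<longlonglongrightarrow> U u}"
proof -
  interpret U: linear U by (rule T)
  show "subspace {u. (\<lambda>n. T n u) \<longlonglongrightarrow> U u}"
    unfolding subspace_def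
    by (auto simp: linear_0[OF T(1)] linear_add[OF T(1)] linear_cmul[OF T(1)] U.zero U.add U.scale
        intro!: tendsto_intros)
  show "closed {u. (\<lambda>n. T n u) \<longlonglongrightarrow> U u}"
  proof (rule closed_sequential_limits[THEN iffD2], intro allI impI, elim conjE)
    fix x l assume x: "\<forall>k. x k \<in> {u. (\<lambda>n. T n u) \<longlonglongrightarrow> U u}" "x \<longlonglongrightarrow> l"
    have "(\<lambda>n. T n l) \<longlonglongrightarrow> U l"
    proof (rule LIMSEQ_I)
      fix e :: real assume e: "e > 0"
      define K' where "K' = \<bar>K\<bar> + 1"
      have K': "K' > 0" "K \<le> K'" by (auto simp: K'_def)
      obtain k where k: "norm (x k - l) < e / (3 * K')"
        using x(2)[unfolded LIMSEQ_iff, rule_format, of "e / (3 * K')"] e K' by auto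
      have "K * norm (x k - l) \<le> K' * norm (x k - l)" using K' by (intro mult_right_mono) auto
      also have "\<dots> < e / 3" using k K' by (simp add: field_simps)
      finally have k3: "K * norm (x k - l) < e / 3" .
      have d: "norm (T n (x k) - T n l) < e / 3" for n
        using k3 b(1)[of n "x k - l"] by (simp add: linear_diff[OF T(1)])
      have d': "norm (U (x k) - U l) < e / 3"
        using k3 b(2)[of "x k - l"] by (simp add: U.diff)
      obtain N where N: "\<And>n. n \<ge> N \<Longrightarrow> norm (T n (x k) - U (x k)) < e / 3"
        using x(1) e LIMSEQ_D[of "\<lambda>n. T n (x k)" "U (x k)" "e / 3"] by auto
      have "norm (T n l - U l) < e" if "n \<ge> N" for n
      proof -
        have "T n l - U l = - (T n (x k) - T n l) + (T n (x k) - U (x k)) + (U (x k) - U l)" by simp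
        then have "norm (T n l - U l) \<le> norm (T n (x k) - T n l) + norm (T n (x k) - U (x k)) + norm (U (x k) - U l)"
          by (metis norm_minus_cancel norm_triangle_mono norm_triangle_ineq order_refl)
        then show ?thesis using d[of n] d' N[OF that] by linarith
      qed
      then show "\<exists>no. \<forall>n\<ge>no. norm (T n l - U l) < e" by blast
    qed
    then show "l \<in> {u. (\<lambda>n. T n u) \<longlonglongrightarrow> U u}" by simp
  qed
qed

section \<open>Coordinatewise affine substitutions\<close>

lemma axis_inner: "axis i (1::real) \<bullet> x = x $ i"
  by (metis cart_eq_inner_axis inner_commute)

text \<open>Vectors multiply componentwise, so \<open>b * x + y\<close> covers translations, the
  reflection, and isotropic as well as anisotropic dilations in one statement.\<close>

lemma lborel_coordinatewise:
  fixes b y :: "real^3"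
  assumes "\<And>i. b $ i \<noteq> 0"
  shows "lborel = density (distr lborel borel (\<lambda>x. b * x + y)) (\<lambda>_. ennreal (\<Prod>i\<in>UNIV. \<bar>b $ i\<bar>))"
proof -
  have B: "Basis = (\<lambda>i. axis i 1 :: real^3) ` UNIV" by (auto simp: Basis_vec_def)
  have inj: "inj (\<lambda>i. axis i 1 :: real^3)" by (auto simp: inj_def axis_eq_axis)
  have m1: "lborel = density (distr lborel borel (\<lambda>x. y + (\<Sum>j\<in>Basis. ((b \<bullet> j) * (x \<bullet> j)) *\<^sub>R j)))
      (\<lambda>_. ennreal (\<Prod>j\<in>Basis. \<bar>b \<bullet> j\<bar>))"
    by (rule lborel_affine_euclidean) (use assms in \<open>auto simp: B inner_axis\<close>)
  have m2: "y + (\<Sum>j\<in>Basis. ((b \<bullet> j) * (x \<bullet> j)) *\<^sub>R j) = b * x + y" for x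
    unfolding B by (subst sum.reindex[OF inj])
      (simp add: o_def inner_axis, simp add: vec_eq_iff axis_def if_distrib cong: if_cong)
  have m3: "(\<Prod>j\<in>Basis. \<bar>b \<bullet> j\<bar>) = (\<Prod>i\<in>UNIV. \<bar>b $ i\<bar>)"
    unfolding B by (subst prod.reindex[OF inj]) (auto simp: inner_axis)
  show ?thesis using m1 unfolding m2 m3 .
qed

lemma vec_mult_measurable [measurable]: "(\<lambda>x. b * x + y :: real^3) \<in> borel_measurable borel"
proof -
  have "(\<lambda>x. b * x + y) = (\<lambda>x. \<chi> i. b $ i * x $ i + y $ i)" by (simp add: fun_eq_iff vec_eq_iff)
  moreover have "continuous_on UNIV (\<lambda>x. \<chi> i. b $ i * x $ i + y $ i)"
    by (intro continuous_on_vec_lambda continuous_intros)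
  ultimately show ?thesis by (simp add: borel_measurable_continuous_onI)
qed

definition jac :: "real^3 \<Rightarrow> real" where "jac b = (\<Prod>i\<in>UNIV. \<bar>b $ i\<bar>)"

lemma jac_pos: "(\<And>i. b $ i \<noteq> 0) \<Longrightarrow> jac b > 0"
  unfolding jac_def by (intro prod_pos) auto

lemma nn_integral_coordinatewise:
  assumes b: "\<And>i. b $ i \<noteq> 0" and [measurable]: "f \<in> borel_measurable borel"
  shows "(\<integral>\<^sup>+x. f x \<partial>lborel) = ennreal (jac b) * (\<integral>\<^sup>+x. f (b * x + y) \<partial>lborel)"
proof -
  have "(\<integral>\<^sup>+x. f x \<partial>lborel) = (\<integral>\<^sup>+x. f x \<partial>density (distr lborel borel (\<lambda>x. b * x + y)) (\<lambda>_. ennreal (jac b)))"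
    using arg_cong[OF lborel_coordinatewise[OF b, of y], of "\<lambda>M. integral\<^sup>N M f"] unfolding jac_def .
  also have "\<dots> = (\<integral>\<^sup>+x. ennreal (jac b) * f x \<partial>distr lborel borel (\<lambda>x. b * x + y))"
    by (rule nn_integral_density) auto
  also have "\<dots> = (\<integral>\<^sup>+x. ennreal (jac b) * f (b * x + y) \<partial>lborel)"
    by (rule nn_integral_distr) auto
  finally show ?thesis by (simp add: nn_integral_cmult)
qed

lemma integrable_coordinatewise:
  fixes f :: "real^3 \<Rightarrow> 'b::{banach, second_countable_topology}"
  assumes b: "\<And>i. b $ i \<noteq> 0" and f: "integrable lborel f"
  shows "integrable lborel (\<lambda>x. f (b * x + y))"
proof -
  have [measurable]: "f \<in> borel_measurable borel" using f by auto
  show ?thesis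
    using f nn_integral_coordinatewise[OF b, of "\<lambda>x. ennreal (norm (f x))" y] jac_pos[OF b]
    by (auto simp: integrable_iff_bounded ennreal_mult_less_top)
qed

lemma integral_coordinatewise:
  fixes f :: "real^3 \<Rightarrow> 'b::{banach, second_countable_topology}"
  assumes b: "\<And>i. b $ i \<noteq> 0" and [measurable]: "f \<in> borel_measurable borel"
  shows "(LINT x|lborel. f x) = jac b *\<^sub>R (LINT x|lborel. f (b * x + y))"
proof -
  have "(LINT x|lborel. f x) = (LINT x|density (distr lborel borel (\<lambda>x. b * x + y)) (\<lambda>_. ennreal (jac b)). f x)"
    using arg_cong[OF lborel_coordinatewise[OF b, of y], of "\<lambda>M. integral\<^sup>L M f"] unfolding jac_def .
  also have "\<dots> = (LINT x|distr lborel borel (\<lambda>x. b * x + y). jac b *\<^sub>R f x)"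
    by (rule integral_density) (use jac_pos[OF b] in auto)
  also have "\<dots> = (LINT x|lborel. jac b *\<^sub>R f (b * x + y))"
    by (rule integral_distr) auto
  finally show ?thesis by simp
qed

lemma AE_coordinatewise:
  fixes b y :: "real^3"
  assumes b: "\<And>i. b $ i \<noteq> 0" and "AE x in lborel. P x"
  shows "AE x in lborel. P (b * x + y)"
proof -
  have ex: "\<exists>N\<in>null_sets lborel. {x \<in> space lborel. \<not> P x} \<subseteq> N"
    using assms(2) by (simp only: eventually_ae_filter)
  define N where "N = (SOME N. N \<in> null_sets lborel \<and> {x \<in> space lborel. \<not> P x} \<subseteq> N)"
  have N: "N \<in> null_sets lborel \<and> {x \<in> space lborel. \<not> P x} \<subseteq> N"
    unfolding N_def by (rule someI_ex) (use ex in \<open>simp only: Bex_def\<close>)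
  have [measurable]: "N \<in> sets borel" using null_setsD2[OF conjunct1[OF N]] by simp
  have "(\<integral>\<^sup>+x. indicator N x \<partial>lborel) = 0"
    using null_setsD1[OF conjunct1[OF N]] by (subst nn_integral_indicator) simp_all
  then have "ennreal (jac b) * (\<integral>\<^sup>+x. indicator N (b * x + y) \<partial>lborel) = 0"
    by (subst nn_integral_coordinatewise[OF b, symmetric]) simp_all
  then have z: "(\<integral>\<^sup>+x. indicator N (b * x + y) \<partial>lborel) = 0"
    using jac_pos[OF b] by simp
  have "(\<lambda>x. indicator N (b * x + y) :: ennreal) \<in> borel_measurable lborel" by measurable
  with z have "AE x in lborel. (indicator N (b * x + y) :: ennreal) = 0"
    by (simp only: nn_integral_0_iff_AE)
  then show ?thesis
  proof (rule eventually_mono)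
    fix x assume "(indicator N (b * x + y) :: ennreal) = 0"
    then have "b * x + y \<notin> N" by (simp add: indicator_def split: if_splits)
    then show "P (b * x + y)" using contra_subsetD[OF conjunct2[OF N]] by simp
  qed
qed

lemma square_integrable_coordinatewise:
  fixes f :: "real^3 \<Rightarrow> 'b::euclidean_space"
  assumes b: "\<And>i. b $ i \<noteq> 0" and f: "square_integrable f"
  shows "square_integrable (\<lambda>x. f (b * x + y))"
proof -
  note [measurable] = square_integrable_measurable[OF f]
  show ?thesis using integrable_coordinatewise[OF b, of "\<lambda>x. (norm (f x))\<^sup>2" y] f
    by (simp add: square_integrable_def)
qed

definition l2_comp :: "real^3 \<Rightarrow> real^3 \<Rightarrow> l2 \<Rightarrow> l2" where
  "l2_comp b y u = l2_of (\<lambda>x. l2_fun u (b * x + y))"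

lemma l2_comp_l2_of:
  assumes b: "\<And>i. b $ i \<noteq> 0" and f: "square_integrable f"
  shows "l2_comp b y (l2_of f) = l2_of (\<lambda>x. f (b * x + y))"
  unfolding l2_comp_def
  by (rule l2_of_cong[OF square_integrable_coordinatewise[OF b l2_fun_square_integrable]
        square_integrable_coordinatewise[OF b f] AE_coordinatewise[OF b l2_fun_l2_of[OF f]]])

lemma norm_l2_comp:
  assumes b: "\<And>i. b $ i \<noteq> 0"
  shows "(norm u)\<^sup>2 = jac b * (norm (l2_comp b y u))\<^sup>2"
  unfolding l2_comp_def norm_l2_of[OF square_integrable_coordinatewise[OF b l2_fun_square_integrable]]
    norm_l2_fun[of u]
  by (subst integral_coordinatewise[OF b, of _ y]) auto

lemma linear_l2_comp:
  assumes b: "\<And>i. b $ i \<noteq> 0"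
  shows "linear (l2_comp b y)"
proof
  note s = square_integrable_coordinatewise[OF b l2_fun_square_integrable]
  show "l2_comp b y (u + v) = l2_comp b y u + l2_comp b y v" for u v
    unfolding l2_comp_def l2_of_add[OF s s, symmetric]
    by (rule l2_of_cong[OF s square_integrable_add[OF s s] AE_coordinatewise[OF b l2_fun_plus]])
  show "l2_comp b y (r *\<^sub>R u) = r *\<^sub>R l2_comp b y u" for r u
    unfolding l2_comp_def l2_of_scaleR[OF s, symmetric]
    by (rule l2_of_cong[OF s square_integrable_scaleR[OF s] AE_coordinatewise[OF b l2_fun_scaleR]])
qed

lemma test_function_continuous:
  assumes "test_function \<phi>" shows "continuous_on UNIV \<phi>"
proof -
  have "C_k 0 \<phi>" using assms unfolding test_function_def by blast
  then show ?thesis by simp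
qed

lemma test_function_support:
  assumes "test_function \<phi>"
  obtains R where "R > 0" "\<And>x. \<phi> x \<noteq> 0 \<Longrightarrow> norm x \<le> R"
proof -
  have "bounded (closure {x. \<phi> x \<noteq> 0})" using assms by (simp add: test_function_def compact_imp_bounded)
  then obtain R where "R > 0" "\<forall>x\<in>closure {x. \<phi> x \<noteq> 0}. norm x \<le> R" unfolding bounded_pos by blast
  moreover have "x \<in> closure {x. \<phi> x \<noteq> 0}" if "\<phi> x \<noteq> 0" for x
    using that closure_subset[of "{x. \<phi> x \<noteq> 0}"] by auto
  ultimately show ?thesis by (intro that[of R]) auto
qed

lemma continuous_compact_support_bounded:
  fixes \<phi> :: "real^3 \<Rightarrow> real"
  assumes "continuous_on UNIV \<phi>" "\<And>x. \<phi> x \<noteq> 0 \<Longrightarrow> norm x \<le> R"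
  obtains S where "S \<ge> 0" "\<And>x. \<bar>\<phi> x\<bar> \<le> S"
proof -
  have "bounded (\<phi> ` cball 0 R)"
    by (intro compact_imp_bounded compact_continuous_image continuous_on_subset[OF assms(1)]) auto
  then obtain S where S: "S > 0" "\<forall>x\<in>cball 0 R. \<bar>\<phi> x\<bar> \<le> S" by (auto simp: bounded_pos)
  have "\<bar>\<phi> x\<bar> \<le> S" for x using S assms(2)[of x] by (cases "\<phi> x = 0") auto
  then show ?thesis using S(1) that[of S] by auto
qed

lemma square_integrable_indicator_cball: "square_integrable (\<lambda>x. c * indicator (cball 0 R) x :: real)"
proof -
  have [measurable]: "cball 0 R \<in> sets (borel :: (real^3) measure)" by (intro borel_closed closed_cball)
  show ?thesis
  by (auto simp: square_integrable_def power_mult_distrib power2_eq_square[of "indicator _ _"]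
      indicator_inter_arith[symmetric] abs_mult intro!: integrable_real_indicator emeasure_lborel_cball_finite)
qed

text \<open>Composition scales the norm by 1 / sqrt (\<open>jac\<close>), which stays bounded along
  a convergent sequence of nondegenerate factors. By density it suffices to treat test functions,
  for which dominated convergence applies.\<close>

lemma l2_comp_tendsto:
  assumes b: "\<And>n i. b n $ i \<noteq> 0" "\<And>i. b' $ i \<noteq> 0" and l: "b \<longlonglongrightarrow> b'" "y \<longlonglongrightarrow> y'"
  shows "(\<lambda>n. l2_comp (b n) (y n) u) \<longlonglongrightarrow> l2_comp b' y' u"
proof -
  have lj: "(\<lambda>n. jac (b n)) \<longlonglongrightarrow> jac b'" unfolding jac_def by (intro tendsto_intros l)
  have nb: "norm (l2_comp c z u) = norm u / sqrt (jac c)" if "\<And>i. c $ i \<noteq> 0" for c z u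
  proof -
    have "sqrt ((norm u)\<^sup>2) = sqrt (jac c * (norm (l2_comp c z u))\<^sup>2)" using norm_l2_comp[OF that] by simp
    then show ?thesis using jac_pos[OF that] by (simp add: real_sqrt_mult field_simps)
  qed
  have lj': "(\<lambda>n. 1 / sqrt (jac (b n))) \<longlonglongrightarrow> 1 / sqrt (jac b')"
    using jac_pos[OF b(2)] by (intro tendsto_intros lj) auto
  then obtain K where K: "K > 0" "\<And>n. norm (1 / sqrt (jac (b n))) \<le> K"
    using convergent_imp_Bseq[OF convergentI[OF lj']] by (auto simp: Bseq_def)
  have K0: "1 / sqrt (jac b') \<le> K"
    by (rule tendsto_upperbound[OF lj'])
       (use abs_le_D1[OF K(2)[unfolded real_norm_def]] in \<open>auto intro!: always_eventually\<close>)
  have B1: "norm (l2_comp (b n) (y n) u) \<le> K * norm u" for n u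
    using mult_right_mono[OF K(2)[of n], of "norm u"] jac_pos[OF b(1)[of n]] by (simp add: nb b field_simps)
  have B2: "norm (l2_comp b' y' u) \<le> K * norm u" for u
    using mult_right_mono[OF K0, of "norm u"] by (simp add: nb b)
  have main: "(\<lambda>n. l2_comp (b n) (y n) (l2_of (\<lambda>x. z * of_real (\<phi> x)))) \<longlonglongrightarrow> l2_comp b' y' (l2_of (\<lambda>x. z * of_real (\<phi> x)))"
    if t: "test_function \<phi>" for \<phi> z
  proof -
    have c: "continuous_on UNIV \<phi>" using t by (rule test_function_continuous)
    obtain R where R: "R > 0" "\<And>x. \<phi> x \<noteq> 0 \<Longrightarrow> norm x \<le> R" using test_function_support[OF t] by blast
    obtain S where S: "S \<ge> 0" "\<And>x. \<bar>\<phi> x\<bar> \<le> S" using continuous_compact_support_bounded[OF c R(2)] by blast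
    have s: "square_integrable (\<lambda>x. z * complex_of_real (\<phi> x))"
      by (rule square_integrable_cmult[OF square_integrable_of_real[OF test_function_square_integrable[OF t]]]) auto
    have "\<exists>D. \<forall>n. 1 / \<bar>b n $ i\<bar> \<le> D" for i
    proof -
      have "(\<lambda>n. 1 / \<bar>b n $ i\<bar>) \<longlonglongrightarrow> 1 / \<bar>b' $ i\<bar>" using b(2) by (intro tendsto_intros l) auto
      then have "Bseq (\<lambda>n. 1 / \<bar>b n $ i\<bar>)" by (rule convergent_imp_Bseq[OF convergentI])
      then obtain D where "\<And>n. norm (1 / \<bar>b n $ i\<bar>) \<le> D" by (auto simp: Bseq_def)
      then show ?thesis by (intro exI[of _ D]) (auto simp: abs_le_iff)
    qed
    then obtain D where D: "\<And>i n. 1 / \<bar>b n $ i\<bar> \<le> D i" by metis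
    obtain Y where Y: "Y > 0" "\<And>n. norm (y n) \<le> Y" using convergent_imp_Bseq[OF convergentI[OF l(2)]] by (auto simp: Bseq_def)
    define Q where "Q = (\<Sum>i\<in>UNIV. (R + Y) * D i)"
    \<comment> \<open>All the substituted functions vanish outside one ball: \<open>Y\<close> bounds
      the shifts and \<open>D i\<close> the inverse scale factors.\<close>
    have bd: "norm x \<le> Q" if "\<phi> (b n * x + y n) \<noteq> 0" for n x
    proof -
      have "\<bar>x $ i\<bar> \<le> (R + Y) * D i" for i
      proof -
        have "\<bar>b n $ i * x $ i\<bar> = \<bar>(b n * x + y n) $ i - y n $ i\<bar>" by simp
        also have "\<dots> \<le> \<bar>(b n * x + y n) $ i\<bar> + \<bar>y n $ i\<bar>" by (rule abs_triangle_ineq4)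
        also have "\<dots> \<le> R + Y"
          using component_le_norm_cart[of "b n * x + y n" i] component_le_norm_cart[of "y n" i] R(2)[OF that] Y(2)[of n]
          by linarith
        finally have "\<bar>x $ i\<bar> \<le> (R + Y) * (1 / \<bar>b n $ i\<bar>)" using b(1)[of n i] by (simp add: abs_mult field_simps)
        also have "\<dots> \<le> (R + Y) * D i" using D[of n i] R Y by (intro mult_left_mono) auto
        finally show ?thesis .
      qed
      then have "(\<Sum>i\<in>UNIV. \<bar>x $ i\<bar>) \<le> Q" unfolding Q_def by (intro sum_mono) auto
      then show ?thesis using norm_le_l1_cart[of x] by linarith
    qed
    show ?thesis
      unfolding l2_comp_l2_of[OF b(1) s] l2_comp_l2_of[OF b(2) s]
    proof (rule l2_dominated_convergence[where w = "\<lambda>x. (cmod z * S) * indicator (cball 0 Q) x"])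
      show "AE x in lborel. cmod (z * of_real (\<phi> (b n * x + y n))) \<le> cmod z * S * indicator (cball 0 Q) x" for n
      proof (intro AE_I2)
        fix x show "cmod (z * of_real (\<phi> (b n * x + y n))) \<le> cmod z * S * indicator (cball 0 Q) x"
        proof (cases "\<phi> (b n * x + y n) = 0")
          case False
          then have "norm x \<le> Q" by (rule bd)
          then show ?thesis using S by (simp add: norm_mult mult_left_mono)
        qed (use S in simp)
      qed
      have "(\<lambda>n. \<phi> (b n * x + y n)) \<longlonglongrightarrow> \<phi> (b' * x + y')" for x
      proof (rule continuous_on_tendsto_compose[OF c])
        show "(\<lambda>n. b n * x + y n) \<longlonglongrightarrow> b' * x + y'"
          by (rule vec_tendstoI) (auto intro!: tendsto_intros l)
      qed auto
      then show "AE x in lborel. (\<lambda>n. z * of_real (\<phi> (b n * x + y n))) \<longlonglongrightarrow> z * of_real (\<phi> (b' * x + y'))"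
        by (intro AE_I2 tendsto_intros)
    qed (rule square_integrable_coordinatewise[OF b(1) s] square_integrable_coordinatewise[OF b(2) s]
        square_integrable_indicator_cball)+
  qed
  note cl = closed_convergence_set[where T = "\<lambda>n. l2_comp (b n) (y n)" and U = "l2_comp b' y'" and K = K,
      OF linear_l2_comp[OF b(1)] linear_l2_comp[OF b(2)] B1 B2]
  have "u \<in> {u. (\<lambda>n. l2_comp (b n) (y n) u) \<longlonglongrightarrow> l2_comp b' y' u}"
  proof (rule l2_dense[OF cl])
    fix \<phi> assume t: "test_function \<phi>"
    show "l2_of (\<lambda>x. of_real (\<phi> x)) \<in> {u. (\<lambda>n. l2_comp (b n) (y n) u) \<longlonglongrightarrow> l2_comp b' y' u}"
      using main[OF t, of 1] by simp
    show "l2_of (\<lambda>x. \<i> * of_real (\<phi> x)) \<in> {u. (\<lambda>n. l2_comp (b n) (y n) u) \<longlonglongrightarrow> l2_comp b' y' u}"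
      using main[OF t, of \<i>] by simp
  qed
  then show ?thesis by simp
qed

section \<open>Plancherel's theorem\<close>

lemma integral_lborel_prod:
  fixes f :: "real^3 \<Rightarrow> real \<Rightarrow> complex"
  assumes "\<And>b. b \<in> Basis \<Longrightarrow> integrable lborel (f b)"
  shows "integrable lborel (\<lambda>x. \<Prod>b\<in>Basis. f b (x \<bullet> b))"
    "(LINT x|lborel. (\<Prod>b\<in>Basis. f b (x \<bullet> b))) = (\<Prod>b\<in>Basis. LINT t|lborel. f b t)"
proof -
  interpret product_sigma_finite "\<lambda>_::real^3. lborel :: real measure" by standard
  have [measurable]: "f b \<in> borel_measurable borel" if "b \<in> Basis" for b using assms[OF that] by auto
  have [measurable]: "(\<lambda>g. \<Sum>b\<in>Basis. g b *\<^sub>R b) \<in> (\<Pi>\<^sub>M b\<in>Basis. lborel) \<rightarrow>\<^sub>M (borel :: (real^3) measure)"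
    by measurable
  have e: "(\<Prod>b\<in>Basis. f b ((\<Sum>b\<in>Basis. g b *\<^sub>R b) \<bullet> b)) = (\<Prod>b\<in>Basis. f b (g b))" for g
    by (intro prod.cong) auto
  have d: "lborel = distr (\<Pi>\<^sub>M b\<in>Basis. lborel) borel (\<lambda>g. \<Sum>b\<in>(Basis :: (real^3) set). g b *\<^sub>R b)"
    by (rule lborel_eq)
  have i: "integrable (\<Pi>\<^sub>M b\<in>Basis. lborel) (\<lambda>g. \<Prod>b\<in>Basis. f b (g b))"
    by (rule product_integrable_prod) (use assms in auto)
  show "integrable lborel (\<lambda>x. \<Prod>b\<in>Basis. f b (x \<bullet> b))"
    using i by (subst d) (simp add: integrable_distr_eq e)
  have "(LINT x|lborel. (\<Prod>b\<in>Basis. f b (x \<bullet> b))) = (LINT g|(\<Pi>\<^sub>M b\<in>Basis. lborel). (\<Prod>b\<in>Basis. f b (g b)))"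
    by (subst d) (simp add: integral_distr e)
  also have "\<dots> = (\<Prod>b\<in>Basis. LINT t|lborel. f b t)"
    by (rule product_integral_prod) (use assms in auto)
  finally show "(LINT x|lborel. (\<Prod>b\<in>Basis. f b (x \<bullet> b))) = (\<Prod>b\<in>Basis. LINT t|lborel. f b t)" .
qed

section \<open>Gaussians and their transforms\<close>

definition gauss :: "real^3 \<Rightarrow> real" where "gauss x = exp (- (norm x)\<^sup>2 / 2)"

lemma gauss_pos: "gauss x > 0" by (simp add: gauss_def)

lemma gauss_measurable [measurable]: "gauss \<in> borel_measurable borel"
  unfolding gauss_def by measurable

text \<open>Read off from the characteristic function of the standard normal distribution after
  removing its normalisation sqrt (2 pi).\<close>

lemma gauss_1d:
  fixes t :: real
  shows "integrable lborel (\<lambda>x. exp (complex_of_real (- x\<^sup>2 / 2) + \<i> * of_real (t * x)))"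
    "(LINT x|lborel. exp (complex_of_real (- x\<^sup>2 / 2) + \<i> * of_real (t * x))) = of_real (sqrt (2 * pi) * exp (- t\<^sup>2 / 2))"
proof -
  have e: "exp (complex_of_real (- x\<^sup>2 / 2) + \<i> * of_real (t * x))
      = complex_of_real (sqrt (2 * pi)) * (std_normal_density x *\<^sub>R iexp (t * x))" for x
    unfolding exp_add exp_of_real by (simp add: std_normal_density_def scaleR_conv_of_real)
  interpret prob_space std_normal_distribution by (rule prob_space_normal_density) simp
  have i: "integrable lborel (\<lambda>x. std_normal_density x *\<^sub>R iexp (t * x))"
    by (rule Bochner_Integration.integrable_bound[OF integrable_std_normal_moment[of 0]]) (auto simp: normal_density_nonneg)
  show "integrable lborel (\<lambda>x. exp (complex_of_real (- x\<^sup>2 / 2) + \<i> * of_real (t * x)))"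
    unfolding e using i by (rule integrable_mult_right)
  have "(LINT x|lborel. std_normal_density x *\<^sub>R iexp (t * x)) = (LINT x|std_normal_distribution. iexp (t * x))"
    by (rule integral_density[symmetric]) (auto simp: normal_density_nonneg)
  also have "\<dots> = of_real (exp (- t\<^sup>2 / 2))"
    using fun_cong[OF char_std_normal_distribution, of t] by (simp add: char_def)
  finally show "(LINT x|lborel. exp (complex_of_real (- x\<^sup>2 / 2) + \<i> * of_real (t * x))) = of_real (sqrt (2 * pi) * exp (- t\<^sup>2 / 2))"
    unfolding e by (subst integral_mult_right_zero) simp
qed

text \<open>This is (2 pi)^(3/2), the integral of \<open>gauss\<close>.\<close>

definition gconst :: real where "gconst = sqrt (2 * pi) ^ 3"

lemma gauss_fourier:
  shows "integrable lborel (\<lambda>x. complex_of_real (gauss x))"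
    "fourier (\<lambda>x. of_real (gauss x)) z = of_real (gconst * gauss z)"
proof -
  let ?f = "\<lambda>(b::real^3) x. exp (complex_of_real (- x\<^sup>2 / 2) + \<i> * of_real (- (z \<bullet> b) * x))"
  have e: "(\<Prod>b\<in>Basis. exp (complex_of_real (- (x \<bullet> b)\<^sup>2 / 2) + \<i> * of_real (- (w \<bullet> b) * (x \<bullet> b))))
     = of_real (gauss x) * cis (- (x \<bullet> w))" for x w :: "real^3"
  proof -
    have "(\<Prod>b\<in>Basis. exp (complex_of_real (- (x \<bullet> b)\<^sup>2 / 2) + \<i> * of_real (- (w \<bullet> b) * (x \<bullet> b))))
      = exp (\<Sum>b\<in>Basis. complex_of_real (- (x \<bullet> b)\<^sup>2 / 2) + \<i> * of_real (- (w \<bullet> b) * (x \<bullet> b)))"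
      by (simp add: exp_sum)
    also have "(\<Sum>b\<in>Basis. complex_of_real (- (x \<bullet> b)\<^sup>2 / 2) + \<i> * of_real (- (w \<bullet> b) * (x \<bullet> b)))
      = complex_of_real (- (\<Sum>b\<in>Basis. (x \<bullet> b) * (x \<bullet> b)) / 2) + \<i> * of_real (- (\<Sum>b\<in>Basis. (x \<bullet> b) * (w \<bullet> b)))"
      by (simp add: sum.distrib sum_subtractf sum_distrib_left sum_negf power2_eq_square sum_divide_distrib mult.commute)
    also have "\<dots> = of_real (- (norm x)\<^sup>2 / 2) + \<i> * of_real (- (x \<bullet> w))"
      unfolding euclidean_inner[symmetric] by (simp add: power2_norm_eq_inner)
    also have "exp \<dots> = of_real (gauss x) * cis (- (x \<bullet> w))"
      by (simp only: exp_add) (simp add: gauss_def cis_conv_exp flip: exp_of_real)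
    finally show ?thesis .
  qed
  have e0: "(\<Prod>b\<in>Basis. exp (complex_of_real (- (x \<bullet> b)\<^sup>2 / 2) + \<i> * of_real (0 * (x \<bullet> b)))) = of_real (gauss x)" for x :: "real^3"
    using e[of x 0] by simp
  show "integrable lborel (\<lambda>x. complex_of_real (gauss x))"
    using integral_lborel_prod(1)[of "\<lambda>b x. exp (complex_of_real (- x\<^sup>2 / 2) + \<i> * of_real (0 * x))", OF gauss_1d(1)]
    unfolding e0 .
  have "fourier (\<lambda>x. of_real (gauss x)) z = (\<Prod>b\<in>Basis. LINT t|lborel. ?f b t)"
    unfolding fourier_def using integral_lborel_prod(2)[of ?f, OF gauss_1d(1)] unfolding e .
  also have "\<dots> = (\<Prod>b\<in>Basis. of_real (sqrt (2 * pi) * exp (- (- (z \<bullet> b))\<^sup>2 / 2)))"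
    by (intro prod.cong gauss_1d(2) refl)
  also have "\<dots> = of_real (gconst * exp (\<Sum>b\<in>Basis. - (z \<bullet> b)\<^sup>2 / 2))"
    by (simp add: prod.distrib exp_sum gconst_def of_real_prod)
  also have "(\<Sum>b\<in>Basis. - (z \<bullet> b)\<^sup>2 / 2) = - (\<Sum>b\<in>Basis. (z \<bullet> b) * (z \<bullet> b)) / 2"
    by (simp add: sum_negf power2_eq_square sum_divide_distrib)
  also have "\<dots> = - (norm z)\<^sup>2 / 2"
    unfolding euclidean_inner[symmetric] by (simp add: power2_norm_eq_inner)
  finally show "fourier (\<lambda>x. of_real (gauss x)) z = of_real (gconst * gauss z)" by (simp add: gauss_def)
qed

section \<open>Rules for the integral transform\<close>

lemma cis_inner_measurable [measurable (raw)]: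
  fixes f g :: "'a \<Rightarrow> real^3"
  assumes [measurable]: "f \<in> borel_measurable M" "g \<in> borel_measurable M"
  shows "(\<lambda>x. cis (- (f x \<bullet> g x))) \<in> borel_measurable M"
proof -
  have "cis \<in> borel_measurable borel"
    by (intro borel_measurable_continuous_onI continuous_on_cis continuous_on_id)
  then show ?thesis by measurable
qed

lemma fourier_measurable [measurable]:
  assumes [measurable]: "f \<in> borel_measurable borel"
  shows "fourier f \<in> borel_measurable borel"
  unfolding fourier_def by measurable

lemma integrable_cis:
  fixes f :: "real^3 \<Rightarrow> complex"
  assumes f: "integrable lborel f"
  shows "integrable lborel (\<lambda>x. f x * cis (- (x \<bullet> \<xi>)))"
proof -
  have [measurable]: "f \<in> borel_measurable borel" using f by auto
  show ?thesis
  proof (rule Bochner_Integration.integrable_bound[OF f])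
    show "AE x in lborel. norm (f x * cis (- (x \<bullet> \<xi>))) \<le> norm (f x)" by (simp add: norm_mult)
  qed measurable
qed

lemma norm_fourier_le:
  assumes f: "integrable lborel f"
  shows "cmod (fourier f \<xi>) \<le> (LINT x|lborel. cmod (f x))"
  unfolding fourier_def using integral_norm_bound[of lborel "\<lambda>x. f x * cis (- (x \<bullet> \<xi>))"]
  by (simp add: norm_mult)

lemma fourier_diff:
  "integrable lborel f \<Longrightarrow> integrable lborel g \<Longrightarrow> fourier (\<lambda>x. f x - g x) \<xi> = fourier f \<xi> - fourier g \<xi>"
  unfolding fourier_def by (simp add: left_diff_distrib integrable_cis)

lemma fourier_add:
  "integrable lborel f \<Longrightarrow> integrable lborel g \<Longrightarrow> fourier (\<lambda>x. f x + g x) \<xi> = fourier f \<xi> + fourier g \<xi>"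
  unfolding fourier_def by (simp add: distrib_right integrable_cis)

lemma fourier_cmult: "fourier (\<lambda>x. c * f x) \<xi> = c * fourier f \<xi>"
  unfolding fourier_def by (simp add: mult.assoc)

lemma fourier_cnj: "fourier (\<lambda>x. cnj (f x)) \<xi> = cnj (fourier f (- \<xi>))"
  unfolding fourier_def
  by (subst Bochner_Integration.integral_cnj[symmetric], rule Bochner_Integration.integral_cong) (simp_all add: cis_cnj)

lemma integrable_tensor:
  fixes f g :: "real^3 \<Rightarrow> complex" and h :: "(real^3) \<times> (real^3) \<Rightarrow> complex"
  assumes f: "integrable lborel f" and g: "integrable lborel g"
    and [measurable]: "h \<in> borel_measurable (lborel \<Otimes>\<^sub>M lborel)" and b: "\<And>x y. cmod (h (x, y)) \<le> 1"
  shows "integrable (lborel \<Otimes>\<^sub>M lborel) (\<lambda>(x, y). f x * g y * h (x, y))"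
proof -
  have [measurable]: "f \<in> borel_measurable borel" "g \<in> borel_measurable borel" using f g by auto
  have "integrable (lborel \<Otimes>\<^sub>M lborel) (\<lambda>(x, y). f x * g y)"
  proof (rule lborel_pair.Fubini_integrable)
    show "integrable lborel (\<lambda>x. LINT y|lborel. norm (case (x, y) of (x, y) \<Rightarrow> f x * g y))"
      using f by (simp add: norm_mult)
    show "AE x in lborel. integrable lborel (\<lambda>y. case (x, y) of (x, y) \<Rightarrow> f x * g y)"
      using g by simp
  qed measurable
  then show ?thesis
  proof (rule Bochner_Integration.integrable_bound)
    show "AE p in lborel \<Otimes>\<^sub>M lborel. cmod (case p of (x, y) \<Rightarrow> f x * g y * h (x, y)) \<le> cmod (case p of (x, y) \<Rightarrow> f x * g y)"
      using b by (auto simp: norm_mult intro!: AE_I2 mult_left_le)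
  qed measurable
qed

lemma fourier_multiplication_formula:
  assumes f: "integrable lborel f" and g: "integrable lborel g"
  shows "(LINT \<xi>|lborel. fourier f \<xi> * g \<xi>) = (LINT x|lborel. f x * fourier g x)"
proof -
  have "integrable (lborel \<Otimes>\<^sub>M lborel) (\<lambda>(x, y). f x * g y * (\<lambda>(x, y). cis (- (x \<bullet> y))) (x, y))"
    by (rule integrable_tensor[OF f g]) auto
  then have "integrable (lborel \<Otimes>\<^sub>M lborel) (\<lambda>(x, y). f x * g y * cis (- (x \<bullet> y)))" by simp
  from lborel_pair.Fubini_integral[OF this]
  have "(LINT y|lborel. LINT x|lborel. f x * g y * cis (- (x \<bullet> y))) = (LINT x|lborel. LINT y|lborel. f x * g y * cis (- (x \<bullet> y)))" .
  moreover have "(LINT x|lborel. f x * g y * cis (- (x \<bullet> y))) = fourier f y * g y" for y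
    unfolding fourier_def by (subst integral_mult_left_zero[symmetric]) (simp add: ac_simps)
  moreover have "(LINT y|lborel. f x * g y * cis (- (x \<bullet> y))) = f x * fourier g x" for x
    unfolding fourier_def by (subst integral_mult_right_zero[symmetric]) (simp add: ac_simps inner_commute)
  ultimately show ?thesis by simp
qed

lemma lborel_integral_shift:
  fixes f :: "real^3 \<Rightarrow> 'b::{banach, second_countable_topology}"
  assumes "f \<in> borel_measurable borel"
  shows "(LINT x|lborel. f (x + y)) = (LINT x|lborel. f x)" "(LINT x|lborel. f (y - x)) = (LINT x|lborel. f x)"
proof -
  have "(\<chi> i. 1) * x = x" "(\<chi> i. - 1) * x = - x" for x :: "real^3" by (simp_all add: vec_eq_iff)
  then show "(LINT x|lborel. f (x + y)) = (LINT x|lborel. f x)" "(LINT x|lborel. f (y - x)) = (LINT x|lborel. f x)"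
    using integral_coordinatewise[of "\<chi> i. 1" f y] integral_coordinatewise[of "\<chi> i. - 1" f y] assms
    by (simp_all add: jac_def)
qed

lemma lborel_integrable_shift:
  fixes f :: "real^3 \<Rightarrow> 'b::{banach, second_countable_topology}"
  assumes "integrable lborel f"
  shows "integrable lborel (\<lambda>x. f (x + y))" "integrable lborel (\<lambda>x. f (y - x))"
proof -
  have "(\<chi> i. 1) * x = x" "(\<chi> i. - 1) * x = - x" for x :: "real^3" by (simp_all add: vec_eq_iff)
  then show "integrable lborel (\<lambda>x. f (x + y))" "integrable lborel (\<lambda>x. f (y - x))"
    using integrable_coordinatewise[OF _ assms, of "\<chi> i. 1" y] integrable_coordinatewise[OF _ assms, of "\<chi> i. - 1" y]
    by simp_all
qed

lemma fourier_convolution: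
  assumes f: "integrable lborel f" and g: "integrable lborel g"
  shows "integrable lborel (\<lambda>z. LINT x|lborel. f x * g (z - x))"
    "fourier (\<lambda>z. LINT x|lborel. f x * g (z - x)) \<xi> = fourier f \<xi> * fourier g \<xi>"
proof -
  have [measurable]: "f \<in> borel_measurable borel" "g \<in> borel_measurable borel" using f g by auto
  have i: "integrable (lborel \<Otimes>\<^sub>M lborel) (\<lambda>(x, z). f x * g (z - x))"
  proof (rule lborel_pair.Fubini_integrable)
    have "(LINT z|lborel. cmod (f x * g (z - x))) = cmod (f x) * (LINT z|lborel. cmod (g z))" for x
      using lborel_integral_shift(1)[of "\<lambda>z. cmod (g z)" "- x"] by (simp add: norm_mult)
    then show "integrable lborel (\<lambda>x. LINT z|lborel. norm (case (x, z) of (x, z) \<Rightarrow> f x * g (z - x)))"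
      using f by simp
    show "AE x in lborel. integrable lborel (\<lambda>z. case (x, z) of (x, z) \<Rightarrow> f x * g (z - x))"
      using lborel_integrable_shift(1)[OF g, of "- _"] by (intro AE_I2) simp
  qed measurable
  have "integrable (lborel \<Otimes>\<^sub>M lborel) (\<lambda>(z, x). f x * g (z - x))"
    using lborel_pair.integrable_product_swap[OF i] by (simp add: split_beta)
  from lborel_pair.integrable_fst[OF this]
  show "integrable lborel (\<lambda>z. LINT x|lborel. f x * g (z - x))" by simp
  have i2: "integrable (lborel \<Otimes>\<^sub>M lborel) (\<lambda>(x, z). f x * g (z - x) * cis (- (z \<bullet> \<xi>)))"
    using i by (rule Bochner_Integration.integrable_bound) (auto simp: norm_mult)
  have "fourier (\<lambda>z. LINT x|lborel. f x * g (z - x)) \<xi> = (LINT z|lborel. LINT x|lborel. f x * g (z - x) * cis (- (z \<bullet> \<xi>)))"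
    unfolding fourier_def by simp
  also have "\<dots> = (LINT x|lborel. LINT z|lborel. f x * g (z - x) * cis (- (z \<bullet> \<xi>)))"
    by (rule lborel_pair.Fubini_integral[OF i2])
  also have "\<dots> = (LINT x|lborel. f x * cis (- (x \<bullet> \<xi>)) * fourier g \<xi>)"
  proof (rule Bochner_Integration.integral_cong[OF refl])
    fix x
    have "(LINT z|lborel. f x * g (z - x) * cis (- (z \<bullet> \<xi>)))
       = (LINT z|lborel. f x * g ((z + x) - x) * cis (- ((z + x) \<bullet> \<xi>)))"
      by (rule lborel_integral_shift(1)[symmetric]) measurable
    also have "\<dots> = (LINT z|lborel. (f x * cis (- (x \<bullet> \<xi>))) * (g z * cis (- (z \<bullet> \<xi>))))"
    proof (rule Bochner_Integration.integral_cong[OF refl])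
      fix z
      have "cis (- ((z + x) \<bullet> \<xi>)) = cis (- (x \<bullet> \<xi>)) * cis (- (z \<bullet> \<xi>))"
        unfolding cis_mult by (rule arg_cong[where f = cis]) (simp add: inner_add_left)
      then show "f x * g (z + x - x) * cis (- ((z + x) \<bullet> \<xi>)) = f x * cis (- (x \<bullet> \<xi>)) * (g z * cis (- (z \<bullet> \<xi>)))"
        by (simp add: ac_simps)
    qed
    finally show "(LINT z|lborel. f x * g (z - x) * cis (- (z \<bullet> \<xi>))) = f x * cis (- (x \<bullet> \<xi>)) * fourier g \<xi>"
      unfolding fourier_def by simp
  qed
  finally show "fourier (\<lambda>z. LINT x|lborel. f x * g (z - x)) \<xi> = fourier f \<xi> * fourier g \<xi>"
    unfolding fourier_def by simp
qed

text \<open>This is (2 pi)^3, the Plancherel constant of a transform without prefactor.\<close>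

definition plconst :: real where "plconst = gconst\<^sup>2"

lemma plconst_pos: "plconst > 0" by (simp add: plconst_def gconst_def)

text \<open>The autocorrelation \<open>\<phi>\<close> of \<open>f\<close> has the transform |f^|^2
  and the value |f|_2^2 at 0. Recovering that value amounts to integrating the transform, which is
  made legitimate by Gaussian damping: the damped integral is an average of \<open>\<phi>\<close>
  over a Gaussian that shrinks to the origin.\<close>

lemma plancherel_L1_L2:
  assumes f: "integrable lborel f" and f2: "square_integrable f"
  shows "integrable lborel (\<lambda>\<xi>. (cmod (fourier f \<xi>))\<^sup>2)"
    "(LINT \<xi>|lborel. (cmod (fourier f \<xi>))\<^sup>2) = plconst * (LINT x|lborel. (cmod (f x))\<^sup>2)"
proof -
  have [measurable]: "f \<in> borel_measurable borel" using f by auto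
  define \<phi> where "\<phi> z = (LINT x|lborel. f x * cnj (f (- (z - x))))" for z
  have g: "integrable lborel (\<lambda>x. cnj (f (- x)))"
    using lborel_integrable_shift(2)[OF f, of 0] by simp
  have fg: "fourier (\<lambda>x. cnj (f (- x))) \<xi> = cnj (fourier f \<xi>)" for \<xi>
  proof -
    have "fourier (\<lambda>x. cnj (f (- x))) \<xi> = (LINT x|lborel. cnj (f (- x) * cis (- (- x \<bullet> \<xi>))))"
      unfolding fourier_def by (simp add: cis_cnj)
    also have "\<dots> = (LINT x|lborel. cnj (f x * cis (- (x \<bullet> \<xi>))))"
      using lborel_integral_shift(2)[of "\<lambda>x. cnj (f x * cis (- (x \<bullet> \<xi>)))" 0] by simp
    finally show ?thesis unfolding fourier_def by (simp del: complex_cnj_mult)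
  qed
  have \<phi>i: "integrable lborel \<phi>" and \<phi>f: "\<And>\<xi>. fourier \<phi> \<xi> = of_real ((cmod (fourier f \<xi>))\<^sup>2)"
    using fourier_convolution[OF f g] unfolding \<phi>_def[abs_def] fg by (simp_all add: complex_norm_square del: of_real_power)
  have [measurable]: "\<phi> \<in> borel_measurable borel" using \<phi>i by auto
  \<comment> \<open>As an inner product of \<open>f\<close> with a translate of itself, this real
    part is bounded by Cauchy--Schwarz and continuous at 0 because translations are strongly
    continuous.\<close>
  have R: "Re (\<phi> z) = l2_of f \<bullet> l2_comp (\<chi> i. 1) (- z) (l2_of f)" for z
  proof -
    have e: "(\<chi> i. 1) * x + - z = - (z - x)" for x :: "real^3" by (simp add: vec_eq_iff)
    have s: "square_integrable (\<lambda>x. f (- (z - x)))"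
      using square_integrable_coordinatewise[OF _ f2, of "\<chi> i. 1" "- z"] unfolding e by simp
    have "l2_comp (\<chi> i. 1) (- z) (l2_of f) = l2_of (\<lambda>x. f (- (z - x)))"
      using l2_comp_l2_of[OF _ f2, of "\<chi> i. 1" "- z"] unfolding e by simp
    then show ?thesis unfolding \<phi>_def using Re_integral_mult_cnj[OF f2 s] by simp
  qed
  have nb: "\<bar>Re (\<phi> z)\<bar> \<le> (norm (l2_of f))\<^sup>2" for z
  proof -
    have "(norm (l2_of f))\<^sup>2 = (norm (l2_comp (\<chi> i. 1) (- z) (l2_of f)))\<^sup>2"
      using norm_l2_comp[of "\<chi> i. 1" "l2_of f" "- z"] by (simp add: jac_def)
    then have "norm (l2_of f) = norm (l2_comp (\<chi> i. 1) (- z) (l2_of f))" by simp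
    then show ?thesis unfolding R
      using Cauchy_Schwarz_ineq2[of "l2_of f" "l2_comp (\<chi> i. 1) (- z) (l2_of f)"] by (simp add: power2_eq_square)
  qed
  define e where "e n = 1 / real (Suc n)" for n
  have e0: "e n > 0" "e \<longlonglongrightarrow> 0" for n
    unfolding e_def using LIMSEQ_Suc[OF lim_1_over_n] by auto
  have gi: "integrable lborel (\<lambda>\<xi>. complex_of_real (gauss (e n *\<^sub>R \<xi>)))" for n
  proof -
    have "(\<chi> i. e n) * \<xi> + 0 = e n *\<^sub>R \<xi>" for \<xi> :: "real^3" by (simp add: vec_eq_iff)
    then show ?thesis using integrable_coordinatewise[OF _ gauss_fourier(1), of "\<chi> i. e n" 0] e0(1)[of n] by simp
  qed
  \<comment> \<open>Multiplication formula for \<open>\<phi>\<close> and the wide Gaussian, followed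
    by the substitution \<open>z = e n *\<^sub>R w\<close>, which absorbs the Jacobian.\<close>
  have key: "(LINT \<xi>|lborel. gauss (e n *\<^sub>R \<xi>) * (cmod (fourier f \<xi>))\<^sup>2) = gconst * (LINT w|lborel. gauss w * Re (\<phi> (e n *\<^sub>R w)))"
    and keyi: "integrable lborel (\<lambda>\<xi>. gauss (e n *\<^sub>R \<xi>) * (cmod (fourier f \<xi>))\<^sup>2)" for n
  proof -
    have e': "(\<chi> i. e n) * \<xi> + 0 = e n *\<^sub>R \<xi>" for \<xi> :: "real^3" by (simp add: vec_eq_iff)
    have fs: "complex_of_real (jac (\<chi> i. e n)) * fourier (\<lambda>\<xi>. of_real (gauss (e n *\<^sub>R \<xi>))) (e n *\<^sub>R w) = of_real (gconst * gauss w)" for w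
      unfolding gauss_fourier(2)[symmetric] fourier_def
      using integral_coordinatewise[of "\<chi> i. e n" "\<lambda>x. of_real (gauss x) * cis (- (x \<bullet> w))" 0] e0(1)[of n]
      unfolding e' by (simp add: inner_scaleR_left inner_scaleR_right scaleR_conv_of_real[where 'a = complex])
    have "of_real (LINT \<xi>|lborel. gauss (e n *\<^sub>R \<xi>) * (cmod (fourier f \<xi>))\<^sup>2)
        = (LINT \<xi>|lborel. fourier \<phi> \<xi> * of_real (gauss (e n *\<^sub>R \<xi>)))"
      unfolding \<phi>f integral_complex_of_real[symmetric] by (simp add: mult.commute)
    also have "\<dots> = (LINT z|lborel. \<phi> z * fourier (\<lambda>\<xi>. of_real (gauss (e n *\<^sub>R \<xi>))) z)"
      by (rule fourier_multiplication_formula[OF \<phi>i gi])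
    also have "\<dots> = of_real (jac (\<chi> i. e n)) * (LINT w|lborel. \<phi> (e n *\<^sub>R w) * fourier (\<lambda>\<xi>. of_real (gauss (e n *\<^sub>R \<xi>))) (e n *\<^sub>R w))"
      using e0(1)[of n] by (subst integral_coordinatewise[of "\<chi> i. e n" _ 0]) (simp_all add: e'[simplified] scaleR_conv_of_real[where 'a = complex])
    also have "\<dots> = (LINT w|lborel. of_real (gconst * gauss w) * \<phi> (e n *\<^sub>R w))"
      unfolding fs[symmetric] by (subst integral_mult_right_zero[symmetric]) (simp add: ac_simps)
    finally have eq: "of_real (LINT \<xi>|lborel. gauss (e n *\<^sub>R \<xi>) * (cmod (fourier f \<xi>))\<^sup>2) = (LINT w|lborel. of_real (gconst * gauss w) * \<phi> (e n *\<^sub>R w))" .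
    have ii: "integrable lborel (\<lambda>w. of_real (gconst * gauss w) * \<phi> (e n *\<^sub>R w))"
    proof (rule Bochner_Integration.integrable_bound)
      show "integrable lborel (\<lambda>w. of_real gconst * \<phi> (e n *\<^sub>R w))"
        using integrable_coordinatewise[OF _ \<phi>i, of "\<chi> i. e n" 0] e0(1)[of n] unfolding e' by simp
      show "AE w in lborel. norm (of_real (gconst * gauss w) * \<phi> (e n *\<^sub>R w)) \<le> norm (of_real gconst * \<phi> (e n *\<^sub>R w))"
        by (auto simp: norm_mult gauss_def gconst_def intro!: AE_I2 mult_right_mono mult_left_le_one_le)
    qed measurable
    have "(LINT \<xi>|lborel. gauss (e n *\<^sub>R \<xi>) * (cmod (fourier f \<xi>))\<^sup>2) = (LINT w|lborel. Re (of_real (gconst * gauss w) * \<phi> (e n *\<^sub>R w)))"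
      unfolding integral_Re[OF ii] eq[symmetric] by simp
    then show "(LINT \<xi>|lborel. gauss (e n *\<^sub>R \<xi>) * (cmod (fourier f \<xi>))\<^sup>2) = gconst * (LINT w|lborel. gauss w * Re (\<phi> (e n *\<^sub>R w)))"
      by (simp add: mult.assoc)
    show "integrable lborel (\<lambda>\<xi>. gauss (e n *\<^sub>R \<xi>) * (cmod (fourier f \<xi>))\<^sup>2)"
    proof (rule Bochner_Integration.integrable_bound)
      show "integrable lborel (\<lambda>\<xi>. complex_of_real (gauss (e n *\<^sub>R \<xi>)) * of_real ((LINT x|lborel. cmod (f x))\<^sup>2))"
        by (intro integrable_mult_left gi)
      show "AE \<xi> in lborel. norm (gauss (e n *\<^sub>R \<xi>) * (cmod (fourier f \<xi>))\<^sup>2) \<le>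
          norm (complex_of_real (gauss (e n *\<^sub>R \<xi>)) * of_real ((LINT x|lborel. cmod (f x))\<^sup>2))"
      proof (intro AE_I2)
        fix \<xi> :: "real^3"
        have "(cmod (fourier f \<xi>))\<^sup>2 \<le> (LINT x|lborel. cmod (f x))\<^sup>2"
          by (intro power_mono norm_fourier_le f) simp
        then have "gauss (e n *\<^sub>R \<xi>) * (cmod (fourier f \<xi>))\<^sup>2 \<le> gauss (e n *\<^sub>R \<xi>) * (LINT x|lborel. cmod (f x))\<^sup>2"
          using gauss_pos less_imp_le by (intro mult_left_mono) auto
        then show "norm (gauss (e n *\<^sub>R \<xi>) * (cmod (fourier f \<xi>))\<^sup>2) \<le>
          norm (complex_of_real (gauss (e n *\<^sub>R \<xi>)) * of_real ((LINT x|lborel. cmod (f x))\<^sup>2))"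
          using gauss_pos[of "e n *\<^sub>R \<xi>"] by (simp add: norm_mult norm_power abs_mult)
      qed
    qed measurable
  qed
  have gint: "integrable lborel gauss" using gauss_fourier(1) by (simp add: complex_of_real_integrable_eq)
  have gval: "(LINT w|lborel. gauss w) = gconst"
  proof -
    have "complex_of_real (LINT w|lborel. gauss w) = fourier (\<lambda>x. of_real (gauss x)) 0"
      unfolding fourier_def by simp
    then show ?thesis unfolding gauss_fourier(2) by (simp add: gauss_def del: of_real_mult)
  qed
  have \<phi>0: "Re (\<phi> 0) = (LINT x|lborel. (cmod (f x))\<^sup>2)"
    using Re_integral_mult_cnj[OF f2 f2] norm_l2_of[OF f2] by (simp add: \<phi>_def power2_norm_eq_inner)
  have lim: "(\<lambda>n. LINT w|lborel. gauss w * Re (\<phi> (e n *\<^sub>R w))) \<longlonglongrightarrow> (LINT w|lborel. gauss w * Re (\<phi> 0))"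
  proof (rule integral_dominated_convergence[where w = "\<lambda>w. gauss w * (norm (l2_of f))\<^sup>2"])
    show "integrable lborel (\<lambda>w. gauss w * (norm (l2_of f))\<^sup>2)" using gint by simp
    show "AE w in lborel. norm (gauss w * Re (\<phi> (e n *\<^sub>R w))) \<le> gauss w * (norm (l2_of f))\<^sup>2" for n
      using nb gauss_pos by (auto simp: abs_mult less_imp_le intro!: AE_I2 mult_mono)
    show "AE w in lborel. (\<lambda>n. gauss w * Re (\<phi> (e n *\<^sub>R w))) \<longlonglongrightarrow> gauss w * Re (\<phi> 0)"
    proof (intro AE_I2 tendsto_mult tendsto_const)
      fix w :: "real^3"
      have "(\<lambda>n. - (e n *\<^sub>R w)) \<longlonglongrightarrow> - (0 *\<^sub>R w)" by (intro tendsto_intros e0)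
      then have "(\<lambda>n. - (e n *\<^sub>R w)) \<longlonglongrightarrow> - 0" by simp
      then show "(\<lambda>n. Re (\<phi> (e n *\<^sub>R w))) \<longlonglongrightarrow> Re (\<phi> 0)"
        unfolding R by (intro tendsto_inner tendsto_const l2_comp_tendsto; (assumption | simp))
    qed
  qed measurable
  \<comment> \<open>The damping factors increase to 1, so monotone convergence delivers
    integrability and the value of the integral at once.\<close>
  have hb: "has_bochner_integral lborel (\<lambda>\<xi>. (cmod (fourier f \<xi>))\<^sup>2) (gconst * (gconst * (LINT x|lborel. (cmod (f x))\<^sup>2)))"
  proof (rule has_bochner_integral_monotone_convergence)
    show "integrable lborel (\<lambda>\<xi>. gauss (e n *\<^sub>R \<xi>) * (cmod (fourier f \<xi>))\<^sup>2)" for n by (rule keyi)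
    show "(\<lambda>n. LINT \<xi>|lborel. gauss (e n *\<^sub>R \<xi>) * (cmod (fourier f \<xi>))\<^sup>2) \<longlonglongrightarrow> gconst * (gconst * (LINT x|lborel. (cmod (f x))\<^sup>2))"
      unfolding key using tendsto_mult[OF tendsto_const[of gconst] lim] by (simp add: gval \<phi>0)
    show "AE \<xi> in lborel. mono (\<lambda>n. gauss (e n *\<^sub>R \<xi>) * (cmod (fourier f \<xi>))\<^sup>2)"
    proof (intro AE_I2 monoI mult_right_mono)
      fix \<xi> :: "real^3" and m n :: nat assume "m \<le> n"
      then have "e n \<le> e m" by (simp add: e_def frac_le)
      then have "(e n * norm \<xi>)\<^sup>2 \<le> (e m * norm \<xi>)\<^sup>2"
        using e0(1)[of n] by (intro power_mono mult_right_mono mult_nonneg_nonneg) auto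
      then show "gauss (e m *\<^sub>R \<xi>) \<le> gauss (e n *\<^sub>R \<xi>)" by (simp add: gauss_def power_mult_distrib)
    qed simp
    show "AE \<xi> in lborel. (\<lambda>n. gauss (e n *\<^sub>R \<xi>) * (cmod (fourier f \<xi>))\<^sup>2) \<longlonglongrightarrow> (cmod (fourier f \<xi>))\<^sup>2"
    proof (intro AE_I2)
      fix \<xi> :: "real^3"
      have "(\<lambda>n. gauss (e n *\<^sub>R \<xi>) * (cmod (fourier f \<xi>))\<^sup>2) \<longlonglongrightarrow> exp (- (norm (0 *\<^sub>R \<xi>))\<^sup>2 / 2) * (cmod (fourier f \<xi>))\<^sup>2"
        unfolding gauss_def by (intro tendsto_intros e0) auto
      then show "(\<lambda>n. gauss (e n *\<^sub>R \<xi>) * (cmod (fourier f \<xi>))\<^sup>2) \<longlonglongrightarrow> (cmod (fourier f \<xi>))\<^sup>2" by simp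
    qed
  qed measurable
  show "integrable lborel (\<lambda>\<xi>. (cmod (fourier f \<xi>))\<^sup>2)" using hb by (rule integrable.intros)
  show "(LINT \<xi>|lborel. (cmod (fourier f \<xi>))\<^sup>2) = plconst * (LINT x|lborel. (cmod (f x))\<^sup>2)"
    using has_bochner_integral_integral_eq[OF hb] by (simp add: plconst_def power2_eq_square)
qed

section \<open>Extension of the transform to all square integrable functions\<close>

definition trunc :: "real \<Rightarrow> (real^3 \<Rightarrow> complex) \<Rightarrow> real^3 \<Rightarrow> complex" where
  "trunc R f = (\<lambda>x. indicator (ball 0 R) x * f x)"

lemma ball_sets [measurable]: "ball (x::real^3) R \<in> sets borel"
  by (intro borel_open open_ball)

lemma square_integrable_indicator_ball: "square_integrable (indicator (ball 0 R) :: real^3 \<Rightarrow> complex)"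
proof (rule square_integrable_bound[where C = 1])
  show "square_integrable (\<lambda>x. 1 * indicator (cball 0 R) x :: real)" by (rule square_integrable_indicator_cball)
  show "AE x in lborel. norm (indicator (ball 0 R) x :: complex) \<le> 1 * norm (1 * indicator (cball 0 R) x :: real)"
    by (auto simp: indicator_def)
qed measurable

lemma trunc:
  assumes "square_integrable f"
  shows "square_integrable (trunc R f)" "integrable lborel (trunc R f)"
proof -
  show "square_integrable (trunc R f)" unfolding trunc_def
    by (rule square_integrable_cmult[OF assms, where C = 1]) (auto simp: indicator_def)
  show "integrable lborel (trunc R f)" unfolding trunc_def
    by (rule square_integrable_mult[OF square_integrable_indicator_ball assms])
qed

lemma trunc_tendsto_sequentially:
  assumes f: "square_integrable f" and X: "filterlim X at_top sequentially"
  shows "(\<lambda>n. l2_of (trunc (X n) f)) \<longlonglongrightarrow> l2_of f"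
proof (rule l2_dominated_convergence[where w = "\<lambda>x. cmod (f x)"])
  show "square_integrable (\<lambda>x. cmod (f x))"
    by (rule square_integrable_bound[OF f, where C = 1])
       (use square_integrable_measurable[OF f] in \<open>auto intro: borel_measurable_norm\<close>)
  show "AE x in lborel. cmod (trunc (X n) f x) \<le> cmod (f x)" for n
    by (auto simp: trunc_def indicator_def)
  show "AE x in lborel. (\<lambda>n. trunc (X n) f x) \<longlonglongrightarrow> f x"
  proof (intro AE_I2 tendsto_eventually)
    fix x :: "real^3"
    have "\<forall>\<^sub>F n in sequentially. X n \<ge> norm x + 1" using X by (simp add: filterlim_at_top)
    then show "\<forall>\<^sub>F n in sequentially. trunc (X n) f x = f x"
      by eventually_elim (simp add: trunc_def)
  qed
qed (intro trunc f)+

lemma trunc_nat_tendsto: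
  assumes "square_integrable f"
  shows "(\<lambda>n. l2_of (trunc (real n) f)) \<longlonglongrightarrow> l2_of f"
  by (rule trunc_tendsto_sequentially[OF assms filterlim_real_sequentially])

lemma fourier_L1_L2:
  assumes f: "integrable lborel f" and f2: "square_integrable f"
  shows "square_integrable (fourier f)"
    "norm (l2_of (fourier f)) = sqrt plconst * norm (l2_of f)"
proof -
  have [measurable]: "f \<in> borel_measurable borel" using f by auto
  show s: "square_integrable (fourier f)"
    unfolding square_integrable_def using plancherel_L1_L2(1)[OF f f2] by simp
  have "(norm (l2_of (fourier f)))\<^sup>2 = plconst * (norm (l2_of f))\<^sup>2"
    unfolding norm_l2_of[OF s] norm_l2_of[OF f2] by (rule plancherel_L1_L2(2)[OF f f2])
  then have "sqrt ((norm (l2_of (fourier f)))\<^sup>2) = sqrt (plconst * (norm (l2_of f))\<^sup>2)" by simp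
  then show "norm (l2_of (fourier f)) = sqrt plconst * norm (l2_of f)" by (simp add: real_sqrt_mult)
qed

text \<open>\<open>lim\<close> alone promises nothing; \<open>FT_tendsto\<close> shows that this
  limit exists and that every other integrable approximation has the same one.\<close>

definition FT :: "l2 \<Rightarrow> l2" where
  "FT u = lim (\<lambda>n. l2_of (fourier (trunc (real n) (l2_fun u))))"

lemma fourier_diff_norm:
  assumes "integrable lborel f" "square_integrable f" "integrable lborel g" "square_integrable g"
  shows "norm (l2_of (fourier f) - l2_of (fourier g)) = sqrt plconst * norm (l2_of f - l2_of g)"
proof -
  have "l2_of (fourier f) - l2_of (fourier g) = l2_of (fourier (\<lambda>x. f x - g x))"
    unfolding l2_of_diff[OF fourier_L1_L2(1)[OF assms(1,2)] fourier_L1_L2(1)[OF assms(3,4)], symmetric]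
    by (rule arg_cong[where f = l2_of]) (simp add: fun_eq_iff fourier_diff[OF assms(1,3)])
  also have "norm \<dots> = sqrt plconst * norm (l2_of (\<lambda>x. f x - g x))"
    by (rule fourier_L1_L2(2)) (intro Bochner_Integration.integrable_diff square_integrable_diff assms)+
  finally show ?thesis by (simp add: l2_of_diff assms)
qed

text \<open>On integrable square integrable functions the transform multiplies distances by sqrt
  \<open>plconst\<close>. It therefore maps Cauchy sequences to Cauchy sequences, and two
  approximations of \<open>u\<close> to sequences with the same limit.\<close>

lemma FT_tendsto:
  assumes f: "\<And>n. integrable lborel (f n)" "\<And>n. square_integrable (f n)" and l: "(\<lambda>n. l2_of (f n)) \<longlonglongrightarrow> u"
  shows "(\<lambda>n. l2_of (fourier (f n))) \<longlonglongrightarrow> FT u"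
proof -
  let ?t = "\<lambda>n. trunc (real n) (l2_fun u)"
  note t = trunc[OF l2_fun_square_integrable[of u]]
  have tl: "(\<lambda>n. l2_of (?t n)) \<longlonglongrightarrow> u" using trunc_nat_tendsto[OF l2_fun_square_integrable[of u]] by simp
  have "Cauchy (\<lambda>n. l2_of (fourier (?t n)))"
  proof (rule metric_CauchyI)
    fix e :: real assume e: "e > 0"
    have sp: "sqrt plconst > 0" using plconst_pos by simp
    obtain M where M: "\<forall>m\<ge>M. \<forall>n\<ge>M. dist (l2_of (?t m)) (l2_of (?t n)) < e / sqrt plconst"
      using metric_CauchyD[OF LIMSEQ_imp_Cauchy[OF tl], of "e / sqrt plconst"] e sp by auto
    show "\<exists>M. \<forall>m\<ge>M. \<forall>n\<ge>M. dist (l2_of (fourier (?t m))) (l2_of (fourier (?t n))) < e"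
      using M sp by (intro exI[of _ M]) (auto simp: dist_norm fourier_diff_norm t field_simps)
  qed
  then have "convergent (\<lambda>n. l2_of (fourier (?t n)))" by (simp add: Cauchy_convergent_iff)
  then have FT: "(\<lambda>n. l2_of (fourier (?t n))) \<longlonglongrightarrow> FT u" unfolding FT_def by (simp add: convergent_LIMSEQ_iff)
  have "(\<lambda>n. norm (l2_of (f n) - l2_of (?t n))) \<longlonglongrightarrow> norm (u - u)" by (intro tendsto_intros l tl)
  then have "(\<lambda>n. sqrt plconst * norm (l2_of (f n) - l2_of (?t n))) \<longlonglongrightarrow> 0"
    using tendsto_mult_right_zero by force
  then have "(\<lambda>n. norm (l2_of (fourier (f n)) - l2_of (fourier (?t n)))) \<longlonglongrightarrow> 0"
    by (simp add: fourier_diff_norm f t)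
  then have "(\<lambda>n. l2_of (fourier (f n)) - l2_of (fourier (?t n))) \<longlonglongrightarrow> 0" by (rule tendsto_norm_zero_cancel)
  from tendsto_add[OF this FT] show ?thesis by simp
qed

lemma FT_l2_of:
  assumes "integrable lborel f" "square_integrable f"
  shows "FT (l2_of f) = l2_of (fourier f)"
  using LIMSEQ_unique[OF FT_tendsto[of "\<lambda>_. f", OF assms tendsto_const] tendsto_const] .

lemma FT_trunc_tendsto: "(\<lambda>n. l2_of (fourier (trunc (real n) (l2_fun u)))) \<longlonglongrightarrow> FT u"
  using trunc_nat_tendsto[OF l2_fun_square_integrable[of u]]
  by (intro FT_tendsto trunc l2_fun_square_integrable) simp

lemma linear_FT: "linear FT"
proof
  note t = trunc[OF l2_fun_square_integrable] and tl = trunc_nat_tendsto[OF l2_fun_square_integrable, unfolded l2_of_l2_fun]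
  show "FT (u + v) = FT u + FT v" for u v
  proof -
    let ?f = "\<lambda>n x. trunc (real n) (l2_fun u) x + trunc (real n) (l2_fun v) x"
    have "(\<lambda>n. l2_of (fourier (?f n))) \<longlonglongrightarrow> FT (u + v)"
    proof (rule FT_tendsto)
      show "(\<lambda>n. l2_of (?f n)) \<longlonglongrightarrow> u + v"
        unfolding l2_of_add[OF t(1) t(1)] by (intro tendsto_add tl)
    qed (intro Bochner_Integration.integrable_add square_integrable_add t)+
    moreover have "l2_of (fourier (?f n)) = l2_of (fourier (trunc (real n) (l2_fun u))) + l2_of (fourier (trunc (real n) (l2_fun v)))" for n
      unfolding l2_of_add[OF fourier_L1_L2(1)[OF t(2,1)] fourier_L1_L2(1)[OF t(2,1)], symmetric]
      using fourier_add[OF t(2) t(2)] by presburger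
    ultimately have "(\<lambda>n. l2_of (fourier (trunc (real n) (l2_fun u))) + l2_of (fourier (trunc (real n) (l2_fun v)))) \<longlonglongrightarrow> FT (u + v)"
      by simp
    from LIMSEQ_unique[OF this tendsto_add[OF FT_trunc_tendsto[of u] FT_trunc_tendsto[of v]]] show ?thesis .
  qed
  show "FT (r *\<^sub>R u) = r *\<^sub>R FT u" for r u
  proof -
    let ?f = "\<lambda>n x. r *\<^sub>R trunc (real n) (l2_fun u) x"
    have "(\<lambda>n. l2_of (fourier (?f n))) \<longlonglongrightarrow> FT (r *\<^sub>R u)"
    proof (rule FT_tendsto)
      show "(\<lambda>n. l2_of (?f n)) \<longlonglongrightarrow> r *\<^sub>R u"
        unfolding l2_of_scaleR[OF t(1)] by (intro tendsto_scaleR tendsto_const tl)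
    qed (intro Bochner_Integration.integrable_scaleR_right square_integrable_scaleR t)+
    moreover have "l2_of (fourier (?f n)) = r *\<^sub>R l2_of (fourier (trunc (real n) (l2_fun u)))" for n
      unfolding l2_of_scaleR[OF fourier_L1_L2(1)[OF t(2,1)], symmetric] scaleR_conv_of_real
      using fourier_cmult by presburger
    ultimately have "(\<lambda>n. r *\<^sub>R l2_of (fourier (trunc (real n) (l2_fun u)))) \<longlonglongrightarrow> FT (r *\<^sub>R u)" by simp
    from LIMSEQ_unique[OF this tendsto_scaleR[OF tendsto_const FT_trunc_tendsto[of u]]] show ?thesis .
  qed
qed

lemma norm_FT: "norm (FT u) = sqrt plconst * norm u"
proof -
  note t = trunc[OF l2_fun_square_integrable] and tl = trunc_nat_tendsto[OF l2_fun_square_integrable, unfolded l2_of_l2_fun]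
  have "(\<lambda>n. norm (l2_of (fourier (trunc (real n) (l2_fun u))))) \<longlonglongrightarrow> norm (FT u)"
    by (intro tendsto_norm FT_trunc_tendsto)
  moreover have "(\<lambda>n. sqrt plconst * norm (l2_of (trunc (real n) (l2_fun u)))) \<longlonglongrightarrow> sqrt plconst * norm u"
    by (intro tendsto_intros tl)
  ultimately show ?thesis by (simp add: fourier_L1_L2(2)[OF t(2,1)] LIMSEQ_unique)
qed


lemma inner_FT: "FT u \<bullet> FT v = plconst * (u \<bullet> v)"
proof -
  have n: "(norm (FT w))\<^sup>2 = plconst * (norm w)\<^sup>2" for w
    using plconst_pos by (simp add: norm_FT power_mult_distrib)
  have "2 * (FT u \<bullet> FT v) = (norm (FT (u + v)))\<^sup>2 - (norm (FT u))\<^sup>2 - (norm (FT v))\<^sup>2"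
    by (simp add: linear_add[OF linear_FT] power2_norm_eq_inner inner_add_left inner_add_right inner_commute)
  also have "\<dots> = plconst * ((norm (u + v))\<^sup>2 - (norm u)\<^sup>2 - (norm v)\<^sup>2)"
    unfolding n by (simp add: algebra_simps)
  also have "(norm (u + v))\<^sup>2 - (norm u)\<^sup>2 - (norm v)\<^sup>2 = 2 * (u \<bullet> v)"
    by (simp add: power2_norm_eq_inner inner_add_left inner_add_right inner_commute)
  finally show ?thesis by simp
qed

section \<open>Multiplication operators, conjugation and the inverse transform\<close>

definition l2_mul :: "(real^3 \<Rightarrow> complex) \<Rightarrow> l2 \<Rightarrow> l2" where
  "l2_mul m u = l2_of (\<lambda>x. m x * l2_fun u x)"

lemma l2_mul_l2_of:
  assumes f: "square_integrable f" and m: "m \<in> borel_measurable borel" "\<And>x. cmod (m x) \<le> C"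
  shows "l2_mul m (l2_of f) = l2_of (\<lambda>x. m x * f x)"
  unfolding l2_mul_def
  by (rule l2_of_cong[OF square_integrable_cmult[OF l2_fun_square_integrable m] square_integrable_cmult[OF f m]])
     (use l2_fun_l2_of[OF f] in eventually_elim, simp)

lemma norm_l2_mul_le:
  assumes m: "m \<in> borel_measurable borel" "\<And>x. cmod (m x) \<le> C"
  shows "norm (l2_mul m u) \<le> C * norm u"
proof -
  have C: "C \<ge> 0" using m(2)[of 0] norm_ge_zero order_trans by blast
  have "(norm (l2_mul m u))\<^sup>2 = (LINT x|lborel. (cmod (m x * l2_fun u x))\<^sup>2)"
    unfolding l2_mul_def by (rule norm_l2_of[OF square_integrable_cmult[OF l2_fun_square_integrable m]])
  also have "\<dots> \<le> (LINT x|lborel. C\<^sup>2 * (cmod (l2_fun u x))\<^sup>2)"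
  proof (rule integral_mono)
    show "integrable lborel (\<lambda>x. (cmod (m x * l2_fun u x))\<^sup>2)"
      using square_integrable_cmult[OF l2_fun_square_integrable m] by (simp add: square_integrable_def)
    show "integrable lborel (\<lambda>x. C\<^sup>2 * (cmod (l2_fun u x))\<^sup>2)"
      using l2_fun_square_integrable[of u] by (simp add: square_integrable_def)
    show "(cmod (m x * l2_fun u x))\<^sup>2 \<le> C\<^sup>2 * (cmod (l2_fun u x))\<^sup>2" for x
      by (simp add: norm_mult power_mult_distrib mult_right_mono power_mono m(2))
  qed
  also have "\<dots> = (C * norm u)\<^sup>2" by (simp add: norm_l2_fun power_mult_distrib)
  finally show ?thesis by (rule power2_le_imp_le) (use C in simp)
qed

lemma linear_l2_mul:
  assumes m: "m \<in> borel_measurable borel" "\<And>x. cmod (m x) \<le> C"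
  shows "linear (l2_mul m)"
proof
  note s = square_integrable_cmult[OF l2_fun_square_integrable m]
  show "l2_mul m (u + v) = l2_mul m u + l2_mul m v" for u v
    unfolding l2_mul_def l2_of_add[OF s s, symmetric]
    by (rule l2_of_cong[OF s square_integrable_add[OF s s]])
       (use l2_fun_plus[of u v] in eventually_elim, simp add: distrib_left)
  show "l2_mul m (r *\<^sub>R u) = r *\<^sub>R l2_mul m u" for r u
    unfolding l2_mul_def l2_of_scaleR[OF s, symmetric]
    by (rule l2_of_cong[OF s square_integrable_scaleR[OF s]])
       (use l2_fun_scaleR[of r u] in eventually_elim, simp)
qed

lemma bounded_linear_l2_mul:
  assumes m: "m \<in> borel_measurable borel" "\<And>x. cmod (m x) \<le> C"
  shows "bounded_linear (l2_mul m)"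
  by (rule bounded_linear_intro[where K = C])
     (use norm_l2_mul_le[OF m] in \<open>simp_all add: linear_add[OF linear_l2_mul[OF m]] linear_cmul[OF linear_l2_mul[OF m]] mult.commute\<close>)

definition l2_cnj :: "l2 \<Rightarrow> l2" where
  "l2_cnj u = l2_of (\<lambda>x. cnj (l2_fun u x))"

lemma l2_cnj_l2_of:
  assumes "square_integrable f"
  shows "l2_cnj (l2_of f) = l2_of (\<lambda>x. cnj (f x))"
  unfolding l2_cnj_def
  by (rule l2_of_cong[OF square_integrable_cnj[OF l2_fun_square_integrable] square_integrable_cnj[OF assms]])
     (use l2_fun_l2_of[OF assms] in eventually_elim, simp)

lemma norm_l2_cnj: "norm (l2_cnj u) = norm u"
proof -
  have "(norm (l2_cnj u))\<^sup>2 = (norm u)\<^sup>2"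
    unfolding l2_cnj_def norm_l2_of[OF square_integrable_cnj[OF l2_fun_square_integrable]] norm_l2_fun[of u] by simp
  then show ?thesis by simp
qed

lemma linear_l2_cnj: "linear l2_cnj"
proof
  note s = square_integrable_cnj[OF l2_fun_square_integrable]
  show "l2_cnj (u + v) = l2_cnj u + l2_cnj v" for u v
    unfolding l2_cnj_def l2_of_add[OF s s, symmetric]
    by (rule l2_of_cong[OF s square_integrable_add[OF s s]])
       (use l2_fun_plus[of u v] in eventually_elim, simp)
  show "l2_cnj (r *\<^sub>R u) = r *\<^sub>R l2_cnj u" for r u
    unfolding l2_cnj_def l2_of_scaleR[OF s, symmetric]
    by (rule l2_of_cong[OF s square_integrable_scaleR[OF s]])
       (use l2_fun_scaleR[of r u] in eventually_elim, simp add: scaleR_conv_of_real)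
qed

lemma bounded_linear_l2_cnj: "bounded_linear l2_cnj"
  by (rule bounded_linear_intro[where K = 1])
     (simp_all add: linear_add[OF linear_l2_cnj] linear_cmul[OF linear_l2_cnj] norm_l2_cnj)

text \<open>The adjoint of \<open>FT\<close>; since both are multiples of isometries, both are invertible.\<close>

definition FTa :: "l2 \<Rightarrow> l2" where "FTa u = l2_cnj (FT (l2_cnj u))"

text \<open>Limit of the multiplication formula over truncations. That formula is bilinear, and the
  two conjugations in \<open>FTa\<close> convert it into a statement about the inner
  product.\<close>

lemma FT_adjoint: "FT u \<bullet> v = u \<bullet> FTa v"
proof (rule LIMSEQ_unique)
  note t = trunc[OF l2_fun_square_integrable] and tl = trunc_nat_tendsto[OF l2_fun_square_integrable, unfolded l2_of_l2_fun]
  let ?f = "\<lambda>n. trunc (real n) (l2_fun u)" and ?g = "\<lambda>n. trunc (real n) (l2_fun v)"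
  show "(\<lambda>n. l2_of (fourier (?f n)) \<bullet> l2_of (?g n)) \<longlonglongrightarrow> FT u \<bullet> v"
    by (intro tendsto_inner FT_trunc_tendsto tl)
  have cg: "integrable lborel (\<lambda>x. cnj (?g n x))" "square_integrable (\<lambda>x. cnj (?g n x))" for n
    using t[of n v] by (auto intro: square_integrable_cnj)
  have "(\<lambda>n. l2_of (fourier (\<lambda>x. cnj (?g n x)))) \<longlonglongrightarrow> FT (l2_cnj v)"
  proof (rule FT_tendsto[OF cg])
    show "(\<lambda>n. l2_of (\<lambda>x. cnj (?g n x))) \<longlonglongrightarrow> l2_cnj v"
      unfolding l2_cnj_l2_of[OF t(1), symmetric] by (intro bounded_linear.tendsto[OF bounded_linear_l2_cnj] tl)
  qed
  then have "(\<lambda>n. l2_of (?f n) \<bullet> l2_cnj (l2_of (fourier (\<lambda>x. cnj (?g n x))))) \<longlonglongrightarrow> u \<bullet> FTa v"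
    unfolding FTa_def by (intro tendsto_inner bounded_linear.tendsto[OF bounded_linear_l2_cnj] tl)
  moreover have "l2_of (?f n) \<bullet> l2_cnj (l2_of (fourier (\<lambda>x. cnj (?g n x)))) = l2_of (fourier (?f n)) \<bullet> l2_of (?g n)" for n
  proof -
    note F = fourier_L1_L2(1)[OF cg, of n] and Ff = fourier_L1_L2(1)[OF t(2,1), of n u]
    have "l2_of (?f n) \<bullet> l2_cnj (l2_of (fourier (\<lambda>x. cnj (?g n x)))) = Re (LINT x|lborel. ?f n x * fourier (\<lambda>x. cnj (?g n x)) x)"
      unfolding l2_cnj_l2_of[OF F] using Re_integral_mult_cnj[OF t(1) square_integrable_cnj[OF F], of n u] by simp
    also have "\<dots> = Re (LINT x|lborel. fourier (?f n) x * cnj (?g n x))"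
      using fourier_multiplication_formula[OF t(2) cg(1), of n u n] by simp
    also have "\<dots> = l2_of (fourier (?f n)) \<bullet> l2_of (?g n)"
      by (rule Re_integral_mult_cnj[OF Ff t(1)])
    finally show ?thesis .
  qed
  ultimately show "(\<lambda>n. l2_of (fourier (?f n)) \<bullet> l2_of (?g n)) \<longlonglongrightarrow> u \<bullet> FTa v" by simp
qed

lemma FTa_FT: "FTa (FT u) = plconst *\<^sub>R u"
proof -
  have "v \<bullet> FTa (FT u) = v \<bullet> plconst *\<^sub>R u" for v
    using FT_adjoint[of v "FT u"] inner_FT[of v u] by simp
  then have "(FTa (FT u) - plconst *\<^sub>R u) \<bullet> (FTa (FT u) - plconst *\<^sub>R u) = 0"
    by (simp add: inner_diff_right)
  then show ?thesis by simp
qed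

lemma inner_FTa: "FTa u \<bullet> FTa v = plconst * (u \<bullet> v)"
proof -
  have lin: "FTa (u + v) = FTa u + FTa v" for u v
    by (simp add: FTa_def linear_add[OF linear_l2_cnj] linear_add[OF linear_FT])
  have n: "(norm (FTa w))\<^sup>2 = plconst * (norm w)\<^sup>2" for w
    using plconst_pos by (simp add: FTa_def norm_l2_cnj norm_FT power_mult_distrib)
  have "2 * (FTa u \<bullet> FTa v) = (norm (FTa (u + v)))\<^sup>2 - (norm (FTa u))\<^sup>2 - (norm (FTa v))\<^sup>2"
    by (simp add: lin power2_norm_eq_inner inner_add_left inner_add_right inner_commute)
  also have "\<dots> = plconst * ((norm (u + v))\<^sup>2 - (norm u)\<^sup>2 - (norm v)\<^sup>2)"
    unfolding n by (simp add: algebra_simps)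
  also have "(norm (u + v))\<^sup>2 - (norm u)\<^sup>2 - (norm v)\<^sup>2 = 2 * (u \<bullet> v)"
    by (simp add: power2_norm_eq_inner inner_add_left inner_add_right inner_commute)
  finally show ?thesis by simp
qed

text \<open>\<open>FTa\<close> is an isometry up to the same constant as \<open>FT\<close>, since
  conjugation preserves norms. Preservation of inner products together with adjointness gives this
  second one-sided inverse, and with it surjectivity of \<open>FT\<close>.\<close>

lemma FT_FTa: "FT (FTa u) = plconst *\<^sub>R u"
proof -
  have "FT (FTa u) \<bullet> v = plconst *\<^sub>R u \<bullet> v" for v
    using FT_adjoint[of "FTa u" v] inner_FTa[of u v] by simp
  then have "(FT (FTa u) - plconst *\<^sub>R u) \<bullet> (FT (FTa u) - plconst *\<^sub>R u) = 0"
    by (simp add: inner_diff_left)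
  then show ?thesis by simp
qed

lemma FT_inj: "FT u = FT v \<longleftrightarrow> u = v"
  using FTa_FT[of u] FTa_FT[of v] plconst_pos by (metis real_vector.scale_cancel_left order_less_irrefl)

lemma FT_surj: "\<exists>u. FT u = v"
proof
  show "FT ((1 / plconst) *\<^sub>R FTa v) = v"
    using plconst_pos by (simp add: linear_cmul[OF linear_FT] FT_FTa)
qed

lemma FT_l2_mul_i: "FT (l2_mul (\<lambda>_. \<i>) u) = l2_mul (\<lambda>_. \<i>) (FT u)"
proof -
  note t = trunc[OF l2_fun_square_integrable] and tl = trunc_nat_tendsto[OF l2_fun_square_integrable, unfolded l2_of_l2_fun]
  let ?f = "\<lambda>n x. \<i> * trunc (real n) (l2_fun u) x"
  have bl: "bounded_linear (l2_mul (\<lambda>_. \<i>))" by (rule bounded_linear_l2_mul[where C = 1]) auto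
  have m: "l2_mul (\<lambda>_. \<i>) (l2_of f) = l2_of (\<lambda>x. \<i> * f x)" if "square_integrable f" for f
    by (rule l2_mul_l2_of[OF that, where C = 1]) auto
  have "(\<lambda>n. l2_of (fourier (?f n))) \<longlonglongrightarrow> FT (l2_mul (\<lambda>_. \<i>) u)"
  proof (rule FT_tendsto)
    show "(\<lambda>n. l2_of (?f n)) \<longlonglongrightarrow> l2_mul (\<lambda>_. \<i>) u"
      unfolding m[OF t(1), symmetric] by (intro bounded_linear.tendsto[OF bl] tl)
  qed (use t in \<open>auto intro: square_integrable_i\<close>)
  moreover have "fourier (?f n) = (\<lambda>\<xi>. \<i> * fourier (trunc (real n) (l2_fun u)) \<xi>)" for n
    by (intro ext fourier_cmult)
  ultimately have "(\<lambda>n. l2_mul (\<lambda>_. \<i>) (l2_of (fourier (trunc (real n) (l2_fun u))))) \<longlonglongrightarrow> FT (l2_mul (\<lambda>_. \<i>) u)"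
    by (simp add: m fourier_L1_L2(1)[OF t(2,1)])
  moreover have "(\<lambda>n. l2_mul (\<lambda>_. \<i>) (l2_of (fourier (trunc (real n) (l2_fun u))))) \<longlonglongrightarrow> l2_mul (\<lambda>_. \<i>) (FT u)"
    by (intro bounded_linear.tendsto[OF bl] FT_trunc_tendsto)
  ultimately show ?thesis by (rule LIMSEQ_unique)
qed

text \<open>An arbitrary representative of the transform, so its identities hold almost everywhere
  only; in return it can be evaluated and multiplied pointwise.\<close>

definition ft :: "(real^3 \<Rightarrow> complex) \<Rightarrow> real^3 \<Rightarrow> complex" where
  "ft f = l2_fun (FT (l2_of f))"

lemma ft_square_integrable: "square_integrable (ft f)"
  unfolding ft_def by (rule l2_fun_square_integrable)

lemma ft_measurable [measurable]: "ft f \<in> borel_measurable borel"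
  by (rule square_integrable_measurable[OF ft_square_integrable])

lemma l2_of_ft: "l2_of (ft f) = FT (l2_of f)" by (simp add: ft_def)

lemma parseval:
  assumes f: "square_integrable f" and g: "square_integrable g"
  shows "(LINT x|lborel. ft f x * cnj (ft g x)) = plconst * (LINT x|lborel. f x * cnj (g x))"
proof (rule complex_eqI)
  have m: "l2_mul (\<lambda>_. \<i>) (l2_of h) = l2_of (\<lambda>x. \<i> * h x)" if "square_integrable h" for h
    by (rule l2_mul_l2_of[OF that, where C = 1]) auto
  show "Re (LINT x|lborel. ft f x * cnj (ft g x)) = Re (plconst * (LINT x|lborel. f x * cnj (g x)))"
    by (simp add: Re_integral_mult_cnj[OF ft_square_integrable ft_square_integrable] Re_integral_mult_cnj[OF f g] l2_of_ft inner_FT)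
  show "Im (LINT x|lborel. ft f x * cnj (ft g x)) = Im (plconst * (LINT x|lborel. f x * cnj (g x)))"
    by (simp add: Im_integral_mult_cnj[OF ft_square_integrable ft_square_integrable] Im_integral_mult_cnj[OF f g]
        m[OF ft_square_integrable, symmetric] m[OF g, symmetric] l2_of_ft FT_l2_mul_i[symmetric] inner_FT)
qed

lemma ft_eq_fourier:
  assumes "integrable lborel f" "square_integrable f"
  shows "AE x in lborel. ft f x = fourier f x"
  unfolding ft_def FT_l2_of[OF assms] by (rule l2_fun_l2_of[OF fourier_L1_L2(1)[OF assms]])

text \<open>The link to the notion used in the statement. There the radii run through the reals; as
  \<open>FT_tendsto\<close> covers truncation along any sequence of radii tending to infinity, the
  two limits agree.\<close>

lemma L2_fourier_iff:
  "L2_fourier f F \<longleftrightarrow> square_integrable f \<and> square_integrable F \<and> FT (l2_of f) = l2_of F"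
proof (cases "square_integrable f \<and> square_integrable F")
  case True
  then have f: "square_integrable f" and F: "square_integrable F" by auto
  have t: "trunc R f = (\<lambda>x. indicator (ball 0 R) x * f x)" for R by (simp add: trunc_def)
  have nn: "(\<integral>\<^sup>+\<xi>. ennreal ((cmod (fourier (\<lambda>x. indicator (ball 0 R) x * f x) \<xi> - F \<xi>))\<^sup>2) \<partial>lborel)
     = ennreal ((norm (l2_of (fourier (trunc R f)) - l2_of F))\<^sup>2)" for R
    using nn_norm_l2_of[OF square_integrable_diff[OF fourier_L1_L2(1)[OF trunc(2,1)[OF f]] F]]
      l2_of_diff[OF fourier_L1_L2(1)[OF trunc(2,1)[OF f]] F] by (simp add: t)
  have lim: "((\<lambda>R. l2_of (fourier (trunc R f))) \<longlongrightarrow> FT (l2_of f)) at_top"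
    by (rule tendsto_at_topI_sequentially) (intro FT_tendsto trunc trunc_tendsto_sequentially f)
  have "((\<lambda>R. ennreal ((norm (l2_of (fourier (trunc R f)) - l2_of F))\<^sup>2)) \<longlongrightarrow> 0) at_top
     \<longleftrightarrow> ((\<lambda>R. (norm (l2_of (fourier (trunc R f)) - l2_of F))\<^sup>2) \<longlongrightarrow> 0) at_top"
    by (subst ennreal_0[symmetric], subst tendsto_ennreal_iff) simp_all
  also have "\<dots> \<longleftrightarrow> ((\<lambda>R. l2_of (fourier (trunc R f))) \<longlongrightarrow> l2_of F) at_top"
  proof
    assume "((\<lambda>R. (norm (l2_of (fourier (trunc R f)) - l2_of F))\<^sup>2) \<longlongrightarrow> 0) at_top"
    from tendsto_real_sqrt[OF this] show "((\<lambda>R. l2_of (fourier (trunc R f))) \<longlongrightarrow> l2_of F) at_top"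
      by (simp add: tendsto_norm_zero_iff LIM_zero_iff)
  next
    assume "((\<lambda>R. l2_of (fourier (trunc R f))) \<longlongrightarrow> l2_of F) at_top"
    then have "((\<lambda>R. (norm (l2_of (fourier (trunc R f)) - l2_of F))\<^sup>2) \<longlongrightarrow> (norm (l2_of F - l2_of F))\<^sup>2) at_top"
      by (intro tendsto_intros)
    then show "((\<lambda>R. (norm (l2_of (fourier (trunc R f)) - l2_of F))\<^sup>2) \<longlongrightarrow> 0) at_top" by simp
  qed
  also have "\<dots> \<longleftrightarrow> FT (l2_of f) = l2_of F"
    using lim tendsto_unique[OF _ lim, of "l2_of F"] by auto
  finally show ?thesis unfolding L2_fourier_def nn using f F by simp
qed (auto simp: L2_fourier_def)

section \<open>Reality of the dipolar convolution\<close>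

definition l2_refl :: "l2 \<Rightarrow> l2" where "l2_refl = l2_comp (\<chi> i. - 1) 0"

lemma minus_vec: "(\<chi> i. - 1) * x + 0 = - (x :: real^3)"
  by (simp add: vec_eq_iff)

lemma square_integrable_refl: "square_integrable f \<Longrightarrow> square_integrable (\<lambda>x. f (- x))"
  for f :: "real^3 \<Rightarrow> 'b::euclidean_space"
  using square_integrable_coordinatewise[of "\<chi> i. - 1" f 0] by (simp only: minus_vec) simp

lemma l2_refl_l2_of: "square_integrable f \<Longrightarrow> l2_refl (l2_of f) = l2_of (\<lambda>x. f (- x))"
  unfolding l2_refl_def using l2_comp_l2_of[of "\<chi> i. - 1" f 0] by (simp only: minus_vec) simp

lemma bounded_linear_l2_refl: "bounded_linear l2_refl"
proof (rule bounded_linear_intro[where K = 1])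
  have l: "linear l2_refl" unfolding l2_refl_def by (rule linear_l2_comp) simp
  then show "l2_refl (u + v) = l2_refl u + l2_refl v" "l2_refl (r *\<^sub>R u) = r *\<^sub>R l2_refl u" for u v r
    by (simp_all add: linear_add linear_cmul)
  have "(norm u)\<^sup>2 = (norm (l2_refl u))\<^sup>2" for u
    unfolding l2_refl_def using norm_l2_comp[of "\<chi> i. - 1" u 0] by (simp add: jac_def)
  then show "norm (l2_refl u) \<le> norm u * 1" for u by simp
qed

lemma FT_cnj: "FT (l2_cnj u) = l2_cnj (l2_refl (FT u))"
proof (rule LIMSEQ_unique)
  note t = trunc[OF l2_fun_square_integrable] and tl = trunc_nat_tendsto[OF l2_fun_square_integrable, unfolded l2_of_l2_fun]
  let ?f = "\<lambda>n. trunc (real n) (l2_fun u)"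
  show "(\<lambda>n. l2_of (fourier (\<lambda>x. cnj (?f n x)))) \<longlonglongrightarrow> FT (l2_cnj u)"
  proof (rule FT_tendsto)
    show "(\<lambda>n. l2_of (\<lambda>x. cnj (?f n x))) \<longlonglongrightarrow> l2_cnj u"
      unfolding l2_cnj_l2_of[OF t(1), symmetric] by (intro bounded_linear.tendsto[OF bounded_linear_l2_cnj] tl)
  qed (use t in \<open>auto intro: square_integrable_cnj\<close>)
  have "l2_of (fourier (\<lambda>x. cnj (?f n x))) = l2_cnj (l2_refl (l2_of (fourier (?f n))))" for n
    unfolding l2_refl_l2_of[OF fourier_L1_L2(1)[OF t(2,1)]] l2_cnj_l2_of[OF square_integrable_refl[OF fourier_L1_L2(1)[OF t(2,1)]]]
    using fourier_cnj by presburger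
  then show "(\<lambda>n. l2_of (fourier (\<lambda>x. cnj (?f n x)))) \<longlonglongrightarrow> l2_cnj (l2_refl (FT u))"
    using bounded_linear.tendsto[OF bounded_linear_l2_cnj bounded_linear.tendsto[OF bounded_linear_l2_refl FT_trunc_tendsto[of u]]]
    by simp
qed

lemma ft_real_symmetric:
  assumes f: "square_integrable (f :: real^3 \<Rightarrow> real)"
  shows "AE \<xi> in lborel. ft (\<lambda>x. of_real (f x)) (- \<xi>) = cnj (ft (\<lambda>x. of_real (f x)) \<xi>)"
proof -
  let ?F = "ft (\<lambda>x. of_real (f x))"
  note s = square_integrable_of_real[OF f]
  have "l2_cnj (l2_refl (FT (l2_of (\<lambda>x. of_real (f x))))) = FT (l2_of (\<lambda>x. of_real (f x)))"
    unfolding FT_cnj[symmetric] l2_cnj_l2_of[OF s] by simp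
  then have "l2_of (\<lambda>\<xi>. cnj (?F (- \<xi>))) = l2_of ?F"
    by (simp add: l2_of_ft[symmetric] l2_refl_l2_of[OF ft_square_integrable]
        l2_cnj_l2_of[OF square_integrable_refl[OF ft_square_integrable]])
  then have "AE \<xi> in lborel. cnj (?F (- \<xi>)) = ?F \<xi>"
    by (subst (asm) l2_of_eq_iff) (intro square_integrable_cnj square_integrable_refl ft_square_integrable)+
  then show ?thesis by eventually_elim (metis complex_cnj_cnj)
qed

lemma dipolar_symbol_measurable [measurable]: "dipolar_symbol \<in> borel_measurable borel"
proof -
  have [measurable]: "(\<lambda>\<xi>::real^3. \<xi> $ i) \<in> borel_measurable borel" for i
    by (intro borel_measurable_continuous_onI continuous_intros)
  show ?thesis unfolding dipolar_symbol_def[abs_def] by measurable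
qed

lemma norm_vec3: "(norm (\<xi> :: real^3))\<^sup>2 = (\<xi> $ 1)\<^sup>2 + (\<xi> $ 2)\<^sup>2 + (\<xi> $ 3)\<^sup>2"
  unfolding power2_norm_eq_inner inner_vec_def sum_3 by (simp add: power2_eq_square)

lemma dipolar_symbol_eq:
  assumes "\<xi> \<noteq> 0"
  shows "dipolar_symbol \<xi> = 4 / 3 * pi * (3 * (\<xi> $ 3)\<^sup>2 / (norm \<xi>)\<^sup>2 - 1)"
proof -
  have "2 * (\<xi> $ 3)\<^sup>2 - (\<xi> $ 1)\<^sup>2 - (\<xi> $ 2)\<^sup>2 = 3 * (\<xi> $ 3)\<^sup>2 - (norm \<xi>)\<^sup>2" by (simp add: norm_vec3)
  then show ?thesis unfolding dipolar_symbol_def by (simp only:) (use assms in \<open>simp add: diff_divide_distrib\<close>)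
qed

lemma abs_dipolar_symbol_le: "\<bar>dipolar_symbol \<xi>\<bar> \<le> 4 * pi"
proof (cases "\<xi> = 0")
  case False
  then have n: "(norm \<xi>)\<^sup>2 > 0" by simp
  have "0 \<le> (\<xi> $ 3)\<^sup>2 / (norm \<xi>)\<^sup>2" "(\<xi> $ 3)\<^sup>2 / (norm \<xi>)\<^sup>2 \<le> 1"
    using n by (auto simp: norm_vec3)
  \<comment> \<open>A crude bound, since the expression ranges over [-1, 2] only; it explains the
    constant \<open>4 * pi\<close> instead of \<open>8 / 3 * pi\<close>.\<close>
  then have "\<bar>3 * (\<xi> $ 3)\<^sup>2 / (norm \<xi>)\<^sup>2 - 1\<bar> \<le> 3" by linarith
  from mult_left_mono[OF this, of "4 / 3 * pi"] show ?thesis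
    unfolding dipolar_symbol_eq[OF False] abs_mult by simp
qed (simp add: dipolar_symbol_def)

lemma dipolar_symbol_minus: "dipolar_symbol (- \<xi>) = dipolar_symbol \<xi>"
  by (simp add: dipolar_symbol_def)

text \<open>The transform of a real function is Hermitian, and a real even symbol preserves this
  symmetry. The function with the multiplied transform thus has the same transform as its conjugate,
  hence is real almost everywhere.\<close>

lemma real_multiplier_exists:
  fixes m :: "real^3 \<Rightarrow> real"
  assumes f: "square_integrable (f :: real^3 \<Rightarrow> real)"
    and m: "m \<in> borel_measurable borel" "\<And>\<xi>. \<bar>m \<xi>\<bar> \<le> C" "\<And>\<xi>. m (- \<xi>) = m \<xi>"
  shows "\<exists>g :: real^3 \<Rightarrow> real. square_integrable g \<and>
    FT (l2_of (\<lambda>x. of_real (g x))) = l2_of (\<lambda>\<xi>. of_real (m \<xi>) * ft (\<lambda>x. of_real (f x)) \<xi>)"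
proof -
  let ?F = "ft (\<lambda>x. of_real (f x))"
  have [measurable]: "m \<in> borel_measurable borel" by (rule m)
  have s: "square_integrable (\<lambda>\<xi>. of_real (m \<xi>) * ?F \<xi>)"
    by (rule square_integrable_cmult[OF ft_square_integrable, where C = C]) (use m in auto)
  obtain w where w: "FT w = l2_of (\<lambda>\<xi>. of_real (m \<xi>) * ?F \<xi>)" using FT_surj by metis
  have "FT (l2_cnj w) = l2_of (\<lambda>\<xi>. cnj (of_real (m (- \<xi>)) * ?F (- \<xi>)))"
    unfolding FT_cnj w l2_refl_l2_of[OF s] by (rule l2_cnj_l2_of[OF square_integrable_refl[OF s]])
  also have "\<dots> = FT w" unfolding w
  proof (rule l2_of_cong[OF square_integrable_cnj[OF square_integrable_refl[OF s]] s])
    show "AE \<xi> in lborel. cnj (of_real (m (- \<xi>)) * ?F (- \<xi>)) = of_real (m \<xi>) * ?F \<xi>"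
      using ft_real_symmetric[OF f] by eventually_elim (simp add: m)
  qed
  finally have "l2_cnj w = w" by (simp add: FT_inj)
  then have "AE x in lborel. cnj (l2_fun w x) = l2_fun w x"
    using l2_of_eq_iff[OF square_integrable_cnj[OF l2_fun_square_integrable[of w]] l2_fun_square_integrable[of w]]
    by (simp add: l2_cnj_def)
  then have r: "AE x in lborel. of_real (Re (l2_fun w x)) = l2_fun w x"
    by eventually_elim (simp add: complex_eq_iff)
  have g: "square_integrable (\<lambda>x. Re (l2_fun w x))"
    by (rule square_integrable_bound[OF l2_fun_square_integrable[of w], where C = 1]) (auto intro: abs_Re_le_cmod)
  have "l2_of (\<lambda>x. of_real (Re (l2_fun w x))) = w"
    using l2_of_cong[OF square_integrable_of_real[OF g] l2_fun_square_integrable r] by simp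
  with g w show ?thesis by (intro exI[of _ "\<lambda>x. Re (l2_fun w x)"]) simp
qed

text \<open>Existence of a real solution makes the choice behind \<open>dipolar_conv\<close>
  meaningful. The witness \<open>F\<close> in its specification is unknown, but as a transform of
  \<open>f\<close> it agrees with \<open>ft\<close> almost everywhere.\<close>

lemma dipolar_conv:
  assumes f: "square_integrable f"
  shows "square_integrable (dipolar_conv f)"
    "AE \<xi> in lborel. ft (\<lambda>x. of_real (dipolar_conv f x)) \<xi> = of_real (dipolar_symbol \<xi>) * ft (\<lambda>x. of_real (f x)) \<xi>"
proof -
  let ?F = "ft (\<lambda>x. of_real (f x))"
  have s: "square_integrable (\<lambda>\<xi>. of_real (dipolar_symbol \<xi>) * ?F \<xi>)"
    by (rule square_integrable_cmult[OF ft_square_integrable, where C = "4 * pi"]) (auto simp: abs_dipolar_symbol_le)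
  obtain g :: "real^3 \<Rightarrow> real" where g: "square_integrable g"
    "FT (l2_of (\<lambda>x. of_real (g x))) = l2_of (\<lambda>\<xi>. of_real (dipolar_symbol \<xi>) * ?F \<xi>)"
    using real_multiplier_exists[OF f dipolar_symbol_measurable abs_dipolar_symbol_le dipolar_symbol_minus] by blast
  have "L2_fourier (\<lambda>x. of_real (f x)) ?F"
    unfolding L2_fourier_iff using square_integrable_of_real[OF f] by (simp add: ft_square_integrable l2_of_ft)
  moreover have "L2_fourier (\<lambda>x. of_real (g x)) (\<lambda>\<xi>. of_real (dipolar_symbol \<xi>) * ?F \<xi>)"
    unfolding L2_fourier_iff using square_integrable_of_real[OF g(1)] s g(2) by simp
  ultimately have "fourier_multiplier dipolar_symbol (\<lambda>x. of_real (f x)) (\<lambda>x. of_real (g x))"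
    unfolding fourier_multiplier_def by blast
  then have "fourier_multiplier dipolar_symbol (\<lambda>x. of_real (f x)) (\<lambda>x. of_real (dipolar_conv f x))"
    unfolding dipolar_conv_def
    by (rule someI[where P = "\<lambda>g. fourier_multiplier dipolar_symbol (\<lambda>x. of_real (f x)) (\<lambda>x. of_real (g x))"])
  then obtain F where F: "L2_fourier (\<lambda>x. of_real (f x)) F"
    "L2_fourier (\<lambda>x. of_real (dipolar_conv f x)) (\<lambda>\<xi>. of_real (dipolar_symbol \<xi>) * F \<xi>)"
    unfolding fourier_multiplier_def by blast
  have d: "square_integrable (\<lambda>x. complex_of_real (dipolar_conv f x))" using F(2) by (simp add: L2_fourier_iff)
  then show "square_integrable (dipolar_conv f)"
  proof -
    note [measurable] = square_integrable_measurable[OF d]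
    have "(\<lambda>x. Re (complex_of_real (dipolar_conv f x))) \<in> borel_measurable borel" by measurable
    then show ?thesis
      using square_integrable_bound[OF d, of "\<lambda>x. Re (complex_of_real (dipolar_conv f x))" 1] by simp
  qed
  have "l2_of ?F = l2_of F" using F(1) by (simp add: L2_fourier_iff l2_of_ft)
  then have FF: "AE \<xi> in lborel. ?F \<xi> = F \<xi>"
    using F(1) l2_of_eq_iff[OF ft_square_integrable] by (auto simp: L2_fourier_iff)
  have "AE \<xi> in lborel. ft (\<lambda>x. of_real (dipolar_conv f x)) \<xi> = of_real (dipolar_symbol \<xi>) * F \<xi>"
    using F(2) l2_of_eq_iff[OF ft_square_integrable] l2_of_ft by (auto simp: L2_fourier_iff)
  with FF show "AE \<xi> in lborel. ft (\<lambda>x. of_real (dipolar_conv f x)) \<xi> = of_real (dipolar_symbol \<xi>) * ?F \<xi>"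
    by eventually_elim simp
qed

section \<open>Weak gradients and the Fourier transform\<close>

text \<open>The factor \<open>s\<close> strengthens the induction: each derivative of a reflected
  function produces another sign.\<close>

lemma C_k_reflect:
  "C_k n f \<Longrightarrow> C_k n (\<lambda>x. s * f (y - x))"
proof (induction n arbitrary: f s)
  case 0
  then have "continuous_on UNIV f" by simp
  then show ?case
    by (auto intro!: continuous_intros continuous_on_compose2[of UNIV f])
next
  case (Suc n)
  then have d: "(f has_derivative frechet_derivative f (at x)) (at x)" for x
    by (simp add: frechet_derivative_works[symmetric])
  have D: "((\<lambda>x. s * f (y - x)) has_derivative (\<lambda>h. s * frechet_derivative f (at (y - x)) (- h))) (at x)" for x
  proof -
    have "((\<lambda>x. y - x) has_derivative (\<lambda>h. - h)) (at x)" by (auto intro!: derivative_eq_intros)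
    from has_derivative_compose[OF this d[of "y - x"]]
    show ?thesis by (intro has_derivative_mult_right) 
  qed
  have "partial_deriv i (\<lambda>x. s * f (y - x)) = (\<lambda>x. (- s) * partial_deriv i f (y - x))" for i
  proof
    fix x
    have lin: "linear (frechet_derivative f (at (y - x)))" using d has_derivative_linear by blast
    show "partial_deriv i (\<lambda>x. s * f (y - x)) x = (- s) * partial_deriv i f (y - x)"
      unfolding partial_deriv_def frechet_derivative_at[OF D, symmetric] by (simp add: linear_neg[OF lin])
  qed
  moreover have "C_k n (\<lambda>x. (- s) * partial_deriv i f (y - x))" for i
    by (rule Suc.IH) (use Suc.prems in simp)
  moreover have "(\<lambda>x. s * f (y - x)) differentiable at x" for x using D unfolding differentiable_def by blast
  ultimately show ?case by (simp only: C_k.simps) blast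
qed

lemma partial_deriv_reflect:
  assumes "test_function \<phi>"
  shows "partial_deriv i (\<lambda>x. \<phi> (y - x)) x = - partial_deriv i \<phi> (y - x)"
proof -
  have "C_k 1 \<phi>" using assms unfolding test_function_def by blast
  then have d: "(\<phi> has_derivative frechet_derivative \<phi> (at x)) (at x)" for x
    by (simp add: frechet_derivative_works[symmetric])
  have "((\<lambda>x. y - x) has_derivative (\<lambda>h. - h)) (at x)" by (auto intro!: derivative_eq_intros)
  from has_derivative_compose[OF this d[of "y - x"]]
  have D: "((\<lambda>x. \<phi> (y - x)) has_derivative (\<lambda>h. frechet_derivative \<phi> (at (y - x)) (- h))) (at x)" .
  have lin: "linear (frechet_derivative \<phi> (at (y - x)))" using d has_derivative_linear by blast
  show ?thesis
    unfolding partial_deriv_def frechet_derivative_at[OF D, symmetric] by (simp add: linear_neg[OF lin])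
qed

lemma test_function_reflect:
  assumes t: "test_function \<phi>"
  shows "test_function (\<lambda>x. \<phi> (y - x))"
  unfolding test_function_def
proof
  show "\<forall>n. C_k n (\<lambda>x. \<phi> (y - x))"
    using t C_k_reflect[of _ \<phi> 1 y] by (simp add: test_function_def)
  obtain R where R: "R > 0" "\<And>x. \<phi> x \<noteq> 0 \<Longrightarrow> norm x \<le> R" using test_function_support[OF t] by blast
  have "{x. \<phi> (y - x) \<noteq> 0} \<subseteq> cball y R" using R(2) by (auto simp: dist_norm)
  then have "bounded {x. \<phi> (y - x) \<noteq> 0}" using bounded_cball bounded_subset by blast
  then show "compact (closure {x. \<phi> (y - x) \<noteq> 0})" by (simp add: compact_eq_bounded_closed bounded_closure)
qed

lemma test_function_L1:
  assumes t: "test_function \<phi>"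
  shows "integrable lborel \<phi>" "integrable lborel (partial_deriv i \<phi>)"
proof -
  obtain R where R: "R > 0" "\<And>x. \<phi> x \<noteq> 0 \<Longrightarrow> norm x \<le> R" using test_function_support[OF t] by blast
  have I: "integrable lborel f" if f: "square_integrable f" and z: "\<And>x. f x \<noteq> 0 \<Longrightarrow> norm x \<le> R" for f :: "real^3 \<Rightarrow> real"
  proof -
    have "integrable lborel (\<lambda>x. (1 * indicator (cball 0 R) x) \<bullet> f x)"
      by (rule square_integrable_inner[OF square_integrable_indicator_cball f])
    also have "(\<lambda>x. (1 * indicator (cball 0 R) x) \<bullet> f x) = f" using z by (auto simp: fun_eq_iff indicator_def)
    finally show ?thesis .
  qed
  show "integrable lborel \<phi>" by (rule I[OF test_function_square_integrable[OF t] R(2)])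
  show "integrable lborel (partial_deriv i \<phi>)"
  proof (rule I[OF test_function_partial_square_integrable[OF t]])
    fix x assume p: "partial_deriv i \<phi> x \<noteq> 0"
    show "norm x \<le> R"
    proof (rule ccontr)
      assume n: "\<not> norm x \<le> R"
      have "(\<phi> has_derivative (\<lambda>h. 0)) (at x)"
      proof (rule has_derivative_transform_within_open[of "\<lambda>x. 0"])
        show "open (- cball 0 R)" "x \<in> - cball 0 R" using n by auto
        show "0 = \<phi> z" if "z \<in> - cball 0 R" for z using that R(2)[of z] by auto
      qed auto
      then have "frechet_derivative \<phi> (at x) = (\<lambda>h. 0)" by (metis frechet_derivative_at)
      then show False using p by (simp add: partial_deriv_def)
    qed
  qed
qed

text \<open>The derivative is the limit of difference quotients, whose transforms carry the factor
  (e^(i h t) - 1) / h with t the i-th frequency component; dominated convergence passes to the limit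
  on the left, and the derivative of \<open>cis\<close> at 0 does so on the right.\<close>

lemma fourier_partial_deriv:
  assumes t: "test_function \<phi>"
  shows "fourier (\<lambda>x. of_real (partial_deriv i \<phi> x)) \<xi> = \<i> * of_real (\<xi> $ i) * fourier (\<lambda>x. of_real (\<phi> x)) \<xi>"
proof -
  let ?e = "axis i 1 :: real^3"
  obtain R where R: "R > 0" "\<And>x. \<phi> x \<noteq> 0 \<Longrightarrow> norm x \<le> R" using test_function_support[OF t] by blast
  note si = test_function_square_integrable[OF t] test_function_partial_square_integrable[OF t, of i]
  note [measurable] = si[THEN square_integrable_measurable]
  have C1: "C_k 1 \<phi>" using t unfolding test_function_def by blast
  then have d: "(\<phi> has_derivative frechet_derivative \<phi> (at x)) (at x)" for x
    by (simp add: frechet_derivative_works[symmetric])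
  have D: "((\<lambda>t. \<phi> (x + t *\<^sub>R ?e)) has_real_derivative partial_deriv i \<phi> (x + t *\<^sub>R ?e)) (at t)" for x t
  proof -
    have "((\<lambda>t. x + t *\<^sub>R ?e) has_derivative (\<lambda>h. h *\<^sub>R ?e)) (at t)" by (auto intro!: derivative_eq_intros)
    from has_derivative_compose[OF this d[of "x + t *\<^sub>R ?e"]]
    have "((\<lambda>t. \<phi> (x + t *\<^sub>R ?e)) has_derivative (\<lambda>h. frechet_derivative \<phi> (at (x + t *\<^sub>R ?e)) (h *\<^sub>R ?e))) (at t)" .
    moreover have "frechet_derivative \<phi> (at (x + t *\<^sub>R ?e)) (h *\<^sub>R ?e) = partial_deriv i \<phi> (x + t *\<^sub>R ?e) * h" for h
      unfolding partial_deriv_def using linear_cmul[OF has_derivative_linear[OF d[of "x + t *\<^sub>R ?e"]], of h ?e] by simp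
    ultimately show ?thesis by (simp add: has_field_derivative_def)
  qed
  have cont: "continuous_on UNIV (partial_deriv i \<phi>)" using C1 by simp
  have "partial_deriv i \<phi> x = 0" if "\<not> norm x \<le> R" for x
  proof -
    have "(\<phi> has_derivative (\<lambda>h. 0)) (at x)"
    proof (rule has_derivative_transform_within_open[of "\<lambda>x. 0"])
      show "open (- cball 0 R)" "x \<in> - cball 0 R" using that by auto
      show "0 = \<phi> z" if "z \<in> - cball 0 R" for z using that R(2)[of z] by auto
    qed auto
    then have "frechet_derivative \<phi> (at x) = (\<lambda>h. 0)" by (metis frechet_derivative_at)
    then show ?thesis by (simp add: partial_deriv_def)
  qed
  then obtain S where S: "S \<ge> 0" "\<And>x. \<bar>partial_deriv i \<phi> x\<bar> \<le> S"
    using continuous_compact_support_bounded[OF cont, of R] by blast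
  define h where "h n = 1 / real (Suc n)" for n
  have h: "h n > 0" "h n \<le> 1" "h \<longlonglongrightarrow> 0" for n
    unfolding h_def using LIMSEQ_Suc[OF lim_1_over_n] by auto
  have h': "filterlim h (at 0) sequentially"
    unfolding filterlim_at using h(1,3) by (auto intro!: always_eventually simp: less_imp_neq[symmetric])
  define q where "q n x = (\<phi> (x + h n *\<^sub>R ?e) - \<phi> x) / h n" for n x
  have qi: "integrable lborel (\<lambda>x. complex_of_real (\<phi> (x + h n *\<^sub>R ?e)))" "integrable lborel (\<lambda>x. complex_of_real (\<phi> x))" for n
    using lborel_integrable_shift(1)[OF test_function_L1(1)[OF t], of "h n *\<^sub>R ?e"] test_function_L1(1)[OF t]
    by (simp_all add: complex_of_real_integrable_eq)
  have qf: "fourier (\<lambda>x. of_real (q n x)) \<xi> = (cis (h n * \<xi> $ i) - 1) / h n * fourier (\<lambda>x. of_real (\<phi> x)) \<xi>" for n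
  proof -
    have e: "?e \<bullet> \<xi> = \<xi> $ i" by (rule axis_inner)
    have "fourier (\<lambda>x. of_real (\<phi> (x + h n *\<^sub>R ?e))) \<xi>
       = (LINT x|lborel. (\<lambda>x. cis (h n * \<xi> $ i) * (of_real (\<phi> x) * cis (- (x \<bullet> \<xi>)))) (x + h n *\<^sub>R ?e))"
      unfolding fourier_def
    proof (rule Bochner_Integration.integral_cong[OF refl])
      fix x :: "real^3"
      have "cis (- (x \<bullet> \<xi>)) = cis (h n * \<xi> $ i) * cis (- ((x + h n *\<^sub>R ?e) \<bullet> \<xi>))"
        unfolding cis_mult by (rule arg_cong[where f = cis]) (simp add: inner_add_left e)
      then show "of_real (\<phi> (x + h n *\<^sub>R ?e)) * cis (- (x \<bullet> \<xi>)) =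
         cis (h n * \<xi> $ i) * (of_real (\<phi> (x + h n *\<^sub>R ?e)) * cis (- ((x + h n *\<^sub>R ?e) \<bullet> \<xi>)))"
        by (simp add: ac_simps)
    qed
    also have "\<dots> = cis (h n * \<xi> $ i) * fourier (\<lambda>x. of_real (\<phi> x)) \<xi>"
      unfolding fourier_def by (subst lborel_integral_shift(1)) auto
    finally have "fourier (\<lambda>x. of_real (\<phi> (x + h n *\<^sub>R ?e)) - of_real (\<phi> x)) \<xi> = (cis (h n * \<xi> $ i) - 1) * fourier (\<lambda>x. of_real (\<phi> x)) \<xi>"
      using fourier_diff[OF qi, of n \<xi>] by (simp add: left_diff_distrib)
    moreover have "fourier (\<lambda>x. of_real (q n x)) \<xi> = of_real (1 / h n) * fourier (\<lambda>x. of_real (\<phi> (x + h n *\<^sub>R ?e)) - of_real (\<phi> x)) \<xi>"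
      unfolding fourier_cmult[symmetric] by (simp add: q_def[abs_def])
    ultimately show ?thesis by simp
  qed
  have lim1: "(\<lambda>n. fourier (\<lambda>x. of_real (q n x)) \<xi>) \<longlonglongrightarrow> fourier (\<lambda>x. of_real (partial_deriv i \<phi> x)) \<xi>"
    unfolding fourier_def
  \<comment> \<open>By the mean value theorem the quotients are bounded by \<open>S\<close>; as the
    shifts have length at most 1, they vanish outside the radius \<open>R + 1\<close>.\<close>
  proof (rule integral_dominated_convergence[where w = "\<lambda>x. S * indicator (cball 0 (R + 1)) x"])
    show "integrable lborel (\<lambda>x::real^3. S * indicator (cball 0 (R + 1)) x)"
      by (intro integrable_mult_right integrable_real_indicator) (use emeasure_lborel_cball_finite[of "0::real^3" "R + 1"] in \<open>auto intro: borel_closed\<close>)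
    show "AE x in lborel. (\<lambda>n. of_real (q n x) * cis (- (x \<bullet> \<xi>))) \<longlonglongrightarrow> of_real (partial_deriv i \<phi> x) * cis (- (x \<bullet> \<xi>))"
    proof (intro AE_I2 tendsto_mult tendsto_const tendsto_of_real)
      fix x
      have "((\<lambda>t. (\<phi> (x + t *\<^sub>R ?e) - \<phi> (x + 0 *\<^sub>R ?e)) / (t - 0)) \<longlongrightarrow> partial_deriv i \<phi> (x + 0 *\<^sub>R ?e)) (at 0)"
        using D[of x 0] by (simp add: has_field_derivative_iff)
      from filterlim_compose[OF this h'] show "(\<lambda>n. q n x) \<longlonglongrightarrow> partial_deriv i \<phi> x" by (simp add: q_def)
    qed
    show "AE x in lborel. norm (of_real (q n x) * cis (- (x \<bullet> \<xi>))) \<le> S * indicator (cball 0 (R + 1)) x" for n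
    proof (intro AE_I2)
      fix x :: "real^3"
      have "\<bar>q n x\<bar> \<le> S * indicator (cball 0 (R + 1)) x"
      proof (cases "norm x \<le> R + 1")
        case True
        obtain z where "\<phi> (x + h n *\<^sub>R ?e) - \<phi> (x + 0 *\<^sub>R ?e) = (h n - 0) * partial_deriv i \<phi> (x + z *\<^sub>R ?e)"
          using MVT2[OF h(1)[of n], of "\<lambda>t. \<phi> (x + t *\<^sub>R ?e)" "\<lambda>t. partial_deriv i \<phi> (x + t *\<^sub>R ?e)"] D by blast
        then have "q n x = partial_deriv i \<phi> (x + z *\<^sub>R ?e)" using h(1)[of n] by (simp add: q_def)
        then show ?thesis using S(2) True by simp
      next
        case False
        have "norm (h n *\<^sub>R ?e) \<le> 1" using h(1,2)[of n] by simp
        then have "\<not> norm (x + h n *\<^sub>R ?e) \<le> R" using False norm_triangle_ineq4[of "x + h n *\<^sub>R ?e" "h n *\<^sub>R ?e"] by simp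
        then have "\<phi> (x + h n *\<^sub>R ?e) = 0" "\<phi> x = 0" using R(2) False by force+
        then show ?thesis using S(1) by (simp add: q_def)
      qed
      then show "norm (of_real (q n x) * cis (- (x \<bullet> \<xi>))) \<le> S * indicator (cball 0 (R + 1)) x" by (simp add: norm_mult)
    qed
    show "(\<lambda>x. of_real (q n x) * cis (- (x \<bullet> \<xi>))) \<in> borel_measurable lborel" for n unfolding q_def by measurable
  qed measurable
  have "(\<lambda>n. (cis (h n * \<xi> $ i) - 1) / h n) \<longlonglongrightarrow> \<i> * of_real (\<xi> $ i)"
  proof -
    have "((\<lambda>t. cis (t * \<xi> $ i)) has_vector_derivative \<i> * of_real (\<xi> $ i)) (at 0)"
    proof -
      have "((\<lambda>t. exp (\<i> * of_real (\<xi> $ i) * of_real t)) has_vector_derivative (\<i> * of_real (\<xi> $ i) * exp (\<i> * of_real (\<xi> $ i) * of_real 0))) (at 0)"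
        by (rule has_vector_derivative_real_field) (auto intro!: derivative_eq_intros)
      then show ?thesis by (simp add: cis_conv_exp mult.assoc mult.commute[of "of_real (\<xi> $ i)"])
    qed
    then have "((\<lambda>y. (cis (y * \<xi> $ i) - cis (0 * \<xi> $ i) - (y - 0) *\<^sub>R (\<i> * of_real (\<xi> $ i))) /\<^sub>R norm (y - 0)) \<longlongrightarrow> 0) (at 0)"
      unfolding has_vector_derivative_def has_derivative_at_within by simp
    from filterlim_compose[OF this h'] 
    have "(\<lambda>n. (cis (h n * \<xi> $ i) - 1 - h n *\<^sub>R (\<i> * of_real (\<xi> $ i))) /\<^sub>R h n) \<longlonglongrightarrow> 0"
      using h(1) by (simp add: abs_of_pos)
    moreover have "(cis (h n * \<xi> $ i) - 1 - h n *\<^sub>R (\<i> * of_real (\<xi> $ i))) /\<^sub>R h n = (cis (h n * \<xi> $ i) - 1) / h n - \<i> * of_real (\<xi> $ i)" for n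
      using h(1)[of n] by (simp add: scaleR_conv_of_real field_simps)
    ultimately show ?thesis by (simp add: LIM_zero_iff)
  qed
  from tendsto_mult[OF this tendsto_const[of "fourier (\<lambda>x. of_real (\<phi> x)) \<xi>"]]
  have "(\<lambda>n. fourier (\<lambda>x. of_real (q n x)) \<xi>) \<longlonglongrightarrow> \<i> * of_real (\<xi> $ i) * fourier (\<lambda>x. of_real (\<phi> x)) \<xi>"
    by (simp add: qf)
  with lim1 show ?thesis by (rule LIMSEQ_unique)
qed

text \<open>Parseval for \<open>u\<close> and a reflected translate of \<open>\<psi>\<close>.
  Letting \<open>y\<close> vary, a family of weak identities tested with all translates becomes an
  equality of two transforms.\<close>

lemma parseval_convolution:
  fixes u \<psi> :: "real^3 \<Rightarrow> complex"
  assumes u: "square_integrable u" and p: "integrable lborel \<psi>" "square_integrable \<psi>"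
  shows "fourier (\<lambda>\<xi>. ft u \<xi> * fourier \<psi> \<xi>) (- y) = plconst * (LINT x|lborel. u x * \<psi> (y - x))"
proof -
  define k where "k x = cnj (\<psi> (y - x))" for x
  have [measurable]: "\<psi> \<in> borel_measurable borel" using p(1) by auto
  have rm: "(\<chi> i. - 1) * x + y = y - x" for x :: "real^3" by (simp add: vec_eq_iff)
  have k: "integrable lborel k" "square_integrable k"
    unfolding k_def[abs_def] using lborel_integrable_shift(2)[OF p(1), of y]
      square_integrable_coordinatewise[of "\<chi> i. - 1", OF _ p(2), of y] unfolding rm
    by (auto intro!: square_integrable_cnj)
  have kf: "fourier k \<xi> = cis (- (y \<bullet> \<xi>)) * cnj (fourier \<psi> \<xi>)" for \<xi>
  proof -
    have "fourier k \<xi> = (LINT x|lborel. (\<lambda>x. cnj (\<psi> x) * cis (- ((y - x) \<bullet> \<xi>))) (y - x))"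
      unfolding fourier_def k_def by simp
    also have "\<dots> = (LINT x|lborel. cnj (\<psi> x) * cis (- ((y - x) \<bullet> \<xi>)))"
      by (rule lborel_integral_shift(2)) measurable
    also have "\<dots> = (LINT x|lborel. cis (- (y \<bullet> \<xi>)) * cnj (\<psi> x * cis (- (x \<bullet> \<xi>))))"
    proof (rule Bochner_Integration.integral_cong[OF refl])
      fix x
      have "cis (- ((y - x) \<bullet> \<xi>)) = cis (- (y \<bullet> \<xi>)) * cis (x \<bullet> \<xi>)"
        unfolding cis_mult by (rule arg_cong[where f = cis]) (simp add: inner_diff_left)
      then show "cnj (\<psi> x) * cis (- ((y - x) \<bullet> \<xi>)) = cis (- (y \<bullet> \<xi>)) * cnj (\<psi> x * cis (- (x \<bullet> \<xi>)))"
        by (simp add: cis_cnj ac_simps)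
    qed
    also have "\<dots> = cis (- (y \<bullet> \<xi>)) * cnj (fourier \<psi> \<xi>)"
      unfolding fourier_def by (simp del: complex_cnj_mult)
    finally show ?thesis .
  qed
  have "plconst * (LINT x|lborel. u x * \<psi> (y - x)) = plconst * (LINT x|lborel. u x * cnj (k x))"
    by (simp add: k_def)
  also have "\<dots> = (LINT \<xi>|lborel. ft u \<xi> * cnj (ft k \<xi>))"
    by (rule parseval[OF u k(2), symmetric])
  also have "\<dots> = (LINT \<xi>|lborel. ft u \<xi> * fourier \<psi> \<xi> * cis (- (\<xi> \<bullet> (- y))))"
  proof (rule integral_cong_AE)
    show "AE \<xi> in lborel. ft u \<xi> * cnj (ft k \<xi>) = ft u \<xi> * fourier \<psi> \<xi> * cis (- (\<xi> \<bullet> (- y)))"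
      using ft_eq_fourier[OF k] by eventually_elim (simp add: kf cis_cnj inner_commute ac_simps)
  qed measurable
  finally show ?thesis unfolding fourier_def by simp
qed

lemma fourier_L1_bounded:
  assumes "integrable lborel \<psi>"
  shows "fourier \<psi> \<in> borel_measurable borel" "cmod (fourier \<psi> \<xi>) \<le> (LINT x|lborel. cmod (\<psi> x))"
proof -
  have [measurable]: "\<psi> \<in> borel_measurable borel" using assms by auto
  show "fourier \<psi> \<in> borel_measurable borel" by measurable
qed (rule norm_fourier_le[OF assms])

lemma vec_nth_measurable [measurable]: "(\<lambda>\<xi>::real^3. \<xi> $ i) \<in> borel_measurable borel"
  by (intro borel_measurable_continuous_onI continuous_intros)

text \<open>Testing the weak gradient with all translates of a reflected test function shows that
  two integrable functions have the same transform, hence coincide. This gives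
  \<open>q * fourier \<phi> = 0\<close> for every test function; it remains to divide by a transform
  without zeros.\<close>

lemma ft_gradient:
  assumes u: "square_integrable u" and G: "square_integrable G" and w: "weak_gradient_of u G"
  shows "AE \<xi> in lborel. ft (\<lambda>x. G x $ j) \<xi> = \<i> * of_real (\<xi> $ j) * ft u \<xi>"
proof -
  let ?G = "\<lambda>x. G x $ j"
  have Gj: "square_integrable ?G" using G by (rule square_integrable_nth)
  define q where "q \<xi> = \<i> * of_real (\<xi> $ j) * ft u \<xi> - ft ?G \<xi>" for \<xi>
  have [measurable]: "q \<in> borel_measurable borel" unfolding q_def by measurable
  have z: "AE \<xi> in lborel. q \<xi> * fourier (\<lambda>x. of_real (\<phi> x)) \<xi> = 0" if t: "test_function \<phi>" for \<phi>
  proof -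
    let ?\<phi> = "\<lambda>x. complex_of_real (\<phi> x)" and ?d = "\<lambda>x. complex_of_real (partial_deriv j \<phi> x)"
    have p: "integrable lborel ?\<phi>" "integrable lborel ?d" "square_integrable ?\<phi>" "square_integrable ?d"
      using test_function_L1[OF t] test_function_square_integrable[OF t] test_function_partial_square_integrable[OF t]
      by (auto simp: complex_of_real_integrable_eq intro: square_integrable_of_real)
    note F = fourier_L1_L2(1)[OF p(1,3)] fourier_L1_L2(1)[OF p(2,4)]
    let ?h1 = "\<lambda>\<xi>. ft u \<xi> * fourier ?d \<xi>" and ?h2 = "\<lambda>\<xi>. ft ?G \<xi> * fourier ?\<phi> \<xi>"
    have i: "integrable lborel ?h1" "integrable lborel ?h2"
      by (intro square_integrable_mult ft_square_integrable F)+
    have "square_integrable (\<lambda>\<xi>. fourier ?d \<xi> * ft u \<xi>)" "square_integrable (\<lambda>\<xi>. fourier ?\<phi> \<xi> * ft ?G \<xi>)"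
      by (rule square_integrable_cmult[OF ft_square_integrable fourier_L1_bounded(1) fourier_L1_bounded(2)]; rule p)+
    then have s: "square_integrable ?h1" "square_integrable ?h2" by (simp_all add: mult.commute)
    have eq: "fourier ?h1 (- y) = fourier ?h2 (- y)" for y
    proof -
      have "(LINT x|lborel. u x * of_real (partial_deriv j (\<lambda>x. \<phi> (y - x)) x)) = - (LINT x|lborel. G x $ j * of_real (\<phi> (y - x)))"
        using w test_function_reflect[OF t, of y] unfolding weak_gradient_of_def by blast
      then have "(LINT x|lborel. u x * ?d (y - x)) = (LINT x|lborel. G x $ j * ?\<phi> (y - x))"
        by (simp add: partial_deriv_reflect[OF t])
      then show ?thesis
        unfolding parseval_convolution[OF u p(2,4)] parseval_convolution[OF Gj p(1,3)] by simp
    qed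
    have "fourier (\<lambda>\<xi>. ?h1 \<xi> - ?h2 \<xi>) \<xi> = 0" for \<xi>
      using eq[of "- \<xi>"] by (simp add: fourier_diff[OF i])
    then have "(LINT \<xi>|lborel. (cmod (?h1 \<xi> - ?h2 \<xi>))\<^sup>2) = 0"
      using plancherel_L1_L2(2)[OF Bochner_Integration.integrable_diff[OF i] square_integrable_diff[OF s]] plconst_pos by simp
    then have "AE \<xi> in lborel. (cmod (?h1 \<xi> - ?h2 \<xi>))\<^sup>2 = 0"
      by (subst (asm) integral_nonneg_eq_0_iff_AE)
         (use square_integrable_diff[OF s] in \<open>auto simp: square_integrable_def\<close>)
    then show ?thesis
      by eventually_elim (simp add: q_def fourier_partial_deriv[OF t] algebra_simps)
  qed
  \<comment> \<open>\<open>q\<close> itself may be unbounded. Its support indicator acts as a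
    bounded operator, so the functions whose transforms are killed by it form a closed
    subspace.\<close>
  define m :: "real^3 \<Rightarrow> complex" where "m \<xi> = (if q \<xi> \<noteq> 0 then 1 else 0)" for \<xi>
  have m: "m \<in> borel_measurable borel" "\<And>\<xi>. cmod (m \<xi>) \<le> 1" unfolding m_def by auto
  define S where "S = {f. l2_mul m (FT f) = 0}"
  have blFT: "bounded_linear FT"
    by (rule bounded_linear_intro[where K = "sqrt plconst"])
       (simp_all add: linear_add[OF linear_FT] linear_cmul[OF linear_FT] norm_FT)
  interpret T: bounded_linear "\<lambda>f. l2_mul m (FT f)"
    by (rule bounded_linear_compose[OF bounded_linear_l2_mul[OF m] blFT])
  have S1: "subspace S" unfolding S_def by (auto simp: subspace_def T.zero T.add T.scale)
  have S2: "closed S" unfolding S_def by (intro closed_Collect_eq T.continuous_on continuous_on_const continuous_on_id)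
  have inS: "l2_of (\<lambda>x. c * of_real (\<phi> x)) \<in> S" if t: "test_function \<phi>" for \<phi> c
  proof -
    let ?\<phi> = "\<lambda>x. c * complex_of_real (\<phi> x)"
    have p: "integrable lborel ?\<phi>" "square_integrable ?\<phi>"
      using test_function_L1(1)[OF t] square_integrable_cmult[OF square_integrable_of_real[OF test_function_square_integrable[OF t]], of "\<lambda>_. c" "cmod c"]
      by (auto simp: complex_of_real_integrable_eq)
    have "l2_mul m (FT (l2_of ?\<phi>)) = l2_of (\<lambda>\<xi>. m \<xi> * fourier ?\<phi> \<xi>)"
      unfolding FT_l2_of[OF p] by (rule l2_mul_l2_of[OF fourier_L1_L2(1)[OF p] m])
    also have "\<dots> = l2_of (\<lambda>\<xi>. 0)"
    proof (rule l2_of_cong[OF square_integrable_cmult[OF fourier_L1_L2(1)[OF p] m] square_integrable_0])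
      show "AE \<xi> in lborel. m \<xi> * fourier ?\<phi> \<xi> = 0"
        using z[OF t] by eventually_elim (auto simp: m_def fourier_cmult)
    qed
    finally show ?thesis by (simp add: S_def zero_l2_def)
  qed
  \<comment> \<open>By density the annihilation holds for every element of \<open>l2\<close>, in
    particular for one whose transform is a Gaussian and vanishes nowhere.\<close>
  obtain f where f: "FT f = l2_of (\<lambda>\<xi>. of_real (gauss \<xi>))" using FT_surj by metis
  have gs: "square_integrable (\<lambda>\<xi>. complex_of_real (gauss \<xi>))"
    unfolding square_integrable_def
  proof
    have gi: "integrable lborel gauss" using gauss_fourier(1) by (simp add: complex_of_real_integrable_eq)
    show "integrable lborel (\<lambda>\<xi>. (norm (complex_of_real (gauss \<xi>)))\<^sup>2)"
    proof (rule Bochner_Integration.integrable_bound[OF gi])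
      show "AE \<xi> in lborel. norm ((norm (complex_of_real (gauss \<xi>)))\<^sup>2) \<le> norm (gauss \<xi>)"
        by (auto simp: gauss_def power2_eq_square intro!: AE_I2 mult_left_le)
    qed measurable
  qed measurable
  have "f \<in> S"
    by (rule l2_dense[OF S1 S2]) (use inS[of _ 1] inS[of _ \<i>] in auto)
  then have "l2_of (\<lambda>\<xi>. m \<xi> * of_real (gauss \<xi>)) = l2_of (\<lambda>\<xi>. 0)"
    unfolding S_def by (simp add: f l2_mul_l2_of[OF gs m] zero_l2_def)
  then have "AE \<xi> in lborel. m \<xi> * of_real (gauss \<xi>) = 0"
    by (subst (asm) l2_of_eq_iff[OF square_integrable_cmult[OF gs m] square_integrable_0])
  then show ?thesis
  proof eventually_elim
    case (elim \<xi>)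
    then have "q \<xi> = 0" using gauss_pos[of \<xi>] by (auto simp: m_def split: if_splits)
    then show ?case by (simp add: q_def)
  qed
qed

text \<open>Converse direction: Parseval turns the weak derivative into an identity between
  multipliers.\<close>

lemma gradient_of_ft:
  assumes f: "square_integrable f" and g: "\<And>j. square_integrable (g j)"
    and e: "\<And>j. AE \<xi> in lborel. ft (g j) \<xi> = \<i> * of_real (\<xi> $ j) * ft f \<xi>"
  shows "square_integrable (\<lambda>x. \<chi> j. g j x)" "weak_gradient_of f (\<lambda>x. \<chi> j. g j x)"
proof -
  note [measurable] = g[THEN square_integrable_measurable]
  have m: "(\<lambda>x. \<chi> j. g j x) \<in> borel_measurable borel"
  proof -
    have "continuous_on UNIV (\<lambda>z::complex. if i = j then z else 0)" for i j :: 3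
      by (cases "i = j") (simp_all add: continuous_on_id)
    then have "(\<lambda>z::complex. \<chi> i. if i = j then z else 0) \<in> borel_measurable borel" for j :: 3
      by (intro borel_measurable_continuous_onI continuous_on_vec_lambda)
    then have "(\<lambda>x. \<chi> i. if i = j then g j x else 0) \<in> borel_measurable borel" for j
      by (rule measurable_compose[OF square_integrable_measurable[OF g[of j]]])
    then have "(\<lambda>x. \<Sum>j\<in>UNIV. (\<chi> i. if i = j then g j x else 0) :: complex^3) \<in> borel_measurable borel"
      by (intro borel_measurable_sum)
    also have "(\<lambda>x. \<Sum>j\<in>UNIV. (\<chi> i. if i = j then g j x else 0)) = (\<lambda>x. \<chi> j. g j x)"
      by (simp add: fun_eq_iff vec_eq_iff)
    finally show ?thesis .
  qed
  have n: "(norm (\<chi> j. g j x))\<^sup>2 = (\<Sum>j\<in>UNIV. (cmod (g j x))\<^sup>2)" for x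
    by (simp add: norm_vec_def L2_set_def sum_nonneg)
  show "square_integrable (\<lambda>x. \<chi> j. g j x)"
    unfolding square_integrable_def n using m g by (auto simp: square_integrable_def)
  show "weak_gradient_of f (\<lambda>x. \<chi> j. g j x)"
    unfolding weak_gradient_of_def
  proof (intro allI impI)
    fix \<phi> i assume t: "test_function \<phi>"
    let ?\<phi> = "\<lambda>x. complex_of_real (\<phi> x)" and ?d = "\<lambda>x. complex_of_real (partial_deriv i \<phi> x)"
    have p: "integrable lborel ?\<phi>" "integrable lborel ?d" "square_integrable ?\<phi>" "square_integrable ?d"
      using test_function_L1[OF t] test_function_square_integrable[OF t] test_function_partial_square_integrable[OF t]
      by (auto simp: complex_of_real_integrable_eq intro: square_integrable_of_real)
    have "plconst * (LINT x|lborel. f x * cnj (?d x)) = (LINT \<xi>|lborel. ft f \<xi> * cnj (ft ?d \<xi>))"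
      by (rule parseval[OF f p(4), symmetric])
    also have "\<dots> = (LINT \<xi>|lborel. - (ft (g i) \<xi> * cnj (ft ?\<phi> \<xi>)))"
    proof (rule integral_cong_AE)
      show "AE \<xi> in lborel. ft f \<xi> * cnj (ft ?d \<xi>) = - (ft (g i) \<xi> * cnj (ft ?\<phi> \<xi>))"
        using e[of i] ft_eq_fourier[OF p(1,3)] ft_eq_fourier[OF p(2,4)]
        by eventually_elim (simp add: fourier_partial_deriv[OF t])
    qed measurable
    also have "\<dots> = - (plconst * (LINT x|lborel. g i x * cnj (?\<phi> x)))"
      using parseval[OF g p(3), of i] by simp
    finally have "of_real plconst * (LINT x|lborel. f x * ?d x) = of_real plconst * (- (LINT x|lborel. g i x * ?\<phi> x))"
      by simp
    then have "(LINT x|lborel. f x * ?d x) = - (LINT x|lborel. g i x * ?\<phi> x)"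
      by (rule mult_left_cancel[THEN iffD1, rotated]) (use plconst_pos in simp)
    then show "(LINT x|lborel. f x * complex_of_real (partial_deriv i \<phi> x)) =
        - (LINT x|lborel. (\<chi> j. g j x) $ i * complex_of_real (\<phi> x))" by simp
  qed
qed

section \<open>The Sobolev space on the Fourier side\<close>

definition hat :: "h1 \<Rightarrow> real^3 \<Rightarrow> complex" where "hat u = ft (fun_of u)"

lemma hat_square_integrable: "square_integrable (hat u)"
  unfolding hat_def by (rule ft_square_integrable)

lemma hat_measurable [measurable]: "hat u \<in> borel_measurable borel"
  unfolding hat_def by measurable

lemma ft_grad: "AE \<xi> in lborel. ft (\<lambda>x. grad u x $ j) \<xi> = \<i> * of_real (\<xi> $ j) * hat u \<xi>"
  unfolding hat_def by (rule ft_gradient[OF fun_of_square_integrable grad_square_integrable grad_weak_gradient])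

lemma hat_nth_square_integrable: "square_integrable (\<lambda>\<xi>. of_real (\<xi> $ j) * hat u \<xi>)"
proof (rule square_integrable_bound[OF ft_square_integrable[of "\<lambda>x. grad u x $ j"], where C = 1])
  show "AE \<xi> in lborel. norm (of_real (\<xi> $ j) * hat u \<xi>) \<le> 1 * norm (ft (\<lambda>x. grad u x $ j) \<xi>)"
    using ft_grad[of u j] by eventually_elim (simp add: norm_mult)
qed measurable

text \<open>\<open>FT\<close> is onto, so the profile and its products with the coordinates are all
  transforms; the latter supply the weak gradient. Elements of \<open>h1\<close> can hence be
  constructed by prescribing their transforms.\<close>

lemma h1_exists:
  assumes a: "square_integrable a" and b: "\<And>j. square_integrable (\<lambda>\<xi>. of_real (\<xi> $ j) * a \<xi>)"
  shows "\<exists>u. AE \<xi> in lborel. hat u \<xi> = a \<xi>"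
proof -
  have ex: "\<exists>f. square_integrable f \<and> (AE \<xi> in lborel. ft f \<xi> = h \<xi>)" if h: "square_integrable h" for h
  proof -
    obtain w where w: "FT w = l2_of h" using FT_surj by metis
    have "AE \<xi> in lborel. ft (l2_fun w) \<xi> = h \<xi>"
      unfolding ft_def by (simp add: w l2_fun_l2_of[OF h])
    then show ?thesis using l2_fun_square_integrable by blast
  qed
  obtain f where f: "square_integrable f" "AE \<xi> in lborel. ft f \<xi> = a \<xi>" using ex[OF a] by blast
  have "\<exists>g. square_integrable g \<and> (AE \<xi> in lborel. ft g \<xi> = \<i> * (of_real (\<xi> $ j) * a \<xi>))" for j
    using ex[OF square_integrable_i[OF b]] by blast
  then obtain g where g: "\<And>j. square_integrable (g j)" "\<And>j. AE \<xi> in lborel. ft (g j) \<xi> = \<i> * (of_real (\<xi> $ j) * a \<xi>)"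
    by metis
  have "AE \<xi> in lborel. ft (g j) \<xi> = \<i> * of_real (\<xi> $ j) * ft f \<xi>" for j
    using g(2)[of j] f(2) by eventually_elim simp
  note G = gradient_of_ft[OF f(1) g(1) this]
  have H: "H1 f" unfolding H1_def using f(1) G by blast
  have "l2_of (fun_of (h1_of f)) = l2_of f"
    by (rule l2_of_cong[OF fun_of_square_integrable f(1) fun_of_h1_of[OF H]])
  then have "hat (h1_of f) = ft f" by (simp add: hat_def ft_def)
  then show ?thesis using f(2) by (intro exI[of _ "h1_of f"]) simp
qed

lemma ft_add:
  assumes "square_integrable f" "square_integrable g"
  shows "AE \<xi> in lborel. ft (\<lambda>x. f x + g x) \<xi> = ft f \<xi> + ft g \<xi>"
  unfolding ft_def l2_of_add[OF assms] linear_add[OF linear_FT] by (rule l2_fun_plus)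

lemma ft_cong:
  assumes "square_integrable f" "square_integrable g" "AE x in lborel. f x = g x"
  shows "ft f = ft g"
  unfolding ft_def l2_of_cong[OF assms] ..

lemma hat_plus: "AE \<xi> in lborel. hat (u + v) \<xi> = hat u \<xi> + hat v \<xi>"
  unfolding hat_def ft_cong[OF fun_of_square_integrable square_integrable_add[OF fun_of_square_integrable fun_of_square_integrable] fun_of_plus]
  by (rule ft_add[OF fun_of_square_integrable fun_of_square_integrable])

lemma hat_scaleR: "AE \<xi> in lborel. hat (c *\<^sub>R u) \<xi> = c *\<^sub>R hat u \<xi>"
  unfolding hat_def ft_cong[OF fun_of_square_integrable square_integrable_scaleR[OF fun_of_square_integrable] fun_of_scaleR]
  unfolding ft_def l2_of_scaleR[OF fun_of_square_integrable] linear_cmul[OF linear_FT] by (rule l2_fun_scaleR)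

lemma h1_hat_eqI:
  assumes "AE \<xi> in lborel. hat u \<xi> = hat v \<xi>"
  shows "u = v"
proof -
  have "l2_of (hat u) = l2_of (hat v)" by (rule l2_of_cong[OF hat_square_integrable hat_square_integrable assms])
  then have "l2_of (fun_of u) = l2_of (fun_of v)" by (simp add: hat_def l2_of_ft FT_inj)
  then show ?thesis
    using l2_of_eq_iff[OF fun_of_square_integrable fun_of_square_integrable] by (intro h1_eqI) simp
qed

lemma integral_fun_of: "plconst * (LINT x|lborel. fun_of u x * cnj (fun_of v x)) = (LINT \<xi>|lborel. hat u \<xi> * cnj (hat v \<xi>))"
  unfolding hat_def by (rule parseval[OF fun_of_square_integrable fun_of_square_integrable, symmetric])

lemma norm_eq_sum_nth: "(norm (\<xi> :: real^3))\<^sup>2 = (\<Sum>j\<in>UNIV. (\<xi> $ j)\<^sup>2)"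
  by (simp add: norm_vec_def L2_set_def sum_nonneg)

lemma integral_grad:
  "plconst * (LINT x|lborel. (\<Sum>j\<in>UNIV. grad u x $ j * cnj (grad v x $ j)))
    = (LINT \<xi>|lborel. of_real ((norm \<xi>)\<^sup>2) * hat u \<xi> * cnj (hat v \<xi>))"
proof -
  have gs: "square_integrable (\<lambda>x. grad u x $ j)" for u j by (intro square_integrable_nth grad_square_integrable)
  have i: "integrable lborel (\<lambda>x. grad u x $ j * cnj (grad v x $ j))" for j
    by (intro square_integrable_mult square_integrable_cnj gs)
  have k: "plconst * (LINT x|lborel. grad u x $ j * cnj (grad v x $ j))
      = (LINT \<xi>|lborel. of_real ((\<xi> $ j)\<^sup>2) * hat u \<xi> * cnj (hat v \<xi>))" for j
  proof -
    have "plconst * (LINT x|lborel. grad u x $ j * cnj (grad v x $ j))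
       = (LINT \<xi>|lborel. ft (\<lambda>x. grad u x $ j) \<xi> * cnj (ft (\<lambda>x. grad v x $ j) \<xi>))"
      by (rule parseval[OF gs gs, symmetric])
    also have "\<dots> = (LINT \<xi>|lborel. of_real ((\<xi> $ j)\<^sup>2) * hat u \<xi> * cnj (hat v \<xi>))"
    proof (rule integral_cong_AE)
      show "AE \<xi> in lborel. ft (\<lambda>x. grad u x $ j) \<xi> * cnj (ft (\<lambda>x. grad v x $ j) \<xi>) = of_real ((\<xi> $ j)\<^sup>2) * hat u \<xi> * cnj (hat v \<xi>)"
        using ft_grad[of u j] ft_grad[of v j]
      proof eventually_elim
        case (elim \<xi>)
        show ?case unfolding elim by (simp add: complex_eq_iff power2_eq_square algebra_simps)
      qed
    qed measurable
    finally show ?thesis .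
  qed
  have ih: "integrable lborel (\<lambda>\<xi>. of_real ((\<xi> $ j)\<^sup>2) * hat u \<xi> * cnj (hat v \<xi>))" for j
  proof -
    have "integrable lborel (\<lambda>\<xi>. (of_real (\<xi> $ j) * hat u \<xi>) * cnj (of_real (\<xi> $ j) * hat v \<xi>))"
      by (intro square_integrable_mult square_integrable_cnj hat_nth_square_integrable)
    then show ?thesis by (simp add: power2_eq_square ac_simps)
  qed
  have "plconst * (LINT x|lborel. (\<Sum>j\<in>UNIV. grad u x $ j * cnj (grad v x $ j)))
     = (\<Sum>j\<in>UNIV. plconst * (LINT x|lborel. grad u x $ j * cnj (grad v x $ j)))"
    by (simp add: Bochner_Integration.integral_sum i sum_distrib_left)
  also have "\<dots> = (LINT \<xi>|lborel. (\<Sum>j\<in>UNIV. of_real ((\<xi> $ j)\<^sup>2) * hat u \<xi> * cnj (hat v \<xi>)))"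
    unfolding k by (rule Bochner_Integration.integral_sum[symmetric]) (rule ih)
  also have "(\<lambda>\<xi>. (\<Sum>j\<in>UNIV. of_real ((\<xi> $ j)\<^sup>2) * hat u \<xi> * cnj (hat v \<xi>))) = (\<lambda>\<xi>. of_real ((norm \<xi>)\<^sup>2) * hat u \<xi> * cnj (hat v \<xi>))"
    unfolding norm_eq_sum_nth by (simp add: sum_distrib_right)
  finally show ?thesis .
qed

text \<open>The Japanese bracket of the frequency.\<close>

definition wt :: "real^3 \<Rightarrow> real" where "wt \<xi> = sqrt (1 + (norm \<xi>)\<^sup>2)"

lemma wt_ge_1: "wt \<xi> \<ge> 1" by (simp add: wt_def)

lemma wt_pos: "wt \<xi> > 0" using wt_ge_1[of \<xi>] by linarith

lemma wt_power2: "(wt \<xi>)\<^sup>2 = 1 + (norm \<xi>)\<^sup>2" by (simp add: wt_def)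

lemma wt_measurable [measurable]: "wt \<in> borel_measurable borel"
  unfolding wt_def[abs_def] by measurable

lemma wt_hat_square_integrable: "square_integrable (\<lambda>\<xi>. of_real (wt \<xi>) * hat u \<xi>)"
proof -
  have "integrable lborel (\<lambda>\<xi>. (norm (hat u \<xi>))\<^sup>2 + (\<Sum>j\<in>UNIV. (norm (of_real (\<xi> $ j) * hat u \<xi>))\<^sup>2))"
    using hat_square_integrable[of u] hat_nth_square_integrable[of _ u]
    by (intro Bochner_Integration.integrable_add Bochner_Integration.integrable_sum) (simp_all add: square_integrable_def)
  also have "(\<lambda>\<xi>. (norm (hat u \<xi>))\<^sup>2 + (\<Sum>j\<in>UNIV. (norm (of_real (\<xi> $ j) * hat u \<xi>))\<^sup>2)) = (\<lambda>\<xi>. (norm (of_real (wt \<xi>) * hat u \<xi>))\<^sup>2)"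
    by (simp add: fun_eq_iff norm_mult power_mult_distrib wt_power2 norm_eq_sum_nth sum_distrib_right[symmetric] distrib_right)
  finally show ?thesis unfolding square_integrable_def by simp
qed

text \<open>An isomorphism from \<open>h1\<close> onto \<open>l2\<close>, isometric up to the factor
  sqrt \<open>plconst\<close>: completeness and weak convergence are transported along it.\<close>

definition Phi :: "h1 \<Rightarrow> l2" where "Phi u = l2_of (\<lambda>\<xi>. of_real (wt \<xi>) * hat u \<xi>)"

lemma Phi_plus: "Phi (u + v) = Phi u + Phi v"
  unfolding Phi_def l2_of_add[OF wt_hat_square_integrable wt_hat_square_integrable, symmetric]
  by (rule l2_of_cong[OF wt_hat_square_integrable square_integrable_add[OF wt_hat_square_integrable wt_hat_square_integrable]])
     (use hat_plus[of u v] in eventually_elim, simp add: distrib_left)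

lemma Phi_scaleR: "Phi (c *\<^sub>R u) = c *\<^sub>R Phi u"
  unfolding Phi_def l2_of_scaleR[OF wt_hat_square_integrable, symmetric]
  by (rule l2_of_cong[OF wt_hat_square_integrable square_integrable_scaleR[OF wt_hat_square_integrable]])
     (use hat_scaleR[of c u] in eventually_elim, simp)

lemma linear_Phi: "linear Phi" by (rule linearI) (simp_all add: Phi_plus Phi_scaleR)

lemma inner_grad: "grad u x \<bullet> grad v x = Re (\<Sum>j\<in>UNIV. grad u x $ j * cnj (grad v x $ j))"
  by (simp add: inner_vec_def inner_complex_def)

lemma inner_Phi: "Phi u \<bullet> Phi v = plconst * (u \<bullet> v)"
proof -
  have gs: "square_integrable (\<lambda>x. grad u x $ j)" for u j by (intro square_integrable_nth grad_square_integrable)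
  have ig: "integrable lborel (\<lambda>x. (\<Sum>j\<in>UNIV. grad u x $ j * cnj (grad v x $ j)))"
    by (intro Bochner_Integration.integrable_sum square_integrable_mult square_integrable_cnj gs)
  have iu: "integrable lborel (\<lambda>x. fun_of u x * cnj (fun_of v x))"
    by (intro square_integrable_mult square_integrable_cnj fun_of_square_integrable)
  have "u \<bullet> v = Re (LINT x|lborel. fun_of u x * cnj (fun_of v x)) + Re (LINT x|lborel. (\<Sum>j\<in>UNIV. grad u x $ j * cnj (grad v x $ j)))"
    unfolding inner_h1_def inner_grad integral_Re[OF ig, symmetric] integral_Re[OF iu, symmetric] by (simp add: inner_complex_def)
  then have "plconst * (u \<bullet> v) = Re (plconst * (LINT x|lborel. fun_of u x * cnj (fun_of v x)) + plconst * (LINT x|lborel. (\<Sum>j\<in>UNIV. grad u x $ j * cnj (grad v x $ j))))"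
    by (simp add: algebra_simps)
  also have "\<dots> = Re ((LINT \<xi>|lborel. hat u \<xi> * cnj (hat v \<xi>)) + (LINT \<xi>|lborel. of_real ((norm \<xi>)\<^sup>2) * hat u \<xi> * cnj (hat v \<xi>)))"
    unfolding integral_fun_of integral_grad ..
  also have "(LINT \<xi>|lborel. hat u \<xi> * cnj (hat v \<xi>)) + (LINT \<xi>|lborel. of_real ((norm \<xi>)\<^sup>2) * hat u \<xi> * cnj (hat v \<xi>))
     = (LINT \<xi>|lborel. hat u \<xi> * cnj (hat v \<xi>) + of_real ((norm \<xi>)\<^sup>2) * hat u \<xi> * cnj (hat v \<xi>))"
  proof (rule Bochner_Integration.integral_add[symmetric])
    show i1: "integrable lborel (\<lambda>\<xi>. hat u \<xi> * cnj (hat v \<xi>))"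
      by (intro square_integrable_mult square_integrable_cnj hat_square_integrable)
    have "integrable lborel (\<lambda>\<xi>. (of_real (wt \<xi>) * hat u \<xi>) * cnj (of_real (wt \<xi>) * hat v \<xi>) - hat u \<xi> * cnj (hat v \<xi>))"
      by (intro Bochner_Integration.integrable_diff i1 square_integrable_mult square_integrable_cnj wt_hat_square_integrable)
    also have "(\<lambda>\<xi>. (of_real (wt \<xi>) * hat u \<xi>) * cnj (of_real (wt \<xi>) * hat v \<xi>) - hat u \<xi> * cnj (hat v \<xi>))
      = (\<lambda>\<xi>. (of_real ((wt \<xi>)\<^sup>2) - 1) * hat u \<xi> * cnj (hat v \<xi>))"
      by (simp add: fun_eq_iff power2_eq_square algebra_simps)
    finally show "integrable lborel (\<lambda>\<xi>. of_real ((norm \<xi>)\<^sup>2) * hat u \<xi> * cnj (hat v \<xi>))"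
      unfolding wt_power2 by simp
  qed
  also have "(\<lambda>\<xi>. hat u \<xi> * cnj (hat v \<xi>) + of_real ((norm \<xi>)\<^sup>2) * hat u \<xi> * cnj (hat v \<xi>))
     = (\<lambda>\<xi>. (of_real (wt \<xi>) * hat u \<xi>) * cnj (of_real (wt \<xi>) * hat v \<xi>))"
  proof
    fix \<xi>
    have "(of_real (wt \<xi>) * hat u \<xi>) * cnj (of_real (wt \<xi>) * hat v \<xi>) = of_real ((wt \<xi>)\<^sup>2) * (hat u \<xi> * cnj (hat v \<xi>))"
      by (simp add: power2_eq_square ac_simps)
    then show "hat u \<xi> * cnj (hat v \<xi>) + of_real ((norm \<xi>)\<^sup>2) * hat u \<xi> * cnj (hat v \<xi>) = (of_real (wt \<xi>) * hat u \<xi>) * cnj (of_real (wt \<xi>) * hat v \<xi>)"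
      unfolding wt_power2 by (simp add: algebra_simps)
  qed
  also have "Re (LINT \<xi>|lborel. (of_real (wt \<xi>) * hat u \<xi>) * cnj (of_real (wt \<xi>) * hat v \<xi>)) = Phi u \<bullet> Phi v"
    unfolding Phi_def by (rule Re_integral_mult_cnj[OF wt_hat_square_integrable wt_hat_square_integrable])
  finally show ?thesis by simp
qed

lemma norm_Phi: "norm (Phi u) = sqrt plconst * norm u"
  by (simp add: norm_eq_sqrt_inner inner_Phi real_sqrt_mult)

lemma Phi_surj: "\<exists>u. Phi u = w"
proof -
  let ?a = "\<lambda>\<xi>. of_real (1 / wt \<xi>) * l2_fun w \<xi>"
  have a: "square_integrable ?a"
    by (rule square_integrable_cmult[OF l2_fun_square_integrable, where C = 1]) (auto simp: wt_ge_1 wt_pos less_imp_le norm_divide)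
  have "square_integrable (\<lambda>\<xi>. of_real (\<xi> $ j) * ?a \<xi>)" for j
  proof -
    have "\<bar>\<xi> $ j\<bar> \<le> wt \<xi>" for \<xi>
      using component_le_norm_cart[of \<xi> j] real_sqrt_le_mono[of "(norm \<xi>)\<^sup>2" "1 + (norm \<xi>)\<^sup>2"] by (simp add: wt_def)
    then have "square_integrable (\<lambda>\<xi>. of_real (\<xi> $ j / wt \<xi>) * l2_fun w \<xi>)"
      by (intro square_integrable_cmult[OF l2_fun_square_integrable, where C = 1])
         (auto simp: norm_divide divide_le_eq wt_pos abs_of_pos)
    then show ?thesis by simp
  qed
  then obtain u where u: "AE \<xi> in lborel. hat u \<xi> = ?a \<xi>" using h1_exists[OF a] by blast
  have "Phi u = l2_of (l2_fun w)" unfolding Phi_def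
  proof (rule l2_of_cong[OF wt_hat_square_integrable l2_fun_square_integrable])
    show "AE \<xi> in lborel. of_real (wt \<xi>) * hat u \<xi> = l2_fun w \<xi>"
      using u by eventually_elim (use wt_pos less_imp_neq in \<open>force\<close>)
  qed
  then show ?thesis by auto
qed

instance h1 :: complete_space
proof
  fix X :: "nat \<Rightarrow> h1" assume X: "Cauchy X"
  have sp: "sqrt plconst > 0" using plconst_pos by simp
  have d: "norm (Phi u - Phi v) = sqrt plconst * norm (u - v)" for u v
    using norm_Phi[of "u - v"] by (simp add: linear_diff[OF linear_Phi])
  have "Cauchy (\<lambda>n. Phi (X n))"
  proof (rule metric_CauchyI)
    fix e :: real assume "e > 0"
    then obtain M where "\<forall>m\<ge>M. \<forall>n\<ge>M. dist (X m) (X n) < e / sqrt plconst"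
      using metric_CauchyD[OF X, of "e / sqrt plconst"] sp by auto
    then show "\<exists>M. \<forall>m\<ge>M. \<forall>n\<ge>M. dist (Phi (X m)) (Phi (X n)) < e"
      using sp by (intro exI[of _ M]) (auto simp: dist_norm d field_simps)
  qed
  then obtain w where w: "(\<lambda>n. Phi (X n)) \<longlonglongrightarrow> w" using Cauchy_convergent_iff convergent_def by blast
  obtain u where u: "Phi u = w" using Phi_surj by blast
  have "(\<lambda>n. norm (Phi (X n) - Phi u) / sqrt plconst) \<longlonglongrightarrow> norm (w - w) / sqrt plconst"
    unfolding u using sp by (intro tendsto_intros w) auto
  then have "(\<lambda>n. norm (X n - u)) \<longlonglongrightarrow> 0" using sp by (simp add: d)
  then have "X \<longlonglongrightarrow> u" by (simp add: LIM_zero_iff tendsto_norm_zero_iff)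
  then show "convergent X" by (auto simp: convergent_def)
qed

section \<open>Products of functions in the Sobolev space\<close>

lemma nn_integral_shift:
  fixes f :: "real^3 \<Rightarrow> ennreal"
  assumes "f \<in> borel_measurable borel"
  shows "(\<integral>\<^sup>+x. f (x + y) \<partial>lborel) = (\<integral>\<^sup>+x. f x \<partial>lborel)" "(\<integral>\<^sup>+x. f (x - y) \<partial>lborel) = (\<integral>\<^sup>+x. f x \<partial>lborel)"
    "(\<integral>\<^sup>+x. f (y - x) \<partial>lborel) = (\<integral>\<^sup>+x. f x \<partial>lborel)"
proof -
  have "(\<chi> i. 1) * x = x" "(\<chi> i. - 1) * x = - x" for x :: "real^3" by (simp_all add: vec_eq_iff)
  then show "(\<integral>\<^sup>+x. f (x + y) \<partial>lborel) = (\<integral>\<^sup>+x. f x \<partial>lborel)" "(\<integral>\<^sup>+x. f (x - y) \<partial>lborel) = (\<integral>\<^sup>+x. f x \<partial>lborel)"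
    "(\<integral>\<^sup>+x. f (y - x) \<partial>lborel) = (\<integral>\<^sup>+x. f x \<partial>lborel)"
    using nn_integral_coordinatewise[of "\<chi> i. 1" f y] nn_integral_coordinatewise[of "\<chi> i. - 1" f y]
      nn_integral_coordinatewise[of "\<chi> i. 1" f "- y"] assms
    by (simp_all add: jac_def)
qed

text \<open>The exponent lies between 3, which integrability on three-dimensional space has to
  exceed, and 4, the total weight available in a product of two H^1 functions.\<close>

definition decay :: "real^3 \<Rightarrow> real" where "decay \<xi> = wt \<xi> powr (- (7/2))"

lemma decay_measurable [measurable]: "decay \<in> borel_measurable borel"
  unfolding decay_def[abs_def] by measurable

lemma decay_nonneg: "decay \<xi> \<ge> 0" by (simp add: decay_def)

lemma decay_finite: "(\<integral>\<^sup>+\<xi>. ennreal (decay \<xi>) \<partial>lborel) < \<infinity>"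
proof -
  let ?V = "unit_ball_vol 3"
  \<comment> \<open>Dyadic comparison: the k-th ball has volume of order 2^(3 k) and the weight
    there is 2^(- 7 k / 2), so the terms decay like 2^(- k / 2).\<close>
  have pw: "ennreal (decay \<xi>) \<le> (\<Sum>k. ennreal (2 powr (- (7/2) * real k)) * indicator (ball 0 (2 ^ Suc k)) \<xi>)" for \<xi>
  proof -
    have "\<exists>n. wt \<xi> < 2 ^ Suc n"
    proof -
      obtain n where "wt \<xi> < 2 ^ n" using real_arch_pow[of 2 "wt \<xi>"] by auto
      then have "wt \<xi> < 2 ^ Suc n" using wt_pos[of \<xi>] by simp
      then show ?thesis by blast
    qed
    then obtain n where n: "wt \<xi> < 2 ^ Suc n" "\<And>m. m < n \<Longrightarrow> \<not> wt \<xi> < 2 ^ Suc m"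
      using exists_least_iff[of "\<lambda>n. wt \<xi> < 2 ^ Suc n"] by blast
    have n2: "2 ^ n \<le> wt \<xi>"
    proof (cases n)
      case 0 then show ?thesis using wt_ge_1[of \<xi>] by simp
    next
      case (Suc m) then show ?thesis using n(2)[of m] by simp
    qed
    have "norm \<xi> \<le> wt \<xi>" unfolding wt_def by (rule real_le_rsqrt) simp
    then have b: "\<xi> \<in> ball 0 (2 ^ Suc n)" using n(1) by simp
    have "decay \<xi> \<le> (2 ^ n) powr (- (7/2))"
      unfolding decay_def by (rule powr_mono2') (use n2 in auto)
    also have "(2 ^ n :: real) = 2 powr real n" by (simp add: powr_realpow)
    also have "(2 powr real n) powr (- (7/2)) = 2 powr (- (7/2) * real n)" by (simp add: powr_powr mult.commute)
    finally have "ennreal (decay \<xi>) \<le> ennreal (2 powr (- (7/2) * real n)) * indicator (ball 0 (2 ^ Suc n)) \<xi>"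
      using b by (simp add: ennreal_leI)
    also have "\<dots> \<le> (\<Sum>k. ennreal (2 powr (- (7/2) * real k)) * indicator (ball 0 (2 ^ Suc k)) \<xi>)"
    proof -
      have "F n \<le> (\<Sum>k. F k)" for F :: "nat \<Rightarrow> ennreal" using sum_le_suminf[of F "{n}"] by simp
      then show ?thesis .
    qed
    finally show ?thesis .
  qed
  have "(\<integral>\<^sup>+\<xi>. ennreal (decay \<xi>) \<partial>lborel) \<le> (\<integral>\<^sup>+\<xi>. (\<Sum>k. ennreal (2 powr (- (7/2) * real k)) * indicator (ball (0::real^3) (2 ^ Suc k)) \<xi>) \<partial>lborel)"
    by (rule nn_integral_mono) (rule pw)
  also have "\<dots> = (\<Sum>k. \<integral>\<^sup>+\<xi>. ennreal (2 powr (- (7/2) * real k)) * indicator (ball (0::real^3) (2 ^ Suc k)) \<xi> \<partial>lborel)"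
    by (rule nn_integral_suminf) measurable
  also have "\<dots> = (\<Sum>k. ennreal (8 * ?V * (2 powr (- (1/2))) ^ k))"
  proof (intro suminf_cong)
    fix k
    have "(\<integral>\<^sup>+\<xi>. ennreal (2 powr (- (7/2) * real k)) * indicator (ball (0::real^3) (2 ^ Suc k)) \<xi> \<partial>lborel)
      = ennreal (2 powr (- (7/2) * real k)) * ennreal (?V * (2 ^ Suc k) ^ 3)"
      using emeasure_ball[of "2 ^ Suc k" "0::real^3"] by (subst nn_integral_cmult_indicator) auto
    also have "\<dots> = ennreal (2 powr (- (7/2) * real k) * (?V * (2 ^ Suc k) ^ 3))"
      by (simp add: ennreal_mult)
    also have "2 powr (- (7/2) * real k) * (?V * (2 ^ Suc k) ^ 3) = 8 * ?V * (2 powr (- (7/2) * real k) * (2 ^ k) ^ 3)"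
      by (simp add: power_mult_distrib)
    also have "((2::real) ^ k) ^ 3 = 2 powr (3 * real k)"
      by (simp add: powr_realpow[symmetric] powr_powr power_mult[symmetric] mult.commute)
    also have "2 powr (- (7/2) * real k) * 2 powr (3 * real k) = 2 powr (- (1/2) * real k)"
      unfolding powr_add[symmetric] by (rule arg_cong[where f = "\<lambda>x. 2 powr x"]) (simp add: algebra_simps)
    also have "\<dots> = (2 powr (- (1/2))) ^ k" by (simp add: powr_power mult.commute)
    finally show "(\<integral>\<^sup>+\<xi>. ennreal (2 powr (- (7/2) * real k)) * indicator (ball (0::real^3) (2 ^ Suc k)) \<xi> \<partial>lborel)
      = ennreal (8 * ?V * (2 powr (- (1/2))) ^ k)" .
  qed
  also have "\<dots> < \<infinity>"
  proof -
    have "(2::real) powr (- (1/2)) < 2 powr 0" by (rule powr_less_mono) auto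
    then have "summable (\<lambda>k. 8 * ?V * (2 powr (- (1/2)))^k)"
      by (intro summable_mult summable_geometric) simp
    then show ?thesis by (subst suminf_ennreal2) auto
  qed
  finally show ?thesis .
qed

definition kap :: real where "kap = enn2real (\<integral>\<^sup>+\<xi>. ennreal (decay \<xi>) \<partial>lborel)"

lemma nn_integral_decay: "(\<integral>\<^sup>+\<xi>. ennreal (decay \<xi>) \<partial>lborel) = ennreal kap"
  unfolding kap_def using decay_finite by (simp add: less_top)

lemma kap_nonneg: "kap \<ge> 0" by (simp add: kap_def)

text \<open>Cauchy--Schwarz with the weights \<open>wt \<xi>\<close> and \<open>wt (\<xi> - \<zeta>)\<close>. The parameter \<open>d\<close> allows for a
  gain when \<open>\<zeta>\<close> is restricted to high frequencies.\<close>

lemma correlation_bound: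
  fixes A B :: "real^3 \<Rightarrow> real"
  assumes [measurable]: "A \<in> borel_measurable borel" "B \<in> borel_measurable borel" "Z \<in> sets borel"
    and A: "\<And>\<xi>. A \<xi> \<ge> 0" and B: "\<And>\<xi>. B \<xi> \<ge> 0" and d: "d \<ge> 0"
    and Z: "\<And>\<xi> \<zeta>. \<zeta> \<in> Z \<Longrightarrow> 1 / ((wt \<xi>)\<^sup>2 * (wt (\<xi> - \<zeta>))\<^sup>2) \<le> d * (decay \<xi> + decay (\<xi> - \<zeta>))"
  shows "(\<integral>\<^sup>+\<zeta>. indicator Z \<zeta> * (\<integral>\<^sup>+\<xi>. ennreal (A \<xi> * B (\<xi> - \<zeta>)) \<partial>lborel)\<^sup>2 \<partial>lborel)
    \<le> ennreal (2 * d * kap) * (\<integral>\<^sup>+\<xi>. ennreal ((wt \<xi> * A \<xi>)\<^sup>2) \<partial>lborel) * (\<integral>\<^sup>+\<xi>. ennreal ((wt \<xi> * B \<xi>)\<^sup>2) \<partial>lborel)"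
proof -
  let ?a = "\<lambda>\<xi>. ennreal ((wt \<xi> * A \<xi>)\<^sup>2)" and ?b = "\<lambda>\<xi>. ennreal ((wt \<xi> * B \<xi>)\<^sup>2)"
  have cs: "indicator Z \<zeta> * (\<integral>\<^sup>+\<xi>. ennreal (A \<xi> * B (\<xi> - \<zeta>)) \<partial>lborel)\<^sup>2
    \<le> ennreal (2 * d * kap) * (\<integral>\<^sup>+\<xi>. ?a \<xi> * ?b (\<xi> - \<zeta>) \<partial>lborel)" for \<zeta>
  proof (cases "\<zeta> \<in> Z")
    case True
    have "(\<integral>\<^sup>+\<xi>. ennreal (A \<xi> * B (\<xi> - \<zeta>)) \<partial>lborel)
       = (\<integral>\<^sup>+\<xi>. ennreal ((wt \<xi> * A \<xi>) * (wt (\<xi> - \<zeta>) * B (\<xi> - \<zeta>))) * ennreal (1 / (wt \<xi> * wt (\<xi> - \<zeta>))) \<partial>lborel)"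
    proof (rule nn_integral_cong)
      fix \<xi>
      show "ennreal (A \<xi> * B (\<xi> - \<zeta>)) = ennreal ((wt \<xi> * A \<xi>) * (wt (\<xi> - \<zeta>) * B (\<xi> - \<zeta>))) * ennreal (1 / (wt \<xi> * wt (\<xi> - \<zeta>)))"
        using wt_pos[of \<xi>] wt_pos[of "\<xi> - \<zeta>"] A[of \<xi>] B[of "\<xi> - \<zeta>"]
        by (subst ennreal_mult[symmetric]) (auto simp: field_simps)
    qed
    then have "(\<integral>\<^sup>+\<xi>. ennreal (A \<xi> * B (\<xi> - \<zeta>)) \<partial>lborel)\<^sup>2 \<le>
       (\<integral>\<^sup>+\<xi>. (ennreal ((wt \<xi> * A \<xi>) * (wt (\<xi> - \<zeta>) * B (\<xi> - \<zeta>))))\<^sup>2 \<partial>lborel) * (\<integral>\<^sup>+\<xi>. (ennreal (1 / (wt \<xi> * wt (\<xi> - \<zeta>))))\<^sup>2 \<partial>lborel)"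
      by (simp only:) (rule Cauchy_Schwarz_nn_integral; measurable)
    also have e1: "(\<integral>\<^sup>+\<xi>. (ennreal ((wt \<xi> * A \<xi>) * (wt (\<xi> - \<zeta>) * B (\<xi> - \<zeta>))))\<^sup>2 \<partial>lborel) = (\<integral>\<^sup>+\<xi>. ?a \<xi> * ?b (\<xi> - \<zeta>) \<partial>lborel)"
    proof (rule nn_integral_cong)
      have sq: "(ennreal (x * y))\<^sup>2 = ennreal (x\<^sup>2) * ennreal (y\<^sup>2)" if "0 \<le> x" "0 \<le> y" for x y
        using that by (simp add: ennreal_power ennreal_mult[symmetric] power_mult_distrib)
      show "(ennreal ((wt \<xi> * A \<xi>) * (wt (\<xi> - \<zeta>) * B (\<xi> - \<zeta>))))\<^sup>2 = ?a \<xi> * ?b (\<xi> - \<zeta>)" for \<xi>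
        by (rule sq) (use A B wt_pos[THEN less_imp_le] in \<open>auto intro!: mult_nonneg_nonneg\<close>)
    qed
    finally have main: "(\<integral>\<^sup>+\<xi>. ennreal (A \<xi> * B (\<xi> - \<zeta>)) \<partial>lborel)\<^sup>2 \<le> (\<integral>\<^sup>+\<xi>. ?a \<xi> * ?b (\<xi> - \<zeta>) \<partial>lborel) * (\<integral>\<^sup>+\<xi>. (ennreal (1 / (wt \<xi> * wt (\<xi> - \<zeta>))))\<^sup>2 \<partial>lborel)" .
    have "(\<integral>\<^sup>+\<xi>. (ennreal (1 / (wt \<xi> * wt (\<xi> - \<zeta>))))\<^sup>2 \<partial>lborel) \<le> (\<integral>\<^sup>+\<xi>. ennreal d * (ennreal (decay \<xi>) + ennreal (decay (\<xi> - \<zeta>))) \<partial>lborel)"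
    proof (rule nn_integral_mono)
      fix \<xi>
      have "(ennreal (1 / (wt \<xi> * wt (\<xi> - \<zeta>))))\<^sup>2 = ennreal (1 / ((wt \<xi>)\<^sup>2 * (wt (\<xi> - \<zeta>))\<^sup>2))"
        using wt_pos[THEN less_imp_le] by (simp add: ennreal_power power_divide power_mult_distrib)
      also have "\<dots> \<le> ennreal (d * (decay \<xi> + decay (\<xi> - \<zeta>)))" by (intro ennreal_leI Z True)
      finally show "(ennreal (1 / (wt \<xi> * wt (\<xi> - \<zeta>))))\<^sup>2 \<le> ennreal d * (ennreal (decay \<xi>) + ennreal (decay (\<xi> - \<zeta>)))"
        using d decay_nonneg by (simp add: ennreal_mult)
    qed
    also have "\<dots> = ennreal d * (ennreal kap + ennreal kap)"
      using nn_integral_shift(2)[of "\<lambda>\<xi>. ennreal (decay \<xi>)" \<zeta>]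
      by (subst nn_integral_cmult, simp) (simp add: nn_integral_add nn_integral_decay)
    also have "\<dots> = ennreal (2 * d * kap)"
      using d kap_nonneg by (simp add: ennreal_mult ennreal_plus[symmetric] mult_2[symmetric] del: ennreal_plus) (simp add: ac_simps ennreal_mult[symmetric])
    finally have "(\<integral>\<^sup>+\<xi>. (ennreal (1 / (wt \<xi> * wt (\<xi> - \<zeta>))))\<^sup>2 \<partial>lborel) \<le> ennreal (2 * d * kap)" .
    from order_trans[OF main mult_left_mono[OF this]] show ?thesis using True by (simp add: mult.commute)
  qed simp
  have "(\<integral>\<^sup>+\<zeta>. indicator Z \<zeta> * (\<integral>\<^sup>+\<xi>. ennreal (A \<xi> * B (\<xi> - \<zeta>)) \<partial>lborel)\<^sup>2 \<partial>lborel)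
    \<le> (\<integral>\<^sup>+\<zeta>. ennreal (2 * d * kap) * (\<integral>\<^sup>+\<xi>. ?a \<xi> * ?b (\<xi> - \<zeta>) \<partial>lborel) \<partial>lborel)"
    by (rule nn_integral_mono) (rule cs)
  also have "\<dots> = ennreal (2 * d * kap) * (\<integral>\<^sup>+\<zeta>. \<integral>\<^sup>+\<xi>. ?a \<xi> * ?b (\<xi> - \<zeta>) \<partial>lborel \<partial>lborel)"
    by (rule nn_integral_cmult) measurable
  also have "(\<integral>\<^sup>+\<zeta>. \<integral>\<^sup>+\<xi>. ?a \<xi> * ?b (\<xi> - \<zeta>) \<partial>lborel \<partial>lborel) = (\<integral>\<^sup>+\<xi>. \<integral>\<^sup>+\<zeta>. ?a \<xi> * ?b (\<xi> - \<zeta>) \<partial>lborel \<partial>lborel)"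
    by (rule lborel_pair.Fubini'[symmetric]) measurable
  also have "\<dots> = (\<integral>\<^sup>+\<xi>. ?a \<xi> * (\<integral>\<^sup>+\<zeta>. ?b \<zeta> \<partial>lborel) \<partial>lborel)"
    by (intro nn_integral_cong) (simp add: nn_integral_cmult nn_integral_shift(3)[of ?b])
  also have "\<dots> = (\<integral>\<^sup>+\<xi>. ?a \<xi> \<partial>lborel) * (\<integral>\<^sup>+\<zeta>. ?b \<zeta> \<partial>lborel)"
    by (rule nn_integral_multc) measurable
  finally show ?thesis by (simp add: mult.assoc)
qed

text \<open>The larger weight has 2 powers to spend: 3/2 are traded down to the smaller weight,
  completing its exponent to 7/2, and the remaining 1/2 is paid against \<open>N\<close>.\<close>

lemma weights_le_decay:
  assumes x: "x \<ge> 1" and y: "y \<ge> (1::real)" and N: "N > 0" "x \<ge> N \<or> y \<ge> N"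
  shows "1 / (x\<^sup>2 * y\<^sup>2) \<le> N powr (- (1/2)) * (x powr (- (7/2)) + y powr (- (7/2)))"
proof -
  have main: "1 / (x\<^sup>2 * y\<^sup>2) \<le> N powr (- (1/2)) * x powr (- (7/2))" if "x \<le> y" "x \<ge> 1" "y \<ge> N" for x y :: real
  proof -
    have y0: "y > 0" "x > 0" using that by linarith+
    have "1 / (x\<^sup>2 * y\<^sup>2) = x powr (- 2) * (y powr (- (3/2)) * y powr (- (1/2)))"
      using y0 by (simp add: powr_add[symmetric] powr_minus_divide powr_numeral)
    also have "\<dots> \<le> x powr (- 2) * (x powr (- (3/2)) * N powr (- (1/2)))"
      using that y0 N by (intro mult_left_mono mult_mono powr_mono2') auto
    also have "\<dots> = N powr (- (1/2)) * x powr (- (7/2))"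
      using y0 by (simp add: powr_add[symmetric])
    finally show ?thesis .
  qed
  show ?thesis
  proof (cases "x \<le> y")
    case True
    then have "1 / (x\<^sup>2 * y\<^sup>2) \<le> N powr (- (1/2)) * x powr (- (7/2))" using main[of x y] x N by linarith
    also have "\<dots> \<le> N powr (- (1/2)) * (x powr (- (7/2)) + y powr (- (7/2)))" by (intro mult_left_mono) auto
    finally show ?thesis .
  next
    case False
    then have "1 / (y\<^sup>2 * x\<^sup>2) \<le> N powr (- (1/2)) * y powr (- (7/2))" using main[of y x] y N by linarith
    also have "\<dots> \<le> N powr (- (1/2)) * (x powr (- (7/2)) + y powr (- (7/2)))" by (intro mult_left_mono) auto
    finally show ?thesis by (simp add: mult.commute)
  qed
qed

lemma wt_ge_norm: "norm \<xi> \<le> wt \<xi>"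
  unfolding wt_def by (rule real_le_rsqrt) simp

lemma decay_all: "1 / ((wt \<xi>)\<^sup>2 * (wt \<eta>)\<^sup>2) \<le> 1 * (decay \<xi> + decay \<eta>)"
  using weights_le_decay[of "wt \<xi>" "wt \<eta>" 1] wt_ge_1 by (simp add: decay_def)

text \<open>By the triangle inequality a large \<open>\<zeta>\<close> forces one of the frequencies
  \<open>\<xi>\<close> and \<open>\<xi> - \<zeta>\<close> to be at least \<open>N\<close>.\<close>

lemma decay_high:
  assumes "N > 0" "norm \<zeta> \<ge> 2 * N"
  shows "1 / ((wt \<xi>)\<^sup>2 * (wt (\<xi> - \<zeta>))\<^sup>2) \<le> N powr (- (1/2)) * (decay \<xi> + decay (\<xi> - \<zeta>))"
proof -
  have "norm \<zeta> \<le> norm \<xi> + norm (\<xi> - \<zeta>)" using norm_triangle_ineq4[of \<xi> "\<xi> - \<zeta>"] by simp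
  then have "norm \<xi> \<ge> N \<or> norm (\<xi> - \<zeta>) \<ge> N" using assms by linarith
  then have "wt \<xi> \<ge> N \<or> wt (\<xi> - \<zeta>) \<ge> N" using wt_ge_norm order_trans by blast
  then show ?thesis unfolding decay_def by (intro weights_le_decay wt_ge_1 assms)
qed

lemma nn_wt_hat: "(\<integral>\<^sup>+\<xi>. ennreal ((wt \<xi> * cmod (hat u \<xi>))\<^sup>2) \<partial>lborel) = ennreal (plconst * (norm u)\<^sup>2)"
proof -
  have "(\<integral>\<^sup>+\<xi>. ennreal ((cmod (of_real (wt \<xi>) * hat u \<xi>))\<^sup>2) \<partial>lborel) = ennreal ((norm (Phi u))\<^sup>2)"
    unfolding Phi_def by (rule nn_norm_l2_of[OF wt_hat_square_integrable])
  then show ?thesis using plconst_pos wt_pos[THEN less_imp_le]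
    by (simp add: norm_mult norm_Phi power_mult_distrib abs_of_nonneg)
qed

section \<open>Transforms of products\<close>

lemma one_vec: "(\<chi> i. 1) * x + - y = x - (y :: real^3)"
  by (simp add: vec_eq_iff)

lemma FT_modulate:
  assumes g: "square_integrable g"
  shows "AE \<xi> in lborel. ft (\<lambda>x. cis (x \<bullet> \<zeta>) * g x) \<xi> = ft g (\<xi> - \<zeta>)"
proof -
  let ?m = "\<lambda>x. cis (x \<bullet> \<zeta>)"
  have m: "?m \<in> borel_measurable borel" "\<And>x. cmod (?m x) \<le> 1"
    using cis_inner_measurable[of "\<lambda>x. x" borel "\<lambda>x. - \<zeta>"] by auto
  have mg: "square_integrable (\<lambda>x. ?m x * g x)" by (rule square_integrable_cmult[OF g m])
  note t = trunc[OF g] and tl = trunc_nat_tendsto[OF g]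
  let ?f = "\<lambda>n x. ?m x * trunc (real n) g x"
  have ms: "square_integrable (?f n)" for n by (rule square_integrable_cmult[OF t(1) m])
  have mi: "integrable lborel (?f n)" for n
    by (rule Bochner_Integration.integrable_bound[OF t(2)[of "real n"]])
       (use square_integrable_measurable[OF ms[of n]] in \<open>auto simp: norm_mult\<close>)
  have "(\<lambda>n. l2_of (fourier (?f n))) \<longlonglongrightarrow> FT (l2_of (\<lambda>x. ?m x * g x))"
  proof (rule FT_tendsto[OF mi ms])
    show "(\<lambda>n. l2_of (?f n)) \<longlonglongrightarrow> l2_of (\<lambda>x. ?m x * g x)"
      unfolding l2_mul_l2_of[OF t(1) m, symmetric] l2_mul_l2_of[OF g m, symmetric]
      by (intro bounded_linear.tendsto[OF bounded_linear_l2_mul[OF m]] tl)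
  qed
  moreover have "fourier (?f n) = (\<lambda>\<xi>. fourier (trunc (real n) g) (\<xi> - \<zeta>))" for n
  proof
    fix \<xi>
    have "cis (x \<bullet> \<zeta>) * cis (- (x \<bullet> \<xi>)) = cis (- (x \<bullet> (\<xi> - \<zeta>)))" for x
      unfolding cis_mult by (rule arg_cong[where f = cis]) (simp add: inner_diff_right)
    then have eq: "?f n x * cis (- (x \<bullet> \<xi>)) = trunc (real n) g x * cis (- (x \<bullet> (\<xi> - \<zeta>)))" for x
      by (metis mult.assoc mult.commute)
    show "fourier (?f n) \<xi> = fourier (trunc (real n) g) (\<xi> - \<zeta>)" unfolding fourier_def eq ..
  qed
  moreover have "l2_of (\<lambda>\<xi>. fourier (trunc (real n) g) (\<xi> - \<zeta>)) = l2_comp (\<chi> i. 1) (- \<zeta>) (l2_of (fourier (trunc (real n) g)))" for n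
    using l2_comp_l2_of[of "\<chi> i. 1" "fourier (trunc (real n) g)" "- \<zeta>", OF _ fourier_L1_L2(1)[OF t(2,1)]]
    unfolding one_vec by simp
  ultimately have l1: "(\<lambda>n. l2_comp (\<chi> i. 1) (- \<zeta>) (l2_of (fourier (trunc (real n) g)))) \<longlonglongrightarrow> FT (l2_of (\<lambda>x. ?m x * g x))"
    by simp
  have bl: "bounded_linear (l2_comp (\<chi> i. 1) (- \<zeta>))"
  proof (rule bounded_linear_intro[where K = 1])
    show "l2_comp (\<chi> i. 1) (- \<zeta>) (u + v) = l2_comp (\<chi> i. 1) (- \<zeta>) u + l2_comp (\<chi> i. 1) (- \<zeta>) v"
      "l2_comp (\<chi> i. 1) (- \<zeta>) (r *\<^sub>R u) = r *\<^sub>R l2_comp (\<chi> i. 1) (- \<zeta>) u" for u v r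
      by (simp_all add: linear_add[OF linear_l2_comp] linear_cmul[OF linear_l2_comp])
    have "(norm u)\<^sup>2 = (norm (l2_comp (\<chi> i. 1) (- \<zeta>) u))\<^sup>2" for u
      using norm_l2_comp[of "\<chi> i. 1" u "- \<zeta>"] by (simp add: jac_def)
    then show "norm (l2_comp (\<chi> i. 1) (- \<zeta>) u) \<le> norm u * 1" for u by simp
  qed
  have l2: "(\<lambda>n. l2_comp (\<chi> i. 1) (- \<zeta>) (l2_of (fourier (trunc (real n) g)))) \<longlonglongrightarrow> l2_comp (\<chi> i. 1) (- \<zeta>) (FT (l2_of g))"
    by (intro bounded_linear.tendsto[OF bl] FT_tendsto t tl)
  have "FT (l2_of (\<lambda>x. ?m x * g x)) = l2_of (\<lambda>\<xi>. ft g (\<xi> - \<zeta>))"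
    using LIMSEQ_unique[OF l1 l2] unfolding l2_comp_def one_vec ft_def .
  moreover have "square_integrable (\<lambda>\<xi>. ft g (\<xi> - \<zeta>))"
    using square_integrable_coordinatewise[of "\<chi> i. 1" "ft g" "- \<zeta>", OF _ ft_square_integrable] unfolding one_vec by simp
  ultimately show ?thesis unfolding ft_def[of "\<lambda>x. ?m x * g x"] by (simp add: l2_fun_l2_of)
qed

lemma ft_shift_square_integrable: "square_integrable f \<Longrightarrow> square_integrable (\<lambda>\<xi>. f (\<xi> - \<zeta>))"
  for f :: "real^3 \<Rightarrow> 'b::euclidean_space"
  using square_integrable_coordinatewise[of "\<chi> i. 1" f "- \<zeta>"] unfolding one_vec by simp

text \<open>Parseval for \<open>f\<close> and a modulated \<open>g\<close>, modulation being
  translation on the transform side.\<close>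

lemma fourier_product:
  assumes f: "square_integrable f" and g: "square_integrable g"
  shows "plconst * fourier (\<lambda>x. f x * cnj (g x)) \<zeta> = (LINT \<xi>|lborel. ft f \<xi> * cnj (ft g (\<xi> - \<zeta>)))"
proof -
  have m: "(\<lambda>x. cis (x \<bullet> \<zeta>)) \<in> borel_measurable borel" "\<And>x. cmod (cis (x \<bullet> \<zeta>)) \<le> 1"
    using cis_inner_measurable[of "\<lambda>x. x" borel "\<lambda>x. - \<zeta>"] by auto
  have mg: "square_integrable (\<lambda>x. cis (x \<bullet> \<zeta>) * g x)" by (rule square_integrable_cmult[OF g m])
  have "fourier (\<lambda>x. f x * cnj (g x)) \<zeta> = (LINT x|lborel. f x * cnj (cis (x \<bullet> \<zeta>) * g x))"
    unfolding fourier_def by (simp add: cis_cnj ac_simps)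
  then have "plconst * fourier (\<lambda>x. f x * cnj (g x)) \<zeta> = (LINT \<xi>|lborel. ft f \<xi> * cnj (ft (\<lambda>x. cis (x \<bullet> \<zeta>) * g x) \<xi>))"
    using parseval[OF f mg] by simp
  also have "\<dots> = (LINT \<xi>|lborel. ft f \<xi> * cnj (ft g (\<xi> - \<zeta>)))"
  proof (rule integral_cong_AE)
    show "AE \<xi> in lborel. ft f \<xi> * cnj (ft (\<lambda>x. cis (x \<bullet> \<zeta>) * g x) \<xi>) = ft f \<xi> * cnj (ft g (\<xi> - \<zeta>))"
      using FT_modulate[OF g, of \<zeta>] by eventually_elim simp
  qed measurable
  finally show ?thesis .
qed

lemma FTa_l2_of:
  assumes a: "integrable lborel a" "square_integrable a"
  shows "FTa (l2_of a) = l2_of (\<lambda>x. fourier a (- x))"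
proof -
  have c: "integrable lborel (\<lambda>x. cnj (a x))" "square_integrable (\<lambda>x. cnj (a x))"
    using a by (auto intro: square_integrable_cnj)
  have "FTa (l2_of a) = l2_cnj (l2_of (fourier (\<lambda>x. cnj (a x))))"
    unfolding FTa_def l2_cnj_l2_of[OF a(2)] FT_l2_of[OF c] ..
  also have "\<dots> = l2_of (\<lambda>x. cnj (fourier (\<lambda>x. cnj (a x)) x))"
    by (rule l2_cnj_l2_of[OF fourier_L1_L2(1)[OF c]])
  finally show ?thesis by (simp add: fourier_cnj)
qed

text \<open>Inverse transform of the truncated transform. Integrability of the truncation makes
  these approximations bounded, so that their products are square integrable from the
  outset.\<close>

definition lowpass :: "nat \<Rightarrow> h1 \<Rightarrow> real^3 \<Rightarrow> complex" where
  "lowpass n u x = of_real (1 / plconst) * fourier (trunc (real n) (hat u)) (- x)"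

lemma lowpass:
  shows "square_integrable (lowpass n u)"
    "AE \<xi> in lborel. ft (lowpass n u) \<xi> = trunc (real n) (hat u) \<xi>"
    "\<exists>K. \<forall>x. cmod (lowpass n u x) \<le> K"
    "(\<lambda>n. l2_of (lowpass n u)) \<longlonglongrightarrow> l2_of (fun_of u)"
proof -
  note t = trunc[OF hat_square_integrable]
  have s: "square_integrable (\<lambda>x. fourier (trunc (real n) (hat u)) (- x))" for n
    by (rule square_integrable_refl[OF fourier_L1_L2(1)[OF t(2,1)]])
  have e: "lowpass n u = (\<lambda>x. (1 / plconst) *\<^sub>R fourier (trunc (real n) (hat u)) (- x))" for n
    by (simp add: fun_eq_iff lowpass_def scaleR_conv_of_real)
  have l: "l2_of (lowpass n u) = (1 / plconst) *\<^sub>R FTa (l2_of (trunc (real n) (hat u)))" for n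
    unfolding e l2_of_scaleR[OF s] FTa_l2_of[OF t(2,1)] ..
  show "square_integrable (lowpass n u)" unfolding e by (rule square_integrable_scaleR[OF s])
  have "FT (l2_of (lowpass n u)) = l2_of (trunc (real n) (hat u))"
    unfolding l using plconst_pos by (simp add: linear_cmul[OF linear_FT] FT_FTa)
  then show "AE \<xi> in lborel. ft (lowpass n u) \<xi> = trunc (real n) (hat u) \<xi>"
    unfolding ft_def by (simp add: l2_fun_l2_of[OF t(1)])
  show "\<exists>K. \<forall>x. cmod (lowpass n u x) \<le> K"
  proof (intro exI allI)
    fix x
    show "cmod (lowpass n u x) \<le> 1 / plconst * (LINT x|lborel. cmod (trunc (real n) (hat u) x))"
      unfolding lowpass_def norm_mult using plconst_pos norm_fourier_le[OF t(2)]
      by (simp add: norm_divide divide_right_mono)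
  qed
  have blFTa: "bounded_linear FTa"
    unfolding FTa_def[abs_def]
  proof (rule bounded_linear_compose[OF bounded_linear_l2_cnj bounded_linear_compose[OF _ bounded_linear_l2_cnj]])
    show "bounded_linear FT"
      by (rule bounded_linear_intro[where K = "sqrt plconst"])
         (simp_all add: linear_add[OF linear_FT] linear_cmul[OF linear_FT] norm_FT)
  qed
  have "(\<lambda>n. l2_of (lowpass n u)) \<longlonglongrightarrow> (1 / plconst) *\<^sub>R FTa (l2_of (hat u))"
    unfolding l by (intro tendsto_scaleR tendsto_const bounded_linear.tendsto[OF blFTa] trunc_nat_tendsto hat_square_integrable)
  also have "(1 / plconst) *\<^sub>R FTa (l2_of (hat u)) = l2_of (fun_of u)"
    unfolding hat_def l2_of_ft FTa_FT using plconst_pos by simp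
  finally show "(\<lambda>n. l2_of (lowpass n u)) \<longlonglongrightarrow> l2_of (fun_of u)" .
qed

text \<open>The transforms are only required to be majorised, so that frequency truncations can be
  inserted as well as the functions themselves. The set \<open>Z\<close> and the constant
  \<open>d\<close> let the same proof serve the global and the high-frequency estimate.\<close>

lemma fourier_product_bound:
  assumes f: "square_integrable f" and g: "square_integrable g" and Zs: "Z \<in> sets borel" and d: "d \<ge> 0"
    and Z: "\<And>\<xi> \<zeta>. \<zeta> \<in> Z \<Longrightarrow> 1 / ((wt \<xi>)\<^sup>2 * (wt (\<xi> - \<zeta>))\<^sup>2) \<le> d * (decay \<xi> + decay (\<xi> - \<zeta>))"
    and F: "AE \<xi> in lborel. cmod (ft f \<xi>) \<le> cmod (hat u \<xi>)" and G: "AE \<xi> in lborel. cmod (ft g \<xi>) \<le> cmod (hat v \<xi>)"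
  shows "(\<integral>\<^sup>+\<zeta>. indicator Z \<zeta> * ennreal ((cmod (fourier (\<lambda>x. f x * cnj (g x)) \<zeta>))\<^sup>2) \<partial>lborel)
    \<le> ennreal (2 * d * kap * (norm u)\<^sup>2 * (norm v)\<^sup>2)"
proof -
  have [measurable]: "Z \<in> sets borel" by (rule Zs)
  have pc: "ennreal (cmod (fourier (\<lambda>x. f x * cnj (g x)) \<zeta>)) \<le> ennreal (1 / plconst) * (\<integral>\<^sup>+\<xi>. ennreal (cmod (ft f \<xi>) * cmod (ft g (\<xi> - \<zeta>))) \<partial>lborel)" for \<zeta>
  proof -
    have "plconst * cmod (fourier (\<lambda>x. f x * cnj (g x)) \<zeta>) = cmod (LINT \<xi>|lborel. ft f \<xi> * cnj (ft g (\<xi> - \<zeta>)))"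
      unfolding fourier_product[OF f g, symmetric] using plconst_pos by (simp add: norm_mult)
    moreover have i: "integrable lborel (\<lambda>\<xi>. ft f \<xi> * cnj (ft g (\<xi> - \<zeta>)))"
      by (intro square_integrable_mult square_integrable_cnj ft_shift_square_integrable ft_square_integrable)
    ultimately have "ennreal (plconst * cmod (fourier (\<lambda>x. f x * cnj (g x)) \<zeta>)) \<le> (\<integral>\<^sup>+\<xi>. ennreal (cmod (ft f \<xi>) * cmod (ft g (\<xi> - \<zeta>))) \<partial>lborel)"
      using integral_norm_bound_ennreal[OF i] by (simp add: norm_mult)
    then have "ennreal (1 / plconst) * ennreal (plconst * cmod (fourier (\<lambda>x. f x * cnj (g x)) \<zeta>)) \<le> ennreal (1 / plconst) * (\<integral>\<^sup>+\<xi>. ennreal (cmod (ft f \<xi>) * cmod (ft g (\<xi> - \<zeta>))) \<partial>lborel)"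
      by (rule mult_left_mono) simp
    then show ?thesis using plconst_pos by (simp add: ennreal_mult[symmetric])
  qed
  have "(\<integral>\<^sup>+\<zeta>. indicator Z \<zeta> * ennreal ((cmod (fourier (\<lambda>x. f x * cnj (g x)) \<zeta>))\<^sup>2) \<partial>lborel)
    \<le> (\<integral>\<^sup>+\<zeta>. ennreal ((1 / plconst)\<^sup>2) * (indicator Z \<zeta> * (\<integral>\<^sup>+\<xi>. ennreal (cmod (ft f \<xi>) * cmod (ft g (\<xi> - \<zeta>))) \<partial>lborel)\<^sup>2) \<partial>lborel)"
  proof (rule nn_integral_mono)
    fix \<zeta>
    have "ennreal ((cmod (fourier (\<lambda>x. f x * cnj (g x)) \<zeta>))\<^sup>2) = (ennreal (cmod (fourier (\<lambda>x. f x * cnj (g x)) \<zeta>)))\<^sup>2"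
      by (simp add: ennreal_power)
    also have "\<dots> \<le> (ennreal (1 / plconst) * (\<integral>\<^sup>+\<xi>. ennreal (cmod (ft f \<xi>) * cmod (ft g (\<xi> - \<zeta>))) \<partial>lborel))\<^sup>2"
      by (rule power_mono[OF pc]) simp
    also have "\<dots> = ennreal ((1 / plconst)\<^sup>2) * (\<integral>\<^sup>+\<xi>. ennreal (cmod (ft f \<xi>) * cmod (ft g (\<xi> - \<zeta>))) \<partial>lborel)\<^sup>2"
      unfolding power_mult_distrib using plconst_pos by (simp add: ennreal_power)
    finally show "indicator Z \<zeta> * ennreal ((cmod (fourier (\<lambda>x. f x * cnj (g x)) \<zeta>))\<^sup>2) \<le>
      ennreal ((1 / plconst)\<^sup>2) * (indicator Z \<zeta> * (\<integral>\<^sup>+\<xi>. ennreal (cmod (ft f \<xi>) * cmod (ft g (\<xi> - \<zeta>))) \<partial>lborel)\<^sup>2)"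
      by (auto simp: indicator_def)
  qed
  also have "\<dots> = ennreal ((1 / plconst)\<^sup>2) * (\<integral>\<^sup>+\<zeta>. (indicator Z \<zeta> * (\<integral>\<^sup>+\<xi>. ennreal (cmod (ft f \<xi>) * cmod (ft g (\<xi> - \<zeta>))) \<partial>lborel)\<^sup>2) \<partial>lborel)"
    by (rule nn_integral_cmult) measurable
  also have "\<dots> \<le> ennreal ((1 / plconst)\<^sup>2) * (ennreal (2 * d * kap) * (\<integral>\<^sup>+\<xi>. ennreal ((wt \<xi> * cmod (ft f \<xi>))\<^sup>2) \<partial>lborel) * (\<integral>\<^sup>+\<xi>. ennreal ((wt \<xi> * cmod (ft g \<xi>))\<^sup>2) \<partial>lborel))"
    by (intro mult_left_mono correlation_bound d Z) auto
  also have "\<dots> \<le> ennreal ((1 / plconst)\<^sup>2) * (ennreal (2 * d * kap) * ennreal (plconst * (norm u)\<^sup>2) * ennreal (plconst * (norm v)\<^sup>2))"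
  proof (intro mult_left_mono mult_mono)
    show "(\<integral>\<^sup>+\<xi>. ennreal ((wt \<xi> * cmod (ft f \<xi>))\<^sup>2) \<partial>lborel) \<le> ennreal (plconst * (norm u)\<^sup>2)"
      unfolding nn_wt_hat[symmetric]
      by (rule nn_integral_mono_AE) (use F in eventually_elim, auto intro!: ennreal_leI power_mono mult_left_mono mult_nonneg_nonneg wt_pos[THEN less_imp_le])
    show "(\<integral>\<^sup>+\<xi>. ennreal ((wt \<xi> * cmod (ft g \<xi>))\<^sup>2) \<partial>lborel) \<le> ennreal (plconst * (norm v)\<^sup>2)"
      unfolding nn_wt_hat[symmetric]
      by (rule nn_integral_mono_AE) (use G in eventually_elim, auto intro!: ennreal_leI power_mono mult_left_mono mult_nonneg_nonneg wt_pos[THEN less_imp_le])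
  qed auto
  also have "\<dots> = ennreal ((1 / plconst)\<^sup>2 * (2 * d * kap * (plconst * (norm u)\<^sup>2) * (plconst * (norm v)\<^sup>2)))"
    using d kap_nonneg plconst_pos by (simp add: ennreal_mult)
  also have "(1 / plconst)\<^sup>2 * (2 * d * kap * (plconst * (norm u)\<^sup>2) * (plconst * (norm v)\<^sup>2)) = 2 * d * kap * (norm u)\<^sup>2 * (norm v)\<^sup>2"
    using plconst_pos by (simp add: power2_eq_square)
  finally show ?thesis .
qed

text \<open>Plancherel for a product presupposes its square integrability, so it is applied to
  low-pass approximations. Their bounds are uniform, and Fatou's lemma along almost everywhere
  convergent subsequences passes to the limit.\<close>

lemma product_L2:
  shows "square_integrable (\<lambda>x. fun_of u x * cnj (fun_of v x))"
    "(LINT x|lborel. (cmod (fun_of u x * cnj (fun_of v x)))\<^sup>2) \<le> 2 * kap / plconst * (norm u)\<^sup>2 * (norm v)\<^sup>2"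
proof -
  have bd: "(\<integral>\<^sup>+x. ennreal ((cmod (lowpass m u x * cnj (lowpass n v x)))\<^sup>2) \<partial>lborel) \<le> ennreal (2 * kap / plconst * (norm u)\<^sup>2 * (norm v)\<^sup>2)" for m n
  proof -
    let ?p = "\<lambda>x. lowpass m u x * cnj (lowpass n v x)"
    obtain K where K: "\<And>x. cmod (lowpass m u x) \<le> K" using lowpass(3) by metis
    have p1: "integrable lborel ?p" by (intro square_integrable_mult square_integrable_cnj lowpass)
    have p2: "square_integrable ?p"
      by (rule square_integrable_cmult[OF square_integrable_cnj[OF lowpass(1)] square_integrable_measurable[OF lowpass(1)] K])
    have le: "AE \<xi> in lborel. cmod (ft (lowpass m u) \<xi>) \<le> cmod (hat u \<xi>)" for m u
      using lowpass(2)[of m u] by eventually_elim (auto simp: trunc_def indicator_def)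
    have "ennreal (plconst * (norm (l2_of ?p))\<^sup>2) = ennreal ((norm (l2_of (fourier ?p)))\<^sup>2)"
      using plconst_pos by (simp add: fourier_L1_L2(2)[OF p1 p2] power_mult_distrib)
    also have "\<dots> = (\<integral>\<^sup>+\<zeta>. indicator UNIV \<zeta> * ennreal ((cmod (fourier ?p \<zeta>))\<^sup>2) \<partial>lborel)"
      using nn_norm_l2_of[OF fourier_L1_L2(1)[OF p1 p2]] by simp
    also have "\<dots> \<le> ennreal (2 * 1 * kap * (norm u)\<^sup>2 * (norm v)\<^sup>2)"
      by (rule fourier_product_bound[OF lowpass(1) lowpass(1) _ _ _ le le]) (use decay_all in auto)
    finally have "plconst * (norm (l2_of ?p))\<^sup>2 \<le> 2 * kap * (norm u)\<^sup>2 * (norm v)\<^sup>2"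
      using kap_nonneg by simp
    then have "(norm (l2_of ?p))\<^sup>2 \<le> 2 * kap / plconst * (norm u)\<^sup>2 * (norm v)\<^sup>2"
      using plconst_pos by (simp add: field_simps)
    then show ?thesis unfolding nn_norm_l2_of[OF p2] by (rule ennreal_leI)
  qed
  obtain r where r: "strict_mono r" "AE x in lborel. (\<lambda>n. lowpass (r n) u x) \<longlonglongrightarrow> fun_of u x"
    using l2_tendsto_AE_subseq[OF lowpass(1) fun_of_square_integrable lowpass(4)] by blast
  obtain s where s: "strict_mono s" "AE x in lborel. (\<lambda>n. lowpass (s n) v x) \<longlonglongrightarrow> fun_of v x"
    using l2_tendsto_AE_subseq[OF lowpass(1) fun_of_square_integrable lowpass(4)] by blast
  have [measurable]: "lowpass n u \<in> borel_measurable borel" for n u by (rule square_integrable_measurable[OF lowpass(1)])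
  have "(\<integral>\<^sup>+x. ennreal ((cmod (fun_of u x * cnj (fun_of v x)))\<^sup>2) \<partial>lborel)
     = (\<integral>\<^sup>+x. liminf (\<lambda>n. ennreal ((cmod (lowpass (r n) u x * cnj (lowpass (s n) v x)))\<^sup>2)) \<partial>lborel)"
  proof (rule nn_integral_cong_AE)
    show "AE x in lborel. ennreal ((cmod (fun_of u x * cnj (fun_of v x)))\<^sup>2) = liminf (\<lambda>n. ennreal ((cmod (lowpass (r n) u x * cnj (lowpass (s n) v x)))\<^sup>2))"
      using r(2) s(2)
    proof eventually_elim
      case (elim x)
      have "(\<lambda>n. ennreal ((cmod (lowpass (r n) u x * cnj (lowpass (s n) v x)))\<^sup>2)) \<longlonglongrightarrow> ennreal ((cmod (fun_of u x * cnj (fun_of v x)))\<^sup>2)"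
        by (intro tendsto_intros elim tendsto_ennrealI)
      then show ?case by (intro lim_imp_Liminf[symmetric]) simp_all
    qed
  qed
  also have "\<dots> \<le> liminf (\<lambda>n. \<integral>\<^sup>+x. ennreal ((cmod (lowpass (r n) u x * cnj (lowpass (s n) v x)))\<^sup>2) \<partial>lborel)"
    by (rule nn_integral_liminf) measurable
  also have "\<dots> \<le> ennreal (2 * kap / plconst * (norm u)\<^sup>2 * (norm v)\<^sup>2)"
    by (rule Liminf_le) (use bd in \<open>auto intro!: always_eventually\<close>)
  finally have b: "(\<integral>\<^sup>+x. ennreal ((cmod (fun_of u x * cnj (fun_of v x)))\<^sup>2) \<partial>lborel) \<le> ennreal (2 * kap / plconst * (norm u)\<^sup>2 * (norm v)\<^sup>2)" .
  show si: "square_integrable (\<lambda>x. fun_of u x * cnj (fun_of v x))"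
    unfolding square_integrable_nn using b by (auto simp: less_top[symmetric] top_unique)
  show "(LINT x|lborel. (cmod (fun_of u x * cnj (fun_of v x)))\<^sup>2) \<le> 2 * kap / plconst * (norm u)\<^sup>2 * (norm v)\<^sup>2"
  proof -
    have "0 \<le> 2 * kap / plconst * (norm u)\<^sup>2 * (norm v)\<^sup>2" using kap_nonneg plconst_pos by simp
    then show ?thesis using b unfolding nn_norm_l2_of[OF si] norm_l2_of[OF si, symmetric] by simp
  qed
qed

text \<open>The real part of u times conjugate v: bilinear and symmetric over the reals, with
  \<open>prodR u u\<close> equal to |u|^2, hence suited to differentiating the energy.\<close>

definition prodR :: "h1 \<Rightarrow> h1 \<Rightarrow> l2" where
  "prodR u v = l2_of (\<lambda>x. of_real (fun_of u x \<bullet> fun_of v x))"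

lemma prodR_square_integrable: "square_integrable (\<lambda>x. fun_of u x \<bullet> fun_of v x)"
proof (rule square_integrable_bound[OF product_L2(1)[of u v], where C = 1])
  have "\<bar>a \<bullet> b\<bar> \<le> cmod (a * cnj b)" for a b :: complex
    using Cauchy_Schwarz_ineq2[of a b] by (simp add: norm_mult)
  then show "AE x in lborel. norm (fun_of u x \<bullet> fun_of v x) \<le> 1 * cmod (fun_of u x * cnj (fun_of v x))" by simp
qed measurable

lemmas prodR_si = square_integrable_of_real[OF prodR_square_integrable]

lemma norm_prodR: "norm (prodR u v) \<le> sqrt (2 * kap / plconst) * norm u * norm v"
proof -
  have "(norm (prodR u v))\<^sup>2 = (LINT x|lborel. (cmod (of_real (fun_of u x \<bullet> fun_of v x)))\<^sup>2)"
    unfolding prodR_def by (rule norm_l2_of[OF prodR_si])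
  also have "\<dots> \<le> (LINT x|lborel. (cmod (fun_of u x * cnj (fun_of v x)))\<^sup>2)"
  proof (rule integral_mono)
    show "integrable lborel (\<lambda>x. (cmod (complex_of_real (fun_of u x \<bullet> fun_of v x)))\<^sup>2)"
      using prodR_si[of u v] by (simp add: square_integrable_def)
    show "integrable lborel (\<lambda>x. (cmod (fun_of u x * cnj (fun_of v x)))\<^sup>2)"
      using product_L2(1)[of u v] by (simp add: square_integrable_def)
    show "(cmod (complex_of_real (fun_of u x \<bullet> fun_of v x)))\<^sup>2 \<le> (cmod (fun_of u x * cnj (fun_of v x)))\<^sup>2" for x
      using Cauchy_Schwarz_ineq2[of "fun_of u x" "fun_of v x"] by (intro power_mono) (simp_all add: norm_mult)
  qed
  also have "\<dots> \<le> 2 * kap / plconst * (norm u)\<^sup>2 * (norm v)\<^sup>2" by (rule product_L2(2))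
  also have "\<dots> = (sqrt (2 * kap / plconst) * norm u * norm v)\<^sup>2"
    using kap_nonneg plconst_pos by (simp add: power_mult_distrib)
  finally show ?thesis
    by (rule power2_le_imp_le) (use kap_nonneg plconst_pos in simp)
qed

lemma prodR_commute: "prodR u v = prodR v u"
  by (simp add: prodR_def inner_commute)

lemma prodR_add: "prodR (u + v) w = prodR u w + prodR v w"
  unfolding prodR_def l2_of_add[OF prodR_si prodR_si, symmetric]
  by (rule l2_of_cong[OF prodR_si square_integrable_add[OF prodR_si prodR_si]])
     (use fun_of_plus[of u v] in eventually_elim, simp add: inner_add_left)

lemma prodR_scaleR: "prodR (c *\<^sub>R u) w = c *\<^sub>R prodR u w"
  unfolding prodR_def l2_of_scaleR[OF prodR_si, symmetric]
  by (rule l2_of_cong[OF prodR_si square_integrable_scaleR[OF prodR_si]])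
     (use fun_of_scaleR[of c u] in eventually_elim, simp, simp add: scaleR_conv_of_real)

lemma bounded_bilinear_prodR: "bounded_bilinear prodR"
proof
  show "prodR (a + a') b = prodR a b + prodR a' b" for a a' b by (rule prodR_add)
  show "prodR a (b + b') = prodR a b + prodR a b'" for a b b'
    unfolding prodR_commute[of a] by (rule prodR_add)
  show "prodR (r *\<^sub>R a) b = r *\<^sub>R prodR a b" for r a b by (rule prodR_scaleR)
  show "prodR a (r *\<^sub>R b) = r *\<^sub>R prodR a b" for r a b
    unfolding prodR_commute[of a] by (rule prodR_scaleR)
  show "\<exists>K. \<forall>a b. norm (prodR a b) \<le> norm a * norm b * K"
    using norm_prodR by (intro exI[of _ "sqrt (2 * kap / plconst)"]) (simp add: ac_simps)
qed

lemma bounded_linear_FT: "bounded_linear FT"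
  by (rule bounded_linear_intro[where K = "sqrt plconst"])
     (simp_all add: linear_add[OF linear_FT] linear_cmul[OF linear_FT] norm_FT)

lemma bounded_linear_FTa: "bounded_linear FTa"
  unfolding FTa_def[abs_def]
  by (intro bounded_linear_compose[OF bounded_linear_l2_cnj bounded_linear_compose[OF bounded_linear_FT bounded_linear_l2_cnj]])

section \<open>The energy\<close>

text \<open>Multiplier of the whole quartic interaction, with \<open>a\<close> and \<open>b\<close>
  in the roles of the two coupling constants.\<close>

definition symb :: "real \<Rightarrow> real \<Rightarrow> real^3 \<Rightarrow> real" where
  "symb a b \<xi> = a + b * dipolar_symbol \<xi>"

lemma symb_measurable [measurable]: "symb a b \<in> borel_measurable borel"
  unfolding symb_def[abs_def] by measurable

lemma abs_symb_le: "\<bar>symb a b \<xi>\<bar> \<le> \<bar>a\<bar> + \<bar>b\<bar> * (4 * pi)"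
proof -
  have "\<bar>symb a b \<xi>\<bar> \<le> \<bar>a\<bar> + \<bar>b\<bar> * \<bar>dipolar_symbol \<xi>\<bar>"
    unfolding symb_def using abs_triangle_ineq[of a "b * dipolar_symbol \<xi>"] by (simp add: abs_mult)
  also have "\<dots> \<le> \<bar>a\<bar> + \<bar>b\<bar> * (4 * pi)" by (intro add_left_mono mult_left_mono abs_dipolar_symbol_le) simp
  finally show ?thesis .
qed

lemma symb_complex:
  "(\<lambda>\<xi>. complex_of_real (symb a b \<xi>)) \<in> borel_measurable borel" "cmod (complex_of_real (symb a b \<xi>)) \<le> \<bar>a\<bar> + \<bar>b\<bar> * (4 * pi)"
  using abs_symb_le by auto

text \<open>The operator W -> a W + b (K * W). Up to the factor \<open>plconst\<close>,
  \<open>FTa\<close> inverts \<open>FT\<close>.\<close>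

definition Top :: "real \<Rightarrow> real \<Rightarrow> l2 \<Rightarrow> l2" where
  "Top a b W = (1 / plconst) *\<^sub>R FTa (l2_mul (\<lambda>\<xi>. of_real (symb a b \<xi>)) (FT W))"

lemma bounded_linear_Top: "bounded_linear (Top a b)"
  unfolding Top_def[abs_def]
  by (intro bounded_linear_const_scaleR bounded_linear_compose[OF bounded_linear_FTa]
      bounded_linear_compose[OF bounded_linear_l2_mul[OF symb_complex] bounded_linear_FT])

lemma FT_Top: "FT (Top a b W) = l2_mul (\<lambda>\<xi>. of_real (symb a b \<xi>)) (FT W)"
  unfolding Top_def using plconst_pos by (simp add: linear_cmul[OF linear_FT] FT_FTa)

lemma inner_l2_mul_real:
  assumes m: "m \<in> borel_measurable borel" "\<And>x. cmod (complex_of_real (m x)) \<le> C"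
  shows "l2_mul (\<lambda>x. of_real (m x)) u \<bullet> v = (LINT x|lborel. m x * (l2_fun u x \<bullet> l2_fun v x))"
proof -
  have m': "(\<lambda>x. complex_of_real (m x)) \<in> borel_measurable borel" using m(1) by measurable
  note s = square_integrable_cmult[OF l2_fun_square_integrable[of u] m' m(2)]
  have "l2_mul (\<lambda>x. of_real (m x)) u \<bullet> v = l2_of (\<lambda>x. of_real (m x) * l2_fun u x) \<bullet> l2_of (l2_fun v)"
    by (simp add: l2_mul_def)
  also have "\<dots> = (LINT x|lborel. (of_real (m x) * l2_fun u x) \<bullet> l2_fun v x)"
    by (rule inner_l2_of[OF s l2_fun_square_integrable])
  also have "\<dots> = (LINT x|lborel. m x * (l2_fun u x \<bullet> l2_fun v x))"
    by (simp add: inner_complex_def algebra_simps)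
  finally show ?thesis .
qed

lemma inner_Top: "plconst * (Top a b U \<bullet> W) = (LINT \<xi>|lborel. symb a b \<xi> * (l2_fun (FT U) \<xi> \<bullet> l2_fun (FT W) \<xi>))"
  unfolding inner_FT[symmetric] FT_Top by (rule inner_l2_mul_real[OF symb_measurable symb_complex(2)])

lemma Top_selfadjoint: "Top a b U \<bullet> W = U \<bullet> Top a b W"
proof -
  have "plconst * (Top a b U \<bullet> W) = plconst * (Top a b W \<bullet> U)"
    unfolding inner_Top by (simp add: inner_commute)
  then show ?thesis using plconst_pos by (simp add: inner_commute)
qed

text \<open>The local and the dipolar term together are one quadratic form of the density
  |u|^2.\<close>

definition quart :: "real \<Rightarrow> real \<Rightarrow> h1 \<Rightarrow> real" where
  "quart a b u = Top a b (prodR u u) \<bullet> prodR u u"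

lemma abs_sq_eq: "abs_sq u x = fun_of u x \<bullet> fun_of u x"
  by (simp add: abs_sq_def dot_square_norm)

lemma l2_of_dipolar_conv:
  assumes f: "square_integrable f"
  shows "l2_of (\<lambda>x. of_real (dipolar_conv f x)) = Top 0 1 (l2_of (\<lambda>x. of_real (f x)))"
proof -
  have s: "square_integrable (\<lambda>\<xi>. of_real (symb 0 1 \<xi>) * ft (\<lambda>x. of_real (f x)) \<xi>)"
    by (rule square_integrable_cmult[OF ft_square_integrable symb_complex])
  have "FT (l2_of (\<lambda>x. of_real (dipolar_conv f x))) = l2_of (ft (\<lambda>x. of_real (dipolar_conv f x)))"
    by (simp add: l2_of_ft)
  also have "\<dots> = l2_of (\<lambda>\<xi>. of_real (symb 0 1 \<xi>) * ft (\<lambda>x. of_real (f x)) \<xi>)"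
    by (rule l2_of_cong[OF ft_square_integrable s]) (use dipolar_conv(2)[OF f] in eventually_elim, simp add: symb_def)
  also have "\<dots> = FT (Top 0 1 (l2_of (\<lambda>x. of_real (f x))))"
    unfolding FT_Top by (simp add: l2_mul_def ft_def)
  finally show ?thesis by (simp add: FT_inj)
qed

lemma Top_split: "Top a b W = a *\<^sub>R W + b *\<^sub>R Top 0 1 W"
proof -
  have "FT (Top a b W) = a *\<^sub>R FT W + b *\<^sub>R FT (Top 0 1 W)"
  proof -
    note s = square_integrable_cmult[OF l2_fun_square_integrable[of "FT W"] symb_complex]
    have "a *\<^sub>R FT W + b *\<^sub>R FT (Top 0 1 W) = l2_of (\<lambda>\<xi>. a *\<^sub>R l2_fun (FT W) \<xi> + b *\<^sub>R (of_real (symb 0 1 \<xi>) * l2_fun (FT W) \<xi>))"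
      unfolding FT_Top l2_mul_def l2_of_add[OF square_integrable_scaleR[OF l2_fun_square_integrable] square_integrable_scaleR[OF s]]
        l2_of_scaleR[OF l2_fun_square_integrable] l2_of_scaleR[OF s] by simp
    also have "(\<lambda>\<xi>. a *\<^sub>R l2_fun (FT W) \<xi> + b *\<^sub>R (of_real (symb 0 1 \<xi>) * l2_fun (FT W) \<xi>)) = (\<lambda>\<xi>. of_real (symb a b \<xi>) * l2_fun (FT W) \<xi>)"
      by (simp add: fun_eq_iff symb_def scaleR_conv_of_real[where 'a = complex] algebra_simps)
    finally show ?thesis by (simp add: FT_Top l2_mul_def)
  qed
  then have "FT (Top a b W) = FT (a *\<^sub>R W + b *\<^sub>R Top 0 1 W)"
    by (simp add: linear_add[OF linear_FT] linear_cmul[OF linear_FT])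
  then show ?thesis by (simp add: FT_inj)
qed

lemma energy_eq: "energy a b u = 1/2 * kinetic u + 1/2 * quart a b u"
proof -
  have r: "prodR u u = l2_of (\<lambda>x. of_real (abs_sq u x))" by (simp add: prodR_def abs_sq_eq)
  have s: "square_integrable (abs_sq u)" using prodR_square_integrable[of u u] by (simp add: abs_sq_eq[abs_def])
  have e4: "(LINT x|lborel. (cmod (fun_of u x)) ^ 4) = prodR u u \<bullet> prodR u u"
    unfolding r inner_l2_of[OF square_integrable_of_real[OF s] square_integrable_of_real[OF s]]
    by (simp add: abs_sq_def inner_complex_def power_mult[symmetric] power2_eq_square[symmetric])
  have ed: "(LINT x|lborel. dipolar_conv (abs_sq u) x * abs_sq u x) = Top 0 1 (prodR u u) \<bullet> prodR u u"
    unfolding r l2_of_dipolar_conv[OF s, symmetric]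
      inner_l2_of[OF square_integrable_of_real[OF dipolar_conv(1)[OF s]] square_integrable_of_real[OF s]]
    by (simp add: inner_complex_def)
  show ?thesis unfolding energy_def e4 ed quart_def Top_split[of a b]
    by (simp add: inner_add_left algebra_simps add_divide_distrib)
qed

section \<open>Mass, kinetic energy and products in terms of transforms\<close>

definition emb :: "h1 \<Rightarrow> l2" where "emb u = l2_of (fun_of u)"

lemma l2_inner_eq: "l2_inner u v = emb u \<bullet> emb v"
  unfolding l2_inner_def emb_def by (rule inner_l2_of[OF fun_of_square_integrable fun_of_square_integrable, symmetric])

lemma mass_eq_inner: "mass u = l2_inner u u"
  unfolding mass_def l2_inner_def by (simp add: abs_sq_eq[abs_def])

lemma kinetic_eq_inner: "kinetic u = u \<bullet> u - l2_inner u u"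
  unfolding kinetic_def inner_h1_def l2_inner_def by (simp add: power2_norm_eq_inner)

lemma mass_nonneg: "mass u \<ge> 0" by (simp add: mass_eq_inner l2_inner_eq)

lemma kinetic_nonneg: "kinetic u \<ge> 0" unfolding kinetic_def by (simp add: integral_nonneg_AE)

lemma norm_h1_eq: "(norm u)\<^sup>2 = mass u + kinetic u"
  by (simp add: power2_norm_eq_inner kinetic_eq_inner mass_eq_inner)

lemma bounded_linear_emb: "bounded_linear emb"
proof (rule bounded_linear_intro[where K = 1])
  note s = fun_of_square_integrable
  show "emb (u + v) = emb u + emb v" for u v
    unfolding emb_def l2_of_add[OF s s, symmetric] by (rule l2_of_cong[OF s square_integrable_add[OF s s] fun_of_plus])
  show "emb (r *\<^sub>R u) = r *\<^sub>R emb u" for r u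
    unfolding emb_def l2_of_scaleR[OF s, symmetric] by (rule l2_of_cong[OF s square_integrable_scaleR[OF s] fun_of_scaleR])
  show "norm (emb u) \<le> norm u * 1" for u
  proof -
    have "(norm (emb u))\<^sup>2 \<le> (norm u)\<^sup>2"
      using kinetic_nonneg[of u] by (simp add: norm_h1_eq mass_eq_inner l2_inner_eq power2_norm_eq_inner)
    then show ?thesis by simp
  qed
qed

lemma mass_hat: "plconst * mass u = (LINT \<xi>|lborel. (cmod (hat u \<xi>))\<^sup>2)"
proof -
  have "plconst * mass u = (norm (FT (emb u)))\<^sup>2"
    using plconst_pos by (simp add: mass_eq_inner l2_inner_eq norm_FT power_mult_distrib power2_norm_eq_inner[symmetric])
  also have "FT (emb u) = l2_of (hat u)" by (simp add: emb_def hat_def l2_of_ft)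
  also have "(norm (l2_of (hat u)))\<^sup>2 = (LINT \<xi>|lborel. (cmod (hat u \<xi>))\<^sup>2)" by (rule norm_l2_of[OF hat_square_integrable])
  finally show ?thesis .
qed

lemma norm_hat_square_integrable: "square_integrable (\<lambda>\<xi>. of_real (norm \<xi>) * hat u \<xi>)"
proof (rule square_integrable_bound[OF wt_hat_square_integrable[of u], where C = 1])
  have "norm \<xi> \<le> \<bar>wt \<xi>\<bar>" for \<xi> using wt_ge_norm[of \<xi>] by linarith
  then show "AE \<xi> in lborel. cmod (of_real (norm \<xi>) * hat u \<xi>) \<le> 1 * cmod (of_real (wt \<xi>) * hat u \<xi>)"
    by (intro AE_I2) (simp add: norm_mult mult_right_mono)
qed measurable

lemma kinetic_hat: "plconst * kinetic u = (LINT \<xi>|lborel. (norm \<xi>)\<^sup>2 * (cmod (hat u \<xi>))\<^sup>2)"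
proof -
  have i1: "integrable lborel (\<lambda>\<xi>. (cmod (hat u \<xi>))\<^sup>2)" using hat_square_integrable by (simp add: square_integrable_def)
  have i2: "integrable lborel (\<lambda>\<xi>. (norm \<xi>)\<^sup>2 * (cmod (hat u \<xi>))\<^sup>2)"
    using norm_hat_square_integrable[of u] by (simp add: square_integrable_def norm_mult power_mult_distrib)
  have "plconst * (mass u + kinetic u) = (norm (Phi u))\<^sup>2"
    using plconst_pos by (simp add: norm_Phi power_mult_distrib norm_h1_eq)
  also have "\<dots> = (LINT \<xi>|lborel. (cmod (of_real (wt \<xi>) * hat u \<xi>))\<^sup>2)"
    unfolding Phi_def by (rule norm_l2_of[OF wt_hat_square_integrable])
  also have "\<dots> = (LINT \<xi>|lborel. (cmod (hat u \<xi>))\<^sup>2 + (norm \<xi>)\<^sup>2 * (cmod (hat u \<xi>))\<^sup>2)"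
    by (simp add: norm_mult power_mult_distrib wt_power2 distrib_right)
  also have "\<dots> = plconst * mass u + (LINT \<xi>|lborel. (norm \<xi>)\<^sup>2 * (cmod (hat u \<xi>))\<^sup>2)"
    using i1 i2 by (simp add: mass_hat)
  finally show ?thesis by (simp add: distrib_left)
qed

text \<open>Companion of \<open>prodR\<close>: its transform is an explicit correlation of
  \<open>hat u\<close> and \<open>hat v\<close>, and against real functions both products pair
  alike.\<close>

definition prodC :: "h1 \<Rightarrow> h1 \<Rightarrow> l2" where "prodC u v = l2_of (\<lambda>x. fun_of u x * cnj (fun_of v x))"

definition prodhat :: "h1 \<Rightarrow> h1 \<Rightarrow> real^3 \<Rightarrow> complex" where
  "prodhat u v = fourier (\<lambda>x. fun_of u x * cnj (fun_of v x))"

lemma product_L1: "integrable lborel (\<lambda>x. fun_of u x * cnj (fun_of v x))"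
  by (intro square_integrable_mult square_integrable_cnj fun_of_square_integrable)

lemma prodhat_square_integrable: "square_integrable (prodhat u v)"
  unfolding prodhat_def by (rule fourier_L1_L2(1)[OF product_L1 product_L2(1)])

lemma prodhat_measurable [measurable]: "prodhat u v \<in> borel_measurable borel"
  by (rule square_integrable_measurable[OF prodhat_square_integrable])

lemma FT_prodC: "FT (prodC u v) = l2_of (prodhat u v)"
  unfolding prodC_def prodhat_def by (rule FT_l2_of[OF product_L1 product_L2(1)])

lemma prodhat_eq: "plconst * prodhat u v \<zeta> = (LINT \<xi>|lborel. hat u \<xi> * cnj (hat v (\<xi> - \<zeta>)))"
  unfolding prodhat_def hat_def by (rule fourier_product[OF fun_of_square_integrable fun_of_square_integrable])

lemma prodR_self: "prodR u u = prodC u u"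
  unfolding prodR_def prodC_def by (simp add: dot_square_norm complex_norm_square del: of_real_power)

lemma norm_prodC: "norm (prodC u v) \<le> sqrt (2 * kap / plconst) * norm u * norm v"
proof -
  have "(norm (prodC u v))\<^sup>2 \<le> (sqrt (2 * kap / plconst) * norm u * norm v)\<^sup>2"
    unfolding prodC_def norm_l2_of[OF product_L2(1)]
    using product_L2(2)[of u v] kap_nonneg plconst_pos by (simp add: power_mult_distrib)
  then show ?thesis by (rule power2_le_imp_le) (use kap_nonneg plconst_pos in simp)
qed

lemma inner_prodC_real:
  assumes f: "square_integrable (f :: real^3 \<Rightarrow> real)"
  shows "l2_of (\<lambda>x. of_real (f x)) \<bullet> prodC u v = l2_of (\<lambda>x. of_real (f x)) \<bullet> prodR u v"
  unfolding prodC_def prodR_def inner_l2_of[OF square_integrable_of_real[OF f] product_L2(1)]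
    inner_l2_of[OF square_integrable_of_real[OF f] prodR_si]
  by (simp add: inner_complex_def)

lemma quart_eq: "plconst * quart a b u = (LINT \<zeta>|lborel. symb a b \<zeta> * (cmod (prodhat u u \<zeta>))\<^sup>2)"
proof -
  have "plconst * quart a b u = (LINT \<zeta>|lborel. symb a b \<zeta> * (l2_fun (FT (prodC u u)) \<zeta> \<bullet> l2_fun (FT (prodC u u)) \<zeta>))"
    unfolding quart_def prodR_self by (rule inner_Top)
  also have "\<dots> = (LINT \<zeta>|lborel. symb a b \<zeta> * (cmod (prodhat u u \<zeta>))\<^sup>2)"
  proof (rule integral_cong_AE)
    show "AE \<zeta> in lborel. symb a b \<zeta> * (l2_fun (FT (prodC u u)) \<zeta> \<bullet> l2_fun (FT (prodC u u)) \<zeta>) = symb a b \<zeta> * (cmod (prodhat u u \<zeta>))\<^sup>2"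
      using l2_fun_l2_of[OF prodhat_square_integrable[of u u]] unfolding FT_prodC
      by eventually_elim (simp add: dot_square_norm)
  qed measurable
  finally show ?thesis .
qed

text \<open>Applied to \<open>hat v\<close>, this is up to \<open>plconst\<close> the transform of v
  multiplied by a potential with transform \<open>w\<close>. The integral is 0 where it fails to
  exist.\<close>

definition conv :: "(real^3 \<Rightarrow> complex) \<Rightarrow> (real^3 \<Rightarrow> complex) \<Rightarrow> real^3 \<Rightarrow> complex" where
  "conv w a \<xi> = (LINT \<eta>|lborel. w (\<xi> - \<eta>) * a \<eta>)"

lemma conv_measurable [measurable]:
  assumes [measurable]: "w \<in> borel_measurable borel" "a \<in> borel_measurable borel"
  shows "conv w a \<in> borel_measurable borel"
  unfolding conv_def by measurable

text \<open>Fubini is legitimate because \<open>w\<close> is square integrable and so is the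
  correlation of the moduli of \<open>hat u\<close> and \<open>hat v\<close>, by
  \<open>correlation_bound\<close> with \<open>d = 1\<close>.\<close>

lemma trilinear:
  assumes w: "square_integrable w"
  shows "integrable (lborel \<Otimes>\<^sub>M lborel) (\<lambda>(\<zeta>, \<xi>). w \<zeta> * cnj (hat u \<xi>) * hat v (\<xi> - \<zeta>))"
    "integrable lborel (\<lambda>\<xi>. conv w (hat v) \<xi> * cnj (hat u \<xi>))"
    "plconst * (LINT \<zeta>|lborel. w \<zeta> * cnj (prodhat u v \<zeta>)) = (LINT \<xi>|lborel. conv w (hat v) \<xi> * cnj (hat u \<xi>))"
proof -
  note [measurable] = square_integrable_measurable[OF w]
  let ?c = "\<lambda>\<zeta>. \<integral>\<^sup>+\<xi>. ennreal (cmod (hat u \<xi>) * cmod (hat v (\<xi> - \<zeta>))) \<partial>lborel"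
  have fin: "(\<integral>\<^sup>+\<zeta>. \<integral>\<^sup>+\<xi>. ennreal (cmod (w \<zeta> * cnj (hat u \<xi>) * hat v (\<xi> - \<zeta>))) \<partial>lborel \<partial>lborel) < \<infinity>"
  proof -
    have cb: "(\<integral>\<^sup>+\<zeta>. indicator UNIV \<zeta> * (?c \<zeta>)\<^sup>2 \<partial>lborel) \<le> ennreal (2 * 1 * kap) * (\<integral>\<^sup>+\<xi>. ennreal ((wt \<xi> * cmod (hat u \<xi>))\<^sup>2) \<partial>lborel) * (\<integral>\<^sup>+\<xi>. ennreal ((wt \<xi> * cmod (hat v \<xi>))\<^sup>2) \<partial>lborel)"
      by (rule correlation_bound) (use decay_all in auto)
    also have "\<dots> < \<infinity>" unfolding nn_wt_hat by (simp add: ennreal_mult_less_top)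
    finally have c2: "(\<integral>\<^sup>+\<zeta>. (?c \<zeta>)\<^sup>2 \<partial>lborel) < \<infinity>" by simp
    have w2: "(\<integral>\<^sup>+\<zeta>. (ennreal (cmod (w \<zeta>)))\<^sup>2 \<partial>lborel) < \<infinity>"
      using w by (simp add: square_integrable_nn ennreal_power)
    have "(\<integral>\<^sup>+\<zeta>. \<integral>\<^sup>+\<xi>. ennreal (cmod (w \<zeta> * cnj (hat u \<xi>) * hat v (\<xi> - \<zeta>))) \<partial>lborel \<partial>lborel) = (\<integral>\<^sup>+\<zeta>. ennreal (cmod (w \<zeta>)) * ?c \<zeta> \<partial>lborel)"
    proof (rule nn_integral_cong)
      fix \<zeta>
      show "(\<integral>\<^sup>+\<xi>. ennreal (cmod (w \<zeta> * cnj (hat u \<xi>) * hat v (\<xi> - \<zeta>))) \<partial>lborel) = ennreal (cmod (w \<zeta>)) * ?c \<zeta>"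
        by (subst nn_integral_cmult[symmetric]) (simp_all add: norm_mult ennreal_mult[symmetric] mult.assoc)
    qed
    moreover have "(\<integral>\<^sup>+\<zeta>. ennreal (cmod (w \<zeta>)) * ?c \<zeta> \<partial>lborel)\<^sup>2 \<le> (\<integral>\<^sup>+\<zeta>. (ennreal (cmod (w \<zeta>)))\<^sup>2 \<partial>lborel) * (\<integral>\<^sup>+\<zeta>. (?c \<zeta>)\<^sup>2 \<partial>lborel)"
      by (rule Cauchy_Schwarz_nn_integral) measurable
    moreover have "(\<integral>\<^sup>+\<zeta>. (ennreal (cmod (w \<zeta>)))\<^sup>2 \<partial>lborel) * (\<integral>\<^sup>+\<zeta>. (?c \<zeta>)\<^sup>2 \<partial>lborel) < \<infinity>"
      using w2 c2 by (simp add: ennreal_mult_less_top)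
    ultimately have "(\<integral>\<^sup>+\<zeta>. \<integral>\<^sup>+\<xi>. ennreal (cmod (w \<zeta> * cnj (hat u \<xi>) * hat v (\<xi> - \<zeta>))) \<partial>lborel \<partial>lborel)\<^sup>2 < \<infinity>" by simp
    then show ?thesis by (simp add: power_less_top_ennreal)
  qed
  show i: "integrable (lborel \<Otimes>\<^sub>M lborel) (\<lambda>(\<zeta>, \<xi>). w \<zeta> * cnj (hat u \<xi>) * hat v (\<xi> - \<zeta>))"
    unfolding integrable_iff_bounded
  proof
    show m: "(\<lambda>(\<zeta>, \<xi>). w \<zeta> * cnj (hat u \<xi>) * hat v (\<xi> - \<zeta>)) \<in> borel_measurable (lborel \<Otimes>\<^sub>M lborel)" by measurable
    have "(\<integral>\<^sup>+p. ennreal (norm (case p of (\<zeta>, \<xi>) \<Rightarrow> w \<zeta> * cnj (hat u \<xi>) * hat v (\<xi> - \<zeta>))) \<partial>(lborel \<Otimes>\<^sub>M lborel))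
       = (\<integral>\<^sup>+\<zeta>. \<integral>\<^sup>+\<xi>. ennreal (cmod (w \<zeta> * cnj (hat u \<xi>) * hat v (\<xi> - \<zeta>))) \<partial>lborel \<partial>lborel)"
      by (subst lborel.nn_integral_fst[symmetric]) simp_all
    then show "(\<integral>\<^sup>+p. ennreal (norm (case p of (\<zeta>, \<xi>) \<Rightarrow> w \<zeta> * cnj (hat u \<xi>) * hat v (\<xi> - \<zeta>))) \<partial>(lborel \<Otimes>\<^sub>M lborel)) < \<infinity>"
      using fin by simp
  qed
  have c: "(LINT \<zeta>|lborel. w \<zeta> * cnj (hat u \<xi>) * hat v (\<xi> - \<zeta>)) = conv w (hat v) \<xi> * cnj (hat u \<xi>)" for \<xi>
  proof -
    have "(LINT \<zeta>|lborel. w \<zeta> * cnj (hat u \<xi>) * hat v (\<xi> - \<zeta>)) = (LINT \<zeta>|lborel. (\<lambda>\<eta>. w (\<xi> - \<eta>) * cnj (hat u \<xi>) * hat v \<eta>) (\<xi> - \<zeta>))" by simp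
    also have "\<dots> = (LINT \<eta>|lborel. w (\<xi> - \<eta>) * cnj (hat u \<xi>) * hat v \<eta>)" by (rule lborel_integral_shift(2)) measurable
    also have "\<dots> = (LINT \<eta>|lborel. cnj (hat u \<xi>) * (w (\<xi> - \<eta>) * hat v \<eta>))" by (simp add: ac_simps)
    finally show ?thesis unfolding conv_def by (simp add: mult.commute)
  qed
  show "integrable lborel (\<lambda>\<xi>. conv w (hat v) \<xi> * cnj (hat u \<xi>))"
    using lborel_pair.integrable_snd[OF i] unfolding c .
  have "plconst * (LINT \<zeta>|lborel. w \<zeta> * cnj (prodhat u v \<zeta>)) = (LINT \<zeta>|lborel. w \<zeta> * cnj (plconst * prodhat u v \<zeta>))"
    by (subst integral_mult_right_zero[symmetric]) (simp add: ac_simps)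
  also have "\<dots> = (LINT \<zeta>|lborel. LINT \<xi>|lborel. w \<zeta> * cnj (hat u \<xi>) * hat v (\<xi> - \<zeta>))"
  proof (rule Bochner_Integration.integral_cong[OF refl])
    fix \<zeta>
    have "cnj (plconst * prodhat u v \<zeta>) = (LINT \<xi>|lborel. cnj (hat u \<xi> * cnj (hat v (\<xi> - \<zeta>))))"
      unfolding prodhat_eq by (rule Bochner_Integration.integral_cnj[symmetric])
    then have "w \<zeta> * cnj (plconst * prodhat u v \<zeta>) = (LINT \<xi>|lborel. w \<zeta> * (cnj (hat u \<xi>) * hat v (\<xi> - \<zeta>)))"
      by simp
    then show "w \<zeta> * cnj (plconst * prodhat u v \<zeta>) = (LINT \<xi>|lborel. w \<zeta> * cnj (hat u \<xi>) * hat v (\<xi> - \<zeta>))"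
      by (simp add: mult.assoc)
  qed
  also have "\<dots> = (LINT \<xi>|lborel. LINT \<zeta>|lborel. w \<zeta> * cnj (hat u \<xi>) * hat v (\<xi> - \<zeta>))"
    by (rule lborel_pair.Fubini_integral[OF i, symmetric])
  finally show "plconst * (LINT \<zeta>|lborel. w \<zeta> * cnj (prodhat u v \<zeta>)) = (LINT \<xi>|lborel. conv w (hat v) \<xi> * cnj (hat u \<xi>))"
    unfolding c .
qed

lemma inner_prodC: "plconst\<^sup>2 * (W \<bullet> prodC u v) = Re (LINT \<xi>|lborel. conv (l2_fun (FT W)) (hat v) \<xi> * cnj (hat u \<xi>))"
proof -
  have "plconst * (W \<bullet> prodC u v) = l2_of (l2_fun (FT W)) \<bullet> l2_of (prodhat u v)"
    by (simp add: inner_FT[symmetric] FT_prodC)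
  also have "\<dots> = Re (LINT \<zeta>|lborel. l2_fun (FT W) \<zeta> * cnj (prodhat u v \<zeta>))"
    by (rule Re_integral_mult_cnj[OF l2_fun_square_integrable prodhat_square_integrable, symmetric])
  finally have "plconst\<^sup>2 * (W \<bullet> prodC u v) = Re (plconst * (LINT \<zeta>|lborel. l2_fun (FT W) \<zeta> * cnj (prodhat u v \<zeta>)))"
    by (simp add: power2_eq_square)
  then show ?thesis unfolding trilinear(3)[OF l2_fun_square_integrable] .
qed

text \<open>The kernel \<open>W^(\<xi> - \<eta>) / (wt \<xi> \<cdot> wt \<eta>)\<close> is of Hilbert--Schmidt type, which replaces Rellich's theorem.\<close>

lemma potential_compact_0:
  assumes weak: "\<And>x. (\<lambda>n. r n \<bullet> x) \<longlonglongrightarrow> 0" and bdd: "\<And>n. norm (r n) \<le> K"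
  shows "(\<lambda>n. W \<bullet> prodC (r n) (r n)) \<longlonglongrightarrow> 0"
proof -
  let ?w = "l2_fun (FT W)"
  have K0: "K \<ge> 0" using bdd[of 0] norm_ge_zero order_trans by blast
  have ws: "square_integrable ?w" by (rule l2_fun_square_integrable)
  \<comment> \<open>The row of the kernel at \<open>\<xi>\<close>, conjugated. Its square
    integrability makes evaluation of the convolution at a fixed \<open>\<xi>\<close> a pair of
    continuous functionals of \<open>Phi u\<close>.\<close>
  define g where "g \<xi> \<eta> = cnj (of_real (1 / wt \<eta>) * ?w (\<xi> - \<eta>))" for \<xi> \<eta>
  have wsh: "square_integrable (\<lambda>\<eta>. ?w (\<xi> - \<eta>))" for \<xi>
  proof -
    have "(\<chi> i. - 1) * \<eta> + \<xi> = \<xi> - \<eta>" for \<eta> :: "real^3" by (simp add: vec_eq_iff)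
    then show ?thesis using square_integrable_coordinatewise[of "\<chi> i. - 1" ?w \<xi>, OF _ ws] by simp
  qed
  have gs: "square_integrable (g \<xi>)" for \<xi>
    unfolding g_def[abs_def]
    by (intro square_integrable_cnj square_integrable_cmult[OF wsh, where C = 1])
       (auto simp: wt_ge_1 wt_pos less_imp_le norm_divide)
  have [measurable]: "(\<lambda>(\<xi>, \<eta>). g \<xi> \<eta>) \<in> borel_measurable (borel \<Otimes>\<^sub>M borel)" unfolding g_def by measurable
  have gm[measurable]: "g \<xi> \<in> borel_measurable borel" for \<xi> by (rule square_integrable_measurable[OF gs])
  have ck: "conv ?w (hat u) \<xi> = (LINT \<eta>|lborel. of_real (wt \<eta>) * hat u \<eta> * cnj (g \<xi> \<eta>))" for u \<xi>
    unfolding conv_def g_def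
    by (intro Bochner_Integration.integral_cong refl) (use wt_pos in \<open>simp add: less_imp_neq[symmetric]\<close>)
  \<comment> \<open>Squared row norm of the weighted kernel; its integral is the squared
    Hilbert--Schmidt norm.\<close>
  define D where "D \<xi> = (norm (l2_of (g \<xi>)))\<^sup>2 / (wt \<xi>)\<^sup>2" for \<xi>
  have Deq: "ennreal ((norm (l2_of (g \<xi>)))\<^sup>2) = (\<integral>\<^sup>+\<eta>. ennreal ((cmod (g \<xi> \<eta>))\<^sup>2) \<partial>lborel)" for \<xi>
    by (rule nn_norm_l2_of[OF gs, symmetric])
  have Dm[measurable]: "D \<in> borel_measurable borel"
    unfolding D_def norm_l2_of[OF gs] by measurable
  have Dfin: "(\<integral>\<^sup>+\<xi>. ennreal (D \<xi>) \<partial>lborel) < \<infinity>"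
  proof -
    have "(\<integral>\<^sup>+\<xi>. ennreal (D \<xi>) \<partial>lborel) = (\<integral>\<^sup>+\<xi>. \<integral>\<^sup>+\<eta>. ennreal ((cmod (?w (\<xi> - \<eta>)))\<^sup>2 * (1 / ((wt \<xi>)\<^sup>2 * (wt \<eta>)\<^sup>2))) \<partial>lborel \<partial>lborel)"
    proof (rule nn_integral_cong)
      fix \<xi>
      have "ennreal (D \<xi>) = ennreal (1 / (wt \<xi>)\<^sup>2) * (\<integral>\<^sup>+\<eta>. ennreal ((cmod (g \<xi> \<eta>))\<^sup>2) \<partial>lborel)"
        unfolding D_def Deq[symmetric] by (simp add: ennreal_mult[symmetric])
      also have "\<dots> = (\<integral>\<^sup>+\<eta>. ennreal (1 / (wt \<xi>)\<^sup>2) * ennreal ((cmod (g \<xi> \<eta>))\<^sup>2) \<partial>lborel)"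
        by (rule nn_integral_cmult[symmetric]) measurable
      also have "\<dots> = (\<integral>\<^sup>+\<eta>. ennreal ((cmod (?w (\<xi> - \<eta>)))\<^sup>2 * (1 / ((wt \<xi>)\<^sup>2 * (wt \<eta>)\<^sup>2))) \<partial>lborel)"
        by (intro nn_integral_cong) (simp add: g_def norm_mult norm_divide power_mult_distrib power_divide ennreal_mult[symmetric] ac_simps)
      finally show "ennreal (D \<xi>) = (\<integral>\<^sup>+\<eta>. ennreal ((cmod (?w (\<xi> - \<eta>)))\<^sup>2 * (1 / ((wt \<xi>)\<^sup>2 * (wt \<eta>)\<^sup>2))) \<partial>lborel)" .
    qed
    also have "\<dots> \<le> (\<integral>\<^sup>+\<xi>. \<integral>\<^sup>+\<eta>. ennreal ((cmod (?w (\<xi> - \<eta>)))\<^sup>2) * ennreal (decay \<xi>) + ennreal ((cmod (?w (\<xi> - \<eta>)))\<^sup>2) * ennreal (decay \<eta>) \<partial>lborel \<partial>lborel)"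
    proof (intro nn_integral_mono)
      fix \<xi> \<eta>
      have "(cmod (?w (\<xi> - \<eta>)))\<^sup>2 * (1 / ((wt \<xi>)\<^sup>2 * (wt \<eta>)\<^sup>2)) \<le> (cmod (?w (\<xi> - \<eta>)))\<^sup>2 * (decay \<xi> + decay \<eta>)"
        using decay_all[of \<xi> \<eta>] by (intro mult_left_mono) simp_all
      then show "ennreal ((cmod (?w (\<xi> - \<eta>)))\<^sup>2 * (1 / ((wt \<xi>)\<^sup>2 * (wt \<eta>)\<^sup>2))) \<le> ennreal ((cmod (?w (\<xi> - \<eta>)))\<^sup>2) * ennreal (decay \<xi>) + ennreal ((cmod (?w (\<xi> - \<eta>)))\<^sup>2) * ennreal (decay \<eta>)"
        using decay_nonneg by (simp add: ennreal_mult[symmetric] ennreal_plus[symmetric] distrib_left ennreal_leI del: ennreal_plus)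
    qed
    also have "\<dots> = (\<integral>\<^sup>+\<xi>. \<integral>\<^sup>+\<eta>. ennreal ((cmod (?w (\<xi> - \<eta>)))\<^sup>2) * ennreal (decay \<xi>) \<partial>lborel \<partial>lborel) + (\<integral>\<^sup>+\<xi>. \<integral>\<^sup>+\<eta>. ennreal ((cmod (?w (\<xi> - \<eta>)))\<^sup>2) * ennreal (decay \<eta>) \<partial>lborel \<partial>lborel)"
      by (simp add: nn_integral_add)
    also have "(\<integral>\<^sup>+\<xi>. \<integral>\<^sup>+\<eta>. ennreal ((cmod (?w (\<xi> - \<eta>)))\<^sup>2) * ennreal (decay \<eta>) \<partial>lborel \<partial>lborel) = (\<integral>\<^sup>+\<eta>. \<integral>\<^sup>+\<xi>. ennreal ((cmod (?w (\<xi> - \<eta>)))\<^sup>2) * ennreal (decay \<eta>) \<partial>lborel \<partial>lborel)"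
      by (rule lborel_pair.Fubini'[symmetric]) measurable
    also have "(\<integral>\<^sup>+\<eta>. \<integral>\<^sup>+\<xi>. ennreal ((cmod (?w (\<xi> - \<eta>)))\<^sup>2) * ennreal (decay \<eta>) \<partial>lborel \<partial>lborel) = ennreal ((norm (FT W))\<^sup>2) * ennreal kap"
      using nn_integral_shift(2)[of "\<lambda>\<xi>. ennreal ((cmod (?w \<xi>))\<^sup>2)"] nn_norm_l2_of[OF ws]
      by (simp add: nn_integral_multc nn_integral_cmult nn_integral_decay)
    also have "(\<integral>\<^sup>+\<xi>. \<integral>\<^sup>+\<eta>. ennreal ((cmod (?w (\<xi> - \<eta>)))\<^sup>2) * ennreal (decay \<xi>) \<partial>lborel \<partial>lborel) = ennreal ((norm (FT W))\<^sup>2) * ennreal kap"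
      using nn_integral_shift(3)[of "\<lambda>\<xi>. ennreal ((cmod (?w \<xi>))\<^sup>2)"] nn_norm_l2_of[OF ws]
      by (simp add: nn_integral_multc nn_integral_cmult nn_integral_decay)
    also have "ennreal ((norm (FT W))\<^sup>2) * ennreal kap + ennreal ((norm (FT W))\<^sup>2) * ennreal kap < \<infinity>"
      by (simp add: ennreal_mult_less_top)
    finally show ?thesis .
  qed
  have Dn: "D \<xi> \<ge> 0" for \<xi> by (simp add: D_def)
  have Di: "integrable lborel D" using Dfin Dn Dm by (simp add: integrable_iff_bounded)
  \<comment> \<open>For fixed \<open>\<xi>\<close>, weak convergence sends this to 0, and up to a
    constant its square is dominated by the integrable \<open>D\<close>; so it tends to 0 in
    norm.\<close>
  define k where "k n \<xi> = of_real (1 / wt \<xi>) * conv ?w (hat (r n)) \<xi>" for n \<xi>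
  have [measurable]: "k n \<in> borel_measurable borel" for n unfolding k_def by measurable
  have kb: "(cmod (k n \<xi>))\<^sup>2 \<le> 2 * plconst * K\<^sup>2 * D \<xi>"
    and kl: "(\<lambda>n. (cmod (k n \<xi>))\<^sup>2) \<longlonglongrightarrow> 0" for n \<xi>
  proof -
    have re: "Re (conv ?w (hat u) \<xi>) = Phi u \<bullet> l2_of (g \<xi>)" and im: "Im (conv ?w (hat u) \<xi>) = Phi u \<bullet> l2_of (\<lambda>\<eta>. \<i> * g \<xi> \<eta>)" for u
      unfolding ck Phi_def by (rule Re_integral_mult_cnj[OF wt_hat_square_integrable gs], rule Im_integral_mult_cnj[OF wt_hat_square_integrable gs])
    have ni: "norm (l2_of (\<lambda>\<eta>. \<i> * g \<xi> \<eta>)) = norm (l2_of (g \<xi>))"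
    proof -
      have "(norm (l2_of (\<lambda>\<eta>. \<i> * g \<xi> \<eta>)))\<^sup>2 = (norm (l2_of (g \<xi>)))\<^sup>2"
        unfolding norm_l2_of[OF square_integrable_i[OF gs]] norm_l2_of[OF gs] by (simp add: norm_mult)
      then show ?thesis by simp
    qed
    have nP: "norm (Phi (r n)) \<le> sqrt plconst * K" for n
      unfolding norm_Phi using bdd[of n] plconst_pos by (simp add: mult_left_mono)
    have cz: "(Phi (r n) \<bullet> z)\<^sup>2 \<le> plconst * K\<^sup>2 * (norm z)\<^sup>2" for n z
    proof -
      have "\<bar>Phi (r n) \<bullet> z\<bar> \<le> (sqrt plconst * K) * norm z"
        using Cauchy_Schwarz_ineq2[of "Phi (r n)" z] mult_right_mono[OF nP[of n] norm_ge_zero[of z]] by linarith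
      then have "\<bar>Phi (r n) \<bullet> z\<bar>\<^sup>2 \<le> ((sqrt plconst * K) * norm z)\<^sup>2" by (intro power_mono) auto
      then show ?thesis using plconst_pos by (simp add: power_mult_distrib)
    qed
    have kn: "(cmod (k n \<xi>))\<^sup>2 = ((Phi (r n) \<bullet> l2_of (g \<xi>))\<^sup>2 + (Phi (r n) \<bullet> l2_of (\<lambda>\<eta>. \<i> * g \<xi> \<eta>))\<^sup>2) / (wt \<xi>)\<^sup>2" for n
      unfolding k_def norm_mult power_mult_distrib cmod_power2[of "conv ?w (hat (r n)) \<xi>"] re im
      by (simp add: norm_divide power_divide)
    have "(Phi (r n) \<bullet> l2_of (g \<xi>))\<^sup>2 + (Phi (r n) \<bullet> l2_of (\<lambda>\<eta>. \<i> * g \<xi> \<eta>))\<^sup>2 \<le> 2 * plconst * K\<^sup>2 * (norm (l2_of (g \<xi>)))\<^sup>2"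
      using cz[of n "l2_of (g \<xi>)"] cz[of n "l2_of (\<lambda>\<eta>. \<i> * g \<xi> \<eta>)"] unfolding ni by linarith
    then show "(cmod (k n \<xi>))\<^sup>2 \<le> 2 * plconst * K\<^sup>2 * D \<xi>"
      unfolding kn D_def by (simp add: divide_right_mono)
    have wz: "(\<lambda>n. Phi (r n) \<bullet> z) \<longlonglongrightarrow> 0" for z
    proof -
      obtain x where "Phi x = z" using Phi_surj by blast
      then show ?thesis using tendsto_mult_right_zero[OF weak[of x], of plconst] inner_Phi[of _ x] by simp
    qed
    have "(\<lambda>n. ((Phi (r n) \<bullet> l2_of (g \<xi>))\<^sup>2 + (Phi (r n) \<bullet> l2_of (\<lambda>\<eta>. \<i> * g \<xi> \<eta>))\<^sup>2) / (wt \<xi>)\<^sup>2) \<longlonglongrightarrow> (0\<^sup>2 + 0\<^sup>2) / (wt \<xi>)\<^sup>2"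
      by (intro tendsto_intros wz) (use wt_pos[of \<xi>] in simp)
    then show "(\<lambda>n. (cmod (k n \<xi>))\<^sup>2) \<longlonglongrightarrow> 0" unfolding kn by simp
  qed
  have ks: "square_integrable (k n)" for n
    unfolding square_integrable_def
  proof
    show "integrable lborel (\<lambda>\<xi>. (norm (k n \<xi>))\<^sup>2)"
      by (rule Bochner_Integration.integrable_bound[OF integrable_mult_right[OF Di, of "2 * plconst * K\<^sup>2"]])
         (use kb Dn plconst_pos in \<open>auto simp: abs_mult intro!: AE_I2\<close>)
  qed measurable
  have "(\<lambda>n. (LINT \<xi>|lborel. (cmod (k n \<xi>))\<^sup>2)) \<longlonglongrightarrow> (LINT \<xi>|(lborel :: (real^3) measure). 0 :: real)"
    by (rule integral_dominated_convergence[where w = "\<lambda>\<xi>. 2 * plconst * K\<^sup>2 * D \<xi>"])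
       (use Di kb kl in \<open>auto intro!: AE_I2\<close>)
  then have "(\<lambda>n. (norm (l2_of (k n)))\<^sup>2) \<longlonglongrightarrow> 0" unfolding norm_l2_of[OF ks] by simp
  from tendsto_real_sqrt[OF this] have nk: "(\<lambda>n. norm (l2_of (k n))) \<longlonglongrightarrow> 0" by simp
  have bound: "\<bar>W \<bullet> prodC (r n) (r n)\<bar> \<le> norm (l2_of (k n)) * (sqrt plconst * K / plconst\<^sup>2)" for n
  proof -
    have "plconst\<^sup>2 * (W \<bullet> prodC (r n) (r n)) = Re (LINT \<xi>|lborel. k n \<xi> * cnj (of_real (wt \<xi>) * hat (r n) \<xi>))"
      unfolding inner_prodC k_def
      by (rule arg_cong[where f = Re], intro Bochner_Integration.integral_cong refl) (use wt_pos in \<open>simp add: less_imp_neq[symmetric]\<close>)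
    also have "\<dots> = l2_of (k n) \<bullet> Phi (r n)"
      unfolding Phi_def by (rule Re_integral_mult_cnj[OF ks wt_hat_square_integrable])
    finally have "plconst\<^sup>2 * \<bar>W \<bullet> prodC (r n) (r n)\<bar> = \<bar>l2_of (k n) \<bullet> Phi (r n)\<bar>"
      by (metis abs_mult abs_of_nonneg zero_le_power2)
    also have "\<dots> \<le> norm (l2_of (k n)) * norm (Phi (r n))" by (rule Cauchy_Schwarz_ineq2)
    also have "\<dots> \<le> norm (l2_of (k n)) * (sqrt plconst * K)"
      unfolding norm_Phi using bdd[of n] plconst_pos by (intro mult_left_mono) auto
    finally show ?thesis using plconst_pos by (simp add: field_simps)
  qed
  show ?thesis
  proof (rule Lim_null_comparison)
    show "\<forall>\<^sub>F n in sequentially. norm (W \<bullet> prodC (r n) (r n)) \<le> norm (l2_of (k n)) * (sqrt plconst * K / plconst\<^sup>2)"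
      using bound by (intro always_eventually) simp
    show "(\<lambda>n. norm (l2_of (k n)) * (sqrt plconst * K / plconst\<^sup>2)) \<longlonglongrightarrow> 0"
      by (rule tendsto_mult_left_zero[OF nk])
  qed
qed

section \<open>Scalings and translations on the Fourier side\<close>

lemma plcancel: "plconst * x = c * (plconst * y) \<Longrightarrow> x = c * y"
  using plconst_pos by (metis less_irrefl mult.left_commute mult_left_cancel)

lemma plcancel_complex: "complex_of_real plconst * x = c * (of_real plconst * y) \<Longrightarrow> x = c * y"
  using plconst_pos by (metis less_irrefl mult.left_commute mult_left_cancel of_real_eq_0_iff)

lemma prodhat_cong:
  assumes u: "AE \<xi> in lborel. hat u \<xi> = a \<xi>" and v: "AE \<xi> in lborel. hat v \<xi> = c \<xi>"
    and [measurable]: "a \<in> borel_measurable borel" "c \<in> borel_measurable borel"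
  shows "plconst * prodhat u v \<zeta> = (LINT \<xi>|lborel. a \<xi> * cnj (c (\<xi> - \<zeta>)))"
  unfolding prodhat_eq
proof (rule integral_cong_AE)
  have "AE \<xi> in lborel. hat v (\<xi> - \<zeta>) = c (\<xi> - \<zeta>)"
    using AE_coordinatewise[of "\<chi> i. 1" "\<lambda>\<xi>. hat v \<xi> = c \<xi>" "- \<zeta>", OF _ v] unfolding one_vec by simp
  with u show "AE \<xi> in lborel. hat u \<xi> * cnj (hat v (\<xi> - \<zeta>)) = a \<xi> * cnj (c (\<xi> - \<zeta>))"
    by eventually_elim simp
qed measurable

text \<open>In space, for nonzero components of \<open>b\<close>, this is the function x -> s / |b1
  b2 b3| * u (x1 / b1, x2 / b2, x3 / b3).\<close>

definition dil :: "real \<Rightarrow> real^3 \<Rightarrow> h1 \<Rightarrow> h1" where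
  "dil s b u = (SOME v. AE \<xi> in lborel. hat v \<xi> = of_real s * hat u (b * \<xi>))"

lemma mult_vec_measurable [measurable]: "(\<lambda>x. b * x :: real^3) \<in> borel_measurable borel"
  using vec_mult_measurable[of b 0] by simp

lemma hat_dil:
  assumes b: "\<And>i. b $ i \<noteq> 0"
  shows "AE \<xi> in lborel. hat (dil s b u) \<xi> = of_real s * hat u (b * \<xi>)"
proof -
  have s1: "square_integrable (\<lambda>\<xi>. of_real s * hat u (b * \<xi>))"
    using square_integrable_coordinatewise[OF b hat_square_integrable[of u], of 0]
    by (intro square_integrable_cmult[where C = "\<bar>s\<bar>"]) auto
  have s2: "square_integrable (\<lambda>\<xi>. of_real (\<xi> $ j) * (of_real s * hat u (b * \<xi>)))" for j
  proof -
    have "square_integrable (\<lambda>\<xi>. of_real (s / b $ j) * (of_real ((b * \<xi> + 0) $ j) * hat u (b * \<xi> + 0)))"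
      by (intro square_integrable_cmult[OF square_integrable_coordinatewise[OF b hat_nth_square_integrable[of j u]], where C = "\<bar>s / b $ j\<bar>"])
         (auto simp: norm_divide)
    moreover have "of_real (s / b $ j) * (of_real ((b * \<xi> + 0) $ j) * hat u (b * \<xi> + 0)) = of_real (\<xi> $ j) * (of_real s * hat u (b * \<xi>))" for \<xi>
      using b[of j] by simp
    ultimately show ?thesis by simp
  qed
  show ?thesis unfolding dil_def by (rule someI_ex[OF h1_exists[OF s1 s2]])
qed

lemma mass_dil:
  assumes b: "\<And>i. b $ i \<noteq> 0"
  shows "mass (dil s b u) = s\<^sup>2 / jac b * mass u"
proof -
  have "plconst * mass (dil s b u) = (LINT \<xi>|lborel. s\<^sup>2 * (cmod (hat u (b * \<xi>)))\<^sup>2)"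
    unfolding mass_hat
  proof (rule integral_cong_AE)
    show "AE \<xi> in lborel. (cmod (hat (dil s b u) \<xi>))\<^sup>2 = s\<^sup>2 * (cmod (hat u (b * \<xi>)))\<^sup>2"
      using hat_dil[OF b, of s u] by eventually_elim (simp add: norm_mult power_mult_distrib)
  qed measurable
  also have "\<dots> = s\<^sup>2 / jac b * (plconst * mass u)"
    unfolding mass_hat using integral_coordinatewise[OF b, of "\<lambda>\<xi>. (cmod (hat u \<xi>))\<^sup>2" 0] jac_pos[OF b] by simp
  finally show ?thesis by (rule plcancel)
qed

lemma scaleR_inverse_eq: "(x :: complex) = c *\<^sub>R y \<Longrightarrow> c > 0 \<Longrightarrow> y = of_real (1 / c) * x"
  by (simp add: scaleR_conv_of_real)

lemma prodhat_dil:
  assumes b: "\<And>i. b $ i \<noteq> 0"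
  shows "prodhat (dil s b u) (dil s b u) \<zeta> = of_real (s\<^sup>2 / jac b) * prodhat u u (b * \<zeta>)"
proof -
  have "plconst * prodhat (dil s b u) (dil s b u) \<zeta> = (LINT \<xi>|lborel. (of_real s * hat u (b * \<xi>)) * cnj (of_real s * hat u (b * (\<xi> - \<zeta>))))"
    by (rule prodhat_cong[OF hat_dil[OF b] hat_dil[OF b]]) measurable
  also have "\<dots> = (LINT \<xi>|lborel. of_real (s\<^sup>2) * (hat u (b * \<xi> + 0) * cnj (hat u ((b * \<xi> + 0) - b * \<zeta>))))"
    by (simp add: right_diff_distrib power2_eq_square ac_simps)
  also have "\<dots> = of_real (s\<^sup>2) * (LINT \<xi>|lborel. hat u (b * \<xi> + 0) * cnj (hat u ((b * \<xi> + 0) - b * \<zeta>)))"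
    by (rule integral_mult_right_zero)
  also have "(LINT \<xi>|lborel. hat u (b * \<xi> + 0) * cnj (hat u ((b * \<xi> + 0) - b * \<zeta>))) = of_real (1 / jac b) * (plconst * prodhat u u (b * \<zeta>))"
  proof -
    have "(\<lambda>\<xi>. hat u \<xi> * cnj (hat u (\<xi> - b * \<zeta>))) \<in> borel_measurable borel" by measurable
    from integral_coordinatewise[OF b this, of 0] show ?thesis
      unfolding prodhat_eq by (rule scaleR_inverse_eq[OF _ jac_pos[OF b]])
  qed
  finally show ?thesis by (rule plcancel_complex[OF trans]) (simp add: ac_simps)
qed

text \<open>Two powers of 1 / \<open>jac b\<close> come from the squared transform of the density
  and one from the change of variables. Anisotropy survives only in the argument of the
  symbol.\<close>

lemma quart_dil:
  assumes b: "\<And>i. b $ i \<noteq> 0"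
  shows "plconst * quart p q (dil s b u) = s ^ 4 / jac b ^ 3 * (LINT \<zeta>|lborel. symb p q ((\<chi> i. 1 / b $ i) * \<zeta>) * (cmod (prodhat u u \<zeta>))\<^sup>2)"
proof -
  have inv: "(\<chi> i. 1 / b $ i) * (b * \<zeta>) = \<zeta>" for \<zeta> using b by (simp add: vec_eq_iff)
  have "plconst * quart p q (dil s b u) = (LINT \<zeta>|lborel. (s\<^sup>2 / jac b)\<^sup>2 * (symb p q \<zeta> * (cmod (prodhat u u (b * \<zeta>)))\<^sup>2))"
    unfolding quart_eq prodhat_dil[OF b] norm_mult norm_of_real power_mult_distrib power2_abs
    by (intro Bochner_Integration.integral_cong refl) simp
  also have "\<dots> = (s\<^sup>2 / jac b)\<^sup>2 * (LINT \<zeta>|lborel. symb p q \<zeta> * (cmod (prodhat u u (b * \<zeta>)))\<^sup>2)" by simp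
  also have "(LINT \<zeta>|lborel. symb p q \<zeta> * (cmod (prodhat u u (b * \<zeta>)))\<^sup>2) = 1 / jac b * (LINT \<zeta>|lborel. symb p q ((\<chi> i. 1 / b $ i) * \<zeta>) * (cmod (prodhat u u \<zeta>))\<^sup>2)"
    using integral_coordinatewise[OF b, of "\<lambda>\<zeta>. symb p q ((\<chi> i. 1 / b $ i) * \<zeta>) * (cmod (prodhat u u \<zeta>))\<^sup>2" 0] jac_pos[OF b]
    by (simp add: inv)
  finally show ?thesis by (simp add: power2_eq_square power3_eq_cube power4_eq_xxxx)
qed

lemma dipolar_symbol_scaleR: "c \<noteq> 0 \<Longrightarrow> dipolar_symbol (c *\<^sub>R \<xi>) = dipolar_symbol \<xi>"
  unfolding dipolar_symbol_def by (simp add: power_mult_distrib right_diff_distrib[symmetric] mult.left_commute[of 2])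

definition idil :: "real \<Rightarrow> real \<Rightarrow> h1 \<Rightarrow> h1" where "idil s t u = dil s (\<chi> i. t) u"

lemma scal_vec: "(\<chi> i. t) * \<xi> = t *\<^sub>R (\<xi> :: real^3)" by (simp add: vec_eq_iff)

lemma jac_const: "t > 0 \<Longrightarrow> jac (\<chi> i. t) = t ^ 3" by (simp add: jac_def)

lemma hat_idil: "t > 0 \<Longrightarrow> AE \<xi> in lborel. hat (idil s t u) \<xi> = of_real s * hat u (t *\<^sub>R \<xi>)"
  using hat_dil[of "\<chi> i. t" s u] unfolding idil_def scal_vec by simp

lemma mass_idil: "t > 0 \<Longrightarrow> mass (idil s t u) = s\<^sup>2 / t ^ 3 * mass u"
  unfolding idil_def by (subst mass_dil) (simp_all add: jac_const)

text \<open>The dipolar symbol is homogeneous of degree 0, so an isotropic dilation leaves it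
  unchanged.\<close>

lemma quart_idil:
  assumes t: "t > 0"
  shows "quart p q (idil s t u) = s ^ 4 / t ^ 9 * quart p q u"
proof -
  have "(\<chi> i. 1 / (\<chi> i. t) $ i) * \<zeta> = (1 / t) *\<^sub>R \<zeta>" for \<zeta> :: "real^3" by (simp add: vec_eq_iff)
  then have "plconst * quart p q (idil s t u) = s ^ 4 / t ^ 9 * (plconst * quart p q u)"
    unfolding idil_def quart_eq[of p q u] using t
    by (subst quart_dil) (simp_all add: jac_const power_mult[symmetric] symb_def dipolar_symbol_scaleR)
  then show ?thesis by (rule plcancel)
qed

lemma kinetic_idil:
  assumes t: "t > 0"
  shows "kinetic (idil s t u) = s\<^sup>2 / t ^ 5 * kinetic u"
proof -
  have "plconst * kinetic (idil s t u) = (LINT \<xi>|lborel. s\<^sup>2 / t\<^sup>2 * ((norm (t *\<^sub>R \<xi>))\<^sup>2 * (cmod (hat u (t *\<^sub>R \<xi>)))\<^sup>2))"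
    unfolding kinetic_hat
  proof (rule integral_cong_AE)
    show "AE \<xi> in lborel. (norm \<xi>)\<^sup>2 * (cmod (hat (idil s t u) \<xi>))\<^sup>2 = s\<^sup>2 / t\<^sup>2 * ((norm (t *\<^sub>R \<xi>))\<^sup>2 * (cmod (hat u (t *\<^sub>R \<xi>)))\<^sup>2)"
      using hat_idil[OF t, of s u] by eventually_elim (use t in \<open>simp add: norm_mult power_mult_distrib\<close>)
  qed measurable
  also have "\<dots> = s\<^sup>2 / t\<^sup>2 * (LINT \<xi>|lborel. (norm (t *\<^sub>R \<xi>))\<^sup>2 * (cmod (hat u (t *\<^sub>R \<xi>)))\<^sup>2)" by (rule integral_mult_right_zero)
  also have "(LINT \<xi>|lborel. (norm (t *\<^sub>R \<xi>))\<^sup>2 * (cmod (hat u (t *\<^sub>R \<xi>)))\<^sup>2) = 1 / t ^ 3 * (plconst * kinetic u)"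
    unfolding kinetic_hat using integral_coordinatewise[of "\<chi> i. t" "\<lambda>\<xi>. (norm \<xi>)\<^sup>2 * (cmod (hat u \<xi>))\<^sup>2" 0] t
    by (simp add: scal_vec jac_const)
  finally show ?thesis using plconst_pos t by (simp add: field_simps eval_nat_numeral)
qed

text \<open>The transform of the translate x -> u (x + y).\<close>

definition phase :: "real^3 \<Rightarrow> h1 \<Rightarrow> h1" where
  "phase y u = (SOME v. AE \<xi> in lborel. hat v \<xi> = cis (\<xi> \<bullet> y) * hat u \<xi>)"

lemma cis_measurable': "(\<lambda>\<xi>::real^3. cis (\<xi> \<bullet> y)) \<in> borel_measurable borel"
  using cis_inner_measurable[of "\<lambda>x. x" borel "\<lambda>x. - y"] by auto

lemma hat_phase: "AE \<xi> in lborel. hat (phase y u) \<xi> = cis (\<xi> \<bullet> y) * hat u \<xi>"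
proof -
  have s1: "square_integrable (\<lambda>\<xi>. cis (\<xi> \<bullet> y) * hat u \<xi>)"
    by (rule square_integrable_cmult[OF hat_square_integrable cis_measurable', where C = 1]) simp
  have s2: "square_integrable (\<lambda>\<xi>. of_real (\<xi> $ j) * (cis (\<xi> \<bullet> y) * hat u \<xi>))" for j
    using square_integrable_cmult[OF hat_nth_square_integrable[of j u] cis_measurable'[of y], where C = 1]
    by (simp add: ac_simps)
  show ?thesis unfolding phase_def by (rule someI_ex[OF h1_exists[OF s1 s2]])
qed

lemma mass_phase: "mass (phase y u) = mass u"
proof -
  have "plconst * mass (phase y u) = plconst * mass u"
    unfolding mass_hat
    by (rule integral_cong_AE) (simp_all, use hat_phase[of y u] in eventually_elim, simp add: norm_mult)
  then show ?thesis using plconst_pos by simp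
qed

lemma kinetic_phase: "kinetic (phase y u) = kinetic u"
proof -
  have "plconst * kinetic (phase y u) = plconst * kinetic u"
    unfolding kinetic_hat
    by (rule integral_cong_AE) (simp_all, use hat_phase[of y u] in eventually_elim, simp add: norm_mult)
  then show ?thesis using plconst_pos by simp
qed

lemma prodhat_phase: "prodhat (phase y u) (phase y u) \<zeta> = cis (\<zeta> \<bullet> y) * prodhat u u \<zeta>"
proof -
  note [measurable] = cis_measurable'
  have "plconst * prodhat (phase y u) (phase y u) \<zeta> = (LINT \<xi>|lborel. (cis (\<xi> \<bullet> y) * hat u \<xi>) * cnj (cis ((\<xi> - \<zeta>) \<bullet> y) * hat u (\<xi> - \<zeta>)))"
    by (rule prodhat_cong[OF hat_phase hat_phase]) measurable
  also have "\<dots> = (LINT \<xi>|lborel. cis (\<zeta> \<bullet> y) * (hat u \<xi> * cnj (hat u (\<xi> - \<zeta>))))"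
  proof (rule Bochner_Integration.integral_cong[OF refl])
    fix \<xi>
    have "cis (\<xi> \<bullet> y) * cis (- ((\<xi> - \<zeta>) \<bullet> y)) = cis (\<zeta> \<bullet> y)"
      unfolding cis_mult by (rule arg_cong[where f = cis]) (simp add: inner_diff_left)
    then show "(cis (\<xi> \<bullet> y) * hat u \<xi>) * cnj (cis ((\<xi> - \<zeta>) \<bullet> y) * hat u (\<xi> - \<zeta>)) = cis (\<zeta> \<bullet> y) * (hat u \<xi> * cnj (hat u (\<xi> - \<zeta>)))"
      unfolding complex_cnj_mult cis_cnj by (metis mult.assoc mult.left_commute)
  qed
  also have "\<dots> = plconst * (cis (\<zeta> \<bullet> y) * prodhat u u \<zeta>)"
    using prodhat_eq[of u u \<zeta>] by simp
  finally show ?thesis using plconst_pos by (metis less_irrefl mult_left_cancel of_real_eq_0_iff)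
qed

lemma quart_phase: "quart p q (phase y u) = quart p q u"
proof -
  have "plconst * quart p q (phase y u) = plconst * quart p q u"
    unfolding quart_eq prodhat_phase by (simp add: norm_mult)
  then show ?thesis using plconst_pos by simp
qed

section \<open>A Gagliardo--Nirenberg inequality\<close>

lemma hat_0: "AE \<xi> in lborel. hat 0 \<xi> = 0"
  using hat_scaleR[of 0 0] by simp

text \<open>Zero kinetic energy would confine the transform to the single frequency 0, a null
  set.\<close>

lemma kinetic_pos:
  assumes "u \<noteq> 0" shows "kinetic u > 0"
proof (rule ccontr)
  assume "\<not> kinetic u > 0"
  then have "kinetic u = 0" using kinetic_nonneg[of u] by simp
  then have "(LINT \<xi>|lborel. (norm \<xi>)\<^sup>2 * (cmod (hat u \<xi>))\<^sup>2) = 0" using kinetic_hat[of u] by simp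
  moreover have "integrable lborel (\<lambda>\<xi>. (norm \<xi>)\<^sup>2 * (cmod (hat u \<xi>))\<^sup>2)"
    using norm_hat_square_integrable[of u] by (simp add: square_integrable_def norm_mult power_mult_distrib)
  ultimately have "AE \<xi> in lborel. (norm \<xi>)\<^sup>2 * (cmod (hat u \<xi>))\<^sup>2 = 0"
    by (subst (asm) integral_nonneg_eq_0_iff_AE) auto
  with AE_lborel_singleton[of 0] hat_0 have "AE \<xi> in lborel. hat u \<xi> = hat 0 \<xi>"
    by eventually_elim simp
  then have "u = 0" by (rule h1_hat_eqI)
  with assms show False by simp
qed

lemma mass_pos:
  assumes "u \<noteq> 0" shows "mass u > 0"
proof (rule ccontr)
  assume "\<not> mass u > 0"
  then have "emb u = 0" using mass_nonneg[of u] by (simp add: mass_eq_inner l2_inner_eq)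
  then have "FT (l2_of (fun_of u)) = FT (l2_of (fun_of 0))"
    using linear_simps(3)[OF bounded_linear_emb] by (simp add: emb_def)
  then have "AE x in lborel. fun_of u x = fun_of 0 x"
    using l2_of_eq_iff[OF fun_of_square_integrable fun_of_square_integrable] by (simp add: FT_inj)
  then have "u = 0" by (rule h1_eqI)
  with assms show False by simp
qed

text \<open>With the constant symbol 1 the form is the fourth power of the L^4 norm, which serves as
  the yardstick for all other symbols.\<close>

lemma quart_1_0: "quart 1 0 u = (norm (prodC u u))\<^sup>2"
proof -
  have "FT (Top 1 0 W) = FT W" for W by (simp add: FT_Top symb_def l2_mul_def)
  then show ?thesis by (simp add: quart_def FT_inj prodR_self power2_norm_eq_inner)
qed

lemma integrable_prodhat: "integrable lborel (\<lambda>\<zeta>. (cmod (prodhat u u \<zeta>))\<^sup>2)"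
  using prodhat_square_integrable by (simp add: square_integrable_def)

lemma integrable_symb_prodhat:
  assumes [measurable]: "h \<in> borel_measurable borel"
  shows "integrable lborel (\<lambda>\<zeta>. symb a b (h \<zeta>) * (cmod (prodhat u u \<zeta>))\<^sup>2)"
  by (rule Bochner_Integration.integrable_bound[OF integrable_mult_right[OF integrable_prodhat, of "\<bar>a\<bar> + \<bar>b\<bar> * (4 * pi)" u]])
     (use abs_symb_le in \<open>auto simp: abs_mult intro!: AE_I2 mult_right_mono order_trans[OF abs_symb_le]\<close>)

lemma abs_quart_le: "\<bar>quart a b u\<bar> \<le> (\<bar>a\<bar> + \<bar>b\<bar> * (4 * pi)) * quart 1 0 u"
proof -
  have "\<bar>plconst * quart a b u\<bar> \<le> (LINT \<zeta>|lborel. \<bar>symb a b \<zeta> * (cmod (prodhat u u \<zeta>))\<^sup>2\<bar>)"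
    unfolding quart_eq by (rule integral_abs_bound)
  also have "\<dots> \<le> (LINT \<zeta>|lborel. (\<bar>a\<bar> + \<bar>b\<bar> * (4 * pi)) * (symb 1 0 \<zeta> * (cmod (prodhat u u \<zeta>))\<^sup>2))"
  proof (rule integral_mono)
    show "integrable lborel (\<lambda>\<zeta>. \<bar>symb a b \<zeta> * (cmod (prodhat u u \<zeta>))\<^sup>2\<bar>)"
      by (intro integrable_abs integrable_symb_prodhat) simp
    show "integrable lborel (\<lambda>\<zeta>. (\<bar>a\<bar> + \<bar>b\<bar> * (4 * pi)) * (symb 1 0 \<zeta> * (cmod (prodhat u u \<zeta>))\<^sup>2))"
      by (intro integrable_mult_right integrable_symb_prodhat) simp
    show "\<bar>symb a b \<zeta> * (cmod (prodhat u u \<zeta>))\<^sup>2\<bar> \<le> (\<bar>a\<bar> + \<bar>b\<bar> * (4 * pi)) * (symb 1 0 \<zeta> * (cmod (prodhat u u \<zeta>))\<^sup>2)" for \<zeta>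
      unfolding abs_mult using abs_symb_le[of a b \<zeta>] by (simp add: symb_def[of 1 0] mult_right_mono)
  qed
  also have "\<dots> = (\<bar>a\<bar> + \<bar>b\<bar> * (4 * pi)) * (plconst * quart 1 0 u)"
    unfolding quart_eq by (rule integral_mult_right_zero)
  finally have "plconst * \<bar>quart a b u\<bar> \<le> plconst * ((\<bar>a\<bar> + \<bar>b\<bar> * (4 * pi)) * quart 1 0 u)"
    using plconst_pos by (simp add: abs_mult ac_simps)
  then show ?thesis using plconst_pos by simp
qed

text \<open>Kinetic energy to the power 3/2 times mass to the power 1/2, which scales like the
  quartic form both in amplitude and under isotropic dilations.\<close>

definition gnfun :: "h1 \<Rightarrow> real" where "gnfun u = kinetic u * sqrt (kinetic u * mass u)"

lemma gnfun_pos: "u \<noteq> 0 \<Longrightarrow> gnfun u > 0"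
  unfolding gnfun_def using kinetic_pos mass_pos by simp

lemma gnfun_nonneg: "gnfun u \<ge> 0"
  unfolding gnfun_def using kinetic_nonneg mass_nonneg by simp

lemma quart_0: "quart a b 0 = 0"
proof -
  interpret bounded_bilinear prodR by (rule bounded_bilinear_prodR)
  show ?thesis by (simp add: quart_def zero_left)
qed

text \<open>Amplitude and dilation are two free parameters, enough to set mass and kinetic energy to
  1. The quotient of \<open>quart\<close> and \<open>gnfun\<close> is invariant, and
  \<open>gnfun\<close> becomes 1.\<close>

lemma normalise:
  assumes "u \<noteq> 0"
  obtains s t where "t > 0" "mass (idil s t u) = 1" "kinetic (idil s t u) = 1"
    "\<And>a b. quart a b (idil s t u) = quart a b u / gnfun u"
proof -
  let ?A = "kinetic u" and ?M = "mass u"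
  have A: "?A > 0" and M: "?M > 0" using kinetic_pos mass_pos assms by auto
  define t where "t = sqrt (?A / ?M)"
  define s where "s = sqrt (t ^ 3 / ?M)"
  have t: "t > 0" and t2: "t\<^sup>2 = ?A / ?M" using A M by (auto simp: t_def)
  have s2: "s\<^sup>2 = t ^ 3 / ?M" using t M by (simp add: s_def)
  have m: "mass (idil s t u) = 1" unfolding mass_idil[OF t] s2 using t M by simp
  have k: "kinetic (idil s t u) = 1"
  proof -
    have "t ^ 5 = t ^ 3 * t\<^sup>2" by (simp flip: power_add)
    then show ?thesis unfolding kinetic_idil[OF t] s2 using t M A by (simp add: t2)
  qed
  have q: "quart a b (idil s t u) = quart a b u / gnfun u" for a b
  proof -
    have "s ^ 4 / t ^ 9 = (s\<^sup>2)\<^sup>2 / (t ^ 6 * t ^ 3)" by (simp flip: power_add power_mult)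
    also have "\<dots> = 1 / (t ^ 3 * ?M\<^sup>2)"
    proof -
      have "(s\<^sup>2)\<^sup>2 = t ^ 6 / ?M\<^sup>2" unfolding s2 by (simp add: power_divide flip: power_mult)
      then show ?thesis using t M by (simp add: field_simps)
    qed
    also have "t ^ 3 * ?M\<^sup>2 = gnfun u"
    proof -
      have "t ^ 3 * ?M\<^sup>2 = t\<^sup>2 * ?M * (t * ?M)" by (simp add: power2_eq_square power3_eq_cube)
      also have "t\<^sup>2 * ?M = ?A" using M by (simp add: t2)
      also have "t * ?M = sqrt (?A * ?M)"
      proof (rule real_sqrt_unique[symmetric])
        show "(t * ?M)\<^sup>2 = ?A * ?M" unfolding power_mult_distrib t2 using M by (simp add: power2_eq_square)
      qed (use t M in simp)
      finally show ?thesis by (simp add: gnfun_def)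
    qed
    finally show ?thesis unfolding quart_idil[OF t] by simp
  qed
  show ?thesis using t m k q by (rule that)
qed

text \<open>The last factor is \<open>2 * kap / plconst\<close> from the product estimate times 4,
  the fourth power of the norm of a function normalised to mass and kinetic energy 1.\<close>

definition gnconst :: "real \<Rightarrow> real \<Rightarrow> real" where
  "gnconst a b = (\<bar>a\<bar> + \<bar>b\<bar> * (4 * pi)) * (8 * kap / plconst)"

lemma gnconst_nonneg: "gnconst a b \<ge> 0"
  unfolding gnconst_def using kap_nonneg plconst_pos by simp

lemma gagliardo_nirenberg: "\<bar>quart a b u\<bar> \<le> gnconst a b * gnfun u"
proof (cases "u = 0")
  case True then show ?thesis using gnconst_nonneg gnfun_nonneg by (simp add: quart_0)
next
  case False
  then obtain s t where st: "t > 0" "mass (idil s t u) = 1" "kinetic (idil s t u) = 1"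
    "\<And>a b. quart a b (idil s t u) = quart a b u / gnfun u" by (rule normalise) blast
  let ?v = "idil s t u"
  have n: "(norm ?v)\<^sup>2 = 2" using st by (simp add: norm_h1_eq)
  have "quart 1 0 ?v \<le> (sqrt (2 * kap / plconst) * norm ?v * norm ?v)\<^sup>2"
    unfolding quart_1_0 by (intro power_mono norm_prodC) simp
  also have "\<dots> = 8 * kap / plconst"
    using kap_nonneg plconst_pos n by (simp add: power_mult_distrib flip: power2_eq_square)
  finally have "\<bar>quart a b ?v\<bar> \<le> gnconst a b"
    using abs_quart_le[of a b ?v] mult_left_mono[of "quart 1 0 ?v" "8 * kap / plconst" "\<bar>a\<bar> + \<bar>b\<bar> * (4 * pi)"]
    unfolding gnconst_def by simp
  then show ?thesis unfolding st(4) using gnfun_pos[OF False] by (simp add: field_simps)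
qed

section \<open>The quartic form takes negative values in the unstable regime\<close>

lemma nonzero_exists: "\<exists>u::h1. u \<noteq> 0"
proof -
  obtain u where u: "Phi u = l2_of (indicator (ball 0 1))" using Phi_surj by blast
  have "(norm (Phi u))\<^sup>2 = (LINT \<xi>|lborel. indicator (ball (0::real^3) 1) \<xi>)"
    unfolding u norm_l2_of[OF square_integrable_indicator_ball]
    by (intro Bochner_Integration.integral_cong refl) (simp add: indicator_def)
  also have "\<dots> = measure lborel (ball (0::real^3) 1)" by simp
  also have "\<dots> > 0" using content_ball_pos[of 1 "0::real^3"] by simp
  finally have "u \<noteq> 0" using norm_Phi[of u] by auto
  then show ?thesis by blast
qed

lemma quart_1_0_pos:
  assumes "u \<noteq> 0" shows "quart 1 0 u > 0"
proof (rule ccontr)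
  assume "\<not> quart 1 0 u > 0"
  then have "norm (prodC u u) = 0" by (simp add: quart_1_0)
  then have "prodC u u = l2_of (\<lambda>x. 0)" by (simp add: zero_l2_def)
  then have "AE x in lborel. fun_of u x * cnj (fun_of u x) = 0"
    unfolding prodC_def by (simp add: l2_of_eq_iff product_L2(1) square_integrable_0)
  with fun_of_zero have "AE x in lborel. fun_of u x = fun_of 0 x" by eventually_elim simp
  then have "u = 0" by (rule h1_eqI)
  with assms show False by simp
qed

lemma AE_nth_neq_0: "AE x in lborel. (x :: real^3) $ k \<noteq> 0"
proof -
  have "{x :: real^3. x $ k = 0} \<in> null_sets lebesgue"
    using negligible_standard_hyperplane_cart[of k] by (simp add: negligible_iff_null_sets)
  moreover have s: "{x :: real^3. x $ k = 0} \<in> sets lborel" by (simp add: borel_closed closed_Collect_eq continuous_on_component)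
  ultimately have "{x :: real^3. x $ k = 0} \<in> null_sets lborel" by (simp add: null_sets_completion_iff)
  then show ?thesis by (rule AE_I'[where N = "{x. x $ k = 0}"]) auto
qed

text \<open>An extreme anisotropic dilation pushes the frequencies of the density towards a
  direction in which the symbol is constant. Dominated convergence replaces the symbol by this
  constant, which is negative precisely by the definition of the unstable regime.\<close>

lemma quart_negative:
  assumes "unstable_regime a b"
  shows "\<exists>u. quart a b u < 0"
proof -
  obtain u0 :: h1 where u0: "u0 \<noteq> 0" using nonzero_exists by blast
  let ?I = "LINT \<zeta>|lborel. (cmod (prodhat u0 u0 \<zeta>))\<^sup>2"
  have "plconst * quart 1 0 u0 = ?I" unfolding quart_eq by (simp add: symb_def)
  then have I: "?I > 0" using quart_1_0_pos[OF u0] plconst_pos by (metis mult_pos_pos)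
  have main: "\<exists>u. quart a b u < 0"
    if w: "\<And>n i. w n $ i \<noteq> 0" and L: "L < 0"
      and lim: "\<And>\<zeta>::real^3. \<zeta> $ 1 \<noteq> 0 \<Longrightarrow> \<zeta> $ 3 \<noteq> 0 \<Longrightarrow> (\<lambda>n. symb a b ((\<chi> i. 1 / w n $ i) * \<zeta>)) \<longlonglongrightarrow> L"
    for w :: "nat \<Rightarrow> real^3" and L
  proof -
    have "(\<lambda>n. LINT \<zeta>|lborel. symb a b ((\<chi> i. 1 / w n $ i) * \<zeta>) * (cmod (prodhat u0 u0 \<zeta>))\<^sup>2) \<longlonglongrightarrow> (LINT \<zeta>|lborel. L * (cmod (prodhat u0 u0 \<zeta>))\<^sup>2)"
    proof (rule integral_dominated_convergence[where w = "\<lambda>\<zeta>. (\<bar>a\<bar> + \<bar>b\<bar> * (4 * pi)) * (cmod (prodhat u0 u0 \<zeta>))\<^sup>2"])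
      show "AE \<zeta> in lborel. (\<lambda>n. symb a b ((\<chi> i. 1 / w n $ i) * \<zeta>) * (cmod (prodhat u0 u0 \<zeta>))\<^sup>2) \<longlonglongrightarrow> L * (cmod (prodhat u0 u0 \<zeta>))\<^sup>2"
        using AE_nth_neq_0[of 1] AE_nth_neq_0[of 3] by eventually_elim (intro tendsto_mult tendsto_const lim)
      show "AE \<zeta> in lborel. norm (symb a b ((\<chi> i. 1 / w n $ i) * \<zeta>) * (cmod (prodhat u0 u0 \<zeta>))\<^sup>2) \<le> (\<bar>a\<bar> + \<bar>b\<bar> * (4 * pi)) * (cmod (prodhat u0 u0 \<zeta>))\<^sup>2" for n
        by (intro AE_I2) (simp add: abs_mult mult_right_mono abs_symb_le)
    qed (use integrable_prodhat in \<open>auto\<close>)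
    moreover have "(LINT \<zeta>|lborel. L * (cmod (prodhat u0 u0 \<zeta>))\<^sup>2) < 0" using I L by (simp add: mult_neg_pos)
    ultimately have "\<forall>\<^sub>F n in sequentially. (LINT \<zeta>|lborel. symb a b ((\<chi> i. 1 / w n $ i) * \<zeta>) * (cmod (prodhat u0 u0 \<zeta>))\<^sup>2) < 0"
      by (rule order_tendstoD(2))
    then obtain n where n: "(LINT \<zeta>|lborel. symb a b ((\<chi> i. 1 / w n $ i) * \<zeta>) * (cmod (prodhat u0 u0 \<zeta>))\<^sup>2) < 0"
      using eventually_happens'[OF sequentially_bot] by blast
    have "plconst * quart a b (dil 1 (w n) u0) < 0"
      unfolding quart_dil[OF w] using n jac_pos[OF w, of n] by (simp add: divide_less_0_iff)
    then have "quart a b (dil 1 (w n) u0) < 0" using plconst_pos by (simp add: mult_less_0_iff)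
    then show ?thesis by blast
  qed
  \<comment> \<open>The auxiliary factor \<open>p n\<close> is a common rescaling of the frequency,
    harmless by homogeneity. It lets one computation serve \<open>c\<close> tending to 0 (with
    \<open>p = 1\<close>) and \<open>c\<close> tending to infinity (with
    \<open>p = 1 / c\<close>).\<close>
  have dil_lim: "(\<lambda>n. symb a b (\<chi> i. if i = 3 then c n * \<zeta> $ 3 else \<zeta> $ i)) \<longlonglongrightarrow> a + b * (4 / 3 * pi * ((2 * (d * \<zeta> $ 3)\<^sup>2 - (e * \<zeta> $ 1)\<^sup>2 - (e * \<zeta> $ 2)\<^sup>2) / ((e * \<zeta> $ 1)\<^sup>2 + (e * \<zeta> $ 2)\<^sup>2 + (d * \<zeta> $ 3)\<^sup>2)))"
    if p: "\<And>n. p n \<noteq> 0" "p \<longlonglongrightarrow> e" "(\<lambda>n. p n * c n) \<longlonglongrightarrow> d" and nz: "(e * \<zeta> $ 1)\<^sup>2 + (e * \<zeta> $ 2)\<^sup>2 + (d * \<zeta> $ 3)\<^sup>2 \<noteq> 0"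
    for c p :: "nat \<Rightarrow> real" and d e :: real and \<zeta> :: "real^3"
  proof -
    have "symb a b (\<chi> i. if i = 3 then c n * \<zeta> $ 3 else \<zeta> $ i) = a + b * (4 / 3 * pi * ((2 * (p n * c n * \<zeta> $ 3)\<^sup>2 - (p n * \<zeta> $ 1)\<^sup>2 - (p n * \<zeta> $ 2)\<^sup>2) / ((p n * \<zeta> $ 1)\<^sup>2 + (p n * \<zeta> $ 2)\<^sup>2 + (p n * c n * \<zeta> $ 3)\<^sup>2)))" for n
      unfolding symb_def by (subst dipolar_symbol_scaleR[OF p(1)[of n], symmetric]) (simp only: dipolar_symbol_def norm_vec3, simp add: mult.assoc)
    moreover have "(\<lambda>n. a + b * (4 / 3 * pi * ((2 * (p n * c n * \<zeta> $ 3)\<^sup>2 - (p n * \<zeta> $ 1)\<^sup>2 - (p n * \<zeta> $ 2)\<^sup>2) / ((p n * \<zeta> $ 1)\<^sup>2 + (p n * \<zeta> $ 2)\<^sup>2 + (p n * c n * \<zeta> $ 3)\<^sup>2))))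
      \<longlonglongrightarrow> a + b * (4 / 3 * pi * ((2 * (d * \<zeta> $ 3)\<^sup>2 - (e * \<zeta> $ 1)\<^sup>2 - (e * \<zeta> $ 2)\<^sup>2) / ((e * \<zeta> $ 1)\<^sup>2 + (e * \<zeta> $ 2)\<^sup>2 + (d * \<zeta> $ 3)\<^sup>2)))"
      by (intro tendsto_intros p nz)
    ultimately show ?thesis by simp
  qed
  have h: "(\<lambda>n. 1 / real (Suc n)) \<longlonglongrightarrow> 0" using LIMSEQ_Suc[OF lim_1_over_n] .
  have w: "(\<chi> i. 1 / (\<chi> i. if i = 3 then 1 / c else 1) $ i) * \<zeta> = (\<chi> i. if i = 3 then c * \<zeta> $ 3 else \<zeta> $ i)" for c and \<zeta> :: "real^3"
    by (simp add: vec_eq_iff)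
  consider "b > 0" "a - 4 / 3 * pi * b < 0" | "b < 0" "a + 8 / 3 * pi * b < 0"
    using assms unfolding unstable_regime_def by (meson linorder_neqE_linordered_idom)
  then show ?thesis
  proof cases
    case 1
    \<comment> \<open>The third factor is n + 1, written as \<open>1 / c\<close> to match
      \<open>w\<close> with \<open>c\<close> tending to 0. The profile is stretched along the third
      axis, its frequencies approach the plane with zero third component, and the dipolar symbol
      tends to its minimum \<open>- 4 / 3 * pi\<close>.\<close>
    show ?thesis
    proof (rule main[of "\<lambda>n. \<chi> i. if i = 3 then 1 / (1 / real (Suc n)) else 1" "a - 4 / 3 * pi * b"])
      fix \<zeta> :: "real^3" assume z: "\<zeta> $ 1 \<noteq> 0" "\<zeta> $ 3 \<noteq> 0"
      then have p: "(\<zeta> $ 1)\<^sup>2 + (\<zeta> $ 2)\<^sup>2 > 0" by (simp add: add_pos_nonneg)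
      then have "(- (\<zeta> $ 1)\<^sup>2 - (\<zeta> $ 2)\<^sup>2) / ((\<zeta> $ 1)\<^sup>2 + (\<zeta> $ 2)\<^sup>2) = - 1" using z by (simp add: divide_eq_eq)
      then have e: "a + b * (4 / 3 * pi * ((2 * (0 * \<zeta> $ 3)\<^sup>2 - (1 * \<zeta> $ 1)\<^sup>2 - (1 * \<zeta> $ 2)\<^sup>2) / ((1 * \<zeta> $ 1)\<^sup>2 + (1 * \<zeta> $ 2)\<^sup>2 + (0 * \<zeta> $ 3)\<^sup>2))) = a - 4 / 3 * pi * b"
        by simp
      have d: "(\<lambda>n. 1 * (1 / real (Suc n))) \<longlonglongrightarrow> 0" "(1 * \<zeta> $ 1)\<^sup>2 + (1 * \<zeta> $ 2)\<^sup>2 + (0 * \<zeta> $ 3)\<^sup>2 \<noteq> 0" using h z p by auto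
      show "(\<lambda>n. symb a b ((\<chi> i. 1 / (\<chi> i. if i = 3 then 1 / (1 / real (Suc n)) else 1) $ i) * \<zeta>)) \<longlonglongrightarrow> a - 4 / 3 * pi * b"
        unfolding w using dil_lim[of "\<lambda>_. 1" 1 "\<lambda>n. 1 / real (Suc n)" 0 \<zeta>, OF one_neq_zero tendsto_const d] unfolding e .
    qed (use 1 in auto)
  next
    case 2
    \<comment> \<open>Here the profile is flattened along the third axis, its frequencies approach
      that axis, and the dipolar symbol tends to its maximum \<open>8 / 3 * pi\<close>.\<close>
    show ?thesis
    proof (rule main[of "\<lambda>n. \<chi> i. if i = 3 then 1 / real (Suc n) else 1" "a + 8 / 3 * pi * b"])
      fix \<zeta> :: "real^3" assume z: "\<zeta> $ 1 \<noteq> 0" "\<zeta> $ 3 \<noteq> 0"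
      have w2: "(\<chi> i. 1 / (\<chi> i. if i = 3 then 1 / real (Suc n) else 1) $ i) * \<zeta> = (\<chi> i. if i = 3 then real (Suc n) * \<zeta> $ 3 else \<zeta> $ i)" for n
        by (rule w)
      have e: "a + b * (4 / 3 * pi * ((2 * (1 * \<zeta> $ 3)\<^sup>2 - (0 * \<zeta> $ 1)\<^sup>2 - (0 * \<zeta> $ 2)\<^sup>2) / ((0 * \<zeta> $ 1)\<^sup>2 + (0 * \<zeta> $ 2)\<^sup>2 + (1 * \<zeta> $ 3)\<^sup>2))) = a + 8 / 3 * pi * b"
        using z by simp
      have d: "(\<lambda>n. 1 / real (Suc n) * real (Suc n)) \<longlonglongrightarrow> 1" "(0 * \<zeta> $ 1)\<^sup>2 + (0 * \<zeta> $ 2)\<^sup>2 + (1 * \<zeta> $ 3)\<^sup>2 \<noteq> 0" using z by auto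
      show "(\<lambda>n. symb a b ((\<chi> i. 1 / (\<chi> i. if i = 3 then 1 / real (Suc n) else 1) $ i) * \<zeta>)) \<longlonglongrightarrow> a + 8 / 3 * pi * b"
        unfolding w2 using dil_lim[of "\<lambda>n. 1 / real (Suc n)" 0 "\<lambda>n. real (Suc n)" 1 \<zeta>, OF _ h d] unfolding e by simp
    qed (use 2 in auto)
  qed
qed

section \<open>Maximizers of the Gagliardo--Nirenberg quotient\<close>

text \<open>High frequencies of the density contribute little, so a fixed share of its L^2 norm sits
  at low frequencies. Written as an average against the probability density |v|^2, this share forces
  a smoothed density to be large at some point, which a translation moves to the origin. The
  potential \<open>W\<close> is the smoothing kernel and is the same for all
  \<open>v\<close>.\<close>

lemma nonvanishing:
  assumes \<delta>: "\<delta> > 0"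
  shows "\<exists>W. \<exists>\<epsilon>>0. \<forall>v. mass v = 1 \<longrightarrow> kinetic v = 1 \<longrightarrow> quart 1 0 v \<ge> \<delta> \<longrightarrow>
    (\<exists>y. W \<bullet> prodR (phase y v) (phase y v) \<ge> \<epsilon>)"
proof -
  \<comment> \<open>The factor \<open>8 * kap\<close> is \<open>2 * kap\<close> times the fourth
    power of the norm, which is 4 for the functions considered; the cutoff \<open>N\<close> makes
    the high-frequency part at most half of the total.\<close>
  have "((\<lambda>N. N powr (- (1/2)) * (8 * kap)) \<longlongrightarrow> 0 * (8 * kap)) at_top"
    by (intro tendsto_mult tendsto_const tendsto_neg_powr filterlim_ident) simp
  then have "\<forall>\<^sub>F N in at_top. N powr (- (1/2)) * (8 * kap) < plconst * \<delta> / 2"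
    by (rule order_tendstoD(2)) (use \<delta> plconst_pos in simp)
  with eventually_gt_at_top[of "0::real"] have "\<forall>\<^sub>F N in at_top. N > 0 \<and> N powr (- (1/2)) * (8 * kap) < plconst * \<delta> / 2"
    by eventually_elim simp
  then obtain N :: real where N: "N > 0" "N powr (- (1/2)) * (8 * kap) < plconst * \<delta> / 2"
    using eventually_happens'[OF trivial_limit_at_top_linorder] by blast
  define B where "B = ball (0::real^3) (2 * N)"
  have [measurable]: "B \<in> sets borel" by (simp add: B_def)
  have si: "square_integrable (indicator B :: real^3 \<Rightarrow> complex)"
    unfolding B_def by (rule square_integrable_indicator_ball)
  obtain W where W: "FT W = l2_of (indicator B)" using FT_surj by blast
  define \<epsilon> where "\<epsilon> = plconst * \<delta> / 2"
  have \<epsilon>: "\<epsilon> > 0" using \<delta> plconst_pos by (simp add: \<epsilon>_def)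
  show ?thesis
  proof (intro exI[of _ W] exI[of _ "\<epsilon> / 2 / plconst"] conjI allI impI)
    show "\<epsilon> / 2 / plconst > 0" using \<epsilon> plconst_pos by simp
    fix v assume v: "mass v = 1" "kinetic v = 1" "quart 1 0 v \<ge> \<delta>"
    let ?p = "prodhat v v"
    have n: "(norm v)\<^sup>2 = 2" using v by (simp add: norm_h1_eq)
    have tail: "(LINT \<zeta>|lborel. indicator (- B) \<zeta> * (cmod (?p \<zeta>))\<^sup>2) \<le> \<epsilon>"
    proof -
      have "(\<integral>\<^sup>+\<zeta>. indicator (- B) \<zeta> * ennreal ((cmod (fourier (\<lambda>x. fun_of v x * cnj (fun_of v x)) \<zeta>))\<^sup>2) \<partial>lborel)
        \<le> ennreal (2 * N powr (- (1/2)) * kap * (norm v)\<^sup>2 * (norm v)\<^sup>2)"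
        by (rule fourier_product_bound[OF fun_of_square_integrable fun_of_square_integrable])
           (use N decay_high in \<open>auto simp: hat_def B_def\<close>)
      also have "\<dots> \<le> ennreal \<epsilon>" using N(2) by (intro ennreal_leI) (simp add: n \<epsilon>_def)
      finally have "(\<integral>\<^sup>+\<zeta>. ennreal (indicator (- B) \<zeta> * (cmod (?p \<zeta>))\<^sup>2) \<partial>lborel) \<le> ennreal \<epsilon>"
        unfolding prodhat_def by (simp add: ennreal_mult' ennreal_indicator)
      then show ?thesis using \<epsilon> by (intro integral_real_bounded) auto
    qed
    have split: "(LINT \<zeta>|lborel. (cmod (?p \<zeta>))\<^sup>2) = (LINT \<zeta>|lborel. indicator B \<zeta> * (cmod (?p \<zeta>))\<^sup>2) + (LINT \<zeta>|lborel. indicator (- B) \<zeta> * (cmod (?p \<zeta>))\<^sup>2)"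
    proof -
      have i: "integrable lborel (\<lambda>\<zeta>. indicator S \<zeta> * (cmod (?p \<zeta>))\<^sup>2)" if [measurable]: "S \<in> sets borel" for S
        by (rule Bochner_Integration.integrable_bound[OF integrable_prodhat[of v]]) (auto simp: indicator_def)
      show ?thesis
        by (subst Bochner_Integration.integral_add[symmetric, OF i i])
           (auto intro!: Bochner_Integration.integral_cong simp: indicator_def)
    qed
    have "(LINT \<zeta>|lborel. (cmod (?p \<zeta>))\<^sup>2) = plconst * quart 1 0 v" unfolding quart_eq by (simp add: symb_def)
    also have "\<dots> \<ge> 2 * \<epsilon>" using v(3) plconst_pos by (simp add: \<epsilon>_def)
    finally have low: "(LINT \<zeta>|lborel. indicator B \<zeta> * (cmod (?p \<zeta>))\<^sup>2) \<ge> \<epsilon>" using tail split by linarith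
    \<comment> \<open>Conjugate low-frequency part of the density. Its transform is a multiple of
      the smoothed density, and integrating that against |v|^2 gives the low-frequency
      share.\<close>
    define g where "g \<zeta> = indicator B \<zeta> * cnj (?p \<zeta>)" for \<zeta>
    have gi: "integrable lborel g"
      unfolding g_def[abs_def] by (intro square_integrable_mult si square_integrable_cnj prodhat_square_integrable)
    have "(LINT \<zeta>|lborel. ?p \<zeta> * g \<zeta>) = (LINT x|lborel. fun_of v x * cnj (fun_of v x) * fourier g x)"
      unfolding prodhat_def[of v v] by (rule fourier_multiplication_formula[OF product_L1 gi])
    also have "(LINT \<zeta>|lborel. ?p \<zeta> * g \<zeta>) = (LINT \<zeta>|lborel. of_real (indicator B \<zeta> * (cmod (?p \<zeta>))\<^sup>2))"
      by (intro Bochner_Integration.integral_cong refl) (simp add: g_def complex_norm_square indicator_def del: of_real_power)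
    also have "(LINT x|lborel. fun_of v x * cnj (fun_of v x) * fourier g x) = (LINT x|lborel. of_real (abs_sq v x) * fourier g x)"
      by (intro Bochner_Integration.integral_cong refl) (simp add: abs_sq_def complex_norm_square del: of_real_power)
    finally have eq: "of_real (LINT \<zeta>|lborel. indicator B \<zeta> * (cmod (?p \<zeta>))\<^sup>2) = (LINT x|lborel. of_real (abs_sq v x) * fourier g x)"
      by (simp only: integral_complex_of_real)
    have ai: "integrable lborel (abs_sq v)" unfolding abs_sq_eq[abs_def]
      by (rule square_integrable_inner[OF fun_of_square_integrable fun_of_square_integrable])
    have [measurable]: "fourier g \<in> borel_measurable borel" by (rule fourier_L1_bounded(1)[OF gi])
    have afi: "integrable lborel (\<lambda>x. complex_of_real (abs_sq v x) * fourier g x)"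
    proof (rule Bochner_Integration.integrable_bound)
      show "integrable lborel (\<lambda>x. abs_sq v x * (LINT \<zeta>|lborel. cmod (g \<zeta>)))" using ai by simp
      show "AE x in lborel. norm (of_real (abs_sq v x) * fourier g x) \<le> norm (abs_sq v x * (LINT \<zeta>|lborel. cmod (g \<zeta>)))"
      proof (intro AE_I2)
        fix x
        have "abs_sq v x \<ge> 0" by (simp add: abs_sq_def)
        then show "norm (of_real (abs_sq v x) * fourier g x) \<le> norm (abs_sq v x * (LINT \<zeta>|lborel. cmod (g \<zeta>)))"
          using fourier_L1_bounded(2)[OF gi, of x] by (simp add: norm_mult abs_mult mult_left_mono)
      qed
    qed (use ai in measurable)
    \<comment> \<open>The average with respect to a probability density is at least
      \<open>\<epsilon>\<close>, so the values cannot all stay below half of it.\<close>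
    have "\<exists>y. Re (fourier g y) \<ge> \<epsilon> / 2"
    proof (rule ccontr)
      assume c: "\<not> ?thesis"
      have "(LINT \<zeta>|lborel. indicator B \<zeta> * (cmod (?p \<zeta>))\<^sup>2) = Re (LINT x|lborel. of_real (abs_sq v x) * fourier g x)"
        unfolding eq[symmetric] by simp
      also have "\<dots> = (LINT x|lborel. abs_sq v x * Re (fourier g x))"
        using integral_Re[OF afi] by simp
      also have "\<dots> \<le> (LINT x|lborel. abs_sq v x * (\<epsilon> / 2))"
      proof (rule integral_mono)
        show "integrable lborel (\<lambda>x. abs_sq v x * Re (fourier g x))" using integrable_Re[OF afi] by simp
        show "abs_sq v x * Re (fourier g x) \<le> abs_sq v x * (\<epsilon> / 2)" for x
          using c by (intro mult_left_mono) (auto simp: abs_sq_def not_le less_imp_le)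
      qed (use ai in simp)
      also have "\<dots> = \<epsilon> / 2" using v(1) by (simp add: mass_def)
      finally show False using low \<epsilon> by simp
    qed
    then obtain y where y: "Re (fourier g y) \<ge> \<epsilon> / 2" by blast
    let ?w = "phase y v"
    have "fourier g y = (LINT \<zeta>|lborel. indicator B \<zeta> * cnj (prodhat ?w ?w \<zeta>))"
      unfolding fourier_def g_def prodhat_phase
      by (intro Bochner_Integration.integral_cong refl) (simp add: cis_cnj)
    then have "Re (fourier g y) = l2_of (indicator B) \<bullet> l2_of (prodhat ?w ?w)"
      using Re_integral_mult_cnj[OF si prodhat_square_integrable[of ?w ?w]] by simp
    also have "\<dots> = plconst * (W \<bullet> prodR ?w ?w)" by (simp add: W[symmetric] FT_prodC[symmetric] inner_FT prodR_self)
    finally show "\<exists>y. W \<bullet> prodR (phase y v) (phase y v) \<ge> \<epsilon> / 2 / plconst"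
      using y plconst_pos by (intro exI[of _ y]) (simp add: field_simps)
  qed
qed

text \<open>Pointwise Cauchy--Schwarz bounds the squared norm by the pairing of the fixed density
  |w|^2 with |z n|^2, which vanishes in the limit by compactness.\<close>

lemma prodR_weak_0:
  assumes weak: "\<And>x. (\<lambda>n. z n \<bullet> x) \<longlonglongrightarrow> 0" and bdd: "\<And>n. norm (z n) \<le> K"
  shows "(\<lambda>n. prodR w (z n)) \<longlonglongrightarrow> 0"
proof -
  have le: "(norm (prodR w v))\<^sup>2 \<le> prodR w w \<bullet> prodC v v" for v
  proof -
    have "(norm (prodR w v))\<^sup>2 = (LINT x|lborel. (fun_of w x \<bullet> fun_of v x)\<^sup>2)"
      unfolding prodR_def norm_l2_of[OF prodR_si] by simp
    also have "\<dots> \<le> (LINT x|lborel. (fun_of w x \<bullet> fun_of w x) * (fun_of v x \<bullet> fun_of v x))"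
    proof (rule integral_mono)
      show "integrable lborel (\<lambda>x. (fun_of w x \<bullet> fun_of v x)\<^sup>2)"
        using prodR_square_integrable[of w v] by (simp add: square_integrable_def)
      show "integrable lborel (\<lambda>x. (fun_of w x \<bullet> fun_of w x) * (fun_of v x \<bullet> fun_of v x))"
        using square_integrable_inner[OF prodR_square_integrable[of w w] prodR_square_integrable[of v v]] by simp
    qed (rule Cauchy_Schwarz_ineq)
    also have "\<dots> = prodR w w \<bullet> prodC v v"
      unfolding prodR_self[symmetric] prodR_def inner_l2_of[OF prodR_si prodR_si] by (simp add: inner_complex_def)
    finally show ?thesis .
  qed
  have "(\<lambda>n. (norm (prodR w (z n)))\<^sup>2) \<longlonglongrightarrow> 0"
    by (rule tendsto_sandwich[OF _ _ tendsto_const potential_compact_0[OF weak bdd, of "prodR w w"]]) (auto simp: le)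
  then have "(\<lambda>n. sqrt ((norm (prodR w (z n)))\<^sup>2)) \<longlonglongrightarrow> sqrt 0" by (rule tendsto_real_sqrt)
  then show ?thesis by (simp add: tendsto_norm_zero_iff)
qed

text \<open>Expanding the square of the density, every mixed term either contains
  \<open>prodR w (z n)\<close>, which tends to 0 in norm, or pairs the fixed potential of
  \<open>w\<close> with the density of \<open>z n\<close>, which vanishes by compactness.\<close>

lemma quart_split:
  assumes weak: "\<And>x. (\<lambda>n. z n \<bullet> x) \<longlonglongrightarrow> 0" and bdd: "\<And>n. norm (z n) \<le> K"
  shows "(\<lambda>n. quart a b (w + z n) - quart a b w - quart a b (z n)) \<longlonglongrightarrow> 0"
proof -
  interpret R: bounded_bilinear prodR by (rule bounded_bilinear_prodR)
  interpret T: bounded_linear "Top a b" by (rule bounded_linear_Top)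
  let ?T = "Top a b" and ?P = "prodR w w" and ?R = "\<lambda>n. prodR w (z n)" and ?Z = "\<lambda>n. prodR (z n) (z n)"
  have K0: "K \<ge> 0" using bdd[of 0] norm_ge_zero order_trans by blast
  obtain L where L: "\<And>n. norm (?Z n) \<le> L"
  proof
    fix n
    show "norm (?Z n) \<le> sqrt (2 * kap / plconst) * K * K"
      by (rule order_trans[OF norm_prodR]) (intro mult_mono bdd, use kap_nonneg plconst_pos K0 in auto)
  qed
  have e: "quart a b (w + z n) - quart a b w - quart a b (z n) = 2 * (?T ?P \<bullet> ?Z n) + 4 * (?T ?P \<bullet> ?R n) + 4 * (?T (?R n) \<bullet> ?R n) + 4 * (?T (?R n) \<bullet> ?Z n)" for n
  proof -
    have "prodR (w + z n) (w + z n) = ?P + 2 *\<^sub>R ?R n + ?Z n"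
      by (simp add: R.add_left R.add_right prodR_commute[of "z n" w] scaleR_2)
    then show ?thesis unfolding quart_def
      using Top_selfadjoint[of a b "?Z n" ?P] Top_selfadjoint[of a b "?R n" ?P] Top_selfadjoint[of a b "?Z n" "?R n"]
      by (simp add: T.add T.scaleR inner_add_left inner_add_right inner_commute algebra_simps)
  qed
  have R0: "?R \<longlonglongrightarrow> 0" by (rule prodR_weak_0[OF weak bdd])
  have TR: "(\<lambda>n. ?T (?R n)) \<longlonglongrightarrow> 0" using T.tendsto[OF R0] by (simp add: T.zero)
  have "(\<lambda>n. ?T (?R n) \<bullet> ?Z n) \<longlonglongrightarrow> 0"
  proof (rule Lim_null_comparison)
    show "\<forall>\<^sub>F n in sequentially. norm (?T (?R n) \<bullet> ?Z n) \<le> norm (?T (?R n)) * L"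
      using order_trans[OF Cauchy_Schwarz_ineq2 mult_left_mono[OF L norm_ge_zero]] by (auto intro!: always_eventually)
    show "(\<lambda>n. norm (?T (?R n)) * L) \<longlonglongrightarrow> 0" using tendsto_mult_left_zero[OF tendsto_norm_zero[OF TR]] by simp
  qed
  moreover have "(\<lambda>n. ?T ?P \<bullet> ?Z n) \<longlonglongrightarrow> 0" unfolding prodR_self by (rule potential_compact_0[OF weak bdd])
  ultimately have "(\<lambda>n. 2 * (?T ?P \<bullet> ?Z n) + 4 * (?T ?P \<bullet> ?R n) + 4 * (?T (?R n) \<bullet> ?R n) + 4 * (?T (?R n) \<bullet> ?Z n)) \<longlonglongrightarrow> 2 * 0 + 4 * (?T ?P \<bullet> 0) + 4 * (0 \<bullet> (0::l2)) + 4 * 0"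
    by (intro tendsto_intros TR R0)
  then show ?thesis unfolding e by simp
qed

text \<open>Riesz turns the continuous functional on the left into an H^1 inner product with a fixed
  vector.\<close>

lemma l2_inner_weak_0:
  assumes weak: "\<And>x. (\<lambda>n. z n \<bullet> x) \<longlonglongrightarrow> 0"
  shows "(\<lambda>n. l2_inner w (z n)) \<longlonglongrightarrow> 0"
proof -
  have "bounded_linear (\<lambda>v. emb w \<bullet> emb v)"
    by (rule bounded_linear_compose[OF bounded_linear_inner_right bounded_linear_emb])
  then obtain l where "\<And>v. emb w \<bullet> emb v = v \<bullet> l" using riesz_representation by blast
  then show ?thesis using weak by (simp add: l2_inner_eq)
qed

lemma mass_add: "mass (u + v) = mass u + mass v + 2 * l2_inner u v"
  unfolding mass_eq_inner l2_inner_eq linear_simps(1)[OF bounded_linear_emb]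
  by (simp add: inner_add_left inner_add_right inner_commute)

lemma kinetic_add: "kinetic (u + v) = kinetic u + kinetic v + 2 * (u \<bullet> v - l2_inner u v)"
  unfolding kinetic_eq_inner l2_inner_eq linear_simps(1)[OF bounded_linear_emb]
  by (simp add: inner_add_left inner_add_right inner_commute)

text \<open>\<open>x\<close> and \<open>y\<close> are the shares of kinetic energy and mass retained
  by the weak limit. Both square roots are at most 1, so the sum is a convex combination of numbers
  at most 1 and reaches 1 only if \<open>x * y\<close> does.\<close>

lemma gn_equality:
  fixes x y :: real
  assumes x: "0 < x" "x \<le> 1" and y: "0 < y" "y \<le> 1"
    and le: "1 \<le> x * sqrt (x * y) + (1 - x) * sqrt ((1 - x) * (1 - y))"
  shows "x = 1" "y = 1"
proof -
  have "sqrt (x * y) \<le> 1" "sqrt ((1 - x) * (1 - y)) \<le> 1" using assms by (auto intro: mult_le_one)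
  then have "(1 - x) * sqrt ((1 - x) * (1 - y)) \<le> (1 - x) * 1" using x by (intro mult_left_mono) auto
  with le have "x * 1 \<le> x * sqrt (x * y)" by simp
  then have "1 \<le> x * y" using x by simp
  moreover have "x * y \<le> x" "x * y \<le> y" using x y by (simp_all add: mult_left_le mult_left_le_one_le)
  ultimately show "x = 1" "y = 1" using x y by linarith+
qed

theorem maximizer_exists:
  assumes neg: "\<exists>u. quart a b u < 0"
  shows "\<exists>w J. J > 0 \<and> w \<noteq> 0 \<and> - quart a b w = J * gnfun w \<and> (\<forall>v. - quart a b v \<le> J * gnfun v)"
proof -
  let ?q = "\<lambda>u. - quart a b u / gnfun u"
  define J where "J = (SUP u\<in>{u. u \<noteq> 0}. ?q u)"
  have bdd: "bdd_above (?q ` {u. u \<noteq> 0})"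
  proof (rule bdd_aboveI2)
    fix u :: h1 assume "u \<in> {u. u \<noteq> 0}"
    then have g: "gnfun u > 0" using gnfun_pos by simp
    have "- quart a b u \<le> gnconst a b * gnfun u" using gagliardo_nirenberg[of a b u] by linarith
    then show "?q u \<le> gnconst a b" by (subst pos_divide_le_eq[OF g])
  qed
  obtain u0 where "quart a b u0 < 0" using neg by blast
  moreover from this have u0: "u0 \<noteq> 0" using quart_0[of a b] by auto
  ultimately have "?q u0 > 0" using gnfun_pos by (simp add: divide_neg_pos)
  also have "?q u0 \<le> J" unfolding J_def by (rule cSUP_upper[OF _ bdd]) (use u0 in simp)
  finally have J: "J > 0" .
  have upper: "- quart a b v \<le> J * gnfun v" for v
  proof (cases "v = 0")
    case True then show ?thesis using gnfun_nonneg J by (simp add: quart_0)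
  next
    case False
    then have "?q v \<le> J" unfolding J_def by (intro cSUP_upper[OF _ bdd]) simp
    then show ?thesis by (subst (asm) pos_divide_le_eq[OF gnfun_pos[OF False]])
  qed
  \<comment> \<open>The tolerance has two purposes: \<open>J / 2\<close> keeps the quartic form
    uniformly away from 0 for the nonvanishing argument, and \<open>1 / Suc n\<close> makes the
    sequence maximizing.\<close>
  have ex: "\<exists>v. mass v = 1 \<and> kinetic v = 1 \<and> - quart a b v > J - min (J / 2) (1 / Suc n)" for n
  proof -
    have "\<exists>u\<in>{u. u \<noteq> 0}. J - min (J / 2) (1 / Suc n) < ?q u"
    proof (subst less_cSUP_iff[OF _ bdd, symmetric])
      show "J - min (J / 2) (1 / Suc n) < (SUP u\<in>{u. u \<noteq> 0}. ?q u)" unfolding J_def[symmetric] using J by simp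
    qed (use u0 in auto)
    then obtain u where u: "u \<noteq> 0" "J - min (J / 2) (1 / Suc n) < ?q u" by auto
    obtain s t where "t > 0" "mass (idil s t u) = 1" "kinetic (idil s t u) = 1"
      "quart a b (idil s t u) = quart a b u / gnfun u" using normalise[OF u(1)] by metis
    with u(2) show ?thesis by (intro exI[of _ "idil s t u"]) simp
  qed
  then obtain v where v: "mass (v n) = 1" "kinetic (v n) = 1" "- quart a b (v n) > J - min (J / 2) (1 / Suc n)" for n
    by metis
  let ?S = "\<bar>a\<bar> + \<bar>b\<bar> * (4 * pi)"
  have S: "J / 2 < ?S * quart 1 0 (v n)" for n
    using v(3)[of n] abs_quart_le[of a b "v n"] J by linarith
  have q10: "quart 1 0 (v n) \<ge> 0" for n by (simp add: quart_1_0)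
  have S0: "?S > 0"
  proof (rule ccontr)
    assume c: "\<not> ?S > 0"
    have "?S \<ge> 0" by simp
    with c have z: "?S = 0" by linarith
    show False using S[of 0] J unfolding z by simp
  qed
  have "quart 1 0 (v n) \<ge> J / 2 / ?S" for n
    unfolding pos_divide_le_eq[OF S0] using S[of n] by (simp only: mult.commute less_imp_le)
  moreover obtain W \<epsilon> where W: "\<epsilon> > 0" "\<And>v. mass v = 1 \<Longrightarrow> kinetic v = 1 \<Longrightarrow> quart 1 0 v \<ge> J / 2 / ?S \<Longrightarrow> (\<exists>y. W \<bullet> prodR (phase y v) (phase y v) \<ge> \<epsilon>)"
    using nonvanishing[of "J / 2 / ?S"] J S0 by (metis divide_pos_pos half_gt_zero)
  ultimately have "\<exists>y. W \<bullet> prodR (phase y (v n)) (phase y (v n)) \<ge> \<epsilon>" for n using v by blast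
  then obtain y where y: "W \<bullet> prodR (phase (y n) (v n)) (phase (y n) (v n)) \<ge> \<epsilon>" for n by metis
  define u where "u n = phase (y n) (v n)" for n
  have u: "mass (u n) = 1" "kinetic (u n) = 1" "- quart a b (u n) > J - min (J / 2) (1 / Suc n)" "W \<bullet> prodR (u n) (u n) \<ge> \<epsilon>" for n
    using v y by (auto simp: u_def mass_phase kinetic_phase quart_phase)
  have nu: "norm (u n) \<le> sqrt 2" for n using u by (intro real_le_rsqrt) (simp add: norm_h1_eq)
  obtain r w where r: "strict_mono r" and weak: "\<And>x. (\<lambda>n. u (r n) \<bullet> x) \<longlonglongrightarrow> w \<bullet> x"
    by (rule bounded_weak_subsequence[of u, OF nu]) blast
  define z where "z n = u (r n) - w" for n
  have uz: "u (r n) = w + z n" for n by (simp add: z_def)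
  have wz: "(\<lambda>n. z n \<bullet> x) \<longlonglongrightarrow> 0" for x
    unfolding z_def inner_diff_left using tendsto_diff[OF weak tendsto_const, of x "w \<bullet> x"] by simp
  have bz: "norm (z n) \<le> sqrt 2 + norm w" for n
    unfolding z_def by (rule order_trans[OF norm_triangle_ineq4]) (simp add: nu)
  have qlim: "(\<lambda>n. - quart a b (u (r n))) \<longlonglongrightarrow> J"
  proof (rule tendsto_sandwich)
    show "\<forall>\<^sub>F n in sequentially. J - 1 / Suc n \<le> - quart a b (u (r n))"
    proof (intro always_eventually allI)
      fix n
      have "1 / real (Suc (r n)) \<le> 1 / Suc n" using seq_suble[OF r, of n] by (intro divide_left_mono) auto
      with u(3)[of "r n"] show "J - 1 / Suc n \<le> - quart a b (u (r n))" by linarith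
    qed
    show "\<forall>\<^sub>F n in sequentially. - quart a b (u (r n)) \<le> J"
    proof (intro always_eventually allI)
      fix n
      have "gnfun (u (r n)) = 1" by (simp add: gnfun_def u)
      then show "- quart a b (u (r n)) \<le> J" using upper[of "u (r n)"] by simp
    qed
    show "(\<lambda>n. J - 1 / Suc n) \<longlonglongrightarrow> J" using tendsto_diff[OF tendsto_const LIMSEQ_Suc[OF lim_1_over_n], of J] by simp
  qed simp
  have w0: "w \<noteq> 0"
  proof
    assume "w = 0"
    then have "(\<lambda>n. W \<bullet> prodR (u (r n)) (u (r n))) \<longlonglongrightarrow> 0"
      unfolding prodR_self using weak nu by (intro potential_compact_0) auto
    then have "\<forall>\<^sub>F n in sequentially. W \<bullet> prodR (u (r n)) (u (r n)) < \<epsilon>" using W(1) by (rule order_tendstoD(2))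
    then obtain n where "W \<bullet> prodR (u (r n)) (u (r n)) < \<epsilon>" using eventually_happens'[OF sequentially_bot] by blast
    then show False using u(4)[of "r n"] by simp
  qed
  have li: "(\<lambda>n. l2_inner w (z n)) \<longlonglongrightarrow> 0" by (rule l2_inner_weak_0[OF wz])
  have mz: "(\<lambda>n. mass (z n)) \<longlonglongrightarrow> 1 - mass w"
  proof -
    have "mass (z n) = 1 - mass w - 2 * l2_inner w (z n)" for n using mass_add[of w "z n"] u(1)[of "r n"] uz[of n] by simp
    then show ?thesis using tendsto_diff[OF tendsto_const tendsto_mult[OF tendsto_const li], of "1 - mass w" 2] by simp
  qed
  have kz: "(\<lambda>n. kinetic (z n)) \<longlonglongrightarrow> 1 - kinetic w"
  proof -
    have "kinetic (z n) = 1 - kinetic w - 2 * (z n \<bullet> w - l2_inner w (z n))" for n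
      using kinetic_add[of w "z n"] u(2)[of "r n"] uz[of n] by (simp add: inner_commute)
    then show ?thesis using tendsto_diff[OF tendsto_const tendsto_mult[OF tendsto_const tendsto_diff[OF wz li]], of "1 - kinetic w" 2] by simp
  qed
  have m1: "mass w \<le> 1" "kinetic w \<le> 1"
    using LIMSEQ_le_const[OF mz, of 0] LIMSEQ_le_const[OF kz, of 0] mass_nonneg kinetic_nonneg by auto
  have "(\<lambda>n. - quart a b (u (r n)) + quart a b w + (quart a b (w + z n) - quart a b w - quart a b (z n))) \<longlonglongrightarrow> J + quart a b w + 0"
    by (intro tendsto_add qlim tendsto_const quart_split[OF wz bz])
  then have zl: "(\<lambda>n. - quart a b (z n)) \<longlonglongrightarrow> J + quart a b w" by (simp add: uz)
  have "(\<lambda>n. J * gnfun (z n)) \<longlonglongrightarrow> J * ((1 - kinetic w) * sqrt ((1 - kinetic w) * (1 - mass w)))"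
    unfolding gnfun_def by (intro tendsto_mult tendsto_const tendsto_real_sqrt kz mz)
  \<comment> \<open>The remainders obey the inequality for \<open>J\<close> as well. Adding the one
    for \<open>w\<close> puts the full \<open>J\<close> on the left and the two shares on the right,
    the situation of \<open>gn_equality\<close>.\<close>
  then have le: "J + quart a b w \<le> J * ((1 - kinetic w) * sqrt ((1 - kinetic w) * (1 - mass w)))"
    by (rule LIMSEQ_le[OF zl]) (use upper in blast)
  then have "J * 1 \<le> J * (kinetic w * sqrt (kinetic w * mass w) + (1 - kinetic w) * sqrt ((1 - kinetic w) * (1 - mass w)))"
    using upper[of w] unfolding gnfun_def distrib_left by linarith
  then have "1 \<le> kinetic w * sqrt (kinetic w * mass w) + (1 - kinetic w) * sqrt ((1 - kinetic w) * (1 - mass w))"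
    using J by (rule mult_left_le_imp_le)
  then have "kinetic w = 1" "mass w = 1" using gn_equality[OF kinetic_pos[OF w0] m1(2) mass_pos[OF w0] m1(1)] by auto
  then have "- quart a b w = J * gnfun w" using le upper[of w] by (simp add: gnfun_def)
  then show ?thesis using J w0 upper by blast
qed

section \<open>Euler--Lagrange equations\<close>

text \<open>Normalised so that the derivatives of \<open>kinetic\<close> and \<open>quart\<close>
  are 2 \<open>dkin\<close> and 4 \<open>dquart\<close>, and that of the energy is
  \<open>dkin\<close> + 2 \<open>dquart\<close>.\<close>

definition dkin :: "h1 \<Rightarrow> h1 \<Rightarrow> real" where "dkin u h = u \<bullet> h - l2_inner u h"

definition dquart :: "real \<Rightarrow> real \<Rightarrow> h1 \<Rightarrow> h1 \<Rightarrow> real" where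
  "dquart a b u h = Top a b (prodR u u) \<bullet> prodR u h"

lemma mass_has_derivative: "(mass has_derivative (\<lambda>h. 2 * l2_inner u h)) (at u)"
  unfolding mass_eq_inner[abs_def] l2_inner_eq
  by (rule has_derivative_eq_rhs[OF has_derivative_inner[OF bounded_linear_imp_has_derivative[OF bounded_linear_emb] bounded_linear_imp_has_derivative[OF bounded_linear_emb]]])
     (simp add: fun_eq_iff inner_commute)

lemma kinetic_has_derivative: "(kinetic has_derivative (\<lambda>h. 2 * dkin u h)) (at u)"
proof -
  have e: "kinetic = (\<lambda>v. v \<bullet> v - mass v)" by (simp add: fun_eq_iff kinetic_eq_inner mass_eq_inner)
  show ?thesis unfolding e
    by (rule has_derivative_eq_rhs[OF has_derivative_diff[OF has_derivative_inner[OF has_derivative_ident has_derivative_ident] mass_has_derivative]])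
       (simp add: fun_eq_iff inner_commute dkin_def algebra_simps)
qed

lemma quart_has_derivative: "(quart a b has_derivative (\<lambda>h. 4 * dquart a b u h)) (at u)"
proof -
  interpret R: bounded_bilinear prodR by (rule bounded_bilinear_prodR)
  have R: "((\<lambda>v. prodR v v) has_derivative (\<lambda>h. prodR u h + prodR u h)) (at u)"
    using R.FDERIV[OF has_derivative_ident has_derivative_ident, of u UNIV] unfolding prodR_commute[of h u for h] .
  have sym: "Top a b (prodR u h) \<bullet> prodR u u = Top a b (prodR u u) \<bullet> prodR u h" for h
    unfolding Top_selfadjoint[of a b "prodR u h"] by (rule inner_commute)
  show ?thesis unfolding quart_def[abs_def]
    by (rule has_derivative_eq_rhs[OF has_derivative_inner[OF bounded_linear.has_derivative[OF bounded_linear_Top R] R]])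
       (simp add: fun_eq_iff linear_simps(1)[OF bounded_linear_Top] inner_add_left inner_add_right dquart_def sym)
qed

lemma energy_has_derivative: "(energy a b has_derivative (\<lambda>h. dkin u h + 2 * dquart a b u h)) (at u)"
  unfolding energy_eq[abs_def]
  by (rule has_derivative_eq_rhs[OF has_derivative_add[OF has_derivative_mult_right[OF kinetic_has_derivative] has_derivative_mult_right[OF quart_has_derivative]]])
     (simp add: fun_eq_iff)

lemma l2_inner_linear:
  "l2_inner u (v + w) = l2_inner u v + l2_inner u w" "l2_inner u (v - w) = l2_inner u v - l2_inner u w"
  "l2_inner u (r *\<^sub>R v) = r * l2_inner u v"
  unfolding l2_inner_eq by (simp_all add: linear_simps[OF bounded_linear_emb] inner_add_right inner_diff_right)

text \<open>Subtracting the component along \<open>u\<close> makes any direction tangential. The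
  multiplier is therefore minus the derivative in direction \<open>u\<close> divided by
  \<open>c\<close>.\<close>

lemma critical_on_sphere_iff:
  assumes c: "c > 0"
  shows "critical_on_sphere a b c u \<longleftrightarrow> mass u = c \<and> (\<exists>\<kappa>. \<forall>h. dkin u h + 2 * dquart a b u h + \<kappa> * l2_inner u h = 0)"
    (is "_ \<longleftrightarrow> _ \<and> (\<exists>\<kappa>. \<forall>h. ?D h + _ = 0)")
proof -
  have "(\<forall>v. l2_inner u v = 0 \<longrightarrow> ?D v = 0) \<longleftrightarrow> (\<exists>\<kappa>. \<forall>h. ?D h + \<kappa> * l2_inner u h = 0)" if m: "mass u = c"
  proof
    assume z: "\<forall>v. l2_inner u v = 0 \<longrightarrow> ?D v = 0"
    interpret D: bounded_linear ?D using energy_has_derivative by (rule has_derivative_bounded_linear)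
    show "\<exists>\<kappa>. \<forall>h. ?D h + \<kappa> * l2_inner u h = 0"
    proof (intro exI allI)
      fix h
      have "l2_inner u (h - (l2_inner u h / c) *\<^sub>R u) = 0"
        using m c by (simp add: l2_inner_linear mass_eq_inner[symmetric])
      then have "?D (h - (l2_inner u h / c) *\<^sub>R u) = 0" using z by blast
      then show "?D h + (- ?D u / c) * l2_inner u h = 0"
        unfolding D.diff D.scaleR by (simp add: algebra_simps add_divide_distrib diff_divide_distrib)
    qed
  qed (metis add.right_neutral mult_zero_right)
  moreover have "(\<exists>D. (energy a b has_derivative D) (at u) \<and> (\<forall>v. l2_inner u v = 0 \<longrightarrow> D v = 0)) \<longleftrightarrow> (\<forall>v. l2_inner u v = 0 \<longrightarrow> ?D v = 0)"
    using energy_has_derivative[of a b u] has_derivative_unique by (metis (mono_tags, lifting))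
  ultimately show ?thesis unfolding critical_on_sphere_def sphere_S_def by auto
qed

text \<open>\<open>J * gnfun + quart\<close> is nonnegative and vanishes at \<open>u\<close>, so its
  unconstrained derivative is 0 there. The normalisation of \<open>quart\<close> turns equality into
  J sqrt (A c) = 2/3, which determines both the kinetic energy and the multiplier.\<close>

lemma maximizer_equation:
  assumes J: "J > 0" and eq: "- quart a b u = J * gnfun u" and max: "\<And>v. - quart a b v \<le> J * gnfun v"
    and c: "c > 0" "mass u = c" and q: "quart a b u = - (2 / 3) * kinetic u" and u: "u \<noteq> 0"
  shows "dkin u h + 2 * dquart a b u h + kinetic u / (3 * c) * l2_inner u h = 0"
    and "kinetic u = 4 / (9 * J\<^sup>2 * c)"
proof -
  let ?A = "kinetic u" let ?R = "sqrt (?A * c)"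
  have A: "?A > 0" by (rule kinetic_pos[OF u])
  have R: "?R > 0" "?R\<^sup>2 = ?A * c" using A c by auto
  have "J * (?A * ?R) = 2 / 3 * ?A" using eq q c by (simp add: gnfun_def)
  then have JR: "J * ?R = 2 / 3" using A by simp
  then have "(J * ?R)\<^sup>2 = (2 / 3)\<^sup>2" by simp
  then have "J\<^sup>2 * (?A * c) = 4 / 9" unfolding power_mult_distrib R(2) by (simp add: power2_eq_square)
  then show "?A = 4 / (9 * J\<^sup>2 * c)" using J c by (simp add: field_simps)
  let ?F = "\<lambda>v. J * gnfun v + quart a b v"
  have "(?F has_derivative (\<lambda>h. J * (?A * ((?A * (2 * l2_inner u h) + 2 * dkin u h * mass u) * (inverse (sqrt (?A * mass u)) / 2)) + 2 * dkin u h * sqrt (?A * mass u)) + 4 * dquart a b u h)) (at u)"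
    unfolding gnfun_def
    by (intro has_derivative_add has_derivative_mult_right has_derivative_mult has_derivative_real_sqrt kinetic_has_derivative mass_has_derivative quart_has_derivative)
       (use A c in simp)
  then have "(\<lambda>h. J * (?A * ((?A * (2 * l2_inner u h) + 2 * dkin u h * mass u) * (inverse (sqrt (?A * mass u)) / 2)) + 2 * dkin u h * sqrt (?A * mass u)) + 4 * dquart a b u h) = (\<lambda>h. 0)"
  proof (rule has_derivative_local_min, intro always_eventually allI)
    show "?F u \<le> ?F v" for v using max[of v] eq by linarith
  qed
  then have "J * (?A * ((?A * (2 * l2_inner u h) + 2 * dkin u h * c) * (inverse ?R / 2)) + 2 * dkin u h * ?R) + 4 * dquart a b u h = 0"
    unfolding c(2) by (rule fun_cong)
  moreover have "?A * ((?A * (2 * l2_inner u h) + 2 * dkin u h * c) * (inverse ?R / 2)) = ?R * (?A / c * l2_inner u h + dkin u h)"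
  proof -
    have 1: "?A * (?A * l2_inner u h + dkin u h * c) = ?R\<^sup>2 * (?A / c * l2_inner u h + dkin u h)"
      unfolding R(2) using c by (simp add: field_simps)
    have 2: "(?A * (2 * l2_inner u h) + 2 * dkin u h * c) * (inverse ?R / 2) = (?A * l2_inner u h + dkin u h * c) * inverse ?R"
      by (simp add: algebra_simps)
    have 3: "r\<^sup>2 * x * inverse r = r * x" if "r > 0" for r x :: real using that by (simp add: power2_eq_square)
    have "?A * ((?A * l2_inner u h + dkin u h * c) * inverse ?R) = ?A * (?A * l2_inner u h + dkin u h * c) * inverse ?R"
      by (rule mult.assoc[symmetric])
    then show ?thesis unfolding 2 1 3[OF R(1)] .
  qed
  ultimately have "J * (?R * (?A / c * l2_inner u h + dkin u h) + 2 * dkin u h * ?R) + 4 * dquart a b u h = 0" by (simp only:)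
  then have "J * ?R * (?A / c * l2_inner u h + dkin u h) + 2 * (J * ?R) * dkin u h + 4 * dquart a b u h = 0"
    by (simp add: algebra_simps)
  moreover have "?A / (3 * c) * l2_inner u h = 1 / 3 * (?A / c * l2_inner u h)" by simp
  moreover have "d + 2 * q + y = 0" if "2 / 3 * (x + d) + 2 * (2 / 3) * d + 4 * q = 0" "y = 1 / 3 * x" for x y d q :: real
  proof -
    have "2 * (d + 2 * q + 1 / 3 * x) = 2 / 3 * (x + d) + 2 * (2 / 3) * d + 4 * q" by (simp add: field_simps)
    with that show ?thesis by simp
  qed
  ultimately show "dkin u h + 2 * dquart a b u h + ?A / (3 * c) * l2_inner u h = 0"
    unfolding JR by blast
qed

text \<open>The space is treated as a real one; multiplication by \<open>\<i>\<close> is needed to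
  recover complex identities from their real parts.\<close>

lemma imul_exists: "\<exists>w. (AE x in lborel. fun_of w x = \<i> * fun_of v x) \<and> (AE x in lborel. \<forall>j. grad w x $ j = \<i> * grad v x $ j)"
proof -
  let ?f = "\<lambda>x. \<i> * fun_of v x" and ?G = "\<lambda>x. (\<chi> j. \<i> * grad v x $ j)"
  have G: "square_integrable ?G"
  proof -
    have [measurable]: "?G \<in> borel_measurable borel"
    proof -
      have "(\<lambda>y::complex^3. (\<chi> j. \<i> * y $ j)) \<in> borel_measurable borel"
        by (intro borel_measurable_continuous_onI continuous_intros)
      then show ?thesis by measurable
    qed
    have "norm (?G x) = norm (grad v x)" for x by (simp add: norm_vec_def norm_mult)
    then show ?thesis using grad_square_integrable[of v] by (simp add: square_integrable_def)
  qed
  have w: "weak_gradient_of ?f ?G"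
    using grad_weak_gradient[of v] unfolding weak_gradient_of_def by (simp add: mult.assoc)
  have s: "square_integrable ?f" by (rule square_integrable_i[OF fun_of_square_integrable])
  have H: "H1 ?f" using s G w by (auto simp: H1_def)
  have "AE x in lborel. grad (h1_of ?f) x = ?G x" by (rule grad_eqI[OF G w s fun_of_h1_of[OF H]])
  then have "AE x in lborel. \<forall>j. grad (h1_of ?f) x $ j = \<i> * grad v x $ j" by eventually_elim simp
  with fun_of_h1_of[OF H] show ?thesis by blast
qed

lemma potential_form:
  assumes r: "square_integrable (r :: real^3 \<Rightarrow> real)"
  shows "Re (LINT x|lborel. of_real (r x) * fun_of u x * cnj (fun_of v x)) = l2_of (\<lambda>x. of_real (r x)) \<bullet> prodR u v"
proof -
  have "Re (LINT x|lborel. of_real (r x) * fun_of u x * cnj (fun_of v x)) = Re (LINT x|lborel. of_real (r x) * cnj (fun_of v x * cnj (fun_of u x)))"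
    by (intro arg_cong[where f = Re] Bochner_Integration.integral_cong refl) (simp add: ac_simps)
  also have "\<dots> = l2_of (\<lambda>x. of_real (r x)) \<bullet> prodC v u"
    unfolding prodC_def by (rule Re_integral_mult_cnj[OF square_integrable_of_real[OF r] product_L2(1)])
  finally show ?thesis unfolding inner_prodC_real[OF r] by (simp add: prodR_commute)
qed

text \<open>The real part of the complex weak form is half of the real equation, which explains the
  factor 2 before \<open>\<mu>\<close>. The form is antilinear in the test function, so replacing
  \<open>v\<close> by its multiple by \<open>\<i>\<close> yields the imaginary part.\<close>

lemma solves_stationaryI:
  assumes eq: "\<And>h. dkin u h + 2 * dquart a b u h + 2 * \<mu> * l2_inner u h = 0"
  shows "solves_stationary a b \<mu> u"
proof -
  let ?K = "\<lambda>v. LINT x|lborel. (\<Sum>i\<in>UNIV. grad u x $ i * cnj (grad v x $ i))"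
    and ?V = "\<lambda>r v. LINT x|lborel. of_real (r x :: real) * fun_of u x * cnj (fun_of v x)"
    and ?I = "\<lambda>v. LINT x|lborel. fun_of u x * cnj (fun_of v x)"
  define C where "C v = 1 / 2 * ?K v + of_real a * ?V (abs_sq u) v + of_real b * ?V (dipolar_conv (abs_sq u)) v + of_real \<mu> * ?I v" for v
  have s1: "square_integrable (abs_sq u)" unfolding abs_sq_eq[abs_def] by (rule prodR_square_integrable)
  have P: "prodR u u = l2_of (\<lambda>x. of_real (abs_sq u x))" by (simp add: prodR_def abs_sq_eq)
  have ReC: "Re (C v) = 0" for v
  proof -
    have ki: "integrable lborel (\<lambda>x. \<Sum>i\<in>UNIV. grad u x $ i * cnj (grad v x $ i))"
      by (intro Bochner_Integration.integrable_sum square_integrable_mult square_integrable_cnj square_integrable_nth grad_square_integrable)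
    have "Re (?K v) = (LINT x|lborel. grad u x \<bullet> grad v x)"
      using integral_Re[OF ki] by (simp add: inner_vec_def inner_complex_def)
    also have "\<dots> = dkin u v" by (simp add: dkin_def inner_h1_def l2_inner_def)
    finally have K: "Re (?K v) = dkin u v" .
    have I: "Re (?I v) = l2_inner u v"
      unfolding l2_inner_eq emb_def by (rule Re_integral_mult_cnj[OF fun_of_square_integrable fun_of_square_integrable])
    have "a * Re (?V (abs_sq u) v) + b * Re (?V (dipolar_conv (abs_sq u)) v) = dquart a b u v"
      unfolding potential_form[OF s1] potential_form[OF dipolar_conv(1)[OF s1]] dquart_def l2_of_dipolar_conv[OF s1] P[symmetric]
      by (subst Top_split[of a b]) (simp add: inner_add_left)
    then show ?thesis using eq[of v] K I by (simp add: C_def)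
  qed
  have C0: "C v = 0" for v
  proof -
    obtain w where w: "AE x in lborel. fun_of w x = \<i> * fun_of v x" "AE x in lborel. \<forall>j. grad w x $ j = \<i> * grad v x $ j"
      using imul_exists by blast
    note [measurable] = square_integrable_measurable[OF s1] square_integrable_measurable[OF dipolar_conv(1)[OF s1]] borel_measurable_vec_nth'
    have K: "?K w = - \<i> * ?K v"
      unfolding integral_mult_right_zero[symmetric]
      by (rule integral_cong_AE) (measurable, use w(2) in eventually_elim, simp add: sum_distrib_left sum_negf mult.left_commute)
    have V: "?V r w = - \<i> * ?V r v" if [measurable]: "r \<in> borel_measurable borel" for r
      unfolding integral_mult_right_zero[symmetric]
      by (rule integral_cong_AE) (measurable, use w(1) in eventually_elim, simp add: mult.left_commute)
    have I: "?I w = - \<i> * ?I v"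
      unfolding integral_mult_right_zero[symmetric]
      by (rule integral_cong_AE) (measurable, use w(1) in eventually_elim, simp add: mult.left_commute)
    have "C w = - \<i> * C v"
      unfolding C_def K I V[OF square_integrable_measurable[OF s1]] V[OF square_integrable_measurable[OF dipolar_conv(1)[OF s1]]]
      by (simp only: distrib_left mult.left_commute)
    then have "Re (- \<i> * C v) = 0" using ReC[of w] by simp
    then show ?thesis using ReC[of v] by (simp add: complex_eq_iff)
  qed
  from allI[of "\<lambda>v. C v = 0", OF C0] show ?thesis unfolding solves_stationary_def C_def .
qed

text \<open>The quotient is invariant under amplitude and dilation, so a maximizer can be rescaled
  to satisfy two prescribed conditions. The chemical potential is half of the multiplier A / (3
  c).\<close>

theorem ground_state:
  assumes un: "unstable_regime a b" and c: "c > 0"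
  shows "\<exists>u J. J > 0 \<and> (\<forall>v. - quart a b v \<le> J * gnfun v) \<and> mass u = c \<and> quart a b u = - (2 / 3) * kinetic u \<and>
    kinetic u = 4 / (9 * J\<^sup>2 * c) \<and> solves_stationary a b (kinetic u / (6 * c)) u \<and> critical_on_sphere a b c u"
proof -
  obtain w J where J: "J > 0" and w: "w \<noteq> 0" and eq: "- quart a b w = J * gnfun w" and max: "\<And>v. - quart a b v \<le> J * gnfun v"
    using maximizer_exists[OF quart_negative[OF un]] by blast
  let ?A = "kinetic w" and ?M = "mass w" and ?q = "quart a b w"
  have A: "?A > 0" and M: "?M > 0" using w kinetic_pos mass_pos by auto
  have q: "?q < 0" using eq mult_pos_pos[OF J gnfun_pos[OF w]] by linarith
  \<comment> \<open>The mass condition fixes s^2 = c t^3 / M; inserting this into the condition on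
    \<open>quart\<close> leaves a linear equation for \<open>t\<close>.\<close>
  define t where "t = - (3 * c * ?q) / (2 * ?M * ?A)"
  have t: "t > 0" unfolding t_def using q A M c by (intro divide_pos_pos) (auto simp: mult_pos_neg)
  define s where "s = sqrt (c * t ^ 3 / ?M)"
  have s2: "s\<^sup>2 = c * t ^ 3 / ?M" unfolding s_def using c t M by simp
  have s4: "s ^ 4 = c\<^sup>2 * t ^ 6 / ?M\<^sup>2"
  proof -
    have "s ^ 4 = (s\<^sup>2)\<^sup>2" by (simp flip: power_mult)
    then show ?thesis unfolding s2 by (simp add: power_divide power_mult_distrib flip: power_mult)
  qed
  let ?u = "idil s t w"
  have m: "mass ?u = c" unfolding mass_idil[OF t] s2 using t M by simp
  have k: "kinetic ?u = c * ?A / (?M * t\<^sup>2)"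
    unfolding kinetic_idil[OF t] s2 using t M by (simp add: field_simps eval_nat_numeral)
  have qu: "quart a b ?u = c\<^sup>2 * ?q / (?M\<^sup>2 * t ^ 3)"
    unfolding quart_idil[OF t] s4 using t M by (simp add: field_simps eval_nat_numeral)
  have q2: "quart a b ?u = - (2 / 3) * kinetic ?u"
  proof -
    have "t * (2 * ?M * ?A) = - (3 * c * ?q)" unfolding t_def using A M by simp
    then have "?q = - (2 / 3) * (t * ?M * ?A / c)" using c by (simp add: field_simps)
    then show ?thesis unfolding qu k using t M c by (simp add: field_simps eval_nat_numeral)
  qed
  have g: "- quart a b ?u = J * gnfun ?u"
  proof -
    have "kinetic ?u * mass ?u = (c / (?M * t))\<^sup>2 * (?A * ?M)" unfolding k m using M t by (simp add: field_simps power2_eq_square)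
    then have "sqrt (kinetic ?u * mass ?u) = c / (?M * t) * sqrt (?A * ?M)" using c M t by (simp add: real_sqrt_mult)
    then have "gnfun ?u = kinetic ?u * (c / (?M * t) * sqrt (?A * ?M))" by (simp only: gnfun_def)
    then have "gnfun ?u = c\<^sup>2 / (?M\<^sup>2 * t ^ 3) * gnfun w" unfolding k gnfun_def[of w] by (simp add: power2_eq_square power3_eq_cube ac_simps)
    then have "J * gnfun ?u = c\<^sup>2 / (?M\<^sup>2 * t ^ 3) * (J * gnfun w)" by simp
    also have "\<dots> = - quart a b ?u" unfolding eq[symmetric] qu by simp
    finally show ?thesis by simp
  qed
  have u0: "?u \<noteq> 0" using m c mass_add[of 0 0] by (auto simp: mass_eq_inner l2_inner_eq linear_simps(3)[OF bounded_linear_emb])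
  note el = maximizer_equation[OF J g max c m q2 u0]
  have "solves_stationary a b (kinetic ?u / (6 * c)) ?u"
  proof (rule solves_stationaryI)
    have "2 * (kinetic ?u / (6 * c)) = kinetic ?u / (3 * c)" by simp
    then show "dkin ?u h + 2 * dquart a b ?u h + 2 * (kinetic ?u / (6 * c)) * l2_inner ?u h = 0" for h using el(1)[of h] by simp
  qed
  moreover have "critical_on_sphere a b c ?u" unfolding critical_on_sphere_iff[OF c] using el(1) m by blast
  ultimately show ?thesis using J max m q2 el(2) by blast
qed

section \<open>Regularity of critical points\<close>

text \<open>After squaring, the exponents add up to 7/2; shifting the power of the larger weight
  onto the smaller one leaves a single \<open>decay\<close>.\<close>

lemma wt_powr_weights:
  assumes "s \<ge> 0" "\<sigma> \<ge> 0" "s + \<sigma> = 7 / 4"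
  shows "(wt \<xi> powr (- \<sigma>))\<^sup>2 * (wt \<eta> powr (- s))\<^sup>2 \<le> decay \<xi> + decay \<eta>"
proof -
  have sq: "(x powr p)\<^sup>2 = x powr (2 * p)" if "x \<ge> 1" for x p :: real
    by (simp add: power2_eq_square flip: powr_add mult_2)
  have main: "x powr (- (2 * p)) * y powr (- (2 * q)) \<le> x powr (- (7/2))" if "1 \<le> x" "x \<le> y" "q \<ge> 0" "p + q = 7 / 4" for x y p q :: real
  proof -
    have "y powr (- (2 * q)) \<le> x powr (- (2 * q))" using that by (intro powr_mono2') auto
    then have "x powr (- (2 * p)) * y powr (- (2 * q)) \<le> x powr (- (2 * p)) * x powr (- (2 * q))" by (rule mult_left_mono) simp
    also have "\<dots> = x powr (- (7/2))" unfolding powr_add[symmetric] using that(4) by (intro arg_cong[where f = "(powr) x"]) linarith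
    finally show ?thesis .
  qed
  show ?thesis
  proof (cases "wt \<xi> \<le> wt \<eta>")
    case True
    then have "(wt \<xi> powr (- \<sigma>))\<^sup>2 * (wt \<eta> powr (- s))\<^sup>2 \<le> decay \<xi>"
      using main[OF wt_ge_1 True assms(1), of \<sigma>] assms by (simp add: sq wt_ge_1 decay_def)
    then show ?thesis using decay_nonneg[of \<eta>] by linarith
  next
    case False
    then have "(wt \<xi> powr (- \<sigma>))\<^sup>2 * (wt \<eta> powr (- s))\<^sup>2 \<le> decay \<eta>"
      using main[OF wt_ge_1, of \<eta> "wt \<xi>" \<sigma> s] assms by (simp add: sq wt_ge_1 decay_def mult.commute)
    then show ?thesis using decay_nonneg[of \<xi>] by linarith
  qed
qed

text \<open>Where the integral does not exist, \<open>conv\<close> is 0 by convention and the bound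
  is trivial.\<close>

lemma norm_conv_le: "ennreal (cmod (conv w a \<xi>)) \<le> (\<integral>\<^sup>+\<eta>. ennreal (cmod (w (\<xi> - \<eta>) * a \<eta>)) \<partial>lborel)"
proof (cases "integrable lborel (\<lambda>\<eta>. w (\<xi> - \<eta>) * a \<eta>)")
  case True
  then show ?thesis unfolding conv_def by (rule integral_norm_bound_ennreal)
qed (simp add: conv_def not_integrable_integral_eq)

text \<open>Cauchy--Schwarz with the weight of \<open>a\<close> split off, then Fubini.
  Multiplication by a square integrable potential costs 7/4 derivatives, half of the exponent of
  \<open>decay\<close>.\<close>

lemma conv_weighted_bound:
  assumes w: "square_integrable w" and [measurable]: "a \<in> borel_measurable borel"
    and f: "square_integrable (\<lambda>\<xi>. of_real (wt \<xi> powr s) * a \<xi>)"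
    and s: "s \<ge> 0" "\<sigma> \<ge> 0" "s + \<sigma> = 7 / 4"
  shows "square_integrable (\<lambda>\<xi>. of_real (wt \<xi> powr (- \<sigma>)) * conv w a \<xi>)"
proof -
  note [measurable] = square_integrable_measurable[OF w]
  let ?W = "\<lambda>\<xi>. ennreal ((cmod (w \<xi>))\<^sup>2)"
  let ?F = "\<integral>\<^sup>+\<eta>. ennreal ((cmod (of_real (wt \<eta> powr s) * a \<eta>))\<^sup>2) \<partial>lborel"
  have F: "?F < \<infinity>" using f by (simp add: square_integrable_nn)
  have W: "(\<integral>\<^sup>+\<xi>. ?W \<xi> \<partial>lborel) < \<infinity>" using w by (simp add: square_integrable_nn)
  have pw: "ennreal ((cmod (of_real (wt \<xi> powr (- \<sigma>)) * conv w a \<xi>))\<^sup>2) \<le> (\<integral>\<^sup>+\<eta>. ?W (\<xi> - \<eta>) * (ennreal (decay \<xi>) + ennreal (decay \<eta>)) \<partial>lborel) * ?F" for \<xi>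
  proof -
    let ?b = "\<lambda>\<eta>. ennreal (cmod (w (\<xi> - \<eta>)) * wt \<eta> powr (- s))" and ?f = "\<lambda>\<eta>. ennreal (cmod (of_real (wt \<eta> powr s) * a \<eta>))"
    have "ennreal (cmod (w (\<xi> - \<eta>) * a \<eta>)) = ?b \<eta> * ?f \<eta>" for \<eta>
      using wt_pos[of \<eta>] by (simp add: ennreal_mult[symmetric] norm_mult powr_minus field_simps)
    then have "(ennreal (cmod (conv w a \<xi>)))\<^sup>2 \<le> (\<integral>\<^sup>+\<eta>. ?b \<eta> * ?f \<eta> \<partial>lborel)\<^sup>2"
      using norm_conv_le[of w a \<xi>] by (simp only:) (rule power_mono, auto)
    also have "\<dots> \<le> (\<integral>\<^sup>+\<eta>. (?b \<eta>)\<^sup>2 \<partial>lborel) * (\<integral>\<^sup>+\<eta>. (?f \<eta>)\<^sup>2 \<partial>lborel)" by (rule Cauchy_Schwarz_nn_integral; measurable)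
    also have "(\<integral>\<^sup>+\<eta>. (?f \<eta>)\<^sup>2 \<partial>lborel) = ?F" by (simp add: ennreal_power)
    finally have "(ennreal (wt \<xi> powr (- \<sigma>)))\<^sup>2 * (ennreal (cmod (conv w a \<xi>)))\<^sup>2 \<le> (ennreal (wt \<xi> powr (- \<sigma>)))\<^sup>2 * ((\<integral>\<^sup>+\<eta>. (?b \<eta>)\<^sup>2 \<partial>lborel) * ?F)"
      by (rule mult_left_mono) simp
    also have "\<dots> = (\<integral>\<^sup>+\<eta>. (ennreal (wt \<xi> powr (- \<sigma>)))\<^sup>2 * (?b \<eta>)\<^sup>2 \<partial>lborel) * ?F"
      by (simp add: nn_integral_cmult mult.assoc)
    also have "\<dots> \<le> (\<integral>\<^sup>+\<eta>. ?W (\<xi> - \<eta>) * (ennreal (decay \<xi>) + ennreal (decay \<eta>)) \<partial>lborel) * ?F"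
    proof (intro mult_right_mono nn_integral_mono)
      fix \<eta>
      have "(wt \<xi> powr (- \<sigma>))\<^sup>2 * (cmod (w (\<xi> - \<eta>)) * wt \<eta> powr (- s))\<^sup>2 = (cmod (w (\<xi> - \<eta>)))\<^sup>2 * ((wt \<xi> powr (- \<sigma>))\<^sup>2 * (wt \<eta> powr (- s))\<^sup>2)"
        by (simp add: power_mult_distrib)
      also have "\<dots> \<le> (cmod (w (\<xi> - \<eta>)))\<^sup>2 * (decay \<xi> + decay \<eta>)" by (intro mult_left_mono wt_powr_weights s) simp
      finally show "(ennreal (wt \<xi> powr (- \<sigma>)))\<^sup>2 * (?b \<eta>)\<^sup>2 \<le> ?W (\<xi> - \<eta>) * (ennreal (decay \<xi>) + ennreal (decay \<eta>))"
        by (simp add: ennreal_power ennreal_mult[symmetric] ennreal_plus[symmetric] decay_nonneg ennreal_leI del: ennreal_plus)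
    qed simp
    finally show ?thesis by (simp add: norm_mult power_mult_distrib ennreal_mult ennreal_power)
  qed
  have "(\<integral>\<^sup>+\<xi>. ennreal ((cmod (of_real (wt \<xi> powr (- \<sigma>)) * conv w a \<xi>))\<^sup>2) \<partial>lborel)
    \<le> (\<integral>\<^sup>+\<xi>. (\<integral>\<^sup>+\<eta>. ?W (\<xi> - \<eta>) * (ennreal (decay \<xi>) + ennreal (decay \<eta>)) \<partial>lborel) * ?F \<partial>lborel)"
    by (intro nn_integral_mono pw)
  also have "\<dots> = (\<integral>\<^sup>+\<xi>. \<integral>\<^sup>+\<eta>. ?W (\<xi> - \<eta>) * (ennreal (decay \<xi>) + ennreal (decay \<eta>)) \<partial>lborel \<partial>lborel) * ?F"
    by (rule nn_integral_multc) measurable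
  also have "(\<integral>\<^sup>+\<xi>. \<integral>\<^sup>+\<eta>. ?W (\<xi> - \<eta>) * (ennreal (decay \<xi>) + ennreal (decay \<eta>)) \<partial>lborel \<partial>lborel)
    = (\<integral>\<^sup>+\<xi>. \<integral>\<^sup>+\<eta>. ennreal (decay \<xi>) * ?W (\<xi> - \<eta>) \<partial>lborel \<partial>lborel) + (\<integral>\<^sup>+\<xi>. \<integral>\<^sup>+\<eta>. ennreal (decay \<eta>) * ?W (\<xi> - \<eta>) \<partial>lborel \<partial>lborel)"
  proof -
    have "?W (\<xi> - \<eta>) * (ennreal (decay \<xi>) + ennreal (decay \<eta>)) = ennreal (decay \<xi>) * ?W (\<xi> - \<eta>) + ennreal (decay \<eta>) * ?W (\<xi> - \<eta>)" for \<xi> \<eta>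
      by (subst mult.commute) (rule distrib_right)
    then have "(\<integral>\<^sup>+\<eta>. ?W (\<xi> - \<eta>) * (ennreal (decay \<xi>) + ennreal (decay \<eta>)) \<partial>lborel) = (\<integral>\<^sup>+\<eta>. ennreal (decay \<xi>) * ?W (\<xi> - \<eta>) \<partial>lborel) + (\<integral>\<^sup>+\<eta>. ennreal (decay \<eta>) * ?W (\<xi> - \<eta>) \<partial>lborel)" for \<xi>
      by (simp only:) (rule nn_integral_add; measurable)
    then show ?thesis by (simp only:) (rule nn_integral_add; measurable)
  qed
  also have "(\<integral>\<^sup>+\<xi>. \<integral>\<^sup>+\<eta>. ennreal (decay \<xi>) * ?W (\<xi> - \<eta>) \<partial>lborel \<partial>lborel) = ennreal kap * (\<integral>\<^sup>+\<xi>. ?W \<xi> \<partial>lborel)"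
    using nn_integral_shift(3)[of ?W] by (simp add: nn_integral_cmult nn_integral_multc nn_integral_decay)
  also have "(\<integral>\<^sup>+\<xi>. \<integral>\<^sup>+\<eta>. ennreal (decay \<eta>) * ?W (\<xi> - \<eta>) \<partial>lborel \<partial>lborel) = (\<integral>\<^sup>+\<eta>. \<integral>\<^sup>+\<xi>. ennreal (decay \<eta>) * ?W (\<xi> - \<eta>) \<partial>lborel \<partial>lborel)"
    by (rule lborel_pair.Fubini') measurable
  also have "\<dots> = ennreal kap * (\<integral>\<^sup>+\<xi>. ?W \<xi> \<partial>lborel)"
    using nn_integral_shift(2)[of ?W] by (simp add: nn_integral_cmult nn_integral_multc nn_integral_decay)
  also have "(ennreal kap * (\<integral>\<^sup>+\<xi>. ?W \<xi> \<partial>lborel) + ennreal kap * (\<integral>\<^sup>+\<xi>. ?W \<xi> \<partial>lborel)) * ?F < \<infinity>"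
    using W F by (simp add: ennreal_mult_less_top less_top)
  finally show ?thesis by (simp add: square_integrable_nn)
qed

text \<open>Only against a real function may \<open>prodR\<close> be exchanged for
  \<open>prodC\<close>, whose transform is the explicit correlation.\<close>

lemma real_potential: "\<exists>r. square_integrable r \<and> Top a b (prodR u u) = l2_of (\<lambda>x. of_real (r x :: real))"
proof -
  have s1: "square_integrable (abs_sq u)" unfolding abs_sq_eq[abs_def] by (rule prodR_square_integrable)
  note s2 = dipolar_conv(1)[OF s1]
  have P: "prodR u u = l2_of (\<lambda>x. of_real (abs_sq u x))" by (simp add: prodR_def abs_sq_eq)
  note c1 = square_integrable_of_real[OF s1] and c2 = square_integrable_of_real[OF s2]
  have "Top a b (prodR u u) = l2_of (\<lambda>x. of_real (a *\<^sub>R abs_sq u x + b *\<^sub>R dipolar_conv (abs_sq u) x))"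
    unfolding Top_split[of a b] P l2_of_dipolar_conv[OF s1, symmetric] l2_of_scaleR[OF c1, symmetric] l2_of_scaleR[OF c2, symmetric]
      l2_of_add[OF square_integrable_scaleR[OF c1] square_integrable_scaleR[OF c2], symmetric]
    by (simp add: scaleR_conv_of_real[where 'a = complex])
  then show ?thesis by (intro exI conjI) (rule square_integrable_add[OF square_integrable_scaleR[OF s1] square_integrable_scaleR[OF s2]])
qed

lemma dquart_hat:
  "plconst\<^sup>2 * dquart a b u h = Re (LINT \<xi>|lborel. conv (l2_fun (FT (Top a b (prodR u u)))) (hat u) \<xi> * cnj (hat h \<xi>))"
proof -
  obtain r :: "real^3 \<Rightarrow> real" where r: "square_integrable r" "Top a b (prodR u u) = l2_of (\<lambda>x. of_real (r x))"
    using real_potential by blast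
  have "dquart a b u h = Top a b (prodR u u) \<bullet> prodC h u"
    unfolding dquart_def r(2) inner_prodC_real[OF r(1)] by (simp add: prodR_commute)
  then show ?thesis using inner_prodC by simp
qed

lemma l2_inner_hat: "plconst * l2_inner u h = Re (LINT \<xi>|lborel. hat u \<xi> * cnj (hat h \<xi>))"
proof -
  have "l2_inner u h = Re (LINT x|lborel. fun_of u x * cnj (fun_of h x))"
    unfolding l2_inner_eq emb_def by (rule Re_integral_mult_cnj[OF fun_of_square_integrable fun_of_square_integrable, symmetric])
  then show ?thesis unfolding integral_fun_of[symmetric] by simp
qed

lemma dkin_hat: "plconst * dkin u h = Re (LINT \<xi>|lborel. of_real ((norm \<xi>)\<^sup>2) * hat u \<xi> * cnj (hat h \<xi>))"
proof -
  have ki: "integrable lborel (\<lambda>x. \<Sum>i\<in>UNIV. grad u x $ i * cnj (grad h x $ i))"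
    by (intro Bochner_Integration.integrable_sum square_integrable_mult square_integrable_cnj square_integrable_nth grad_square_integrable)
  have "dkin u h = Re (LINT x|lborel. (\<Sum>i\<in>UNIV. grad u x $ i * cnj (grad h x $ i)))"
    using integral_Re[OF ki] by (simp add: dkin_def inner_h1_def l2_inner_def inner_vec_def inner_complex_def)
  then show ?thesis unfolding integral_grad[symmetric] by simp
qed

lemma integrable_norm_hat_mult: "integrable lborel (\<lambda>\<xi>. of_real ((norm \<xi>)\<^sup>2) * hat u \<xi> * cnj (hat h \<xi>))"
proof -
  have "integrable lborel (\<lambda>\<xi>. (of_real (norm \<xi>) * hat u \<xi>) * cnj (of_real (norm \<xi>) * hat h \<xi>))"
    by (intro square_integrable_mult square_integrable_cnj norm_hat_square_integrable)
  then show ?thesis by (simp add: power2_eq_square ac_simps)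
qed

text \<open>The left-hand side need not be square integrable, so it is tested piecewise, with
  elements of \<open>h1\<close> whose transform is its own restriction to a set where frequency and
  value are bounded.\<close>

lemma stationary_hat:
  assumes eq: "\<And>h. dkin u h + 2 * dquart a b u h + \<kappa> * l2_inner u h = 0"
  shows "AE \<xi> in lborel. of_real ((norm \<xi>)\<^sup>2 + \<kappa>) * hat u \<xi> + of_real (2 / plconst) * conv (l2_fun (FT (Top a b (prodR u u)))) (hat u) \<xi> = 0"
proof -
  let ?w = "l2_fun (FT (Top a b (prodR u u)))"
  have ws: "square_integrable ?w" by (rule l2_fun_square_integrable)
  define q where "q \<xi> = of_real ((norm \<xi>)\<^sup>2 + \<kappa>) * hat u \<xi> + of_real (2 / plconst) * conv ?w (hat u) \<xi>" for \<xi>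
  have [measurable]: "q \<in> borel_measurable borel" unfolding q_def[abs_def] by measurable
  have weak: "Re (LINT \<xi>|lborel. q \<xi> * cnj (hat h \<xi>)) = 0" for h
  proof -
    have "q \<xi> * cnj (hat h \<xi>) = of_real ((norm \<xi>)\<^sup>2) * hat u \<xi> * cnj (hat h \<xi>) + of_real \<kappa> * (hat u \<xi> * cnj (hat h \<xi>)) + of_real (2 / plconst) * (conv ?w (hat u) \<xi> * cnj (hat h \<xi>))" for \<xi>
      by (simp add: q_def algebra_simps)
    moreover have "integrable lborel (\<lambda>\<xi>. hat u \<xi> * cnj (hat h \<xi>))"
      by (intro square_integrable_mult square_integrable_cnj hat_square_integrable)
    ultimately have "(LINT \<xi>|lborel. q \<xi> * cnj (hat h \<xi>)) = (LINT \<xi>|lborel. of_real ((norm \<xi>)\<^sup>2) * hat u \<xi> * cnj (hat h \<xi>))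
        + of_real \<kappa> * (LINT \<xi>|lborel. hat u \<xi> * cnj (hat h \<xi>)) + of_real (2 / plconst) * (LINT \<xi>|lborel. conv ?w (hat u) \<xi> * cnj (hat h \<xi>))"
      using integrable_norm_hat_mult[of u h] trilinear(2)[OF ws, of u h] by simp
    then have "Re (LINT \<xi>|lborel. q \<xi> * cnj (hat h \<xi>)) = plconst * dkin u h + \<kappa> * (plconst * l2_inner u h) + 2 / plconst * (plconst\<^sup>2 * dquart a b u h)"
      unfolding dkin_hat l2_inner_hat dquart_hat by simp
    also have "\<dots> = plconst * (dkin u h + 2 * dquart a b u h + \<kappa> * l2_inner u h)"
      using plconst_pos by (simp add: power2_eq_square algebra_simps)
    finally show ?thesis using eq[of h] by simp
  qed
  have "AE \<xi> in lborel. \<xi> \<in> ball 0 (real n) \<longrightarrow> cmod (q \<xi>) \<le> real n \<longrightarrow> q \<xi> = 0" for n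
  proof -
    \<comment> \<open>Both cutoffs are needed for the truncated profile and its products with the
      coordinates to be square integrable; over all \<open>n\<close> the sets exhaust the
      space.\<close>
    define S where "S = {\<xi> \<in> ball 0 (real n). cmod (q \<xi>) \<le> real n}"
    have [measurable]: "S \<in> sets borel"
      unfolding S_def by measurable
    define g where "g \<xi> = indicator S \<xi> * q \<xi>" for \<xi>
    have [measurable]: "g \<in> borel_measurable borel" unfolding g_def[abs_def] by measurable
    have g1: "square_integrable g"
    proof (rule square_integrable_bound[OF square_integrable_indicator_ball[of "real n"], where C = "real n"])
      show "AE \<xi> in lborel. norm (g \<xi>) \<le> real n * norm (indicator (ball 0 (real n)) \<xi> :: complex)"
        by (intro AE_I2) (auto simp: g_def S_def indicator_def)
    qed simp
    have g2: "square_integrable (\<lambda>\<xi>. of_real (\<xi> $ j) * g \<xi>)" for j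
    proof (rule square_integrable_bound[OF g1, where C = "real n"])
      have "\<bar>\<xi> $ j\<bar> \<le> real n" if "\<xi> \<in> S" for \<xi> using component_le_norm_cart[of \<xi> j] that by (simp add: S_def)
      then show "AE \<xi> in lborel. norm (of_real (\<xi> $ j) * g \<xi>) \<le> real n * norm (g \<xi>)"
        by (intro AE_I2) (auto simp: g_def indicator_def norm_mult mult_right_mono)
    qed measurable
    obtain h where h: "AE \<xi> in lborel. hat h \<xi> = g \<xi>" using h1_exists[OF g1 g2] by blast
    have "(LINT \<xi>|lborel. q \<xi> * cnj (hat h \<xi>)) = (LINT \<xi>|lborel. of_real ((cmod (g \<xi>))\<^sup>2))"
    proof (rule integral_cong_AE)
      show "AE \<xi> in lborel. q \<xi> * cnj (hat h \<xi>) = of_real ((cmod (g \<xi>))\<^sup>2)"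
        using h by eventually_elim (simp add: g_def indicator_def complex_norm_square del: of_real_power)
    qed measurable
    then have "(LINT \<xi>|lborel. (cmod (g \<xi>))\<^sup>2) = 0" using weak[of h] by (simp del: of_real_power)
    moreover have "integrable lborel (\<lambda>\<xi>. (cmod (g \<xi>))\<^sup>2)" using g1 by (simp add: square_integrable_def)
    ultimately have "AE \<xi> in lborel. (cmod (g \<xi>))\<^sup>2 = 0" by (subst (asm) integral_nonneg_eq_0_iff_AE) auto
    then show ?thesis by eventually_elim (auto simp: g_def S_def)
  qed
  then have "AE \<xi> in lborel. \<forall>n. \<xi> \<in> ball 0 (real n) \<longrightarrow> cmod (q \<xi>) \<le> real n \<longrightarrow> q \<xi> = 0" by (simp add: AE_all_countable)
  then have "AE \<xi> in lborel. q \<xi> = 0"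
  proof eventually_elim
    fix \<xi> assume n: "\<forall>n. \<xi> \<in> ball 0 (real n) \<longrightarrow> cmod (q \<xi>) \<le> real n \<longrightarrow> q \<xi> = 0"
    obtain m where "max (norm \<xi>) (cmod (q \<xi>)) < real m" using reals_Archimedean2 by blast
    then show "q \<xi> = 0" using n[rule_format, of m] by simp
  qed
  then show ?thesis unfolding q_def .
qed

text \<open>Dividing by |xi|^2 gains 2 derivatives and the potential costs 7/4, so each pass gains
  1/4: the exponents run through 1, 5/4, 3/2, 7/4 and 2.\<close>

theorem stationary_regular:
  assumes eq: "\<And>h. dkin u h + 2 * dquart a b u h + \<kappa> * l2_inner u h = 0"
  shows "square_integrable (\<lambda>\<xi>. of_real ((wt \<xi>)\<^sup>2) * hat u \<xi>)"
proof -
  let ?w = "conv (l2_fun (FT (Top a b (prodR u u)))) (hat u)"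
  have step: "square_integrable (\<lambda>\<xi>. of_real (wt \<xi> powr (s + 1 / 4)) * hat u \<xi>)"
    if s: "square_integrable (\<lambda>\<xi>. of_real (wt \<xi> powr s) * hat u \<xi>)" "0 \<le> s" "s \<le> 7 / 4" for s
  proof -
    define \<sigma> where "\<sigma> = 7 / 4 - s"
    have \<sigma>: "\<sigma> \<ge> 0" "s + \<sigma> = 7 / 4" using s by (auto simp: \<sigma>_def)
    have w: "square_integrable (\<lambda>\<xi>. of_real (wt \<xi> powr (- \<sigma>)) * ?w \<xi>)"
      by (rule conv_weighted_bound[OF l2_fun_square_integrable hat_measurable s(1,2) \<sigma>])
    have a: "square_integrable (\<lambda>\<xi>. of_real (wt \<xi> powr (- \<sigma>)) * hat u \<xi>)"
    proof (rule square_integrable_cmult[OF hat_square_integrable, where C = 1])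
      show "cmod (of_real (wt \<xi> powr (- \<sigma>))) \<le> 1" for \<xi>
        using powr_mono[of "- \<sigma>" 0 "wt \<xi>"] wt_ge_1[of \<xi>] wt_pos[of \<xi>] \<sigma> by simp
    qed measurable
    have "square_integrable (\<lambda>\<xi>. (1 - \<kappa>) *\<^sub>R (of_real (wt \<xi> powr (- \<sigma>)) * hat u \<xi>) + (- (2 / plconst)) *\<^sub>R (of_real (wt \<xi> powr (- \<sigma>)) * ?w \<xi>))" (is "square_integrable ?g")
      by (intro square_integrable_add square_integrable_scaleR a w)
    then show ?thesis
    proof (rule square_integrable_bound[where C = 1])
      show "AE \<xi> in lborel. norm (of_real (wt \<xi> powr (s + 1 / 4)) * hat u \<xi>) \<le> 1 * norm (?g \<xi>)"
        using stationary_hat[OF eq]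
      proof eventually_elim
        fix \<xi> assume e: "of_real ((norm \<xi>)\<^sup>2 + \<kappa>) * hat u \<xi> + of_real (2 / plconst) * ?w \<xi> = 0"
        have "wt \<xi> powr (s + 1 / 4) = wt \<xi> powr (- \<sigma>) * (wt \<xi>)\<^sup>2"
        proof -
          have "s + 1 / 4 = - \<sigma> + 2" by (simp add: \<sigma>_def)
          then show ?thesis using wt_pos[of \<xi>] by (simp only: powr_add) (simp add: powr_numeral)
        qed
        then have "of_real (wt \<xi> powr (s + 1 / 4)) * hat u \<xi> = of_real (wt \<xi> powr (- \<sigma>)) * (of_real (1 + (norm \<xi>)\<^sup>2) * hat u \<xi>)"
          by (simp only: wt_power2 of_real_mult mult.assoc)
        also have "of_real (1 + (norm \<xi>)\<^sup>2) * hat u \<xi> = of_real (1 - \<kappa>) * hat u \<xi> - of_real (2 / plconst) * ?w \<xi>"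
        proof -
          have "of_real (1 + (norm \<xi>)\<^sup>2) * hat u \<xi> - (of_real (1 - \<kappa>) * hat u \<xi> - of_real (2 / plconst) * ?w \<xi>) = of_real ((norm \<xi>)\<^sup>2 + \<kappa>) * hat u \<xi> + of_real (2 / plconst) * ?w \<xi>"
            by (simp add: algebra_simps)
          then show ?thesis unfolding e by simp
        qed
        finally have "of_real (wt \<xi> powr (s + 1 / 4)) * hat u \<xi> = ?g \<xi>"
          by (simp add: scaleR_conv_of_real[where 'a = complex] algebra_simps)
        then show "norm (of_real (wt \<xi> powr (s + 1 / 4)) * hat u \<xi>) \<le> 1 * norm (?g \<xi>)" by simp
      qed
    qed measurable
  qed
  have "square_integrable (\<lambda>\<xi>. of_real (wt \<xi> powr 1) * hat u \<xi>)"
    using wt_hat_square_integrable[of u] wt_pos[THEN less_imp_le] by simp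
  from step[OF this] have "square_integrable (\<lambda>\<xi>. of_real (wt \<xi> powr (5 / 4)) * hat u \<xi>)" by simp
  from step[OF this] have "square_integrable (\<lambda>\<xi>. of_real (wt \<xi> powr (3 / 2)) * hat u \<xi>)" by simp
  from step[OF this] have "square_integrable (\<lambda>\<xi>. of_real (wt \<xi> powr (7 / 4)) * hat u \<xi>)" by simp
  from step[OF this] have "square_integrable (\<lambda>\<xi>. of_real (wt \<xi> powr 2) * hat u \<xi>)" by simp
  moreover have "complex_of_real (wt \<xi> powr 2) = of_real ((wt \<xi>)\<^sup>2)" for \<xi> using wt_pos[of \<xi>] by (simp add: powr_numeral)
  ultimately show ?thesis by (simp only:)
qed

section \<open>The Pohozaev identity\<close>

lemma square_integrable_shift:
  fixes f :: "real^3 \<Rightarrow> 'b::euclidean_space"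
  shows "square_integrable f \<Longrightarrow> square_integrable (\<lambda>\<xi>. f (\<xi> - \<eta>))"
  using square_integrable_coordinatewise[of "\<chi> i. 1" f "- \<eta>"] unfolding one_vec by simp

text \<open>Up to constants, \<open>bump \<eta> u + bump (- \<eta>) u\<close> is the derivative of \<open>u\<close> along the flow of the
  vector field \<open>sin (\<eta> \<bullet> x) \<eta>\<close>, which approximates the generator of dilations as \<open>\<eta> \<longrightarrow> 0\<close>.\<close>

definition bump :: "real^3 \<Rightarrow> h1 \<Rightarrow> h1" where
  "bump \<eta> u = (SOME v. AE \<xi> in lborel. hat v \<xi> = of_real ((2 *\<^sub>R \<xi> - \<eta>) \<bullet> \<eta>) * hat u (\<xi> - \<eta>))"

context
  fixes u :: h1
  assumes reg: "square_integrable (\<lambda>\<xi>. of_real ((wt \<xi>)\<^sup>2) * hat u \<xi>)"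
begin

text \<open>The variation contains one derivative of \<open>u\<close>, and membership in H^1 takes a
  second one, which \<open>reg\<close> supplies.\<close>

lemma bump_square_integrable:
  "square_integrable (\<lambda>\<xi>. of_real ((2 *\<^sub>R \<xi> - \<eta>) \<bullet> \<eta>) * hat u (\<xi> - \<eta>))"
  "square_integrable (\<lambda>\<xi>. of_real (\<xi> $ j) * (of_real ((2 *\<^sub>R \<xi> - \<eta>) \<bullet> \<eta>) * hat u (\<xi> - \<eta>)))"
proof -
  have b: "\<bar>(2 *\<^sub>R \<xi> + \<eta>) \<bullet> \<eta>\<bar> \<le> (2 + norm \<eta>) * norm \<eta> * wt \<xi>" for \<xi>
  proof -
    have "norm (2 *\<^sub>R \<xi> + \<eta>) \<le> 2 * norm \<xi> + norm \<eta>" using norm_triangle_ineq[of "2 *\<^sub>R \<xi>" \<eta>] by simp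
    also have "\<dots> \<le> (2 + norm \<eta>) * wt \<xi>"
      using wt_ge_norm[of \<xi>] wt_ge_1[of \<xi>] mult_left_mono[OF wt_ge_1[of \<xi>] norm_ge_zero[of \<eta>]] by (simp add: distrib_right)
    finally have "norm (2 *\<^sub>R \<xi> + \<eta>) * norm \<eta> \<le> (2 + norm \<eta>) * wt \<xi> * norm \<eta>" by (rule mult_right_mono) simp
    then show ?thesis using Cauchy_Schwarz_ineq2[of "2 *\<^sub>R \<xi> + \<eta>" \<eta>] by (simp add: ac_simps)
  qed
  have c: "\<bar>(\<xi> + \<eta>) $ j\<bar> \<le> (1 + norm \<eta>) * wt \<xi>" for \<xi> j
  proof -
    have "\<bar>(\<xi> + \<eta>) $ j\<bar> \<le> norm \<xi> + norm \<eta>" using component_le_norm_cart[of "\<xi> + \<eta>" j] norm_triangle_ineq[of \<xi> \<eta>] by linarith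
    also have "\<dots> \<le> (1 + norm \<eta>) * wt \<xi>"
      using wt_ge_norm[of \<xi>] mult_left_mono[OF wt_ge_1[of \<xi>] norm_ge_zero[of \<eta>]] by (simp add: distrib_right)
    finally show ?thesis .
  qed
  let ?q = "\<lambda>\<xi>. of_real ((2 *\<^sub>R \<xi> + \<eta>) \<bullet> \<eta>) * hat u \<xi>"
  have "square_integrable ?q"
  proof (rule square_integrable_bound[OF reg, where C = "(2 + norm \<eta>) * norm \<eta>"])
    show "AE \<xi> in lborel. norm (?q \<xi>) \<le> (2 + norm \<eta>) * norm \<eta> * norm (of_real ((wt \<xi>)\<^sup>2) * hat u \<xi>)"
    proof (rule AE_I2)
      fix \<xi>
      have "wt \<xi> \<le> (wt \<xi>)\<^sup>2" using wt_ge_1[of \<xi>] by (simp add: power2_eq_square mult_le_cancel_left1)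
      then have "(2 + norm \<eta>) * norm \<eta> * wt \<xi> \<le> (2 + norm \<eta>) * norm \<eta> * (wt \<xi>)\<^sup>2" by (intro mult_left_mono) auto
      with b[of \<xi>] have "\<bar>(2 *\<^sub>R \<xi> + \<eta>) \<bullet> \<eta>\<bar> \<le> (2 + norm \<eta>) * norm \<eta> * (wt \<xi>)\<^sup>2" by linarith
      from mult_right_mono[OF this, of "cmod (hat u \<xi>)"]
      show "norm (?q \<xi>) \<le> (2 + norm \<eta>) * norm \<eta> * norm (of_real ((wt \<xi>)\<^sup>2) * hat u \<xi>)"
        by (simp add: norm_mult norm_power mult.assoc)
    qed
  qed measurable
  from square_integrable_shift[OF this, of \<eta>]
  show "square_integrable (\<lambda>\<xi>. of_real ((2 *\<^sub>R \<xi> - \<eta>) \<bullet> \<eta>) * hat u (\<xi> - \<eta>))"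
    by (simp add: scaleR_diff_right scaleR_2 algebra_simps)
  let ?r = "\<lambda>\<xi>. of_real ((\<xi> + \<eta>) $ j) * ?q \<xi>"
  have "square_integrable ?r"
  proof (rule square_integrable_bound[OF reg, where C = "(1 + norm \<eta>) * ((2 + norm \<eta>) * norm \<eta>)"])
    show "AE \<xi> in lborel. norm (?r \<xi>) \<le> (1 + norm \<eta>) * ((2 + norm \<eta>) * norm \<eta>) * norm (of_real ((wt \<xi>)\<^sup>2) * hat u \<xi>)"
    proof (rule AE_I2)
      fix \<xi>
      have "\<bar>(\<xi> + \<eta>) $ j\<bar> * \<bar>(2 *\<^sub>R \<xi> + \<eta>) \<bullet> \<eta>\<bar> \<le> ((1 + norm \<eta>) * wt \<xi>) * ((2 + norm \<eta>) * norm \<eta> * wt \<xi>)"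
        by (intro mult_mono b c) (auto simp: wt_pos less_imp_le)
      note le = mult_right_mono[OF this, of "cmod (hat u \<xi>)"]
      have e: "norm (?r \<xi>) = \<bar>(\<xi> + \<eta>) $ j\<bar> * \<bar>(2 *\<^sub>R \<xi> + \<eta>) \<bullet> \<eta>\<bar> * cmod (hat u \<xi>)"
        by (simp only: norm_mult norm_of_real mult.assoc)
      show "norm (?r \<xi>) \<le> (1 + norm \<eta>) * ((2 + norm \<eta>) * norm \<eta>) * norm (of_real ((wt \<xi>)\<^sup>2) * hat u \<xi>)"
        unfolding e using le by (simp add: norm_mult norm_power power2_eq_square ac_simps)
    qed
  qed measurable
  from square_integrable_shift[OF this, of \<eta>]
  show "square_integrable (\<lambda>\<xi>. of_real (\<xi> $ j) * (of_real ((2 *\<^sub>R \<xi> - \<eta>) \<bullet> \<eta>) * hat u (\<xi> - \<eta>)))"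
    by (simp add: scaleR_diff_right scaleR_2 algebra_simps)
qed

lemma hat_bump: "AE \<xi> in lborel. hat (bump \<eta> u) \<xi> = of_real ((2 *\<^sub>R \<xi> - \<eta>) \<bullet> \<eta>) * hat u (\<xi> - \<eta>)"
  unfolding bump_def by (rule someI_ex[OF h1_exists[OF bump_square_integrable]])

lemma quadratic_bump:
  defines "F \<equiv> \<lambda>\<kappa> \<eta> \<xi>. ((norm \<xi>)\<^sup>2 + \<kappa>) * ((2 *\<^sub>R \<xi> - \<eta>) \<bullet> \<eta>) * (hat u \<xi> \<bullet> hat u (\<xi> - \<eta>))"
  shows "integrable lborel (F \<kappa> \<eta>)" "plconst * (dkin u (bump \<eta> u) + \<kappa> * l2_inner u (bump \<eta> u)) = (LINT \<xi>|lborel. F \<kappa> \<eta> \<xi>)"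
proof -
  let ?h = "bump \<eta> u"
  define G where "G \<xi> = of_real ((norm \<xi>)\<^sup>2) * hat u \<xi> * cnj (hat ?h \<xi>) + of_real \<kappa> * (hat u \<xi> * cnj (hat ?h \<xi>))" for \<xi>
  have i2: "integrable lborel (\<lambda>\<xi>. hat u \<xi> * cnj (hat ?h \<xi>))"
    by (intro square_integrable_mult square_integrable_cnj hat_square_integrable)
  have Gi: "integrable lborel G"
    unfolding G_def[abs_def] by (intro Bochner_Integration.integrable_add integrable_norm_hat_mult integrable_mult_right i2)
  have [measurable]: "F \<kappa> \<eta> \<in> borel_measurable borel" unfolding F_def by measurable
  have alg: "Re (of_real n * x * cnj (of_real t * y) + of_real k * (x * cnj (of_real t * y))) = (n + k) * t * (x \<bullet> y)" for n t k :: real and x y :: complex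
    by (simp add: inner_complex_def algebra_simps)
  have ae: "AE \<xi> in lborel. Re (G \<xi>) = F \<kappa> \<eta> \<xi>"
    using hat_bump[of \<eta>] by eventually_elim (simp only: G_def F_def alg)
  show "integrable lborel (F \<kappa> \<eta>)"
    by (rule integrable_cong_AE_imp[OF integrable_Re[OF Gi] _ ae]) measurable
  have "(LINT \<xi>|lborel. F \<kappa> \<eta> \<xi>) = (LINT \<xi>|lborel. Re (G \<xi>))"
    by (rule integral_cong_AE) (use ae Gi in \<open>auto elim: eventually_mono\<close>)
  also have "\<dots> = Re (LINT \<xi>|lborel. G \<xi>)" by (rule integral_Re[OF Gi])
  also have "(LINT \<xi>|lborel. G \<xi>) = (LINT \<xi>|lborel. of_real ((norm \<xi>)\<^sup>2) * hat u \<xi> * cnj (hat ?h \<xi>)) + of_real \<kappa> * (LINT \<xi>|lborel. hat u \<xi> * cnj (hat ?h \<xi>))"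
    unfolding G_def[abs_def] using integrable_norm_hat_mult i2 by (subst Bochner_Integration.integral_add) auto
  finally show "plconst * (dkin u ?h + \<kappa> * l2_inner u ?h) = (LINT \<xi>|lborel. F \<kappa> \<eta> \<xi>)"
    using dkin_hat[of u ?h] l2_inner_hat[of u ?h] by (simp add: distrib_left mult.left_commute)
qed

text \<open>Shifting the second integral by \<open>\<eta>\<close> aligns the two products of
  transforms with opposite signs. The multiplier cancels, and the difference |xi|^2 - |xi - eta|^2
  reproduces the factor of the variation, whence the square.\<close>

lemma quadratic_virial:
  "plconst * (dkin u (bump \<eta> u + bump (- \<eta>) u) + \<kappa> * l2_inner u (bump \<eta> u + bump (- \<eta>) u))
    = (LINT \<xi>|lborel. ((2 *\<^sub>R \<xi> - \<eta>) \<bullet> \<eta>)\<^sup>2 * (hat u \<xi> \<bullet> hat u (\<xi> - \<eta>)))"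
proof -
  define F where "F \<kappa> \<eta> \<xi> = ((norm \<xi>)\<^sup>2 + \<kappa>) * ((2 *\<^sub>R \<xi> - \<eta>) \<bullet> \<eta>) * (hat u \<xi> \<bullet> hat u (\<xi> - \<eta>))" for \<kappa> \<eta> \<xi>
  note q = quadratic_bump[folded F_def]
  have "F \<kappa> \<eta> \<xi> + F \<kappa> (- \<eta>) (\<xi> + - \<eta>) = ((2 *\<^sub>R \<xi> - \<eta>) \<bullet> \<eta>)\<^sup>2 * (hat u \<xi> \<bullet> hat u (\<xi> - \<eta>))" for \<xi>
  proof -
    have n: "(norm \<xi>)\<^sup>2 - (norm (\<xi> - \<eta>))\<^sup>2 = (2 *\<^sub>R \<xi> - \<eta>) \<bullet> \<eta>"
      by (simp add: power2_norm_eq_inner inner_diff_left inner_diff_right inner_commute)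
    have v: "(2 *\<^sub>R (\<xi> + - \<eta>) - - \<eta>) \<bullet> (- \<eta>) = - ((2 *\<^sub>R \<xi> - \<eta>) \<bullet> \<eta>)"
      by (simp add: inner_diff_left inner_add_left)
    have "F \<kappa> \<eta> \<xi> + F \<kappa> (- \<eta>) (\<xi> + - \<eta>) = ((norm \<xi>)\<^sup>2 - (norm (\<xi> - \<eta>))\<^sup>2) * ((2 *\<^sub>R \<xi> - \<eta>) \<bullet> \<eta>) * (hat u \<xi> \<bullet> hat u (\<xi> - \<eta>))"
      unfolding F_def v by (simp add: inner_commute algebra_simps)
    then show ?thesis unfolding n by (simp add: power2_eq_square)
  qed
  then have "(LINT \<xi>|lborel. ((2 *\<^sub>R \<xi> - \<eta>) \<bullet> \<eta>)\<^sup>2 * (hat u \<xi> \<bullet> hat u (\<xi> - \<eta>))) = (LINT \<xi>|lborel. F \<kappa> \<eta> \<xi>) + (LINT \<xi>|lborel. F \<kappa> (- \<eta>) (\<xi> + - \<eta>))"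
    by (subst Bochner_Integration.integral_add[OF q(1) lborel_integrable_shift(1)[OF q(1)], symmetric]) simp
  also have "(LINT \<xi>|lborel. F \<kappa> (- \<eta>) (\<xi> + - \<eta>)) = (LINT \<xi>|lborel. F \<kappa> (- \<eta>) \<xi>)"
    using q(1) by (intro lborel_integral_shift(1)) auto
  finally show ?thesis unfolding q(2)[symmetric] by (simp add: dkin_def l2_inner_linear inner_add_right algebra_simps)
qed

text \<open>Once the arguments are aligned by a shift, the factors of the two correlations add up to
  \<open>- 2 * (\<zeta> \<bullet> \<eta>)\<close>, which is independent of the integration variable.
  This is the Leibniz rule for the density.\<close>

lemma prodhat_bump:
  "prodhat u (bump \<eta> u) \<zeta> + prodhat (bump (- \<eta>) u) u \<zeta> = of_real (- 2 * (\<zeta> \<bullet> \<eta>)) * prodhat u u (\<zeta> + \<eta>)"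
proof -
  let ?G = "\<lambda>\<eta> \<xi>. of_real ((2 *\<^sub>R \<xi> - \<eta>) \<bullet> \<eta>) * hat u (\<xi> - \<eta>)"
  have i1: "integrable lborel (\<lambda>\<xi>. hat u \<xi> * cnj (?G \<eta> (\<xi> - \<zeta>)))"
    by (intro square_integrable_mult square_integrable_cnj hat_square_integrable square_integrable_shift[OF bump_square_integrable(1)])
  have i2: "integrable lborel (\<lambda>\<xi>. ?G (- \<eta>) \<xi> * cnj (hat u (\<xi> - \<zeta>)))"
    by (intro square_integrable_mult square_integrable_cnj square_integrable_shift[OF hat_square_integrable] bump_square_integrable(1))
  have "plconst * prodhat u (bump \<eta> u) \<zeta> = (LINT \<xi>|lborel. hat u \<xi> * cnj (?G \<eta> (\<xi> - \<zeta>)))"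
    by (rule prodhat_cong[OF _ hat_bump]) (auto, measurable)
  moreover have "plconst * prodhat (bump (- \<eta>) u) u \<zeta> = (LINT \<xi>|lborel. ?G (- \<eta>) (\<xi> + - \<eta>) * cnj (hat u ((\<xi> + - \<eta>) - \<zeta>)))"
  proof -
    have "plconst * prodhat (bump (- \<eta>) u) u \<zeta> = (LINT \<xi>|lborel. ?G (- \<eta>) \<xi> * cnj (hat u (\<xi> - \<zeta>)))"
      by (rule prodhat_cong[OF hat_bump]) (auto, measurable)
    also have "\<dots> = (LINT \<xi>|lborel. ?G (- \<eta>) (\<xi> + - \<eta>) * cnj (hat u ((\<xi> + - \<eta>) - \<zeta>)))"
      using i2 by (intro lborel_integral_shift(1)[symmetric]) auto
    finally show ?thesis .
  qed
  ultimately have "plconst * (prodhat u (bump \<eta> u) \<zeta> + prodhat (bump (- \<eta>) u) u \<zeta>)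
    = (LINT \<xi>|lborel. hat u \<xi> * cnj (?G \<eta> (\<xi> - \<zeta>)) + ?G (- \<eta>) (\<xi> + - \<eta>) * cnj (hat u ((\<xi> + - \<eta>) - \<zeta>)))"
    unfolding Bochner_Integration.integral_add[OF i1 lborel_integrable_shift(1)[OF i2]] by (simp add: distrib_left)
  also have "\<dots> = (LINT \<xi>|lborel. of_real (- 2 * (\<zeta> \<bullet> \<eta>)) * (hat u \<xi> * cnj (hat u (\<xi> - (\<zeta> + \<eta>)))))"
  proof (rule Bochner_Integration.integral_cong[OF refl])
    fix \<xi>
    have 1: "\<xi> - \<zeta> - \<eta> = \<xi> - (\<zeta> + \<eta>)" "\<xi> + - \<eta> - \<zeta> = \<xi> - (\<zeta> + \<eta>)" "\<xi> + - \<eta> - - \<eta> = \<xi>" by (simp_all add: algebra_simps)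
    have 2: "(2 *\<^sub>R (\<xi> - \<zeta>) - \<eta>) \<bullet> \<eta> + (2 *\<^sub>R (\<xi> + - \<eta>) - - \<eta>) \<bullet> (- \<eta>) = - 2 * (\<zeta> \<bullet> \<eta>)"
      by (simp add: inner_diff_left inner_add_left)
    show "hat u \<xi> * cnj (?G \<eta> (\<xi> - \<zeta>)) + ?G (- \<eta>) (\<xi> + - \<eta>) * cnj (hat u ((\<xi> + - \<eta>) - \<zeta>)) = of_real (- 2 * (\<zeta> \<bullet> \<eta>)) * (hat u \<xi> * cnj (hat u (\<xi> - (\<zeta> + \<eta>))))"
      unfolding 1 2[symmetric] by (simp only: complex_cnj_mult complex_cnj_complex_of_real of_real_add distrib_right distrib_left mult.assoc mult.left_commute)
  qed
  also have "\<dots> = of_real (- 2 * (\<zeta> \<bullet> \<eta>)) * (plconst * prodhat u u (\<zeta> + \<eta>))"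
    unfolding prodhat_eq by (rule integral_mult_right_zero)
  finally show ?thesis by (rule plcancel_complex)
qed

text \<open>Collecting the four products by \<open>prodhat_bump\<close> and shifting one of the two
  resulting terms by \<open>\<eta>\<close> produces a difference of the field symbol times
  frequency, which is of second order in \<open>\<eta>\<close>.\<close>

lemma quartic_virial:
  "plconst * dquart a b u (bump \<eta> u + bump (- \<eta>) u)
    = (LINT \<zeta>|lborel. (symb a b \<zeta> * (\<zeta> \<bullet> \<eta>) - symb a b (\<zeta> - \<eta>) * ((\<zeta> - \<eta>) \<bullet> \<eta>)) * (prodhat u u \<zeta> \<bullet> prodhat u u (\<zeta> - \<eta>)))"
proof -
  let ?p = "prodhat u u" and ?h = "bump \<eta> u + bump (- \<eta>) u"
  have RC: "2 *\<^sub>R prodR u v = prodC u v + prodC v u" for v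
  proof -
    have "2 *\<^sub>R prodR u v = l2_of (\<lambda>x. 2 *\<^sub>R of_real (fun_of u x \<bullet> fun_of v x))"
      unfolding prodR_def by (rule l2_of_scaleR[OF prodR_si, symmetric])
    also have "(\<lambda>x. 2 *\<^sub>R complex_of_real (fun_of u x \<bullet> fun_of v x)) = (\<lambda>x. fun_of u x * cnj (fun_of v x) + fun_of v x * cnj (fun_of u x))"
      by (simp add: fun_eq_iff complex_eq_iff inner_complex_def)
    also have "l2_of \<dots> = prodC u v + prodC v u"
      unfolding prodC_def by (rule l2_of_add[OF product_L2(1) product_L2(1)])
    finally show ?thesis .
  qed
  have sa: "square_integrable (\<lambda>\<zeta>. prodhat u (bump \<eta> u) \<zeta> + prodhat (bump (- \<eta>) u) u \<zeta>)" for \<eta>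
    by (intro square_integrable_add prodhat_square_integrable)
  let ?f = "\<lambda>\<eta> \<zeta>. of_real (- 2 * (\<zeta> \<bullet> \<eta>)) * ?p (\<zeta> + \<eta>)"
  have sf: "square_integrable (?f \<eta>)" for \<eta> using sa[of \<eta>] unfolding prodhat_bump .
  interpret R: bounded_bilinear prodR by (rule bounded_bilinear_prodR)
  have "FT (2 *\<^sub>R prodR u ?h) = (FT (prodC u (bump \<eta> u)) + FT (prodC (bump (- \<eta>) u) u)) + (FT (prodC u (bump (- \<eta>) u)) + FT (prodC (bump \<eta> u) u))"
    unfolding R.add_right scaleR_add_right RC linear_add[OF linear_FT] by (simp add: ac_simps)
  also have "FT (prodC u (bump \<eta> u)) + FT (prodC (bump (- \<eta>) u) u) = l2_of (?f \<eta>)"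
    unfolding FT_prodC l2_of_add[OF prodhat_square_integrable prodhat_square_integrable, symmetric] prodhat_bump ..
  also have "FT (prodC u (bump (- \<eta>) u)) + FT (prodC (bump \<eta> u) u) = l2_of (?f (- \<eta>))"
    using prodhat_bump[of "- \<eta>"] unfolding FT_prodC l2_of_add[OF prodhat_square_integrable prodhat_square_integrable, symmetric] by simp
  finally have FT2: "FT (2 *\<^sub>R prodR u ?h) = l2_of (\<lambda>\<zeta>. ?f \<eta> \<zeta> + ?f (- \<eta>) \<zeta>)"
    unfolding l2_of_add[OF sf sf] .
  have ip: "integrable lborel (\<lambda>\<zeta>. symb a b \<zeta> * (\<zeta> \<bullet> \<eta>) * (?p \<zeta> \<bullet> ?p (\<zeta> + \<eta>)))" for \<eta>
  proof -
    have "square_integrable (\<lambda>\<zeta>. of_real (symb a b \<zeta>) * ?p \<zeta>)"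
      by (rule square_integrable_cmult[OF prodhat_square_integrable symb_complex])
    from square_integrable_inner[OF this sf[of \<eta>]]
    have "integrable lborel (\<lambda>\<zeta>. (- 1 / 2) * ((of_real (symb a b \<zeta>) * ?p \<zeta>) \<bullet> (?f \<eta> \<zeta>)))" by (rule integrable_mult_right)
    then show ?thesis by (simp add: inner_complex_def algebra_simps)
  qed
  have alg: "r * (p \<bullet> (of_real (- 2 * (\<zeta> \<bullet> \<eta>)) * x + of_real (- 2 * (\<zeta> \<bullet> - \<eta>)) * y)) = 2 * (r * (\<zeta> \<bullet> \<eta>) * (p \<bullet> y) - r * (\<zeta> \<bullet> \<eta>) * (p \<bullet> x))" for r \<zeta> and p x y :: complex
    by (simp add: inner_complex_def algebra_simps)
  have "2 * (plconst * dquart a b u ?h) = plconst * (Top a b (prodR u u) \<bullet> 2 *\<^sub>R prodR u ?h)" by (simp add: dquart_def)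
  also have "\<dots> = (LINT \<zeta>|lborel. symb a b \<zeta> * (l2_fun (FT (prodC u u)) \<zeta> \<bullet> l2_fun (FT (2 *\<^sub>R prodR u ?h)) \<zeta>))"
    unfolding prodR_self[of u] by (rule inner_Top)
  also have "\<dots> = (LINT \<zeta>|lborel. 2 * (symb a b \<zeta> * (\<zeta> \<bullet> \<eta>) * (?p \<zeta> \<bullet> ?p (\<zeta> + - \<eta>)) - symb a b \<zeta> * (\<zeta> \<bullet> \<eta>) * (?p \<zeta> \<bullet> ?p (\<zeta> + \<eta>))))"
  proof (rule integral_cong_AE)
    show "AE \<zeta> in lborel. symb a b \<zeta> * (l2_fun (FT (prodC u u)) \<zeta> \<bullet> l2_fun (FT (2 *\<^sub>R prodR u ?h)) \<zeta>)
      = 2 * (symb a b \<zeta> * (\<zeta> \<bullet> \<eta>) * (?p \<zeta> \<bullet> ?p (\<zeta> + - \<eta>)) - symb a b \<zeta> * (\<zeta> \<bullet> \<eta>) * (?p \<zeta> \<bullet> ?p (\<zeta> + \<eta>)))"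
      using l2_fun_l2_of[OF prodhat_square_integrable[of u u]] l2_fun_l2_of[OF square_integrable_add[OF sf[of \<eta>] sf[of "- \<eta>"]]]
      unfolding FT_prodC FT2 by eventually_elim (simp only: alg)
  qed measurable
  also have "\<dots> = 2 * (LINT \<zeta>|lborel. symb a b \<zeta> * (\<zeta> \<bullet> \<eta>) * (?p \<zeta> \<bullet> ?p (\<zeta> - \<eta>)) - symb a b \<zeta> * (\<zeta> \<bullet> \<eta>) * (?p \<zeta> \<bullet> ?p (\<zeta> + \<eta>)))"
    unfolding add_uminus_conv_diff by (rule integral_mult_right_zero)
  finally have "plconst * dquart a b u ?h = (LINT \<zeta>|lborel. symb a b \<zeta> * (\<zeta> \<bullet> \<eta>) * (?p \<zeta> \<bullet> ?p (\<zeta> - \<eta>)) - symb a b \<zeta> * (\<zeta> \<bullet> \<eta>) * (?p \<zeta> \<bullet> ?p (\<zeta> + \<eta>)))"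
    by simp
  also have "\<dots> = (LINT \<zeta>|lborel. symb a b \<zeta> * (\<zeta> \<bullet> \<eta>) * (?p \<zeta> \<bullet> ?p (\<zeta> - \<eta>))) - (LINT \<zeta>|lborel. symb a b \<zeta> * (\<zeta> \<bullet> \<eta>) * (?p \<zeta> \<bullet> ?p (\<zeta> + \<eta>)))"
    using ip[of "- \<eta>"] by (intro Bochner_Integration.integral_diff ip) simp
  also have "(LINT \<zeta>|lborel. symb a b \<zeta> * (\<zeta> \<bullet> \<eta>) * (?p \<zeta> \<bullet> ?p (\<zeta> + \<eta>))) = (LINT \<zeta>|lborel. symb a b (\<zeta> + - \<eta>) * ((\<zeta> + - \<eta>) \<bullet> \<eta>) * (?p (\<zeta> + - \<eta>) \<bullet> ?p ((\<zeta> + - \<eta>) + \<eta>)))"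
    using ip[of \<eta>] by (intro lborel_integral_shift(1)[symmetric]) auto
  also have "(LINT \<zeta>|lborel. symb a b \<zeta> * (\<zeta> \<bullet> \<eta>) * (?p \<zeta> \<bullet> ?p (\<zeta> - \<eta>))) - (LINT \<zeta>|lborel. symb a b (\<zeta> + - \<eta>) * ((\<zeta> + - \<eta>) \<bullet> \<eta>) * (?p (\<zeta> + - \<eta>) \<bullet> ?p ((\<zeta> + - \<eta>) + \<eta>)))
    = (LINT \<zeta>|lborel. symb a b \<zeta> * (\<zeta> \<bullet> \<eta>) * (?p \<zeta> \<bullet> ?p (\<zeta> - \<eta>)) - symb a b (\<zeta> + - \<eta>) * ((\<zeta> + - \<eta>) \<bullet> \<eta>) * (?p (\<zeta> + - \<eta>) \<bullet> ?p ((\<zeta> + - \<eta>) + \<eta>)))"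
    using ip[of "- \<eta>"] by (intro Bochner_Integration.integral_diff[symmetric] lborel_integrable_shift(1)[OF ip]) simp
  finally show ?thesis by (simp add: inner_commute left_diff_distrib)
qed

end

text \<open>The equation is tested with \<open>bump \<eta> u + bump (- \<eta>) u\<close>, an
  admissible variation by regularity; the multiplier has already cancelled in
  \<open>quadratic_virial\<close>.\<close>

lemma virial_identity:
  assumes eq: "\<And>h. dkin u h + 2 * dquart a b u h + \<kappa> * l2_inner u h = 0"
  shows "(LINT \<xi>|lborel. ((2 *\<^sub>R \<xi> - \<eta>) \<bullet> \<eta>)\<^sup>2 * (hat u \<xi> \<bullet> hat u (\<xi> - \<eta>)))
    + 2 * (LINT \<zeta>|lborel. (symb a b \<zeta> * (\<zeta> \<bullet> \<eta>) - symb a b (\<zeta> - \<eta>) * ((\<zeta> - \<eta>) \<bullet> \<eta>)) * (prodhat u u \<zeta> \<bullet> prodhat u u (\<zeta> - \<eta>))) = 0"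
proof -
  note reg = stationary_regular[OF eq]
  have "plconst * (dkin u h + 2 * dquart a b u h + \<kappa> * l2_inner u h) = plconst * (dkin u h + \<kappa> * l2_inner u h) + 2 * (plconst * dquart a b u h)" for h
    by (simp add: algebra_simps)
  from this[of "bump \<eta> u + bump (- \<eta>) u"] show ?thesis
    unfolding quadratic_virial[OF reg] quartic_virial[OF reg] eq by simp
qed

subsection \<open>The symbol along coordinate directions\<close>

text \<open>The factor \<open>\<zeta> $ j\<close> hides the exceptional value of the symbol at 0, so
  the formula holds for all frequencies.\<close>

lemma symb_nth: "symb a b \<zeta> * \<zeta> $ j = (a - b * (4 / 3 * pi) + b * (4 * pi) * (\<zeta> $ 3 / norm \<zeta>)\<^sup>2) * \<zeta> $ j"
proof (cases "\<zeta> = 0")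
  case False
  then show ?thesis unfolding symb_def dipolar_symbol_eq[OF False] by (simp add: power_divide algebra_simps)
qed simp

text \<open>The symbol jumps at 0, but times a coordinate it is homogeneous of degree 1 and remains
  Lipschitz. The bound dominates the difference quotients in the limit of small shifts; 5 is 1 from
  the coordinate plus 4 from the squared direction cosine.\<close>

lemma symb_lipschitz: "\<bar>symb a b \<zeta> * \<zeta> $ j - symb a b \<omega> * \<omega> $ j\<bar> \<le> (\<bar>a - b * (4 / 3 * pi)\<bar> + \<bar>b * (4 * pi)\<bar> * 5) * norm (\<zeta> - \<omega>)"
proof -
  let ?d = "norm (\<zeta> - \<omega>)"
  define x y where "x = \<zeta> $ 3 / norm \<zeta>" and "y = \<omega> $ 3 / norm \<omega>"
  have xy: "\<bar>x\<bar> \<le> 1" "\<bar>y\<bar> \<le> 1" "norm \<zeta> * x = \<zeta> $ 3" "norm \<omega> * y = \<omega> $ 3"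
    unfolding x_def y_def using component_le_norm_cart[of \<zeta> 3] component_le_norm_cart[of \<omega> 3] by (auto simp: divide_le_eq_1)
  have cd: "\<bar>\<zeta> $ i - \<omega> $ i\<bar> \<le> ?d" for i using component_le_norm_cart[of "\<zeta> - \<omega>" i] by simp
  \<comment> \<open>Direction cosines are not Lipschitz near 0, but their difference times the norm
    of one of the points is.\<close>
  have "norm \<omega> * (x - y) = (norm \<omega> - norm \<zeta>) * x + (\<zeta> $ 3 - \<omega> $ 3)"
    unfolding xy(3,4)[symmetric] by (simp add: algebra_simps)
  also have "\<bar>\<dots>\<bar> \<le> ?d * 1 + ?d"
    by (intro order_trans[OF abs_triangle_ineq] add_mono cd, unfold abs_mult, intro mult_mono xy)
       (use norm_triangle_ineq3[of \<omega> \<zeta>] in \<open>auto simp: norm_minus_commute\<close>)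
  finally have w: "norm \<omega> * \<bar>x - y\<bar> \<le> 2 * ?d" by (simp add: abs_mult)
  have "\<bar>\<omega> $ j * (x\<^sup>2 - y\<^sup>2)\<bar> = \<bar>\<omega> $ j\<bar> * \<bar>x - y\<bar> * \<bar>x + y\<bar>"
    by (simp add: power2_eq_square square_diff_square_factored abs_mult mult.commute mult.left_commute)
  also have "\<dots> \<le> (norm \<omega> * \<bar>x - y\<bar>) * 2"
    by (intro mult_mono component_le_norm_cart order_refl) (use xy in auto)
  finally have A: "\<bar>\<omega> $ j * (x\<^sup>2 - y\<^sup>2)\<bar> \<le> 4 * ?d" using w by linarith
  have "\<bar>x\<^sup>2\<bar> \<le> 1" using xy(1) by (simp add: abs_square_le_1)
  then have "\<bar>x\<^sup>2\<bar> * \<bar>\<zeta> $ j - \<omega> $ j\<bar> \<le> 1 * ?d" by (intro mult_mono cd) auto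
  then have B: "\<bar>x\<^sup>2 * (\<zeta> $ j - \<omega> $ j)\<bar> \<le> ?d" by (simp add: abs_mult)
  have "x\<^sup>2 * \<zeta> $ j - y\<^sup>2 * \<omega> $ j = x\<^sup>2 * (\<zeta> $ j - \<omega> $ j) + \<omega> $ j * (x\<^sup>2 - y\<^sup>2)" by (simp add: algebra_simps)
  then have C: "\<bar>x\<^sup>2 * \<zeta> $ j - y\<^sup>2 * \<omega> $ j\<bar> \<le> 5 * ?d" using A B by linarith
  let ?\<alpha> = "a - b * (4 / 3 * pi)" and ?\<beta> = "b * (4 * pi)"
  have "symb a b \<zeta> * \<zeta> $ j - symb a b \<omega> * \<omega> $ j = ?\<alpha> * (\<zeta> $ j - \<omega> $ j) + ?\<beta> * (x\<^sup>2 * \<zeta> $ j - y\<^sup>2 * \<omega> $ j)"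
  proof -
    have "(\<alpha> + \<beta> * X) * v - (\<alpha> + \<beta> * Y) * w = \<alpha> * (v - w) + \<beta> * (X * v - Y * w)" for \<alpha> \<beta> X Y v w :: real
      by (simp add: algebra_simps)
    then show ?thesis unfolding symb_nth x_def[symmetric] y_def[symmetric] .
  qed
  also have "\<bar>\<dots>\<bar> \<le> \<bar>?\<alpha>\<bar> * ?d + \<bar>?\<beta>\<bar> * (5 * ?d)"
    by (intro order_trans[OF abs_triangle_ineq] add_mono, unfold abs_mult) (intro mult_left_mono cd C abs_ge_zero mult_nonneg_nonneg)+
  finally show ?thesis by (simp add: distrib_right mult.assoc)
qed

text \<open>The j-th partial derivative of \<open>symb a b \<zeta> * \<zeta> $ j\<close> away from
  the origin, by the quotient rule.\<close>

definition dsymb :: "real \<Rightarrow> real \<Rightarrow> 3 \<Rightarrow> real^3 \<Rightarrow> real" where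
  "dsymb a b j \<zeta> = (a - b * (4 / 3 * pi) + b * (4 * pi) * (\<zeta> $ 3 / norm \<zeta>)\<^sup>2)
     - b * (4 * pi) * (\<zeta> $ j * ((2 * \<zeta> $ j * (\<zeta> $ 3)\<^sup>2 - 2 * (axis j 1 $ 3) * \<zeta> $ 3 * (norm \<zeta>)\<^sup>2) / ((norm \<zeta>)\<^sup>2)\<^sup>2))"

lemma dsymb_measurable [measurable]: "dsymb a b j \<in> borel_measurable borel"
  unfolding dsymb_def[abs_def] by measurable

text \<open>The divergence of a degree-0 symbol times the position field: by Euler's relation the
  radial derivative vanishes, and only the dimension 3 remains.\<close>

lemma sum_dsymb:
  assumes "\<zeta> \<noteq> 0"
  shows "(\<Sum>j\<in>UNIV. dsymb a b j \<zeta>) = 3 * symb a b \<zeta>"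
proof -
  have n: "(norm \<zeta>)\<^sup>2 \<noteq> 0" using assms by simp
  have "(\<Sum>j\<in>UNIV. \<zeta> $ j * ((2 * \<zeta> $ j * (\<zeta> $ 3)\<^sup>2 - 2 * (axis j 1 $ 3) * \<zeta> $ 3 * (norm \<zeta>)\<^sup>2) / ((norm \<zeta>)\<^sup>2)\<^sup>2))
    = (2 * (\<zeta> $ 3)\<^sup>2 * ((\<zeta> $ 1)\<^sup>2 + (\<zeta> $ 2)\<^sup>2 + (\<zeta> $ 3)\<^sup>2) - 2 * (\<zeta> $ 3)\<^sup>2 * (norm \<zeta>)\<^sup>2) / ((norm \<zeta>)\<^sup>2)\<^sup>2"
    unfolding sum_3 by (simp add: axis_def add_divide_distrib[symmetric] diff_divide_distrib[symmetric] power2_eq_square algebra_simps)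
  also have "\<dots> = 0" unfolding norm_vec3[symmetric] by simp
  finally have "(\<Sum>j\<in>UNIV. dsymb a b j \<zeta>) = 3 * (a - b * (4 / 3 * pi) + b * (4 * pi) * (\<zeta> $ 3 / norm \<zeta>)\<^sup>2)"
    unfolding dsymb_def sum_subtractf sum_distrib_left[symmetric] by simp
  also have "a - b * (4 / 3 * pi) + b * (4 * pi) * (\<zeta> $ 3 / norm \<zeta>)\<^sup>2 = symb a b \<zeta>"
    unfolding symb_def dipolar_symbol_eq[OF assms] by (simp add: power_divide algebra_simps)
  finally show ?thesis .
qed

lemma symb_difference_quotient:
  assumes z: "\<zeta> \<noteq> 0" and s: "s \<longlonglongrightarrow> 0" "\<And>n. s n \<noteq> 0"
  shows "(\<lambda>n. (symb a b \<zeta> * \<zeta> $ j - symb a b (\<zeta> - s n *\<^sub>R axis j 1) * (\<zeta> - s n *\<^sub>R axis j 1) $ j) / s n) \<longlonglongrightarrow> dsymb a b j \<zeta>"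
proof -
  let ?\<alpha> = "a - b * (4 / 3 * pi)" and ?\<beta> = "b * (4 * pi)" and ?N = "(norm \<zeta>)\<^sup>2" and ?e = "axis j 1 $ 3 :: real"
  \<comment> \<open>The product along the backward line from \<open>\<zeta>\<close>, as an explicit
    rational function; moving backwards makes its derivative at 0 equal to minus
    \<open>dsymb\<close>.\<close>
  define \<psi> where "\<psi> t = (?\<alpha> + ?\<beta> * ((\<zeta> $ 3 - t * ?e)\<^sup>2 / (?N - 2 * t * \<zeta> $ j + t\<^sup>2))) * (\<zeta> $ j - t)" for t
  have N: "?N \<noteq> 0" using z by simp
  have psi: "symb a b (\<zeta> - t *\<^sub>R axis j 1) * (\<zeta> - t *\<^sub>R axis j 1) $ j = \<psi> t" for t
  proof -
    have "(norm (\<zeta> - t *\<^sub>R axis j 1))\<^sup>2 = ?N - 2 * t * \<zeta> $ j + t\<^sup>2"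
      unfolding power2_norm_eq_inner by (simp add: inner_diff_left inner_diff_right inner_axis inner_axis' power2_eq_square inner_commute[of "axis j 1" \<zeta>] algebra_simps)
    then show ?thesis unfolding symb_nth power_divide by (simp add: \<psi>_def axis_def)
  qed
  have f: "((\<lambda>t. (\<zeta> $ 3 - t * ?e)\<^sup>2) has_real_derivative - (2 * ?e * \<zeta> $ 3)) (at 0)"
    by (auto intro!: derivative_eq_intros)
  have h: "((\<lambda>t. M - 2 * t * \<zeta> $ j + t\<^sup>2) has_real_derivative - (2 * \<zeta> $ j)) (at 0)" for M
    by (auto intro!: derivative_eq_intros)
  have l: "((\<lambda>t. \<zeta> $ j - t) has_real_derivative - 1) (at 0)" by (auto intro!: derivative_eq_intros)
  have D: "((\<lambda>t. (\<zeta> $ 3 - t * ?e)\<^sup>2 / (M - 2 * t * \<zeta> $ j + t\<^sup>2)) has_real_derivative (2 * \<zeta> $ j * (\<zeta> $ 3)\<^sup>2 - 2 * ?e * \<zeta> $ 3 * M) / M\<^sup>2) (at 0)" if "M \<noteq> 0" for M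
    by (rule DERIV_cong[OF DERIV_divide[OF f h[of M]]]) (use that in \<open>simp_all add: power2_eq_square[of M]\<close>)
  have "(\<psi> has_real_derivative (- dsymb a b j \<zeta>)) (at 0)"
    unfolding \<psi>_def[abs_def]
    by (rule DERIV_cong[OF DERIV_mult[OF DERIV_add[OF DERIV_const DERIV_cmult[OF D[OF N]]] l]]) (simp add: dsymb_def power_divide)
  then have "(\<lambda>h. (\<psi> (0 + h) - \<psi> 0) / h) \<midarrow>0\<rightarrow> - dsymb a b j \<zeta>" by (simp only: DERIV_def)
  moreover have "filterlim s (at 0) sequentially" using s by (simp add: filterlim_at)
  ultimately have "(\<lambda>n. (\<psi> (0 + s n) - \<psi> 0) / s n) \<longlonglongrightarrow> - dsymb a b j \<zeta>" by (rule filterlim_compose)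
  from tendsto_minus[OF this] show ?thesis unfolding psi using psi[of 0] by (simp add: minus_divide_left)
qed

lemma l2_inner_of_real:
  "(complex_of_real r * x) \<bullet> (of_real t * y) = r * t * (x \<bullet> y)" "(complex_of_real r * x) \<bullet> y = r * (x \<bullet> y)"
  by (simp_all add: inner_complex_def algebra_simps)

text \<open>The virial identity for a shift by \<open>s n\<close> in direction \<open>j\<close>,
  divided by the square of \<open>s n\<close>. Both parts are inner products involving translates,
  so the limit follows from strong continuity of translations.\<close>

lemma directional_pohozaev:
  assumes eq: "\<And>h. dkin u h + 2 * dquart a b u h + \<kappa> * l2_inner u h = 0"
  shows "4 * (LINT \<xi>|lborel. (\<xi> $ j)\<^sup>2 * (cmod (hat u \<xi>))\<^sup>2) + 2 * (LINT \<zeta>|lborel. dsymb a b j \<zeta> * (cmod (prodhat u u \<zeta>))\<^sup>2) = 0"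
    and "integrable lborel (\<lambda>\<zeta>. dsymb a b j \<zeta> * (cmod (prodhat u u \<zeta>))\<^sup>2)"
proof -
  let ?p = "prodhat u u"
  define e :: "real^3" where "e = axis j 1"
  have e: "\<xi> \<bullet> e = \<xi> $ j" "e $ j = 1" "norm e = 1" for \<xi> by (simp_all add: e_def inner_axis)
  define s where "s n = 1 / real (Suc n)" for n
  have s0: "s \<longlonglongrightarrow> 0" unfolding s_def using LIMSEQ_Suc[OF lim_1_over_n] .
  have sp: "s n > 0" for n by (simp add: s_def)
  define A G P where "A = l2_of (hat u)" and "G = l2_of (\<lambda>\<xi>. of_real (\<xi> $ j) * hat u \<xi>)" and "P = l2_of ?p"
  define S where "S n = l2_comp (\<chi> i. 1) (- (s n *\<^sub>R e))" for n
  have Sl: "(\<lambda>n. S n w) \<longlonglongrightarrow> w" for w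
  proof -
    have "(\<lambda>n. l2_comp (\<chi> i. 1) (- (s n *\<^sub>R e)) w) \<longlonglongrightarrow> l2_comp (\<chi> i. 1) (- (0 *\<^sub>R e)) w"
      by (intro l2_comp_tendsto tendsto_const tendsto_minus tendsto_scaleR s0) auto
    moreover have "l2_comp (\<chi> i. 1) (- (0 *\<^sub>R e)) w = w"
      unfolding l2_comp_def one_vec by simp
    ultimately show ?thesis by (simp add: S_def)
  qed
  have Sf: "S n (l2_of f) = l2_of (\<lambda>\<xi>. f (\<xi> - s n *\<^sub>R e))" if "square_integrable f" for f n
    unfolding S_def by (subst l2_comp_l2_of[OF _ that]) (simp_all only: one_vec, simp)
  have Slin: "linear (S n)" for n unfolding S_def by (rule linear_l2_comp) simp
  note ha = hat_square_integrable[of u] and hn = hat_nth_square_integrable[of j u]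
  have lin: "2 *\<^sub>R G + c *\<^sub>R A = l2_of (\<lambda>\<xi>. of_real (2 * \<xi> $ j + c) * hat u \<xi>)" "square_integrable (\<lambda>\<xi>. of_real (2 * \<xi> $ j + c) * hat u \<xi>)" for c
  proof -
    have f: "(\<lambda>\<xi>. 2 *\<^sub>R (of_real (\<xi> $ j) * hat u \<xi>) + c *\<^sub>R hat u \<xi>) = (\<lambda>\<xi>. of_real (2 * \<xi> $ j + c) * hat u \<xi>)"
      by (simp add: fun_eq_iff scaleR_conv_of_real[where 'a = complex] distrib_right mult.assoc)
    show "square_integrable (\<lambda>\<xi>. of_real (2 * \<xi> $ j + c) * hat u \<xi>)"
      unfolding f[symmetric] by (intro square_integrable_add square_integrable_scaleR ha hn)
    show "2 *\<^sub>R G + c *\<^sub>R A = l2_of (\<lambda>\<xi>. of_real (2 * \<xi> $ j + c) * hat u \<xi>)"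
      unfolding f[symmetric] G_def A_def
        l2_of_add[OF square_integrable_scaleR[OF hn] square_integrable_scaleR[OF ha]] l2_of_scaleR[OF hn] l2_of_scaleR[OF ha] ..
  qed
  \<comment> \<open>The two linear factors are distributed symmetrically: seen from the translated
    point, 2 xi_j - s is 2 (xi - s e)_j + s. Only first moments of \<open>hat u\<close> then
    enter.\<close>
  have kin: "(LINT \<xi>|lborel. ((2 *\<^sub>R \<xi> - s n *\<^sub>R e) \<bullet> (s n *\<^sub>R e))\<^sup>2 * (hat u \<xi> \<bullet> hat u (\<xi> - s n *\<^sub>R e)))
    = (s n)\<^sup>2 * ((2 *\<^sub>R G + (- s n) *\<^sub>R A) \<bullet> S n (2 *\<^sub>R G + s n *\<^sub>R A))" for n
  proof -
    have "(2 *\<^sub>R G + (- s n) *\<^sub>R A) \<bullet> S n (2 *\<^sub>R G + s n *\<^sub>R A)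
      = (LINT \<xi>|lborel. (of_real (2 * \<xi> $ j + (- s n)) * hat u \<xi>) \<bullet> (of_real (2 * (\<xi> - s n *\<^sub>R e) $ j + s n) * hat u (\<xi> - s n *\<^sub>R e)))"
      unfolding lin(1) Sf[OF lin(2)] by (rule inner_l2_of[OF lin(2) square_integrable_shift[OF lin(2)]])
    also have "(s n)\<^sup>2 * \<dots> = (LINT \<xi>|lborel. (s n)\<^sup>2 * ((of_real (2 * \<xi> $ j + (- s n)) * hat u \<xi>) \<bullet> (of_real (2 * (\<xi> - s n *\<^sub>R e) $ j + s n) * hat u (\<xi> - s n *\<^sub>R e))))"
      by (rule integral_mult_right_zero[symmetric])
    also have "\<dots> = (LINT \<xi>|lborel. ((2 *\<^sub>R \<xi> - s n *\<^sub>R e) \<bullet> (s n *\<^sub>R e))\<^sup>2 * (hat u \<xi> \<bullet> hat u (\<xi> - s n *\<^sub>R e)))"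
      unfolding l2_inner_of_real(1)
      by (intro Bochner_Integration.integral_cong refl) (simp add: inner_diff_left e power2_eq_square)
    finally show ?thesis ..
  qed
  \<comment> \<open>Difference quotients of the degree-1 field, uniformly bounded by
    \<open>L\<close> and convergent off the origin.\<close>
  define c where "c n \<zeta> = (symb a b \<zeta> * \<zeta> $ j - symb a b (\<zeta> - s n *\<^sub>R e) * (\<zeta> - s n *\<^sub>R e) $ j) / s n" for n \<zeta>
  have [measurable]: "c n \<in> borel_measurable borel" for n unfolding c_def[abs_def] by measurable
  define L where "L = \<bar>a - b * (4 / 3 * pi)\<bar> + \<bar>b * (4 * pi)\<bar> * 5"
  have cb: "\<bar>c n \<zeta>\<bar> \<le> L" for n \<zeta>
    using symb_lipschitz[of a b \<zeta> j "\<zeta> - s n *\<^sub>R e"] sp[of n] by (simp add: c_def L_def e abs_divide pos_divide_le_eq)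
  have cl: "(\<lambda>n. c n \<zeta>) \<longlonglongrightarrow> dsymb a b j \<zeta>" if "\<zeta> \<noteq> 0" for \<zeta>
    unfolding c_def e_def by (rule symb_difference_quotient[OF that s0]) (use sp in \<open>simp add: less_imp_neq[symmetric]\<close>)
  have nz: "AE \<zeta> in lborel. \<zeta> \<noteq> (0 :: real^3)" by (rule AE_lborel_singleton)
  have db: "\<bar>dsymb a b j \<zeta>\<bar> \<le> L" if "\<zeta> \<noteq> 0" for \<zeta>
    by (rule tendsto_upperbound[OF tendsto_rabs[OF cl[OF that]]]) (auto simp: cb)
  have sc: "square_integrable (\<lambda>\<zeta>. of_real (c n \<zeta>) * ?p \<zeta>)" for n
    by (rule square_integrable_cmult[OF prodhat_square_integrable, where C = L]) (use cb in auto)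
  have sd: "square_integrable (\<lambda>\<zeta>. of_real (dsymb a b j \<zeta>) * ?p \<zeta>)"
  proof (rule square_integrable_bound[OF prodhat_square_integrable, where C = L])
    show "AE \<zeta> in lborel. norm (of_real (dsymb a b j \<zeta>) * ?p \<zeta>) \<le> L * norm (?p \<zeta>)"
      using nz by eventually_elim (simp add: norm_mult mult_right_mono db)
  qed measurable
  have pot: "(LINT \<zeta>|lborel. (symb a b \<zeta> * (\<zeta> \<bullet> (s n *\<^sub>R e)) - symb a b (\<zeta> - s n *\<^sub>R e) * ((\<zeta> - s n *\<^sub>R e) \<bullet> (s n *\<^sub>R e))) * (?p \<zeta> \<bullet> ?p (\<zeta> - s n *\<^sub>R e)))
    = (s n)\<^sup>2 * (l2_of (\<lambda>\<zeta>. of_real (c n \<zeta>) * ?p \<zeta>) \<bullet> S n P)" for n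
  proof -
    have "l2_of (\<lambda>\<zeta>. of_real (c n \<zeta>) * ?p \<zeta>) \<bullet> S n P = (LINT \<zeta>|lborel. (of_real (c n \<zeta>) * ?p \<zeta>) \<bullet> ?p (\<zeta> - s n *\<^sub>R e))"
      unfolding P_def Sf[OF prodhat_square_integrable]
      by (rule inner_l2_of[OF sc square_integrable_shift[OF prodhat_square_integrable]])
    also have "(s n)\<^sup>2 * \<dots> = (LINT \<zeta>|lborel. (s n)\<^sup>2 * ((of_real (c n \<zeta>) * ?p \<zeta>) \<bullet> ?p (\<zeta> - s n *\<^sub>R e)))"
      by (rule integral_mult_right_zero[symmetric])
    also have "\<dots> = (LINT \<zeta>|lborel. (symb a b \<zeta> * (\<zeta> \<bullet> (s n *\<^sub>R e)) - symb a b (\<zeta> - s n *\<^sub>R e) * ((\<zeta> - s n *\<^sub>R e) \<bullet> (s n *\<^sub>R e))) * (?p \<zeta> \<bullet> ?p (\<zeta> - s n *\<^sub>R e)))"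
    proof (intro Bochner_Integration.integral_cong refl)
      fix \<zeta>
      have alg: "X * (t * x) - Y * (t * y) = t * (t * ((X * x - Y * y) / t))" if "t > 0" for t x y X Y :: real
      proof -
        have "t * ((X * x - Y * y) / t) = X * x - Y * y" using that by simp
        then show ?thesis by (simp only: right_diff_distrib mult.left_commute)
      qed
      have "symb a b \<zeta> * (\<zeta> \<bullet> (s n *\<^sub>R e)) - symb a b (\<zeta> - s n *\<^sub>R e) * ((\<zeta> - s n *\<^sub>R e) \<bullet> (s n *\<^sub>R e)) = s n * (s n * c n \<zeta>)"
        unfolding c_def inner_scaleR_right e by (rule alg[OF sp])
      then show "(s n)\<^sup>2 * ((of_real (c n \<zeta>) * ?p \<zeta>) \<bullet> ?p (\<zeta> - s n *\<^sub>R e)) = (symb a b \<zeta> * (\<zeta> \<bullet> (s n *\<^sub>R e)) - symb a b (\<zeta> - s n *\<^sub>R e) * ((\<zeta> - s n *\<^sub>R e) \<bullet> (s n *\<^sub>R e))) * (?p \<zeta> \<bullet> ?p (\<zeta> - s n *\<^sub>R e))"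
        unfolding l2_inner_of_real power2_eq_square by (simp only: mult.assoc)
    qed
    finally show ?thesis ..
  qed
  have z: "(2 *\<^sub>R G + (- s n) *\<^sub>R A) \<bullet> S n (2 *\<^sub>R G + s n *\<^sub>R A) + 2 * (l2_of (\<lambda>\<zeta>. of_real (c n \<zeta>) * ?p \<zeta>) \<bullet> S n P) = 0" for n
  proof -
    have alg: "x + 2 * y = 0" if "t\<^sup>2 * x + 2 * (t\<^sup>2 * y) = 0" "t > 0" for t x y :: real
    proof -
      have "t\<^sup>2 * (x + 2 * y) = 0" using that(1) by (simp add: algebra_simps)
      then show ?thesis using that(2) by simp
    qed
    show ?thesis using virial_identity[OF eq, of "s n *\<^sub>R e"] unfolding kin pot by (rule alg[OF _ sp])
  qed
  have "(\<lambda>n. (2 *\<^sub>R G + (- s n) *\<^sub>R A) \<bullet> (2 *\<^sub>R S n G + s n *\<^sub>R S n A) + 2 * (l2_of (\<lambda>\<zeta>. of_real (c n \<zeta>) * ?p \<zeta>) \<bullet> S n P))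
    \<longlonglongrightarrow> (2 *\<^sub>R G + (- 0) *\<^sub>R A) \<bullet> (2 *\<^sub>R G + 0 *\<^sub>R A) + 2 * (l2_of (\<lambda>\<zeta>. of_real (dsymb a b j \<zeta>) * ?p \<zeta>) \<bullet> P)"
  proof (intro tendsto_intros s0 Sl)
    have "square_integrable (\<lambda>\<zeta>. L *\<^sub>R cmod (?p \<zeta>))"
      by (rule square_integrable_scaleR) (use prodhat_square_integrable[of u u] in \<open>simp add: square_integrable_def\<close>)
    then have w: "square_integrable (\<lambda>\<zeta>. L * cmod (?p \<zeta>))" by simp
    show "(\<lambda>n. l2_of (\<lambda>\<zeta>. of_real (c n \<zeta>) * ?p \<zeta>)) \<longlonglongrightarrow> l2_of (\<lambda>\<zeta>. of_real (dsymb a b j \<zeta>) * ?p \<zeta>)"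
    proof (rule l2_dominated_convergence[OF sc sd w])
      show "AE \<zeta> in lborel. cmod (of_real (c n \<zeta>) * ?p \<zeta>) \<le> L * cmod (?p \<zeta>)" for n
        by (intro AE_I2) (simp add: norm_mult mult_right_mono cb)
      show "AE \<zeta> in lborel. (\<lambda>n. of_real (c n \<zeta>) * ?p \<zeta>) \<longlonglongrightarrow> of_real (dsymb a b j \<zeta>) * ?p \<zeta>"
        using nz by eventually_elim (intro tendsto_intros cl)
    qed
  qed
  then have "(\<lambda>n. 0) \<longlonglongrightarrow> 4 * (G \<bullet> G) + 2 * (l2_of (\<lambda>\<zeta>. of_real (dsymb a b j \<zeta>) * ?p \<zeta>) \<bullet> P)"
    using z by (simp add: linear_add[OF Slin] linear_cmul[OF Slin])
  then have "4 * (G \<bullet> G) + 2 * (l2_of (\<lambda>\<zeta>. of_real (dsymb a b j \<zeta>) * ?p \<zeta>) \<bullet> P) = 0"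
    by (simp add: LIMSEQ_const_iff)
  moreover have "G \<bullet> G = (LINT \<xi>|lborel. (\<xi> $ j)\<^sup>2 * (cmod (hat u \<xi>))\<^sup>2)"
    unfolding G_def inner_l2_of[OF hn hn] l2_inner_of_real(1) by (simp add: power2_eq_square dot_square_norm)
  moreover have "l2_of (\<lambda>\<zeta>. of_real (dsymb a b j \<zeta>) * ?p \<zeta>) \<bullet> P = (LINT \<zeta>|lborel. dsymb a b j \<zeta> * (cmod (?p \<zeta>))\<^sup>2)"
    unfolding P_def inner_l2_of[OF sd prodhat_square_integrable] l2_inner_of_real(2) by (simp add: dot_square_norm)
  ultimately show "4 * (LINT \<xi>|lborel. (\<xi> $ j)\<^sup>2 * (cmod (hat u \<xi>))\<^sup>2) + 2 * (LINT \<zeta>|lborel. dsymb a b j \<zeta> * (cmod (?p \<zeta>))\<^sup>2) = 0"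
    by simp
  show "integrable lborel (\<lambda>\<zeta>. dsymb a b j \<zeta> * (cmod (?p \<zeta>))\<^sup>2)"
    using square_integrable_inner[OF sd prodhat_square_integrable[of u u]] unfolding l2_inner_of_real(2) by (simp add: dot_square_norm)
qed

text \<open>Summing the directional identities over the three axes gives 4 A + 6 B = 0, because the
  derivatives of the symbol field add up to three times the symbol.\<close>

theorem pohozaev:
  assumes eq: "\<And>h. dkin u h + 2 * dquart a b u h + \<kappa> * l2_inner u h = 0"
  shows "kinetic u + 3 / 2 * quart a b u = 0"
proof -
  note d = directional_pohozaev[OF eq]
  have "0 = (\<Sum>j\<in>UNIV. 4 * (LINT \<xi>|lborel. (\<xi> $ j)\<^sup>2 * (cmod (hat u \<xi>))\<^sup>2) + 2 * (LINT \<zeta>|lborel. dsymb a b j \<zeta> * (cmod (prodhat u u \<zeta>))\<^sup>2))"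
    unfolding d(1) by simp
  also have "\<dots> = 4 * (\<Sum>j\<in>UNIV. LINT \<xi>|lborel. (\<xi> $ j)\<^sup>2 * (cmod (hat u \<xi>))\<^sup>2) + 2 * (\<Sum>j\<in>UNIV. LINT \<zeta>|lborel. dsymb a b j \<zeta> * (cmod (prodhat u u \<zeta>))\<^sup>2)"
    by (simp add: sum.distrib sum_distrib_left)
  also have "(\<Sum>j\<in>UNIV. LINT \<xi>|lborel. (\<xi> $ j)\<^sup>2 * (cmod (hat u \<xi>))\<^sup>2) = plconst * kinetic u"
  proof -
    have "integrable lborel (\<lambda>\<xi>. (\<xi> $ j)\<^sup>2 * (cmod (hat u \<xi>))\<^sup>2)" for j
      using hat_nth_square_integrable[of j u] by (simp add: square_integrable_def norm_mult power_mult_distrib)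
    then show ?thesis unfolding kinetic_hat norm_eq_sum_nth sum_distrib_right
      by (intro Bochner_Integration.integral_sum[symmetric]) auto
  qed
  also have "(\<Sum>j\<in>UNIV. LINT \<zeta>|lborel. dsymb a b j \<zeta> * (cmod (prodhat u u \<zeta>))\<^sup>2) = (LINT \<zeta>|lborel. (\<Sum>j\<in>UNIV. dsymb a b j \<zeta> * (cmod (prodhat u u \<zeta>))\<^sup>2))"
    by (intro Bochner_Integration.integral_sum[symmetric] d(2))
  also have "\<dots> = (LINT \<zeta>|lborel. 3 * (symb a b \<zeta> * (cmod (prodhat u u \<zeta>))\<^sup>2))"
  proof (rule integral_cong_AE)
    show "AE \<zeta> in lborel. (\<Sum>j\<in>UNIV. dsymb a b j \<zeta> * (cmod (prodhat u u \<zeta>))\<^sup>2) = 3 * (symb a b \<zeta> * (cmod (prodhat u u \<zeta>))\<^sup>2)"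
      using AE_lborel_singleton[of 0] by eventually_elim (simp add: sum_distrib_right[symmetric] sum_dsymb)
  qed measurable
  also have "\<dots> = 3 * (plconst * quart a b u)" unfolding quart_eq by (rule integral_mult_right_zero)
  finally have "plconst * (kinetic u + 3 / 2 * quart a b u) = 0" by (simp add: algebra_simps)
  then show ?thesis using plconst_pos by simp
qed

section \<open>The mountain pass\<close>

text \<open>Transform of the j-th partial derivative up to the factor \<open>\<i>\<close>. Together
  with \<open>hat\<close> it expresses the H^1 norm by \<open>l2\<close> norms, on which dilations
  act by \<open>l2_comp\<close>.\<close>

definition momentum :: "3 \<Rightarrow> h1 \<Rightarrow> l2" where
  "momentum j v = l2_of (\<lambda>\<xi>. of_real (\<xi> $ j) * hat v \<xi>)"

lemma norm_h1_momentum: "plconst * (norm v)\<^sup>2 = (norm (l2_of (hat v)))\<^sup>2 + (\<Sum>j\<in>UNIV. (norm (momentum j v))\<^sup>2)"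
proof -
  have i: "integrable lborel (\<lambda>\<xi>. (cmod (of_real (\<xi> $ j) * hat v \<xi>))\<^sup>2)" for j
    using hat_nth_square_integrable[of j v] by (simp add: square_integrable_def)
  have "plconst * kinetic v = (LINT \<xi>|lborel. (\<Sum>j\<in>UNIV. (cmod (of_real (\<xi> $ j) * hat v \<xi>))\<^sup>2))"
    unfolding kinetic_hat by (simp add: norm_eq_sum_nth norm_mult power_mult_distrib sum_distrib_right)
  also have "\<dots> = (\<Sum>j\<in>UNIV. (norm (momentum j v))\<^sup>2)"
    unfolding momentum_def norm_l2_of[OF hat_nth_square_integrable] by (intro Bochner_Integration.integral_sum i)
  finally have "plconst * kinetic v = (\<Sum>j\<in>UNIV. (norm (momentum j v))\<^sup>2)" .
  moreover have "plconst * mass v = (norm (l2_of (hat v)))\<^sup>2"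
    unfolding mass_hat norm_l2_of[OF hat_square_integrable] ..
  ultimately show ?thesis by (simp add: norm_h1_eq distrib_left)
qed

lemma hat_diff: "AE \<xi> in lborel. hat (u - v) \<xi> = hat u \<xi> - hat v \<xi>"
proof -
  have "AE \<xi> in lborel. hat ((u - v) + v) \<xi> = hat (u - v) \<xi> + hat v \<xi>" by (rule hat_plus)
  then show ?thesis by eventually_elim simp
qed

lemma l2_of_hat_diff: "l2_of (hat (u - v)) = l2_of (hat u) - l2_of (hat v)"
  unfolding l2_of_diff[OF hat_square_integrable hat_square_integrable, symmetric]
  by (intro l2_of_cong square_integrable_diff hat_square_integrable hat_diff)

lemma momentum_diff: "momentum j (u - v) = momentum j u - momentum j v"
  unfolding momentum_def l2_of_diff[OF hat_nth_square_integrable hat_nth_square_integrable, symmetric]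
  by (intro l2_of_cong square_integrable_diff hat_nth_square_integrable)
     (use hat_diff[of u v] in eventually_elim, simp add: right_diff_distrib)

lemma l2_of_hat_idil:
  assumes t: "t > 0"
  shows "l2_of (hat (idil s t u)) = s *\<^sub>R l2_comp (\<chi> i. t) 0 (l2_of (hat u))"
proof -
  have tz: "(\<chi> i. t) $ i \<noteq> 0" for i using t by simp
  note sc = square_integrable_coordinatewise[OF tz hat_square_integrable[of u], of 0]
  show ?thesis
    unfolding l2_comp_l2_of[OF tz hat_square_integrable] l2_of_scaleR[OF sc, symmetric]
    by (intro l2_of_cong hat_square_integrable square_integrable_scaleR sc)
       (use hat_idil[OF t, of s u] in eventually_elim, simp add: scal_vec scaleR_conv_of_real[where 'a = complex])
qed

lemma momentum_idil:
  assumes t: "t > 0"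
  shows "momentum j (idil s t u) = (s / t) *\<^sub>R l2_comp (\<chi> i. t) 0 (momentum j u)"
proof -
  have tz: "(\<chi> i. t) $ i \<noteq> 0" for i using t by simp
  note sc = square_integrable_coordinatewise[OF tz hat_nth_square_integrable[of j u], of 0]
  show ?thesis
    unfolding momentum_def l2_comp_l2_of[OF tz hat_nth_square_integrable] l2_of_scaleR[OF sc, symmetric]
    by (intro l2_of_cong hat_nth_square_integrable square_integrable_scaleR sc)
       (use hat_idil[OF t, of s u] in eventually_elim, use t in \<open>simp add: scal_vec scaleR_conv_of_real[where 'a = complex]\<close>)
qed

text \<open>Strong continuity of dilations in L^2, applied to the transform and to each first
  moment; the dilation merely changes the scalar factor of the latter.\<close>

lemma idil_tendsto:
  assumes t: "\<And>n. t n > 0" "t' > 0" "t \<longlonglongrightarrow> t'" and s: "s \<longlonglongrightarrow> s'"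
  shows "(\<lambda>n. idil (s n) (t n) u) \<longlonglongrightarrow> idil s' t' u"
proof -
  let ?d = "\<lambda>n. idil (s n) (t n) u - idil s' t' u"
  have v: "(\<lambda>n. (\<chi> i. t n) :: real^3) \<longlonglongrightarrow> (\<chi> i. t')" by (intro tendsto_vec_lambda t)
  have c: "(\<lambda>n. l2_comp (\<chi> i. t n) 0 w) \<longlonglongrightarrow> l2_comp (\<chi> i. t') 0 w" for w
    by (rule l2_comp_tendsto[OF _ _ v tendsto_const]) (use t(1,2) in \<open>simp_all add: less_imp_neq[symmetric]\<close>)
  have "(\<lambda>n. l2_of (hat (?d n))) \<longlonglongrightarrow> 0"
    unfolding l2_of_hat_diff l2_of_hat_idil[OF t(1)] l2_of_hat_idil[OF t(2)]
    by (subst LIM_zero_iff) (intro tendsto_scaleR s c)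
  moreover have "(\<lambda>n. momentum j (?d n)) \<longlonglongrightarrow> 0" for j
    unfolding momentum_diff momentum_idil[OF t(1)] momentum_idil[OF t(2)]
    by (subst LIM_zero_iff) (intro tendsto_scaleR tendsto_divide s c t, use t(2) in simp)
  ultimately have "(\<lambda>n. (norm (l2_of (hat (?d n))))\<^sup>2 + (\<Sum>j\<in>UNIV. (norm (momentum j (?d n)))\<^sup>2)) \<longlonglongrightarrow> (norm (0::l2))\<^sup>2 + (\<Sum>j\<in>(UNIV :: 3 set). (norm (0::l2))\<^sup>2)"
    by (intro tendsto_intros)
  then have "(\<lambda>n. (1 / plconst) * (plconst * (norm (?d n))\<^sup>2)) \<longlonglongrightarrow> (1 / plconst) * 0"
    unfolding norm_h1_momentum by (intro tendsto_mult tendsto_const) simp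
  then have "(\<lambda>n. (norm (?d n))\<^sup>2) \<longlonglongrightarrow> 0" using plconst_pos by simp
  then have "(\<lambda>n. sqrt ((norm (?d n))\<^sup>2)) \<longlonglongrightarrow> sqrt 0" by (rule tendsto_real_sqrt)
  then have "?d \<longlonglongrightarrow> 0" by (simp add: tendsto_norm_zero_iff)
  then show ?thesis by (simp add: LIM_zero_iff)
qed

text \<open>The amplitude that keeps the mass: in space x -> t^(-3/2) u (x / t), so large
  \<open>t\<close> spreads and small \<open>t\<close> concentrates.\<close>

definition dilation :: "real \<Rightarrow> h1 \<Rightarrow> h1" where "dilation t u = idil (sqrt (t ^ 3)) t u"

lemma dilation:
  assumes t: "t > 0"
  shows "mass (dilation t u) = mass u" "kinetic (dilation t u) = kinetic u / t\<^sup>2" "quart a b (dilation t u) = quart a b u / t ^ 3"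
proof -
  have s: "(sqrt (t ^ 3))\<^sup>2 = t ^ 3" using t by simp
  have x4: "x ^ 4 = (x\<^sup>2)\<^sup>2" for x :: real by (simp flip: power_mult)
  have s4: "sqrt (t ^ 3) ^ 4 = (t ^ 3)\<^sup>2" unfolding x4 s ..
  show "mass (dilation t u) = mass u" "kinetic (dilation t u) = kinetic u / t\<^sup>2" "quart a b (dilation t u) = quart a b u / t ^ 3"
    unfolding dilation_def mass_idil[OF t] kinetic_idil[OF t] quart_idil[OF t] s s4 using t by (simp_all add: field_simps eval_nat_numeral)
qed

lemma continuous_on_dilation: "continuous_on {0<..} (\<lambda>t. dilation t u)"
proof (rule continuous_on_sequentiallyI)
  fix t t' assume t: "\<forall>n. t n \<in> {0<..}" "t' \<in> {0<..}" "t \<longlonglongrightarrow> (t' :: real)"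
  show "(\<lambda>n. dilation (t n) u) \<longlonglongrightarrow> dilation t' u"
    unfolding dilation_def by (rule idil_tendsto) (use t in \<open>auto intro!: tendsto_intros\<close>)
qed

text \<open>Minus the derivative at t = 1 of the energy of \<open>dilation t v\<close>.\<close>

definition virial :: "real \<Rightarrow> real \<Rightarrow> h1 \<Rightarrow> real" where "virial a b v = kinetic v + 3 / 2 * quart a b v"

lemma continuous_on_virial: "continuous_on UNIV (virial a b)"
  unfolding virial_def[abs_def]
  by (intro continuous_intros continuous_at_imp_continuous_on ballI has_derivative_continuous[OF kinetic_has_derivative] has_derivative_continuous[OF quart_has_derivative])

theorem theorem1p1:
  fixes c l\<^sub>1 l\<^sub>2 :: real
  assumes "c > 0" and "unstable_regime l\<^sub>1 l\<^sub>2"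
  shows "\<exists>k>0.
    mp_paths l\<^sub>1 l\<^sub>2 c k \<noteq> {} \<and>
    mp_level l\<^sub>1 l\<^sub>2 c k >
      max (SUP g\<in>mp_paths l\<^sub>1 l\<^sub>2 c k. ereal (energy l\<^sub>1 l\<^sub>2 (g 0)))
          (SUP g\<in>mp_paths l\<^sub>1 l\<^sub>2 c k. ereal (energy l\<^sub>1 l\<^sub>2 (g 1))) \<and>
    (\<exists>u \<mu>. \<mu> > 0 \<and> solves_stationary l\<^sub>1 l\<^sub>2 \<mu> u \<and> mass u = c \<and>
      ereal (energy l\<^sub>1 l\<^sub>2 u) = mp_level l\<^sub>1 l\<^sub>2 c k \<and>
      ereal (energy l\<^sub>1 l\<^sub>2 u) =
        (INF v\<in>{v. critical_on_sphere l\<^sub>1 l\<^sub>2 c v}. ereal (energy l\<^sub>1 l\<^sub>2 v)))"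
proof -
  let ?E = "energy l\<^sub>1 l\<^sub>2" and ?B = "quart l\<^sub>1 l\<^sub>2" and ?Q = "virial l\<^sub>1 l\<^sub>2"
  obtain u J where J: "J > 0" and max: "\<And>v. - ?B v \<le> J * gnfun v" and u: "mass u = c" "?B u = - (2 / 3) * kinetic u"
    "kinetic u = 4 / (9 * J\<^sup>2 * c)" "solves_stationary l\<^sub>1 l\<^sub>2 (kinetic u / (6 * c)) u" "critical_on_sphere l\<^sub>1 l\<^sub>2 c u"
    using ground_state[OF assms(2,1)] by blast
  define A where "A = kinetic u"
  have A: "A > 0" unfolding A_def u(3) using J assms(1) by simp
  have Eu: "?E u = A / 6" unfolding energy_eq u(2) A_def by simp
  \<comment> \<open>The kinetic energy \<open>A\<close> of the maximizer is exactly the threshold at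
    which J sqrt (x c) reaches the ratio 2/3 of the Pohozaev constraint.\<close>
  have JA: "(J * sqrt (x * c) < 2 / 3) = (x < A)" if "x \<ge> 0" for x
  proof -
    have sq: "y < z \<longleftrightarrow> y\<^sup>2 < z\<^sup>2" if "0 \<le> y" "0 \<le> z" for y z :: real
      using that power2_less_imp_less[of y z] power_strict_mono[of y z 2] by auto
    have "J * sqrt (x * c) < 2 / 3 \<longleftrightarrow> (J * sqrt (x * c))\<^sup>2 < (2 / 3)\<^sup>2"
      by (rule sq) (use J assms(1) that in simp_all)
    also have "(J * sqrt (x * c))\<^sup>2 = J\<^sup>2 * (x * c)" using assms(1) that by (simp add: power_mult_distrib)
    also have "J\<^sup>2 * (x * c) < (2 / 3)\<^sup>2 \<longleftrightarrow> x < A"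
      unfolding A_def u(3) using J assms(1) by (simp add: field_simps power2_eq_square)
    finally show ?thesis .
  qed
  have c0: "v \<noteq> 0" if "mass v = c" for v using that assms(1) u(1) mass_add[of 0 0] by (auto simp: mass_eq_inner l2_inner_eq linear_simps(3)[OF bounded_linear_emb])
  have gn: "- ?B v \<le> kinetic v * (J * sqrt (kinetic v * c))" if "mass v = c" for v
    using max[of v] that by (simp add: gnfun_def mult.left_commute)
  \<comment> \<open>On the constraint the quartic part is -2/3 of the kinetic energy, so the sharp
    inequality forces the latter to be at least \<open>A\<close>, and the energy is one sixth of
    it.\<close>
  have low: "A / 6 \<le> ?E v" if v: "mass v = c" "?Q v = 0" for v
  proof -
    have B: "?B v = - (2 / 3) * kinetic v" using v(2) by (simp add: virial_def)
    have k: "kinetic v > 0" by (rule kinetic_pos[OF c0[OF v(1)]])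
    have "\<not> J * sqrt (kinetic v * c) < 2 / 3"
    proof
      assume "J * sqrt (kinetic v * c) < 2 / 3"
      then have "kinetic v * (J * sqrt (kinetic v * c)) < kinetic v * (2 / 3)" using k by (rule mult_strict_left_mono)
      then show False using gn[OF v(1)] B by simp
    qed
    then have "A \<le> kinetic v" using JA[OF kinetic_nonneg, of v] by simp
    then show ?thesis unfolding energy_eq B by simp
  qed
  have Qpos: "?Q v > 0" if v: "mass v = c" "kinetic v < A" for v
  proof -
    have k: "kinetic v > 0" by (rule kinetic_pos[OF c0[OF v(1)]])
    have "kinetic v * (J * sqrt (kinetic v * c)) < kinetic v * (2 / 3)"
      using JA[OF kinetic_nonneg, of v] v(2) k by (intro mult_strict_left_mono) auto
    then show ?thesis using gn[OF v(1)] by (simp add: virial_def)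
  qed
  have Qneg: "?Q v < 0" if "?E v < 0" for v using that kinetic_nonneg[of v] by (simp add: energy_eq virial_def)
  let ?C = "gnconst l\<^sub>1 l\<^sub>2"
  \<comment> \<open>The second bound makes the quartic part at most the kinetic energy, so the
    initial energy is at most \<open>k\<close>; the first keeps this at half of the level
    \<open>A / 6\<close>, and the initial kinetic energy below \<open>A\<close>.\<close>
  define k where "k = min (A / 12) (1 / (c * (?C + 1)\<^sup>2))"
  have C: "?C \<ge> 0" by (rule gnconst_nonneg)
  have k: "k > 0" "k \<le> A / 12" "k * c \<le> 1 / (?C + 1)\<^sup>2"
  proof -
    show "k > 0" unfolding k_def using A C assms(1) by simp
    show "k \<le> A / 12" by (simp add: k_def)
    have "k * c \<le> 1 / (c * (?C + 1)\<^sup>2) * c" using assms(1) by (intro mult_right_mono) (simp_all add: k_def)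
    also have "\<dots> = 1 / (?C + 1)\<^sup>2" using assms(1) by simp
    finally show "k * c \<le> 1 / (?C + 1)\<^sup>2" .
  qed
  have start: "?E v \<le> A / 12" if v: "v \<in> A_set c k" for v
  proof -
    have m: "mass v = c" "kinetic v \<le> k" using v by (auto simp: A_set_def sphere_S_def)
    have "sqrt (kinetic v * c) \<le> sqrt ((1 / (?C + 1))\<^sup>2)"
    proof (rule real_sqrt_le_mono)
      have "kinetic v * c \<le> k * c" using m(2) assms(1) by (intro mult_right_mono) auto
      then show "kinetic v * c \<le> (1 / (?C + 1))\<^sup>2" using k(3) by (simp add: power_divide)
    qed
    then have "?C * sqrt (kinetic v * c) \<le> ?C * (1 / (?C + 1))" using C by (intro mult_left_mono) auto
    also have "\<dots> \<le> 1" using C by simp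
    finally have "kinetic v * (?C * sqrt (kinetic v * c)) \<le> kinetic v * 1" using kinetic_nonneg by (rule mult_left_mono)
    moreover have "?B v \<le> ?C * gnfun v" using gagliardo_nirenberg[of l\<^sub>1 l\<^sub>2 v] by linarith
    ultimately have "?B v \<le> kinetic v" using m(1) by (simp add: gnfun_def mult.left_commute)
    then show ?thesis using m(2) k(2) by (simp add: energy_eq)
  qed
  let ?\<Gamma> = "mp_paths l\<^sub>1 l\<^sub>2 c k"
  have path: "path g" "path_image g \<subseteq> sphere_S c" "g 0 \<in> A_set c k" "?E (g 1) < 0" if "g \<in> ?\<Gamma>" for g
    using that by (auto simp: mp_paths_def pathstart_def pathfinish_def)
  have lower: "ereal (A / 6) \<le> mp_level l\<^sub>1 l\<^sub>2 c k"
    unfolding mp_level_def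
  proof (rule INF_greatest)
    fix g assume g: "g \<in> ?\<Gamma>"
    have m: "mass (g t) = c" if "t \<in> {0..1}" for t using subsetD[OF path(2)[OF g], of "g t"] that by (simp add: path_image_def sphere_S_def)
    have "continuous_on {0..1} (\<lambda>t. ?Q (g t))"
      using path(1)[OF g] by (intro continuous_on_compose2[OF continuous_on_virial]) (auto simp: path_def)
    moreover have "?Q (g 0) > 0" using Qpos[of "g 0"] path(3)[OF g] k A by (auto simp: A_set_def sphere_S_def)
    moreover have "?Q (g 1) < 0" using Qneg path(4)[OF g] by blast
    ultimately obtain t where t: "0 \<le> t" "t \<le> 1" "?Q (g t) = 0"
      using IVT2'[of "\<lambda>t. ?Q (g t)" 1 0 0] by auto
    then have "ereal (A / 6) \<le> ereal (?E (g t))" using low[of "g t"] m by simp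
    also have "\<dots> \<le> (SUP t\<in>{0..1}. ereal (?E (g t)))" using t by (intro SUP_upper) auto
    finally show "ereal (A / 6) \<le> (SUP t\<in>{0..1}. ereal (?E (g t)))" .
  qed
  \<comment> \<open>Dilation by this factor lowers the kinetic energy to exactly
    \<open>k\<close>.\<close>
  define t\<^sub>0 where "t\<^sub>0 = sqrt (A / k)"
  have t0: "t\<^sub>0 > 0" "t\<^sub>0\<^sup>2 = A / k" using A k by (auto simp: t\<^sub>0_def)
  \<comment> \<open>Affine in the dilation parameter, from the spread-out state at
    \<open>t\<^sub>0\<close> to the concentrated one at 1/2, where the energy is A (2 - 8/3) <
    0.\<close>
  define g where "g \<tau> = dilation ((1 - \<tau>) * t\<^sub>0 + \<tau> * (1 / 2)) u" for \<tau> :: real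
  have tpos: "(1 - \<tau>) * t\<^sub>0 + \<tau> * (1 / 2) > 0" if "\<tau> \<in> {0..1}" for \<tau>
  proof (cases "\<tau> = 0")
    case False
    then have "(1 - \<tau>) * t\<^sub>0 \<ge> 0" "\<tau> * (1 / 2) > 0" using t0 that by auto
    then show ?thesis by linarith
  qed (use t0 in simp)
  have Ed: "?E (dilation t u) \<le> A / 6" "?E (dilation (1 / 2) u) < 0" if "t > 0" for t
  proof -
    have E: "?E (dilation t u) = A * ((1 / t)\<^sup>2 / 2 - (1 / t) ^ 3 / 3)" if "t > 0" for t
      unfolding energy_eq dilation[OF that] u(2) A_def by (simp add: power_divide algebra_simps)
    \<comment> \<open>With x = 1/t this is the energy profile divided by \<open>A\<close>; the
      factorisation exhibits its maximum 1/6 on x > 0, attained at the maximizer itself.\<close>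
    have "x\<^sup>2 / 2 - x ^ 3 / 3 = 1 / 6 - (x - 1)\<^sup>2 * (2 * x + 1) / 6" for x :: real
    proof -
      have "(x - 1)\<^sup>2 * (2 * x + 1) = 2 * x ^ 3 - 3 * x\<^sup>2 + 1" by (simp add: power2_eq_square power3_eq_cube algebra_simps)
      then show ?thesis by (simp add: field_simps)
    qed
    then have "(1 / t)\<^sup>2 / 2 - (1 / t) ^ 3 / 3 = 1 / 6 - (1 / t - 1)\<^sup>2 * (2 * (1 / t) + 1) / 6" .
    also have "\<dots> \<le> 1 / 6" using that by simp
    finally have "A * ((1 / t)\<^sup>2 / 2 - (1 / t) ^ 3 / 3) \<le> A * (1 / 6)" using A by (intro mult_left_mono) auto
    then show "?E (dilation t u) \<le> A / 6" using E[OF that] by simp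
    have "?E (dilation (1 / 2) u) = A * (- 2 / 3)" by (subst E) (simp_all add: power2_eq_square power3_eq_cube)
    then show "?E (dilation (1 / 2) u) < 0" using A by simp
  qed
  have g: "g \<in> ?\<Gamma>"
  proof -
    have "path g"
      unfolding path_def g_def
      by (rule continuous_on_compose2[OF continuous_on_dilation]) (use tpos in \<open>auto intro!: continuous_intros\<close>)
    moreover have "path_image g \<subseteq> sphere_S c"
      unfolding path_image_def sphere_S_def g_def using dilation(1)[OF tpos] u(1) by auto
    moreover have "g 0 \<in> A_set c k"
      unfolding A_set_def sphere_S_def g_def using t0 dilation(1,2)[OF t0(1), of u] u(1) A k by (simp add: A_def[symmetric])
    moreover have "?E (g 1) < 0" unfolding g_def using Ed(2)[of 1] by simp
    ultimately show ?thesis by (simp add: mp_paths_def pathstart_def pathfinish_def)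
  qed
  have "mp_level l\<^sub>1 l\<^sub>2 c k \<le> (SUP \<tau>\<in>{0..1}. ereal (?E (g \<tau>)))" unfolding mp_level_def by (rule INF_lower[OF g])
  also have "\<dots> \<le> ereal (A / 6)" unfolding g_def using Ed(1)[OF tpos] by (intro SUP_least) auto
  finally have level: "mp_level l\<^sub>1 l\<^sub>2 c k = ereal (A / 6)" using lower by (rule antisym)
  have "(SUP g\<in>?\<Gamma>. ereal (?E (g 0))) \<le> ereal (A / 12)" using start path(3) by (intro SUP_least) auto
  moreover have "(SUP g\<in>?\<Gamma>. ereal (?E (g 1))) \<le> ereal 0" using path(4) by (intro SUP_least) (auto intro: less_imp_le)
  moreover have "ereal (A / 12) < ereal (A / 6)" "ereal 0 < ereal (A / 6)" using A by auto
  ultimately have gap: "max (SUP g\<in>?\<Gamma>. ereal (?E (g 0))) (SUP g\<in>?\<Gamma>. ereal (?E (g 1))) < mp_level l\<^sub>1 l\<^sub>2 c k"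
    unfolding level max_less_iff_conj by (meson le_less_trans)
  have ground: "ereal (?E u) = (INF v\<in>{v. critical_on_sphere l\<^sub>1 l\<^sub>2 c v}. ereal (?E v))"
  proof (rule antisym)
    show "ereal (?E u) \<le> (INF v\<in>{v. critical_on_sphere l\<^sub>1 l\<^sub>2 c v}. ereal (?E v))"
    proof (rule INF_greatest)
      fix v assume "v \<in> {v. critical_on_sphere l\<^sub>1 l\<^sub>2 c v}"
      then obtain \<kappa> where v: "mass v = c" "\<And>h. dkin v h + 2 * dquart l\<^sub>1 l\<^sub>2 v h + \<kappa> * l2_inner v h = 0"
        using critical_on_sphere_iff[OF assms(1)] by auto
      then show "ereal (?E u) \<le> ereal (?E v)" using low[OF v(1)] pohozaev[OF v(2)] Eu by (simp add: virial_def)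
    qed
    show "(INF v\<in>{v. critical_on_sphere l\<^sub>1 l\<^sub>2 c v}. ereal (?E v)) \<le> ereal (?E u)"
      using u(5) by (intro INF_lower) simp
  qed
  have "A / (6 * c) > 0" using A assms(1) by simp
  then show ?thesis
    using k(1) g gap ground u(1) u(4)[folded A_def] level Eu by (intro exI[of _ k] conjI exI[of _ u] exI[of _ "A / (6 * c)"]) auto
qed

end
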